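(* Let $X$ be a finite 2-complex, equipped with its standard structure of branched 2-complex (every face has area $1$), and suppose that $\mathrm{Irred}(X)$ is non-empty. Let $\rho_+(X)=\sup_{Y\in \mathrm{Irred}(X)}\kappa(Y)$ and $\rho_-(X)=\inf_{Y\in \mathrm{Irred}(X)}\kappa(Y)$. Then: (i) $\rho_+(X)$ and $\rho_-(X)$ are the maximum and the minimum, respectively, of an explicit rational linear-programming problem; that is, from $X$ one can construct algorithmically an integer $N$, a finite system of linear equations and inequalities on $\mathbb{R}^N$ with rational coefficients, and a linear functional on $\mathbb{R}^N$ with rational coefficients, whose maximum on the solution set of the system is $\rho_+(X)$ and whose minimum on that solution set is $\rho_-(X)$; (ii) there are $Y_{\max},Y_{\min}\in \mathrm{Irred}(X)$ with $\kappa(Y_{\max})=\rho_+(X)$ and $\kappa(Y_{\min})=\rho_-(X)$. In particular, $\rho_+(X),\rho_-(X)\in\mathbb{Q}$, and both quantities can be computed algorithmically from $X$.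
   Context: Graphs. A graph (in the sense of Serre) $\Gamma$ has a vertex set $V_\Gamma$, an edge set $E_\Gamma$, maps $\iota,\tau:E_\Gamma\to V_\Gamma$ and a fixed-point-free involution $e\mapsto e^*$ of $E_\Gamma$ with $\tau(e)=\iota(e^* )$. Elements of $E_\Gamma$ are oriented edges; geometric edges are pairs $\{e,e^*\}$. Morphisms commute with all this structure. Put $\mathrm{Lk}_\Gamma(v)=\iota^{-1}(v)$. A morphism of graphs is an immersion if it is injective on $\mathrm{Lk}_\Gamma(v)$ for every vertex $v$. A fold is the quotient morphism identifying two distinct edges with the same initial vertex (and their opposites, and their terminal vertices) to one edge. By Stallings, every morphism of finite graphs factors as a finite composition of folds followed by an immersion. 2-complexes. A 2-complex $X$ consists of graphs $\Gamma_X$ (the 1-skeleton) and $S_X$ together with an immersion $w_X:S_X\to\Gamma_X$, where the realisation of $S_X$ is a disjoint union of circles. Faces of $X$ are the components of $S_X$ (set $F_X$); vertices and edges of $X$ are those of $\Gamma_X$. The realisation is obtained by gluing a disc to $\Gamma_X$ along each component of $S_X$. A branched 2-complex is a 2-complex with an area function $\mathrm{Area}:F_X\to\mathbb{R}_{\ge 0}$. A 2-complex is regarded as a (standard) branched 2-complex by giving each face area $1$. A branched morphism $\phi:Y\to X$ consists of a morphism of graphs $\phi:\Gamma_Y\to\Gamma_X$ and an immersion $\phi:S_Y\to S_X$ with $\phi\circ w_Y=w_X\circ\phi$, such that $\mathrm{Area}(f)=m_\phi(f)\,\mathrm{Area}(\phi(f))$ for each face $f$ of $Y$, where $m_\phi(f)$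 is the degree of the covering of circles $f\to\phi(f)$. Links. For a vertex $v$ of $X$, the link $\mathrm{Lk}_X(v)$ is the graph $L$ with vertex set $\mathrm{Lk}_{\Gamma_X}(v)$ and edge set $w_X^{-1}(\mathrm{Lk}_{\Gamma_X}(v))\subseteq E_{S_X}$, with terminus map $\tau_L=w_X$; the opposite in $L$ of an edge $e$ is the unique edge $e'\neq e$ of $S_X$ with $\iota_{S_X}(e')=\iota_{S_X}(e)$. Essential maps. Let $\phi:Y\to X$ be a branched morphism of finite branched 2-complexes. Factor $\Gamma_Y\to\Gamma_X$ as a composition of folds $\Gamma_Y\to\bar\Gamma$ followed by an immersion $\bar\Gamma\to\Gamma_X$, and let $\bar S$ be the image of the natural map $S_Y\to \bar\Gamma\times_{\Gamma_X}S_X$ (fibre product of graphs). These data define the folded complex $\bar Y$ with $\Gamma_{\bar Y}=\bar\Gamma$, $S_{\bar Y}=\bar S$, and a factorisation $Y\to\bar Y\to X$ of $\phi$. The map $\phi$ is essential if $\Gamma_Y\to\bar\Gamma$ is a homotopy equivalence and $S_Y\to\bar S$ is an isomorphism. A branched 2-complex $Y$ is visibly irreducible if for every vertex $v$ of $Y$ the link $\mathrm{Lk}_Y(v)$ is finite with at least two vertices, every vertex of it has valence at least $2$, it is connected, and it has no cut vertices. $\mathrm{Irred}(X)$ is the set of all essential maps $Y\to X$ where $Y$ is a non-empty finite, visibly irreducible branched 2-complex, not necessarily connected. An element is denoted by its domain $Y$. Curvature. $\mathrm{Area}(Y)$ is the sum of the areas of the faces of $Y$; $\tau(Y)=\mathrm{Area}(Y)+\chi(\Gamma_Y)$,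 where $\chi(\Gamma_Y)$ is the number of vertices minus the number of geometric edges; and $\kappa(Y)=\tau(Y)/\mathrm{Area}(Y)$. *)

theory Defs
  imports "HOL-Analysis.Analysis" "HOL-Library.Nat_Bijection"
begin

section \<open>Graphs in the sense of Serre\<close>

record ('v, 'e) sgraph =
  verts :: "'v set"
  edges :: "'e set"
  ini :: "'e \<Rightarrow> 'v"
  opp :: "'e \<Rightarrow> 'e"

definition ter :: "('v, 'e) sgraph \<Rightarrow> 'e \<Rightarrow> 'v" where
  "ter G e = ini G (opp G e)"

definition sgraph :: "('v, 'e) sgraph \<Rightarrow> bool" where
  "sgraph G \<longleftrightarrow>
     (\<forall>e\<in>edges G. ini G e \<in> verts G \<and> opp G e \<in> edges G \<and> opp G (opp G e) = e \<and> opp G e \<noteq> e)"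

definition finite_sgraph :: "('v, 'e) sgraph \<Rightarrow> bool" where
  "finite_sgraph G \<longleftrightarrow> finite (verts G) \<and> finite (edges G)"

definition lk :: "('v, 'e) sgraph \<Rightarrow> 'v \<Rightarrow> 'e set" where
  "lk G v = {e \<in> edges G. ini G e = v}"

record ('v, 'e, 'w, 'f) gmap =
  vmap :: "'v \<Rightarrow> 'w"
  emap :: "'e \<Rightarrow> 'f"

definition gid :: "('v, 'e, 'v, 'e) gmap" where
  "gid = \<lparr>vmap = id, emap = id\<rparr>"

definition gcomp :: "('w, 'f, 'x, 'g) gmap \<Rightarrow> ('v, 'e, 'w, 'f) gmap \<Rightarrow> ('v, 'e, 'x, 'g) gmap" where
  "gcomp g f = \<lparr>vmap = vmap g \<circ> vmap f, emap = emap g \<circ> emap f\<rparr>"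

definition gmap_eq_on ::
    "('v, 'e) sgraph \<Rightarrow> ('v, 'e, 'w, 'f) gmap \<Rightarrow> ('v, 'e, 'w, 'f) gmap \<Rightarrow> bool" where
  "gmap_eq_on G f g \<longleftrightarrow>
     (\<forall>v\<in>verts G. vmap f v = vmap g v) \<and> (\<forall>e\<in>edges G. emap f e = emap g e)"

definition graph_morphism ::
    "('v, 'e) sgraph \<Rightarrow> ('w, 'f) sgraph \<Rightarrow> ('v, 'e, 'w, 'f) gmap \<Rightarrow> bool" where
  "graph_morphism G H f \<longleftrightarrow> sgraph G \<and> sgraph H \<and>
     (\<forall>v\<in>verts G. vmap f v \<in> verts H) \<and>
     (\<forall>e\<in>edges G. emap f e \<in> edges H \<and> ini H (emap f e) = vmap f (ini G e) \<and>
        opp H (emap f e) = emap f (opp G e))"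

definition immersion ::
    "('v, 'e) sgraph \<Rightarrow> ('w, 'f) sgraph \<Rightarrow> ('v, 'e, 'w, 'f) gmap \<Rightarrow> bool" where
  "immersion G H f \<longleftrightarrow> graph_morphism G H f \<and> (\<forall>v\<in>verts G. inj_on (emap f) (lk G v))"

definition graph_isomorphism ::
    "('v, 'e) sgraph \<Rightarrow> ('w, 'f) sgraph \<Rightarrow> ('v, 'e, 'w, 'f) gmap \<Rightarrow> bool" where
  "graph_isomorphism G H f \<longleftrightarrow> graph_morphism G H f \<and>
     bij_betw (vmap f) (verts G) (verts H) \<and> bij_betw (emap f) (edges G) (edges H)"

definition reach :: "('v, 'e) sgraph \<Rightarrow> ('v \<times> 'v) set" where
  "reach G = {(ini G e, ter G e) | e. e \<in> edges G}\<^sup>* \<inter> verts G \<times> verts G"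

definition graph_connected :: "('v, 'e) sgraph \<Rightarrow> bool" where
  "graph_connected G \<longleftrightarrow> verts G \<noteq> {} \<and> (\<forall>x\<in>verts G. \<forall>y\<in>verts G. (x, y) \<in> reach G)"

(* A component is represented by its set of vertices. *)
definition graph_components :: "('v, 'e) sgraph \<Rightarrow> 'v set set" where
  "graph_components G = verts G // reach G"

definition delete_vertex :: "('v, 'e) sgraph \<Rightarrow> 'v \<Rightarrow> ('v, 'e) sgraph" where
  "delete_vertex G x = G\<lparr>verts := verts G - {x},
     edges := {e \<in> edges G. ini G e \<noteq> x \<and> ter G e \<noteq> x}\<rparr>"

definition cut_vertex :: "('v, 'e) sgraph \<Rightarrow> 'v \<Rightarrow> bool" where
  "cut_vertex G x \<longleftrightarrow> x \<in> verts G \<and> \<not> graph_connected (delete_vertex G x)"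

definition euler_char :: "('v, 'e) sgraph \<Rightarrow> int" where
  "euler_char G = int (card (verts G)) - int (card ((\<lambda>e. {e, opp G e}) ` edges G))"

(* A graph is a disjoint union of circles when every component is a finite graph
   all of whose vertices have valence 2 (a loop contributes 2 to the valence). *)
definition circles :: "('v, 'e) sgraph \<Rightarrow> bool" where
  "circles S \<longleftrightarrow> sgraph S \<and> (\<forall>u\<in>verts S. card (lk S u) = 2) \<and> (\<forall>C\<in>graph_components S. finite C)"


section \<open>Geometric realisation and homotopy equivalences of graphs\<close>

(* The point at parameter t on the oriented edge e.  The points (e, t) and
   (opp e, 1 - t) are identified, so a point interior to an edge is this pair. *)
definition edge_point :: "('v, 'e) sgraph \<Rightarrow> 'e \<Rightarrow> real \<Rightarrow> 'v + ('e \<times> real) set" where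
  "edge_point G e t =
     (if t = 0 then Inl (ini G e) else if t = 1 then Inl (ter G e)
      else Inr {(e, t), (opp G e, 1 - t)})"

definition realisation_points :: "('v, 'e) sgraph \<Rightarrow> ('v + ('e \<times> real) set) set" where
  "realisation_points G =
     Inl ` verts G \<union> {edge_point G e t | e t. e \<in> edges G \<and> t \<in> {0..1}}"

(* The quotient topology of the disjoint union of the discrete space of vertices and a
   copy of [0,1] for every oriented edge. *)
definition realisation :: "('v, 'e) sgraph \<Rightarrow> ('v + ('e \<times> real) set) topology" where
  "realisation G = topology (\<lambda>U. U \<subseteq> realisation_points G \<and>
     (\<forall>e\<in>edges G. openin (top_of_set {0..1}) {t \<in> {0..1}. edge_point G e t \<in> U}))"

lemma openin_realisation:
  "openin (realisation G) U \<longleftrightarrow> U \<subseteq> realisation_points G \<and>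
     (\<forall>e\<in>edges G. openin (top_of_set {0..1}) {t \<in> {0..1}. edge_point G e t \<in> U})"
proof -
  let ?P = "\<lambda>U. U \<subseteq> realisation_points G \<and>
     (\<forall>e\<in>edges G. openin (top_of_set {0..1}) {t \<in> {0..1}. edge_point G e t \<in> U})"
  have "?P (S \<inter> T)" if "?P S" "?P T" for S T
  proof -
    have "{t \<in> {0..1}. edge_point G e t \<in> S \<inter> T} =
      {t \<in> {0..1}. edge_point G e t \<in> S} \<inter> {t \<in> {0..1}. edge_point G e t \<in> T}" for e
      by blast
    then show ?thesis using that by (auto simp: openin_Int)
  qed
  moreover have "?P (\<Union>K)" if "\<forall>S\<in>K. ?P S" for K
  proof -
    have "{t \<in> {0..1}. edge_point G e t \<in> \<Union>K} =
      \<Union>((\<lambda>S. {t \<in> {0..1}. edge_point G e t \<in> S}) ` K)" for e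
      by blast
    then show ?thesis using that by (auto intro!: openin_Union)
  qed
  ultimately have "istopology ?P"
    unfolding istopology_def by blast
  then show ?thesis
    by (simp add: realisation_def topology_inverse')
qed

definition realise_map ::
    "('v, 'e, 'w, 'f) gmap \<Rightarrow> 'v + ('e \<times> real) set \<Rightarrow> 'w + ('f \<times> real) set" where
  "realise_map f = map_sum (vmap f) (image (map_prod (emap f) id))"

definition homotopy_equivalence_map :: "'a topology \<Rightarrow> 'b topology \<Rightarrow> ('a \<Rightarrow> 'b) \<Rightarrow> bool" where
  "homotopy_equivalence_map S T f \<longleftrightarrow> continuous_map S T f \<and>
     (\<exists>g. continuous_map T S g \<and>
        homotopic_with (\<lambda>x. True) S S (g \<circ> f) id \<and>
        homotopic_with (\<lambda>x. True) T T (f \<circ> g) id)"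

definition graph_homotopy_equivalence ::
    "('v, 'e) sgraph \<Rightarrow> ('w, 'f) sgraph \<Rightarrow> ('v, 'e, 'w, 'f) gmap \<Rightarrow> bool" where
  "graph_homotopy_equivalence G H f \<longleftrightarrow> graph_morphism G H f \<and>
     homotopy_equivalence_map (realisation G) (realisation H) (realise_map f)"


section \<open>Folds\<close>

(* A fold is described up to isomorphism of its target: a surjective morphism which
   identifies exactly e1 with e2, their opposites, and their termini.  Since opp has no
   fixed points in H, the existence of q excludes the case e2 = opp e1. *)
definition fold_map ::
    "('v, 'e) sgraph \<Rightarrow> ('w, 'f) sgraph \<Rightarrow> ('v, 'e, 'w, 'f) gmap \<Rightarrow> bool" where
  "fold_map G H q \<longleftrightarrow> graph_morphism G H q \<and>
     vmap q ` verts G = verts H \<and> emap q ` edges G = edges H \<and>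
     (\<exists>e1\<in>edges G. \<exists>e2\<in>edges G. e1 \<noteq> e2 \<and> ini G e1 = ini G e2 \<and>
        (\<forall>x\<in>verts G. \<forall>y\<in>verts G.
           vmap q x = vmap q y \<longleftrightarrow> x = y \<or> {x, y} = {ter G e1, ter G e2}) \<and>
        (\<forall>d\<in>edges G. \<forall>d'\<in>edges G.
           emap q d = emap q d' \<longleftrightarrow>
             d = d' \<or> {d, d'} = {e1, e2} \<or> {d, d'} = {opp G e1, opp G e2}))"

(* Finite compositions of folds.  A quotient of a graph is isomorphic to a graph with carriers
   in the same types, so there is no loss in keeping the types fixed. *)
inductive folds ::
    "('v, 'e) sgraph \<Rightarrow> ('v, 'e) sgraph \<Rightarrow> ('v, 'e, 'v, 'e) gmap \<Rightarrow> bool" where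
  folds_refl: "sgraph G \<Longrightarrow> folds G G gid"
| folds_step: "fold_map G H q \<Longrightarrow> folds H K p \<Longrightarrow> folds G K (gcomp p q)"


section \<open>Branched 2-complexes\<close>

record ('v, 'e, 'u, 'd) two_complex =
  skel :: "('v, 'e) sgraph"
  bdry :: "('u, 'd) sgraph"
  att :: "('u, 'd, 'v, 'e) gmap"

definition two_complex :: "('v, 'e, 'u, 'd, 'z) two_complex_scheme \<Rightarrow> bool" where
  "two_complex X \<longleftrightarrow> sgraph (skel X) \<and> circles (bdry X) \<and> immersion (bdry X) (skel X) (att X)"

definition finite_complex :: "('v, 'e, 'u, 'd, 'z) two_complex_scheme \<Rightarrow> bool" where
  "finite_complex X \<longleftrightarrow> finite_sgraph (skel X) \<and> finite_sgraph (bdry X)"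

definition faces :: "('v, 'e, 'u, 'd, 'z) two_complex_scheme \<Rightarrow> 'u set set" where
  "faces X = graph_components (bdry X)"

record ('v, 'e, 'u, 'd) branched_complex = "('v, 'e, 'u, 'd) two_complex" +
  area :: "'u set \<Rightarrow> real"

definition branched_complex :: "('v, 'e, 'u, 'd) branched_complex \<Rightarrow> bool" where
  "branched_complex X \<longleftrightarrow> two_complex X \<and> (\<forall>f\<in>faces X. 0 \<le> area X f)"

definition standard :: "('v, 'e, 'u, 'd) two_complex \<Rightarrow> ('v, 'e, 'u, 'd) branched_complex" where
  "standard X = two_complex.extend X \<lparr>area = (\<lambda>f. 1)\<rparr>"

(* The degree of the covering of circles restricting s to the component f, i.e. the number
   of preimages in f of a vertex of its image; it does not depend on the vertex. *)
definition cover_degree :: "('u, 'd, 'w, 'c) gmap \<Rightarrow> 'u set \<Rightarrow> nat" where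
  "cover_degree s f = card {u \<in> f. vmap s u = vmap s (SOME u. u \<in> f)}"

(* An immersion between disjoint unions of circles maps a component onto a component,
   so vmap s ` f is a face of X. *)
definition branched_morphism ::
    "('v, 'e, 'u, 'd) branched_complex \<Rightarrow> ('w, 'f, 'x, 'c) branched_complex \<Rightarrow>
     ('v, 'e, 'w, 'f) gmap \<Rightarrow> ('u, 'd, 'x, 'c) gmap \<Rightarrow> bool" where
  "branched_morphism Y X p s \<longleftrightarrow> branched_complex Y \<and> branched_complex X \<and>
     graph_morphism (skel Y) (skel X) p \<and>
     immersion (bdry Y) (bdry X) s \<and>
     gmap_eq_on (bdry Y) (gcomp p (att Y)) (gcomp (att X) s) \<and>
     (\<forall>f\<in>faces Y. area Y f = real (cover_degree s f) * area X (vmap s ` f))"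

(* Used only when att X is an immersion, so that no edge of the link is a loop. *)
definition link :: "('v, 'e, 'u, 'd, 'z) two_complex_scheme \<Rightarrow> 'v \<Rightarrow> ('e, 'd) sgraph" where
  "link X v =
     (let flip = (\<lambda>d. THE d'. d' \<in> edges (bdry X) \<and> d' \<noteq> d \<and> ini (bdry X) d' = ini (bdry X) d)
      in \<lparr>verts = lk (skel X) v,
          edges = {d \<in> edges (bdry X). emap (att X) d \<in> lk (skel X) v},
          ini = (\<lambda>d. emap (att X) (flip d)),
          opp = flip\<rparr>)"

definition visibly_irreducible :: "('v, 'e, 'u, 'd, 'z) two_complex_scheme \<Rightarrow> bool" where
  "visibly_irreducible Y \<longleftrightarrow> (\<forall>v\<in>verts (skel Y).
     finite_sgraph (link Y v) \<and> 2 \<le> card (verts (link Y v)) \<and>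
     (\<forall>x\<in>verts (link Y v). 2 \<le> card (lk (link Y v) x)) \<and>
     graph_connected (link Y v) \<and>
     (\<forall>x. \<not> cut_vertex (link Y v) x))"


section \<open>Essential maps\<close>

definition fibre_product ::
    "('a, 'b) sgraph \<Rightarrow> ('c, 'd) sgraph \<Rightarrow> ('a, 'b, 'v, 'e) gmap \<Rightarrow> ('c, 'd, 'v, 'e) gmap \<Rightarrow>
     ('a \<times> 'c, 'b \<times> 'd) sgraph" where
  "fibre_product G H f g =
     \<lparr>verts = {(x, y). x \<in> verts G \<and> y \<in> verts H \<and> vmap f x = vmap g y},
      edges = {(x, y). x \<in> edges G \<and> y \<in> edges H \<and> emap f x = emap g y},
      ini = map_prod (ini G) (ini H),
      opp = map_prod (opp G) (opp H)\<rparr>"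

definition gpair ::
    "('v, 'e, 'a, 'b) gmap \<Rightarrow> ('v, 'e, 'c, 'd) gmap \<Rightarrow> ('v, 'e, 'a \<times> 'c, 'b \<times> 'd) gmap" where
  "gpair f g = \<lparr>vmap = (\<lambda>x. (vmap f x, vmap g x)), emap = (\<lambda>x. (emap f x, emap g x))\<rparr>"

definition image_graph ::
    "('v, 'e) sgraph \<Rightarrow> ('w, 'f) sgraph \<Rightarrow> ('v, 'e, 'w, 'f) gmap \<Rightarrow> ('w, 'f) sgraph" where
  "image_graph G H f = H\<lparr>verts := vmap f ` verts G, edges := emap f ` edges G\<rparr>"

definition essential ::
    "('v, 'e, 'u, 'd) branched_complex \<Rightarrow> ('w, 'f, 'x, 'c) branched_complex \<Rightarrow>
     ('v, 'e, 'w, 'f) gmap \<Rightarrow> ('u, 'd, 'x, 'c) gmap \<Rightarrow> bool" where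
  "essential Y X p s \<longleftrightarrow> branched_morphism Y X p s \<and> finite_complex Y \<and> finite_complex X \<and>
     (\<exists>G q i. folds (skel Y) G q \<and> immersion G (skel X) i \<and>
        gmap_eq_on (skel Y) (gcomp i q) p \<and>
        graph_homotopy_equivalence (skel Y) G q \<and>
        (let h = gpair (gcomp q (att Y)) s;
             S = image_graph (bdry Y) (fibre_product G (bdry X) i (att X)) h
         in graph_isomorphism (bdry Y) S h))"

(* Every finite complex is isomorphic to one with carriers in the natural numbers, so it is
   enough to let the domains Y range over those. *)
definition Irred ::
    "('w, 'f, 'x, 'c) branched_complex \<Rightarrow>
     ((nat, nat, nat, nat) branched_complex \<times> (nat, nat, 'w, 'f) gmap \<times> (nat, nat, 'x, 'c) gmap) set"
  where
  "Irred X = {(Y, p, s). essential Y X p s \<and> verts (skel Y) \<noteq> {} \<and> visibly_irreducible Y}"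


section \<open>Curvature\<close>

definition total_area :: "('v, 'e, 'u, 'd) branched_complex \<Rightarrow> real" where
  "total_area Y = (\<Sum>f\<in>faces Y. area Y f)"

definition total_curvature :: "('v, 'e, 'u, 'd) branched_complex \<Rightarrow> real" where
  "total_curvature Y = total_area Y + of_int (euler_char (skel Y))"

definition avg_curvature :: "('v, 'e, 'u, 'd) branched_complex \<Rightarrow> real" where
  "avg_curvature Y = total_curvature Y / total_area Y"

(* Extended reals, so that the supremum and infimum have their true values even without
   boundedness being known. *)
definition rho_plus :: "('w, 'f, 'x, 'c) branched_complex \<Rightarrow> ereal" where
  "rho_plus X = (SUP (Y, p, s)\<in>Irred X. ereal (avg_curvature Y))"

definition rho_minus :: "('w, 'f, 'x, 'c) branched_complex \<Rightarrow> ereal" where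
  "rho_minus X = (INF (Y, p, s)\<in>Irred X. ereal (avg_curvature Y))"


section \<open>Rational linear programs\<close>

(* Vectors in R^N are lists of length N. *)
definition dot :: "rat list \<Rightarrow> real list \<Rightarrow> real" where
  "dot a x = (\<Sum>i<length x. of_rat (a ! i) * x ! i)"

record linear_program =
  lp_dim :: nat
  lp_eqs :: "(rat list \<times> rat) list"
  lp_ineqs :: "(rat list \<times> rat) list"
  lp_obj :: "rat list"

definition linear_program :: "linear_program \<Rightarrow> bool" where
  "linear_program P \<longleftrightarrow> length (lp_obj P) = lp_dim P \<and>
     (\<forall>(a, b)\<in>set (lp_eqs P) \<union> set (lp_ineqs P). length a = lp_dim P)"

definition lp_solutions :: "linear_program \<Rightarrow> real list set" where
  "lp_solutions P = {x. length x = lp_dim P \<and>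
     (\<forall>(a, b)\<in>set (lp_eqs P). dot a x = of_rat b) \<and>
     (\<forall>(a, b)\<in>set (lp_ineqs P). dot a x \<le> of_rat b)}"

definition lp_maximum :: "linear_program \<Rightarrow> real \<Rightarrow> bool" where
  "lp_maximum P m \<longleftrightarrow> (\<exists>x\<in>lp_solutions P. dot (lp_obj P) x = m) \<and>
     (\<forall>x\<in>lp_solutions P. dot (lp_obj P) x \<le> m)"

definition lp_minimum :: "linear_program \<Rightarrow> real \<Rightarrow> bool" where
  "lp_minimum P m \<longleftrightarrow> (\<exists>x\<in>lp_solutions P. dot (lp_obj P) x = m) \<and>
     (\<forall>x\<in>lp_solutions P. m \<le> dot (lp_obj P) x)"


section \<open>Algorithms: partial recursive functions and codings\<close>

datatype recf = Zero | Succ | Proj nat | Comp recf "recf list" | PrimRec recf recf | Mu recf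

(* computes r xs y: the partial recursive function described by r is defined on the
   argument list xs and has value y there. *)
inductive computes :: "recf \<Rightarrow> nat list \<Rightarrow> nat \<Rightarrow> bool" where
  "computes Zero xs 0"
| "computes Succ [x] (Suc x)"
| "i < length xs \<Longrightarrow> computes (Proj i) xs (xs ! i)"
| "list_all2 (\<lambda>g y. computes g xs y) gs ys \<Longrightarrow> computes f ys z \<Longrightarrow> computes (Comp f gs) xs z"
| "computes f xs y \<Longrightarrow> computes (PrimRec f g) (0 # xs) y"
| "computes (PrimRec f g) (n # xs) y \<Longrightarrow> computes g (y # n # xs) z \<Longrightarrow>
     computes (PrimRec f g) (Suc n # xs) z"
| "computes f (n # xs) 0 \<Longrightarrow> (\<forall>i<n. \<exists>y. computes f (i # xs) (Suc y)) \<Longrightarrow>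
     computes (Mu f) xs n"

definition position :: "'a list \<Rightarrow> 'a \<Rightarrow> nat" where
  "position xs x = length (takeWhile (\<lambda>y. y \<noteq> x) xs)"

(* The code of a finite graph with respect to enumerations of its vertices and edges: the
   number of vertices, and for each edge the positions of its initial vertex and its opposite. *)
definition graph_code :: "('v, 'e) sgraph \<Rightarrow> 'v list \<Rightarrow> 'e list \<Rightarrow> nat" where
  "graph_code G vs es = prod_encode (length vs,
     list_encode (map (\<lambda>e. prod_encode (position vs (ini G e), position es (opp G e))) es))"

definition enumerates :: "'a list \<Rightarrow> 'a set \<Rightarrow> bool" where
  "enumerates xs A \<longleftrightarrow> distinct xs \<and> set xs = A"

(* c is a code of X, for some choice of enumerations. *)
definition complex_code :: "('v, 'e, 'u, 'd) two_complex \<Rightarrow> nat \<Rightarrow> bool" where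
  "complex_code X c \<longleftrightarrow> (\<exists>vs es us ds.
     enumerates vs (verts (skel X)) \<and> enumerates es (edges (skel X)) \<and>
     enumerates us (verts (bdry X)) \<and> enumerates ds (edges (bdry X)) \<and>
     c = list_encode
       [graph_code (skel X) vs es,
        graph_code (bdry X) us ds,
        list_encode (map (\<lambda>u. position vs (vmap (att X) u)) us),
        list_encode (map (\<lambda>d. position es (emap (att X) d)) ds)])"

definition rat_code :: "rat \<Rightarrow> nat" where
  "rat_code q = prod_encode (map_prod int_encode int_encode (quotient_of q))"

definition vec_code :: "rat list \<Rightarrow> nat" where
  "vec_code a = list_encode (map rat_code a)"

definition constraints_code :: "(rat list \<times> rat) list \<Rightarrow> nat" where
  "constraints_code cs = list_encode (map (prod_encode \<circ> map_prod vec_code rat_code) cs)"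

definition lp_code :: "linear_program \<Rightarrow> nat" where
  "lp_code P = list_encode
     [lp_dim P, constraints_code (lp_eqs P), constraints_code (lp_ineqs P), vec_code (lp_obj P)]"

end

theory Submission
	imports Defs "HOL-Library.Z2"
begin

text \<open>An essential map is encoded by labelling the vertices of its domain by the vertices of the folded graph, together with an origami:
an equivalence relation on the edges recording which opposite edges get folded together, whose incidence graph with the vertices is a forest.
Cutting the domain at the labels produces blocks, equivalence relations on darts (oriented edges of the attaching circles) of the target,
of which there are finitely many. Euler characteristic and area are sums over blocks, and blocks glue along compatible edges, so the average
curvature is one plus a ratio of linear functionals on a rational cone. Conversely every integral point of the cone is realised by an
irreducible essential map. Fourier--Motzkin elimination yields strong duality over the rationals; a dual solution with a system of blocks
attaining its bound is a finite certificate for an extremal curvature, and searching for certificates is partial recursive.\<close>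

section \<open>Graphs, folds and origamis\<close>

text \<open>Essentiality is a condition on topological realisations, blocks are finite combinatorial
  data; the bridge has two halves. Of a homotopy equivalence only its effect on first cohomology is
  kept (\<open>split_cocycles\<close>): it forbids folding two edges with equal termini, and then a
  folding can be undone one fold at a time, pulling an origami back from the identity relation of
  the immersed graph. Conversely the forest condition separates the termini of every pair still to
  be folded, and each such fold has an explicit homotopy inverse. Acyclicity is tested by chains
  modulo 2 because these push forward along folds and split over the labels, so that the forest
  condition becomes a condition on each block separately. The extremal ratio is the least a for
  which chi - a * area has a dual bound; the minimum is the same problem for -chi. The program that
  is finally output has two variables: its objective has the two certified extremes as coefficients
  and its solution set is a segment. The program on blocks enters through the certificates.\<close>

definition lab :: "('v, 'e) sgraph => ('v => 'o) => ('e => 'x) => 'e => 'o \<times> 'x" where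
	"lab G vl el e = (vl (ini G e), el e)"

definition near_step ::
	"('v, 'e) sgraph => ('v => 'o) => ('e => 'x) => ('e \<times> 'e) set => 'o \<times> 'x => ('v \<times> 'v) set" where
	"near_step G vl el P h = {(ini G a, ini G b) | a b. (a, b) : P & lab G vl el a ~= h}"

text \<open>Acyclicity of the bipartite graph on the vertices of \<open>G\<close> and the classes of
  \<open>P\<close>, in which every edge \<open>e\<close> joins \<open>ini G e\<close> to its class:
  a finite graph is a forest iff it carries no nonzero cycle modulo 2.\<close>

definition bip_forest :: "('v, 'e) sgraph => ('e \<times> 'e) set => bool" where
	"bip_forest G P \<longleftrightarrow> (\<forall>k :: 'e => bit.
		 (\<forall>v. (\<Sum>e | e : edges G & ini G e = v. k e) = 0) -->
		 (\<forall>c\<in>edges G. (\<Sum>e\<in>P `` {c}. k e) = 0) --> (\<forall>e\<in>edges G. k e = 0))"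

definition eqrel :: "'a set => ('a \<times> 'a) set => bool" where
	"eqrel A P \<longleftrightarrow> P \<subseteq> A \<times> A & (\<forall>a\<in>A. (a, a) : P) & sym P & trans P"

text \<open>For an essential map \<open>vl\<close> is the vertex map to the folded graph and
  \<open>el\<close> the edge map to X; as the folded graph immerses in X, \<open>lab\<close> then
  names an edge of the folded graph. A class of \<open>P\<close> acts as a hub joining the initial
  vertices of its edges. Whenever equally labelled edges start at vertices joined without using hubs
  of their own label, their opposites must share a hub; for edges with a common initial vertex this
  always applies.\<close>

definition origami ::
	"('v, 'e) sgraph => ('v => 'o) => ('e => 'x) => ('e \<times> 'e) set => bool" where
	"origami G vl el P \<longleftrightarrow> sgraph G & finite (edges G) &
		 (\<forall>e\<in>edges G. \<forall>f\<in>edges G. lab G vl el e = lab G vl el f -->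
				lab G vl el (opp G e) = lab G vl el (opp G f)) &
		 (\<forall>e\<in>edges G. el (opp G e) ~= el e) &
		 eqrel (edges G) P & (\<forall>(e, f)\<in>P. lab G vl el e = lab G vl el f) &
		 (\<forall>e\<in>edges G. \<forall>f\<in>edges G. lab G vl el e = lab G vl el f -->
				(ini G e, ini G f) : (near_step G vl el P (lab G vl el e))\<^sup>* --> (opp G e, opp G f) : P) &
		 bip_forest G P"

lemma sum_insert4:
	fixes g :: "'a => 'b :: comm_monoid_add"
	assumes "finite A" "a \<notin> A" "b \<notin> A" "c \<notin> A" "d \<notin> A" "distinct [a, b, c, d]"
	shows "sum g (insert a (insert b (insert c (insert d A)))) = g a + g b + g c + g d + sum g A"
	using assms by (simp add: add.assoc)

lemma sum_insert2:
	fixes g :: "'a => 'b :: comm_monoid_add"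
	assumes "finite A" "a \<notin> A" "b \<notin> A" "a ~= b"
	shows "sum g (insert a (insert b A)) = g a + g b + sum g A"
	using assms by (simp add: add.assoc)

text \<open>The chain of a path in the incidence graph: each step through a class adds the edge by
  which it enters and the edge by which it leaves, so class sums stay zero and vertex sums telescope
  to the two ends.\<close>

lemma near_chain:
	fixes E :: "'e set"
	assumes E: "finite E" and P: "P \<subseteq> E \<times> E" "sym P" "trans P"
		and xy: "(x, y) : {(s a, s b) | a b. (a, b) : P & ok a}\<^sup>*"
		and ok: "!!a b. (a, b) : P ==> ok a = ok b"
	shows "\<exists>k :: 'e => bit. (\<forall>e. k e ~= 0 --> e : E & ok e) &
		 (\<forall>v. (\<Sum>e | e : E & s e = v. k e) = of_bool (v = x) + of_bool (v = y)) &
		 (\<forall>c. (\<Sum>e\<in>P `` {c}. k e) = 0)"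
	using xy
proof (induction rule: rtrancl_induct)
	case base
	show ?case by (rule exI[of _ "%_. 0"]) auto
next
	case (step y z)
	then obtain a b where ab: "y = s a" "z = s b" "(a, b) : P" "ok a" by auto
	obtain k :: "'e => bit" where k: "\<forall>e. k e ~= 0 --> e : E & ok e"
		"\<forall>v. (\<Sum>e | e : E & s e = v. k e) = of_bool (v = x) + of_bool (v = y)"
		"\<forall>c. (\<Sum>e\<in>P `` {c}. k e) = 0"
		using step.IH by blast
	define k' where "k' e = k e + of_bool (e = a) + of_bool (e = b)" for e
	have abE: "a : E" "b : E" using ab P by auto
	have fin: "finite (P `` {c})" for c using P(1) E by (intro finite_subset[OF _ E]) auto
	have "\<forall>e. k' e ~= 0 --> e : E & ok e"
	proof (intro allI impI)
		fix e assume "k' e ~= 0"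
		then have "k e ~= 0 \<or> e = a \<or> e = b" unfolding k'_def by (auto split: if_splits)
		then show "e : E & ok e" using k(1) abE ab(3,4) ok by metis
	qed
	moreover have "(\<Sum>e | e : E & s e = v. k' e) = of_bool (v = x) + of_bool (v = z)" for v
	proof -
		have "(\<Sum>e | e : E & s e = v. of_bool (e = a) :: bit) = of_bool (v = y)"
			"(\<Sum>e | e : E & s e = v. of_bool (e = b) :: bit) = of_bool (v = z)"
			using E abE ab by (auto simp: of_bool_def)
		then have "(\<Sum>e | e : E & s e = v. k' e) = of_bool (v = x) + of_bool (v = y) + of_bool (v = y) + of_bool (v = z)"
			unfolding k'_def sum.distrib using k(2) by simp
		then show ?thesis by (cases "v = x"; cases "v = y"; cases "v = z") simp_all
	qed
	moreover have "(\<Sum>e\<in>P `` {c}. k' e) = 0" for c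
	proof -
		have "(c, a) : P \<longleftrightarrow> (c, b) : P" using ab(3) transD[OF P(3), of c a b] transD[OF P(3), of c b a] symD[OF P(2), of a b] by blast
		then show ?thesis
			unfolding k'_def sum.distrib using k(3) fin[of c] by (auto simp: of_bool_def)
	qed
	ultimately show ?case by blast
qed

lemma sum_zero_saturated:
	fixes k :: "'e => 'b :: comm_monoid_add"
	assumes "finite A" "A \<subseteq> E" and P: "eqrel E P" and sat: "!!a b. a : A ==> (a, b) : P ==> b : A"
		and z: "!!c. c : E ==> (\<Sum>e\<in>P `` {c}. k e) = 0"
	shows "sum k A = 0"
proof -
	let ?C = "(%a. P `` {a}) ` A"
	have "\<Union> ?C = A"
		using sat assms(2) P unfolding eqrel_def by auto
	moreover have "sum k (\<Union> ?C) = (sum \<circ> sum) k ?C"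
	proof (rule sum.Union_disjoint)
		show "\<forall>A'\<in>?C. finite A'" using \<open>\<Union> ?C = A\<close> assms(1) by (metis Sup_upper finite_subset)
		show "\<forall>A'\<in>?C. \<forall>B\<in>?C. A' ~= B --> A' \<inter> B = {}"
		proof (intro ballI impI, rule ccontr)
			fix A' B assume h: "A' : ?C" "B : ?C" "A' ~= B" "A' \<inter> B ~= {}"
			then obtain a b c where "A' = P `` {a}" "B = P `` {b}" "(a, c) : P" "(b, c) : P" by auto
			moreover have "sym P" "trans P" using P unfolding eqrel_def by auto
			ultimately have ab: "(a, b) : P" "(b, a) : P"
				using transD[OF \<open>trans P\<close>, of a c b] transD[OF \<open>trans P\<close>, of b c a] symD[OF \<open>sym P\<close>] \<open>(a, c) : P\<close> \<open>(b, c) : P\<close> by blast+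
			have "P `` {a} = P `` {b}" using ab transD[OF \<open>trans P\<close>, of a b] transD[OF \<open>trans P\<close>, of b a] by blast
			then show False using \<open>A' = P `` {a}\<close> \<open>B = P `` {b}\<close> h(3) by simp
		qed
	qed
	moreover have "(sum \<circ> sum) k ?C = 0"
		unfolding comp_def by (rule sum.neutral) (use z assms(2) in auto)
	ultimately show ?thesis by simp
qed

section \<open>Folding an origami along one pair of edges\<close>

definition fold_graph :: "('v, 'e) sgraph => 'e => 'e => ('v, 'e) sgraph" where
	"fold_graph G e1 e2 = \<lparr>verts = verts G - {ter G e2}, edges = edges G - {e2, opp G e2},
		 ini = (%f. if ini G f = ter G e2 then ter G e1 else ini G f), opp = opp G\<rparr>"

text \<open>The quotient lives on a subset of the old carriers, with \<open>e1\<close> and its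
  terminus as representatives, because \<open>folds\<close> keeps the carrier types fixed.\<close>

definition fold_gmap :: "('v, 'e) sgraph => 'e => 'e => ('v, 'e, 'v, 'e) gmap" where
	"fold_gmap G e1 e2 = \<lparr>vmap = (%v. if v = ter G e2 then ter G e1 else v),
		 emap = (%f. if f = e2 then e1 else if f = opp G e2 then opp G e1 else f)\<rparr>"

lemma fold_graph_simps [simp]:
	"verts (fold_graph G e1 e2) = verts G - {ter G e2}"
	"edges (fold_graph G e1 e2) = edges G - {e2, opp G e2}"
	"ini (fold_graph G e1 e2) f = (if ini G f = ter G e2 then ter G e1 else ini G f)"
	"opp (fold_graph G e1 e2) = opp G"
	by (auto simp: fold_graph_def)

text \<open>The asymmetric condition \<open>ini G e1 ~= ter G e2\<close> keeps the common initial
  vertex among the representatives. It can be arranged by exchanging the edges, since of two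
  distinct termini at most one is the initial vertex.\<close>

locale good_fold =
	fixes G :: "('v, 'e) sgraph" and e1 e2 :: 'e
	assumes G: "sgraph G" and e12: "e1 : edges G" "e2 : edges G" "e1 ~= e2" "e1 ~= opp G e2"
		and ini12: "ini G e1 = ini G e2" and ter12: "ter G e1 ~= ter G e2" "ini G e1 ~= ter G e2"
begin

abbreviation "G1 \<equiv> fold_graph G e1 e2"
abbreviation "q \<equiv> fold_gmap G e1 e2"

lemma opp_facts [simp]:
	"opp G e1 : edges G" "opp G e2 : edges G" "opp G (opp G e1) = e1" "opp G (opp G e2) = e2"
	"opp G e1 ~= e1" "opp G e2 ~= e2" "opp G e1 ~= e2" "opp G e2 ~= e1" "opp G e1 ~= opp G e2"
	"e1 ~= opp G e1" "e2 ~= opp G e2" "e2 ~= opp G e1" "opp G e2 ~= opp G e1"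
	using G e12 unfolding sgraph_def by metis+

lemma opp_inj: "f : edges G ==> g : edges G ==> opp G f = opp G g \<longleftrightarrow> f = g"
	using G unfolding sgraph_def by metis

lemma sgraph_G1: "sgraph G1"
	unfolding sgraph_def
proof (intro ballI conjI)
	fix e assume e: "e : edges G1"
	then have eE: "e : edges G" "e ~= e2" "e ~= opp G e2" by auto
	have "ter G e1 : verts G" using G opp_facts(1) by (simp add: sgraph_def ter_def del: opp_facts)
	then show "ini G1 e : verts G1" using eE G ter12 unfolding sgraph_def by auto
	have "opp G e ~= e2" "opp G e ~= opp G e2" using eE G e12 unfolding sgraph_def by metis+
	then show "opp G1 e : edges G1" using eE G unfolding sgraph_def by auto
	show "opp G1 (opp G1 e) = e" "opp G1 e ~= e" using eE G unfolding sgraph_def by auto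
qed

lemma fold_map_q: "fold_map G G1 q"
	unfolding fold_map_def
proof (intro conjI)
	show "graph_morphism G G1 q"
		unfolding graph_morphism_def
	proof (intro conjI ballI)
		show "sgraph G" "sgraph G1" using G sgraph_G1 by auto
		show "vmap q v : verts G1" if "v : verts G" for v
			using that e12 G ter12 by (auto simp: fold_gmap_def sgraph_def ter_def)
		fix e assume e: "e : edges G"
		show "emap q e : edges G1" using e e12 by (auto simp: fold_gmap_def)
		show "ini G1 (emap q e) = vmap q (ini G e)"
			using e ini12 ter12 by (auto simp: fold_gmap_def ter_def)
		show "opp G1 (emap q e) = emap q (opp G e)"
			using e opp_inj[of e e2] opp_inj[of e "opp G e2"] e12 by (auto simp: fold_gmap_def)
	qed
	have "ter G e1 : verts G" using G e12 by (auto simp: sgraph_def ter_def)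
	then show "vmap q ` verts G = verts G1"
		using ter12 by (auto simp: fold_gmap_def image_iff)
	show "emap q ` edges G = edges G1"
		using e12 by (auto simp: fold_gmap_def image_iff)
	show "\<exists>e1\<in>edges G. \<exists>e2\<in>edges G. e1 ~= e2 & ini G e1 = ini G e2 &
		 (\<forall>x\<in>verts G. \<forall>y\<in>verts G. (vmap q x = vmap q y) = (x = y \<or> {x, y} = {ter G e1, ter G e2})) &
		 (\<forall>d\<in>edges G. \<forall>d'\<in>edges G. (emap q d = emap q d') =
				 (d = d' \<or> {d, d'} = {e1, e2} \<or> {d, d'} = {opp G e1, opp G e2}))"
		using e12 ini12 ter12 by (intro bexI[of _ e1] bexI[of _ e2] conjI) (auto simp: fold_gmap_def doubleton_eq_iff)
qed

context
	fixes vl :: "'v => 'o" and el :: "'e => 'x" and P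
	assumes or: "origami G vl el P" and el12: "el e1 = el e2"
begin

text \<open>After the fold \<open>e1\<close> and \<open>e2\<close> are one edge, so their classes
  have to fuse into \<open>C\<close>; the opposite edges already share a class
  (\<open>Popp\<close>).\<close>

definition "C = P `` {e1} \<union> P `` {e2}"
definition "P1 = {(f, f'). f : edges G1 & f' : edges G1 & ((f, f') : P \<or> f : C & f' : C)}"

abbreviation "l \<equiv> lab G vl el"

lemma or_facts:
	"finite (edges G)" "e : edges G ==> f : edges G ==> l e = l f ==> l (opp G e) = l (opp G f)"
	"e : edges G ==> el (opp G e) ~= el e"
	"(e, f) : P ==> e : edges G" "(e, f) : P ==> f : edges G" "e : edges G ==> (e, e) : P"
	"(e, f) : P ==> (f, e) : P" "(e, f) : P ==> (f, g) : P ==> (e, g) : P"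
	"(e, f) : P ==> l e = l f"
	"e : edges G ==> f : edges G ==> l e = l f ==>
			(ini G e, ini G f) : (near_step G vl el P (l e))\<^sup>* ==> (opp G e, opp G f) : P"
proof -
	note o = or[unfolded origami_def eqrel_def]
	have ST: "sym P" "trans P" using o by blast+
	show "finite (edges G)" using o by blast
	show "e : edges G ==> f : edges G ==> l e = l f ==> l (opp G e) = l (opp G f)" using o by blast
	show "e : edges G ==> el (opp G e) ~= el e" using o by blast
	show "(e, f) : P ==> e : edges G" "(e, f) : P ==> f : edges G" "e : edges G ==> (e, e) : P" using o by blast+
	show "(e, f) : P ==> (f, e) : P" using symD[OF ST(1)] .
	show "(e, f) : P ==> (f, g) : P ==> (e, g) : P" using transD[OF ST(2)] .
	show "(e, f) : P ==> l e = l f" using o by blast+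
	show "e : edges G ==> f : edges G ==> l e = l f ==>
			(ini G e, ini G f) : (near_step G vl el P (l e))\<^sup>* ==> (opp G e, opp G f) : P" using o by blast
qed

lemma l12: "l e1 = l e2" "l (opp G e1) = l (opp G e2)" "l e1 ~= l (opp G e1)"
	"l e1 ~= l (opp G e2)" "l e2 ~= l (opp G e1)" "l e2 ~= l (opp G e2)"
proof -
	show 1: "l e1 = l e2" using el12 ini12 by (simp add: lab_def)
	show 2: "l (opp G e1) = l (opp G e2)" using or_facts(2)[OF e12(1,2) 1] .
	have "el (opp G e1) ~= el e1" using or_facts(3) e12 by blast
	then show "l e1 ~= l (opp G e1)" by (auto simp: lab_def)
	then show "l e1 ~= l (opp G e2)" "l e2 ~= l (opp G e1)" "l e2 ~= l (opp G e2)" using 1 2 by auto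
qed

lemma vl_ter: "vl (ter G e1) = vl (ter G e2)"
	using l12(2) by (simp add: lab_def ter_def)

lemma Popp: "(opp G e1, opp G e2) : P"
	using or_facts(10)[OF e12(1,2) l12(1)] ini12 by simp

text \<open>Two edges with the same initial vertex and the same class would be a double edge of the
  incidence graph, that is, a cycle of length 2.\<close>

lemma notP: "(e1, e2) \<notin> P"
proof
	assume a: "(e1, e2) : P"
	define k :: "'e => bit" where "k e = of_bool (e = e1) + of_bool (e = e2)" for e
	have "(\<Sum>e | e : edges G & ini G e = v. k e) = 0" for v
		unfolding k_def sum.distrib using or_facts(1) e12 ini12 by (auto simp: of_bool_def)
	moreover have "(\<Sum>e\<in>P `` {c}. k e) = 0" for c
	proof -
		have "finite (P `` {c})" by (rule finite_subset[OF _ or_facts(1)]) (use or_facts(5) in auto)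
		moreover have "(c, e1) : P \<longleftrightarrow> (c, e2) : P" using a or_facts(7,8) by blast
		ultimately show ?thesis unfolding k_def sum.distrib by (auto simp: of_bool_def)
	qed
	moreover have "k e1 ~= 0" using e12 by (simp add: k_def)
	ultimately show False using or e12(1) unfolding origami_def bip_forest_def by blast
qed

lemma eqrel_P1: "eqrel (edges G1) P1"
proof -
	have c: "a : C ==> (a, b) : P ==> b : C" for a b unfolding C_def using or_facts(8) by blast
	have c': "b : C ==> (a, b) : P ==> a : C" for a b using c or_facts(7) by blast
	have "trans P1"
	proof (rule transI)
		fix a b d assume h: "(a, b) : P1" "(b, d) : P1"
		show "(a, d) : P1"
		proof (cases "b : C")
			case True
			then have "a : C" "d : C" using h c[of b d] c'[of b a] by (auto simp: P1_def)
			then show ?thesis using h by (simp add: P1_def)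
		next
			case False
			then have "(a, b) : P" "(b, d) : P" using h by (auto simp: P1_def)
			then show ?thesis using h or_facts(8)[of a b d] by (simp add: P1_def)
		qed
	qed
	moreover have "sym P1" unfolding P1_def sym_def using or_facts(7) by blast
	ultimately show ?thesis
		unfolding eqrel_def using or_facts(6) by (auto simp: P1_def)
qed

lemma lab1: "lab G1 vl el f = l f"
	using vl_ter by (simp add: lab_def)

lemma lC: "f : C ==> l f = l e1"
	unfolding C_def using or_facts(9)[of e1 f] or_facts(9)[of e2 f] l12(1) by auto

text \<open>A path in the quotient lifts to \<open>R'\<close>, the old relation enlarged by
  identifying everything joined to either terminus (\<open>XS\<close>). If the lift uses the
  identification and the label is that of \<open>opp G e1\<close>, both opposites are related to
  \<open>e1\<close> or \<open>e2\<close> and so lie in \<open>C\<close>. For any other label the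
  step from \<open>opp G e1\<close> to \<open>opp G e2\<close> is itself allowed, so the termini
  were joined before the fold.\<close>

lemma near_G1:
	assumes f: "f : edges G1" "f' : edges G1" and ll: "l f = l f'"
		and path: "(ini G1 f, ini G1 f') : (near_step G1 vl el P1 (l f))\<^sup>*"
	shows "(opp G f, opp G f') : P1"
proof -
	define R where "R = (near_step G vl el P (l f))\<^sup>*"
	let ?x = "ter G e1" and ?y = "ter G e2"
	define XS where "XS = {i. (i, ?x) : R \<or> (i, ?y) : R}"
	define R' where "R' = R \<union> XS \<times> XS"
	have "sym (near_step G vl el P (l f))"
	proof (rule symI)
		fix a b assume "(a, b) : near_step G vl el P (l f)"
		then obtain c d where cd: "(c, d) : P" "l c ~= l f" "a = ini G c" "b = ini G d" unfolding near_step_def by blast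
		then have "(d, c) : P" "l d ~= l f" using or_facts(7)[of c d] or_facts(9)[of c d] by auto
		then show "(b, a) : near_step G vl el P (l f)" unfolding near_step_def cd by blast
	qed
	then have "sym R" unfolding R_def by (rule sym_rtrancl)
	then have Rsym: "(a, b) : R ==> (b, a) : R" for a b by (rule symD)
	have Rtrans: "(a, b) : R ==> (b, c) : R ==> (a, c) : R" for a b c unfolding R_def by (rule rtrancl_trans)
	have XR: "a : XS" if "(a, b) : R" "b : XS" for a b
		using that Rtrans[of a b ?x] Rtrans[of a b ?y] unfolding XS_def by blast
	have R't: "(a, b) : R' ==> (b, c) : R' ==> (a, c) : R'" for a b c
		unfolding R'_def using Rtrans[of a b c] XR[of a b] XR[of c b] Rsym[of b c] by blast
	have xy: "?x : XS" "?y : XS" unfolding XS_def R_def by auto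
	have i1: "(ini G a, ini G1 a) : R'" "(ini G1 a, ini G a) : R'" for a
		using xy by (auto simp: R'_def R_def)
	have PR: "(a, b) : P ==> l a ~= l f ==> (ini G a, ini G b) : R" for a b
		unfolding R_def near_step_def by blast
	have stepR: "(ini G a, ini G b) : R'" if ab: "(a, b) : P1" "l a ~= l f" for a b
	proof (cases "(a, b) : P")
		case True then show ?thesis using PR that unfolding R'_def by blast
	next
		case False
		then have "a : C" "b : C" using ab unfolding P1_def by auto
		moreover have "(ini G a, ini G e1) : R" if "a : C" "l a ~= l f" for a
			using that PR[of a e1] PR[of a e2] or_facts(7)[of e1 a] or_facts(7)[of e2 a] ini12 unfolding C_def by auto
		moreover have "l b ~= l f" using lC[OF \<open>a : C\<close>] lC[OF \<open>b : C\<close>] ab(2) by simp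
		ultimately have "(ini G a, ini G e1) : R" "(ini G e1, ini G b) : R"
			using ab(2) Rsym by auto
		then show ?thesis using Rtrans[of "ini G a" "ini G e1" "ini G b"] unfolding R'_def by blast
	qed
	have "(i, j) : R'" if "(i, j) : (near_step G1 vl el P1 (l f))\<^sup>*" for i j
		using that
	proof (induction rule: rtrancl_induct)
		case base show ?case by (simp add: R'_def R_def)
	next
		case (step j k)
		then obtain a b where "j = ini G1 a" "k = ini G1 b" "(a, b) : P1" "l a ~= l f"
			unfolding near_step_def lab1 by blast
		then have "(j, k) : R'"
			using R't[OF i1(2)[of a] R't[OF stepR[of a b] i1(1)[of b]]] by simp
		then show ?case using step.IH R't[of i j k] by simp
	qed
	from R't[OF i1(1)[of f] R't[OF this[OF path] i1(2)[of f']]] have "(ini G f, ini G f') : R'" .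
	then consider "(ini G f, ini G f') : R" | "ini G f : XS" "ini G f' : XS" unfolding R'_def by blast
	then have "(opp G f, opp G f') : P \<or> opp G f : C & opp G f' : C"
	proof cases
		case 1
		then show ?thesis using or_facts(10)[of f f'] f ll by (auto simp: R_def)
	next
		case 2
		show ?thesis
		proof (cases "l f = l (opp G e1)")
			case True
			have "opp G j : C" if j: "j : edges G" "l j = l f" "ini G j : XS" for j
			proof -
				have "(ini G j, ini G (opp G e1)) : R \<or> (ini G j, ini G (opp G e2)) : R"
					using j(3) by (auto simp: XS_def ter_def)
				then have "(opp G j, e1) : P \<or> (opp G j, e2) : P"
					using or_facts(10)[of j "opp G e1"] or_facts(10)[of j "opp G e2"] j True l12 by (auto simp: R_def)
				then show ?thesis unfolding C_def using or_facts(7)[of "opp G j"] by blast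
			qed
			then show ?thesis using f ll 2 by auto
		next
			case False
			then have "(?x, ?y) : R" using PR[OF Popp] by (simp add: ter_def)
			then have "(ini G f, ?y) : R" "(ini G f', ?y) : R"
				using 2 Rtrans[of "ini G f" ?x ?y] Rtrans[of "ini G f'" ?x ?y] unfolding XS_def by blast+
			then have "(ini G f, ini G f') : R" using Rsym[of "ini G f'" ?y] Rtrans[of "ini G f" ?y "ini G f'"] by blast
			then show ?thesis using or_facts(10)[of f f'] f ll by (auto simp: R_def)
		qed
	qed
	moreover have "opp G f : edges G1" "opp G f' : edges G1"
		using f sgraph_G1 unfolding sgraph_def by auto
	ultimately show ?thesis unfolding P1_def by simp
qed

lemma bit_simps: "(a :: bit) + a = 0" "(a :: bit) + (a + b) = b" "(a :: bit) + (b + c) + c = a + b"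
	by (cases a; cases b; cases c; simp)+

text \<open>A cycle of the folded incidence graph lifts to a cycle upstairs, which vanishes there.
  The fold removes two edges and fuses two vertices and two classes, so exactly two coefficients
  have to be supplied and two adjusted.\<close>

lemma forest_G1: "bip_forest G1 P1"
	unfolding bip_forest_def
proof (intro allI impI ballI)
	fix k1 :: "'e => bit" and e0
	assume vs: "\<forall>v. (\<Sum>e | e : edges G1 & ini G1 e = v. k1 e) = 0"
		and cs: "\<forall>c\<in>edges G1. (\<Sum>e\<in>P1 `` {c}. k1 e) = 0" and e0: "e0 : edges G1"
	let ?x = "ter G e1" and ?y = "ter G e2" and ?u = "ini G e1"
	define E0 where "E0 = edges G - {e1, e2, opp G e1, opp G e2}"
	have E: "edges G = insert e1 (insert e2 (insert (opp G e1) (insert (opp G e2) E0)))"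
		and E1: "edges G1 = insert e1 (insert (opp G e1) E0)"
		using e12 by (auto simp: E0_def)
	have fin: "finite E0" using or_facts(1) by (simp add: E0_def)
	have notin: "e1 \<notin> E0" "e2 \<notin> E0" "opp G e1 \<notin> E0" "opp G e2 \<notin> E0" by (auto simp: E0_def)
	define F where "F v = (\<Sum>e\<in>E0. if ini G e = v then k1 e else 0)" for v
	define T where "T c = (\<Sum>e\<in>E0. if (c, e) : P then k1 e else 0)" for c
	\<comment> \<open>Forced values: besides edges of \<open>E0\<close> only \<open>opp G e2\<close>
	  starts at the terminus of \<open>e2\<close>, and only \<open>e2\<close> lies in its class, so
	  these coefficients must be \<open>F ?y\<close> and \<open>T e2\<close>. Adding the same amounts
	  to \<open>opp G e1\<close> and \<open>e1\<close> keeps the sums at the class of the opposites and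
	  at the common initial vertex.\<close>
	define k where "k f = (if f = opp G e2 then F ?y else if f = opp G e1 then k1 f + F ?y
		 else if f = e2 then T e2 else if f = e1 then k1 e1 + T e2 else k1 f)" for f
	have k4: "k e1 = k1 e1 + T e2" "k e2 = T e2" "k (opp G e1) = k1 (opp G e1) + F ?y" "k (opp G e2) = F ?y"
		using e12 by (auto simp: k_def)
	have k0: "f : E0 ==> k f = k1 f" for f using notin by (auto simp: k_def)
	have sumE: "(\<Sum>e | e : edges G & Q e. h e) =
			(if Q e1 then h e1 else 0) + (if Q e2 then h e2 else 0) + (if Q (opp G e1) then h (opp G e1) else 0)
			+ (if Q (opp G e2) then h (opp G e2) else 0) + (\<Sum>e\<in>E0. if Q e then h e else 0)" for Q and h :: "'e => bit"
	proof -
		have "(\<Sum>e | e : edges G & Q e. h e) = (\<Sum>e\<in>edges G. if Q e then h e else 0)"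
			using or_facts(1) by (simp add: sum.inter_filter)
		also have "\<dots> = (\<Sum>e\<in>insert e1 (insert e2 (insert (opp G e1) (insert (opp G e2) E0))). if Q e then h e else 0)"
			using E by (rule arg_cong)
		also have "\<dots> = (if Q e1 then h e1 else 0) + (if Q e2 then h e2 else 0) + (if Q (opp G e1) then h (opp G e1) else 0)
			+ (if Q (opp G e2) then h (opp G e2) else 0) + (\<Sum>e\<in>E0. if Q e then h e else 0)"
			by (rule sum_insert4[OF fin notin]) (use e12(3,4) in auto)
		finally show ?thesis .
	qed
	have sumE1: "(\<Sum>e | e : edges G1 & Q e. h e) =
			(if Q e1 then h e1 else 0) + (if Q (opp G e1) then h (opp G e1) else 0)
			+ (\<Sum>e\<in>E0. if Q e then h e else 0)" for Q and h :: "'e => bit"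
	proof -
		have "(\<Sum>e | e : edges G1 & Q e. h e) = (\<Sum>e\<in>edges G1. if Q e then h e else 0)"
			by (rule sum.inter_filter) (simp add: or_facts(1))
		also have "\<dots> = (\<Sum>e\<in>insert e1 (insert (opp G e1) E0). if Q e then h e else 0)"
			using E1 by (rule arg_cong)
		also have "\<dots> = (if Q e1 then h e1 else 0) + (if Q (opp G e1) then h (opp G e1) else 0) + (\<Sum>e\<in>E0. if Q e then h e else 0)"
			by (rule sum_insert2[OF fin notin(1,3)]) auto
		finally show ?thesis .
	qed
	have imP: "P `` {c} = {e. e : edges G & (c, e) : P}" for c using or_facts(5) by auto
	have imP1: "P1 `` {c} = {e. e : edges G1 & (c, e) : P1}" for c by (auto simp: P1_def)
	have kF: "(\<Sum>e\<in>E0. if ini G e = v then k e else 0) = F v" for v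
		unfolding F_def by (rule sum.cong) (auto simp: k0)
	have kT: "(\<Sum>e\<in>E0. if (c, e) : P then k e else 0) = T c" for c
		unfolding T_def by (rule sum.cong) (auto simp: k0)
	have ix: "ini G (opp G e1) = ?x" "ini G (opp G e2) = ?y" by (simp_all add: ter_def)
	have vs1: "(if ?u = v then k1 e1 else 0) + (if ?x = v then k1 (opp G e1) else 0)
			+ (\<Sum>e\<in>E0. if ini G1 e = v then k1 e else 0) = 0" for v
		using vs[rule_format, of v] unfolding sumE1 using ter12 ix by simp
	have Fx: "(\<Sum>e\<in>E0. if ini G1 e = ?x then k1 e else 0) = F ?x + F ?y"
		unfolding F_def sum.distrib[symmetric] using ter12 by (intro sum.cong) auto
	have Fv: "v ~= ?x ==> v ~= ?y ==> (\<Sum>e\<in>E0. if ini G1 e = v then k1 e else 0) = F v" for v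
		unfolding F_def by (intro sum.cong) auto
	have V: "(\<Sum>e | e : edges G & ini G e = v. k e) = 0" for v
	proof -
		have *: "(\<Sum>e | e : edges G & ini G e = v. k e) = (if ?u = v then k1 e1 else 0)
			 + (if ?x = v then k1 (opp G e1) + F ?y else 0) + (if ?y = v then F ?y else 0) + F v"
			unfolding sumE kF k4 ix ini12[symmetric] by (auto simp: bit_simps add_ac)
		consider "v = ?x" | "v = ?y" | "v ~= ?x" "v ~= ?y" by blast
		then show ?thesis
		proof cases
			case 1 then show ?thesis using vs1[of ?x] ter12 unfolding * Fx by (auto simp: add_ac)
		next
			case 2 then show ?thesis using ter12 unfolding * by (auto simp: bit_simps)
		next
			case 3 then show ?thesis using vs1[of v] unfolding * Fv[OF 3] by auto
		qed
	qed
	have notP': "(e1, opp G e1) \<notin> P" "(e1, opp G e2) \<notin> P" "(e2, opp G e1) \<notin> P" "(e2, opp G e2) \<notin> P" "(e2, e1) \<notin> P"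
		using l12 or_facts(9) notP or_facts(7) by blast+
	have Psum: "(\<Sum>e\<in>P `` {c}. k e) = (if (c, e1) : P then k1 e1 + T e2 else 0) + (if (c, e2) : P then T e2 else 0)
			+ (if (c, opp G e1) : P then k1 (opp G e1) else 0) + T c" for c
	proof -
		have "(c, opp G e1) : P \<longleftrightarrow> (c, opp G e2) : P"
			using Popp or_facts(8)[of c "opp G e1" "opp G e2"] or_facts(8)[of c "opp G e2" "opp G e1"] or_facts(7)[of "opp G e1" "opp G e2"] by blast
		then show ?thesis unfolding imP sumE kT k4
			by (cases "(c, opp G e1) : P") (simp_all only: bit_simps if_True if_False add_0_right)
	qed
	have Tcong: "T c = T d" if "(c, d) : P" for c d
	proof -
		have "(c, e) : P \<longleftrightarrow> (d, e) : P" for e using that or_facts(7)[of c d] or_facts(8)[of c d e] or_facts(8)[of d c e] by blast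
		then show ?thesis by (simp add: T_def)
	qed
	have P1sum: "(if (c, e1) : P1 then k1 e1 else 0) + (if (c, opp G e1) : P1 then k1 (opp G e1) else 0)
			+ (\<Sum>e\<in>E0. if (c, e) : P1 then k1 e else 0) = 0" if "c : edges G1" for c
		using cs[rule_format, OF that] unfolding imP1 sumE1 .
	\<comment> \<open>The sum over the fused class; its part in \<open>E0\<close> splits without
	  overlap into the two old classes by \<open>notP\<close>.\<close>
	have TC: "k1 e1 + T e1 + T e2 = 0"
	proof -
		have "(e1, opp G e1) \<notin> P1" "(e1, e1) : P1" "e1 : edges G1"
			using notP' e12 or_facts(6) by (auto simp: P1_def C_def)
		moreover have "(\<Sum>e\<in>E0. if (e1, e) : P1 then k1 e else 0) = T e1 + T e2"
			unfolding T_def sum.distrib[symmetric]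
		proof (rule sum.cong[OF refl])
			fix e assume "e : E0"
			then have "(e1, e) : P1 \<longleftrightarrow> (e1, e) : P \<or> (e2, e) : P"
				using e12 or_facts(6) E1 by (auto simp: P1_def C_def)
			moreover have "\<not> ((e1, e) : P & (e2, e) : P)"
				using notP or_facts(8)[of e1 e e2] or_facts(7)[of e2 e] by blast
			ultimately show "(if (e1, e) : P1 then k1 e else 0) = (if (e1, e) : P then k1 e else 0) + (if (e2, e) : P then k1 e else 0)" by auto
		qed
		ultimately show ?thesis using P1sum[of e1] by (cases "T e1"; cases "T e2"; cases "k1 e1"; simp)
	qed
	have PC: "(\<Sum>e\<in>P `` {c}. k e) = 0" if c: "c : edges G" for c
	proof -
		have outC: "(\<Sum>e\<in>P `` {c}. k e) = 0" if c: "c : edges G1" "c \<notin> C" for c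
		proof -
			have 1: "(c, e1) \<notin> P" "(c, e2) \<notin> P" using c or_facts(7) unfolding C_def by blast+
			have 2: "(c, e) : P1 \<longleftrightarrow> (c, e) : P" if "e : edges G1" for e using c that by (simp add: P1_def)
			have "(\<Sum>e\<in>E0. if (c, e) : P1 then k1 e else 0) = T c"
				unfolding T_def using 2 E1 by (intro sum.cong) auto
			moreover have "e1 : edges G1" "opp G e1 : edges G1" unfolding E1 by auto
			then have "(c, e1) \<notin> P1" "(c, opp G e1) : P1 \<longleftrightarrow> (c, opp G e1) : P" using 1 2 by blast+
			ultimately show ?thesis using P1sum[OF c(1)] 1 unfolding Psum by (cases "(c, opp G e1) : P") simp_all
		qed
		consider "(e1, c) : P" | "(e2, c) : P" | "c \<notin> C" "c : edges G1" | "c \<notin> C" "c : {e2, opp G e2}"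
			using c unfolding C_def by auto
		then show ?thesis
		proof cases
			case 1
			then have "(c, e1) : P" "(c, e2) \<notin> P" "(c, opp G e1) \<notin> P" "T c = T e1"
				using or_facts(7,8) notP notP' Tcong by blast+
			then show ?thesis unfolding Psum using TC by (cases "T e1"; cases "T e2"; cases "k1 e1"; simp)
		next
			case 2
			then have "(c, e2) : P" "(c, e1) \<notin> P" "(c, opp G e1) \<notin> P" "T c = T e2"
				using or_facts(7,8) notP notP' Tcong by blast+
			then show ?thesis unfolding Psum by (simp add: bit_simps)
		next
			case 3 then show ?thesis using outC by blast
		next
			case 4
			then have "c = opp G e2" using or_facts(6)[OF e12(2)] unfolding C_def by auto
			have "P `` {opp G e2} = P `` {opp G e1}"
				using Popp or_facts(7,8) by blast
			moreover have "opp G e1 : edges G1" "opp G e1 \<notin> C" using notP' unfolding C_def by auto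
			ultimately show ?thesis using outC[of "opp G e1"] \<open>c = opp G e2\<close> by simp
		qed
	qed
	have z: "k e = 0" if "e : edges G" for e
		using or V PC that unfolding origami_def bip_forest_def by blast
	have "k1 e1 = 0" using z[OF e12(1)] z[OF e12(2)] k4 by simp
	moreover have "k1 (opp G e1) = 0" using z[of "opp G e1"] z[of "opp G e2"] k4 by simp
	moreover have "e : E0 ==> k1 e = 0" for e using z[of e] k0[of e] E by simp
	ultimately show "k1 e0 = 0" using e0 unfolding E1 by auto
qed

lemma origami_G1: "origami G1 vl el P1"
	unfolding origami_def
proof (intro conjI)
	show "sgraph G1" "finite (edges G1)" "eqrel (edges G1) P1" "bip_forest G1 P1"
		using sgraph_G1 or_facts(1) eqrel_P1 forest_G1 by simp_all
	show "\<forall>e\<in>edges G1. \<forall>f\<in>edges G1. lab G1 vl el e = lab G1 vl el f -->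
			lab G1 vl el (opp G1 e) = lab G1 vl el (opp G1 f)"
		unfolding lab1 fold_graph_simps(4) using or_facts(2) by fastforce
	show "\<forall>e\<in>edges G1. el (opp G1 e) ~= el e" using or_facts(3) by simp
	show "\<forall>(e, f)\<in>P1. lab G1 vl el e = lab G1 vl el f"
		unfolding lab1 using or_facts(9) lC by (fastforce simp: P1_def)
	show "\<forall>e\<in>edges G1. \<forall>f\<in>edges G1. lab G1 vl el e = lab G1 vl el f -->
			(ini G1 e, ini G1 f) : (near_step G1 vl el P1 (lab G1 vl el e))\<^sup>* --> (opp G1 e, opp G1 f) : P1"
		unfolding lab1 using near_G1 by (metis fold_graph_simps(4))
qed

end

end

text \<open>The preimage \<open>Pb\<close> of the relation downstairs is too coarse: it relates
  \<open>e1\<close> and \<open>e2\<close>, which start at one vertex and would form a double edge.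
  Classes with the label of \<open>e1\<close> are therefore split according to whether the far end
  is joined to \<open>ter G e1\<close> by steps avoiding the opposite label. Everything rests on
  \<open>ter G e2\<close> not being joined to it.\<close>

lemma origami_unfold:
	fixes G :: "('v, 'e) sgraph" and G1 :: "('w, 'f) sgraph" and vl :: "'w => 'o" and el :: "'f => 'x"
	assumes mor: "graph_morphism G G1 b" and sur: "emap b ` edges G = edges G1" and fin: "finite (edges G)"
		and e12: "e1 : edges G" "e2 : edges G" "e1 ~= e2" "ini G e1 = ini G e2" "ter G e1 ~= ter G e2"
		and vid: "vmap b (ter G e1) = vmap b (ter G e2)"
		and eid: "!!d d'. d : edges G ==> d' : edges G ==> emap b d = emap b d' \<longleftrightarrow>
			 d = d' \<or> {d, d'} = {e1, e2} \<or> {d, d'} = {opp G e1, opp G e2}"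
		and or1: "origami G1 vl el P1"
	shows "\<exists>P. origami G (vl \<circ> vmap b) (el \<circ> emap b) P"
proof -
	let ?E = "edges G" and ?L = "lab G (vl \<circ> vmap b) (el \<circ> emap b)" and ?L1 = "lab G1 vl el"
	let ?x = "ter G e1" and ?y = "ter G e2" and ?u = "ini G e1"
	have sG: "sgraph G" "sgraph G1" using mor unfolding graph_morphism_def by auto
	have opE: "e : ?E ==> opp G e : ?E" "e : ?E ==> opp G (opp G e) = e" "e : ?E ==> opp G e ~= e" for e
		using sG unfolding sgraph_def by auto
	have bE: "e : ?E ==> emap b e : edges G1" "e : ?E ==> ini G1 (emap b e) = vmap b (ini G e)"
		 "e : ?E ==> emap b (opp G e) = opp G1 (emap b e)" for e
		using mor unfolding graph_morphism_def by auto
	have o1: "eqrel (edges G1) P1" "bip_forest G1 P1" "finite (edges G1)"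
		"!!e f. e : edges G1 ==> f : edges G1 ==> ?L1 e = ?L1 f ==> ?L1 (opp G1 e) = ?L1 (opp G1 f)"
		"!!e. e : edges G1 ==> el (opp G1 e) ~= el e"
		"!!e f. (e, f) : P1 ==> ?L1 e = ?L1 f"
		"!!e f. e : edges G1 ==> f : edges G1 ==> ?L1 e = ?L1 f ==>
				(ini G1 e, ini G1 f) : (near_step G1 vl el P1 (?L1 e))\<^sup>* ==> (opp G1 e, opp G1 f) : P1"
		using or1[unfolded origami_def] by blast+
	have P1s: "sym P1" "trans P1" "!!a. a : edges G1 ==> (a, a) : P1" using o1(1) unfolding eqrel_def by blast+
	have LL: "?L e = ?L1 (emap b e)" if "e : ?E" for e using that bE by (simp add: lab_def)
	have Lopp: "?L (opp G e) = ?L (opp G f)" if "e : ?E" "f : ?E" "?L e = ?L f" for e f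
		using o1(4)[of "emap b e" "emap b f"] that bE opE by (simp add: LL)
	have Lne: "?L (opp G e) ~= ?L e" if "e : ?E" for e
		using o1(5)[of "emap b e"] that bE by (simp add: lab_def)
	have be: "emap b e1 = emap b e2" using eid e12 by blast
	have L12: "?L e2 = ?L e1" "?L (opp G e2) = ?L (opp G e1)"   proof -
		show 1: "?L e2 = ?L e1" using be LL[OF e12(1)] LL[OF e12(2)] by simp
		show "?L (opp G e2) = ?L (opp G e1)" by (rule Lopp[OF e12(2,1) 1])
	qed
	have ne: "opp G e1 ~= e1" "opp G e2 ~= e2" "opp G e1 ~= e2" "opp G e2 ~= e1" "opp G e1 ~= opp G e2"
		using opE[OF e12(1)] opE[OF e12(2)] L12 Lne[OF e12(1)] e12(3) by metis+
	define Pb where "Pb = {(f, f'). f : ?E & f' : ?E & (emap b f, emap b f') : P1}"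
	have Pb: "eqrel ?E Pb"
	proof -
		have "trans Pb" unfolding Pb_def trans_def using P1s(2) by (auto dest: transD)
		moreover have "sym Pb" unfolding Pb_def sym_def using P1s(1) by (auto dest: symD)
		ultimately show ?thesis unfolding eqrel_def Pb_def using P1s(3) bE by auto
	qed
	have PbL: "?L a = ?L a'" if "(a, a') : Pb" for a a' using that o1(6) LL unfolding Pb_def by auto
	define g where "g = ?L e1"
	define gs where "gs = ?L (opp G e1)"
	have gne: "gs ~= g" using Lne e12 unfolding g_def gs_def by auto
	define S where "S = near_step G (vl \<circ> vmap b) (el \<circ> emap b) Pb gs"
	define \<sigma> where "\<sigma> v \<longleftrightarrow> (?x, v) : S\<^sup>*" for v
	define P where "P = {(f, f') : Pb. ?L f = g --> \<sigma> (ini G (opp G f)) = \<sigma> (ini G (opp G f'))}"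
	have P: "eqrel ?E P"
	proof -
		have tr: "trans Pb" and sy: "sym Pb" using Pb unfolding eqrel_def by auto
		have "trans P"
		proof (rule transI)
			fix a c d assume h: "(a, c) : P" "(c, d) : P"
			then have "(a, d) : Pb" using transD[OF tr, of a c d] unfolding P_def by auto
			then show "(a, d) : P" using h PbL[of a c] unfolding P_def by auto
		qed
		moreover have "sym P"
		proof (rule symI)
			fix a c assume h: "(a, c) : P"
			then have "(c, a) : Pb" using symD[OF sy, of a c] unfolding P_def by auto
			then show "(c, a) : P" using h PbL[of a c] unfolding P_def by auto
		qed
		ultimately show ?thesis using Pb unfolding eqrel_def P_def by auto
	qed
	\<comment> \<open>One of the two distinct termini differs from the common initial vertex. Among the
	  four edges moved by the fold only \<open>ew\<close> starts there, so the vertex sum at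
	  \<open>w\<close> isolates one coefficient.\<close>
	obtain w ew where w: "w ~= ?u" "ini G ew = w" "ew = opp G e1 \<or> ew = opp G e2" "w = ?x & w ~= ?y \<or> w = ?y & w ~= ?x"
		using e12(5) unfolding ter_def by metis
	\<comment> \<open>Pushing a chain forward sums it over the fibres of \<open>b\<close>. Zero sums
	  downstairs make the push-forward vanish, so the chain is zero on one-element fibres and takes
	  equal values on the two edges of the other fibres.\<close>
	have push: "(\<forall>f\<in>?E - {e1, e2, opp G e1, opp G e2}. k f = 0) & k e1 = k e2 & k (opp G e1) = k (opp G e2)
			& (\<Sum>e | e : ?E & ini G e = w. k e) = k (opp G e1)"
		if V: "!!v1. (\<Sum>e | e : ?E & vmap b (ini G e) = v1. k e) = 0" and C: "!!c. c : ?E ==> (\<Sum>e\<in>Pb `` {c}. k e) = 0"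
		for k :: "'e => bit"
	proof -
		define k1 where "k1 f1 = (\<Sum>f | f : ?E & emap b f = f1. k f)" for f1
		have grp: "(\<Sum>f1 | f1 : edges G1 & Q f1. k1 f1) = (\<Sum>f | f : ?E & Q (emap b f). k f)" for Q
		proof -
			have "(\<Sum>f1 | f1 : edges G1 & Q f1. sum k {f : {f. f : ?E & Q (emap b f)}. emap b f = f1})
				 = (\<Sum>f | f : ?E & Q (emap b f). k f)"
				by (rule sum.group) (use fin o1(3) bE in auto)
			moreover have "(\<Sum>f1 | f1 : edges G1 & Q f1. k1 f1) = (\<Sum>f1 | f1 : edges G1 & Q f1. sum k {f : {f. f : ?E & Q (emap b f)}. emap b f = f1})"
				unfolding k1_def by (intro sum.cong) (auto intro: arg_cong[where f = "sum k"])
			ultimately show ?thesis by simp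
		qed
		have "(\<Sum>e | e : edges G1 & ini G1 e = v. k1 e) = 0" for v
		proof -
			have "{f. f : ?E & ini G1 (emap b f) = v} = {f. f : ?E & vmap b (ini G f) = v}" using bE by auto
			then show ?thesis unfolding grp using V[of v] by simp
		qed
		moreover have "(\<Sum>e\<in>P1 `` {c}. k1 e) = 0" if "c : edges G1" for c
		proof -
			obtain d where d: "d : ?E" "c = emap b d" using sur \<open>c : edges G1\<close> by auto
			have "P1 `` {c} = {e. e : edges G1 & (c, e) : P1}" using o1(1) unfolding eqrel_def by auto
			moreover have "{f. f : ?E & (c, emap b f) : P1} = Pb `` {d}" using d unfolding Pb_def by auto
			ultimately show ?thesis using grp[of "%e. (c, e) : P1"] C[OF d(1)] by simp
		qed
		ultimately have k1: "k1 f1 = 0" if "f1 : edges G1" for f1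
			using o1(2) that unfolding bip_forest_def by blast
		have 1: "k f = 0" if f: "f : ?E - {e1, e2, opp G e1, opp G e2}" for f
		proof -
			have "{f'. f' : ?E & emap b f' = emap b f} = {f}" using f eid[of _ f] by (auto simp: doubleton_eq_iff)
			then show ?thesis using k1[of "emap b f"] bE(1)[of f] f unfolding k1_def by simp
		qed
		have "{f'. f' : ?E & emap b f' = emap b e1} = {e1, e2}"
			using eid[of _ e1] e12 ne by (auto simp: doubleton_eq_iff)
		then have 2: "k e1 = k e2" using k1[of "emap b e1"] bE(1)[of e1] e12 unfolding k1_def by (cases "k e1"; cases "k e2"; simp)
		have "{f'. f' : ?E & emap b f' = emap b (opp G e1)} = {opp G e1, opp G e2}"
			using eid[of _ "opp G e1"] e12 ne opE by (auto simp: doubleton_eq_iff)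
		then have 3: "k (opp G e1) = k (opp G e2)" using k1[of "emap b (opp G e1)"] bE(1)[of "opp G e1"] e12 opE ne
			unfolding k1_def by (cases "k (opp G e1)"; cases "k (opp G e2)"; simp)
		have "(\<Sum>e | e : ?E & ini G e = w. k e) = (\<Sum>e\<in>{ew}. k e)"
		proof (rule sum.mono_neutral_right)
			show "finite {e. e : ?E & ini G e = w}" "{ew} \<subseteq> {e. e : ?E & ini G e = w}" using fin w opE e12 by auto
			show "\<forall>i\<in>{e. e : ?E & ini G e = w} - {ew}. k i = 0"
			proof
				fix i assume i: "i : {e. e : ?E & ini G e = w} - {ew}"
				then have "i \<notin> {e1, e2, opp G e1, opp G e2}" using w e12(4) by (auto simp: ter_def)
				then show "k i = 0" using 1 i by auto
			qed
		qed
		then show ?thesis using 1 2 3 w(3) by auto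
	qed
	\<comment> \<open>Otherwise \<open>near_chain\<close> gives a chain with boundary \<open>?x\<close>
	  plus \<open>?y\<close>, and this boundary dies downstairs because the two have the same image. By
	  \<open>push\<close> the sum at \<open>w\<close> is the coefficient of \<open>opp G e1\<close>,
	  which is zero since the chain avoids the label \<open>gs\<close>; but the boundary at
	  \<open>w\<close> is 1.\<close>
	have \<sigma>y: "\<not> \<sigma> ?y"
	proof
		assume "\<sigma> ?y"
		then have "(?x, ?y) : {(ini G a, ini G b') | a b'. (a, b') : Pb & ?L a ~= gs}\<^sup>*"
			unfolding \<sigma>_def S_def near_step_def .
		moreover have "Pb \<subseteq> ?E \<times> ?E" "sym Pb" "trans Pb" using Pb unfolding eqrel_def by blast+
		moreover have "!!a b. (a, b) : Pb ==> (?L a ~= gs) = (?L b ~= gs)" using PbL by metis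
		ultimately have "\<exists>k :: 'e => bit. (\<forall>e. k e ~= 0 --> e : ?E & ?L e ~= gs) &
			(\<forall>v. (\<Sum>e | e : ?E & ini G e = v. k e) = of_bool (v = ?x) + of_bool (v = ?y)) &
			(\<forall>c. (\<Sum>e\<in>Pb `` {c}. k e) = 0)"
			by (intro near_chain[OF fin, where ok = "%a. ?L a ~= gs"]) assumption+
		then obtain k :: "'e => bit" where k: "\<forall>e. k e ~= 0 --> e : ?E & ?L e ~= gs"
			"\<forall>v. (\<Sum>e | e : ?E & ini G e = v. k e) = of_bool (v = ?x) + of_bool (v = ?y)"
			"\<forall>c. (\<Sum>e\<in>Pb `` {c}. k e) = 0" by blast
		have "(\<Sum>e | e : ?E & vmap b (ini G e) = v1. k e) = 0" for v1
		proof -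
			let ?S = "{e. e : ?E & vmap b (ini G e) = v1}" and ?T = "{v : ini G ` ?E. vmap b v = v1}"
			have xyE: "?x : ini G ` ?E" "?y : ini G ` ?E" using opE e12 unfolding ter_def by auto
			have "(\<Sum>e\<in>?S. k e) = (\<Sum>v\<in>?T. sum k {e : ?S. ini G e = v})"
				by (rule sum.group[symmetric]) (use fin in auto)
			also have "\<dots> = (\<Sum>v\<in>?T. of_bool (v = ?x) + of_bool (v = ?y))"
			proof (rule sum.cong[OF refl])
				fix v assume "v : ?T"
				then have "{e : ?S. ini G e = v} = {e. e : ?E & ini G e = v}" by auto
				then show "sum k {e : ?S. ini G e = v} = of_bool (v = ?x) + of_bool (v = ?y)" using k(2) by simp
			qed
			also have "\<dots> = of_bool (?x : ?T) + of_bool (?y : ?T)"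
				unfolding sum.distrib using fin by (auto simp: of_bool_def)
			also have "\<dots> = 0" using xyE vid by auto
			finally show ?thesis .
		qed
		then have "(\<Sum>e | e : ?E & ini G e = w. k e) = k (opp G e1)" using push[of k] k(3) by blast
		moreover have "k (opp G e1) = 0" using k(1) unfolding gs_def by blast
		ultimately show False using k(2) w(4) by auto
	qed
	have notP: "(e1, e2) \<notin> P" using \<sigma>y by (auto simp: P_def \<sigma>_def g_def ter_def)
	have "origami G (vl \<circ> vmap b) (el \<circ> emap b) P"
		unfolding origami_def
	proof (intro conjI)
		show "sgraph G" "finite ?E" "eqrel ?E P" using sG fin P by auto
		show "\<forall>e\<in>?E. \<forall>f\<in>?E. ?L e = ?L f --> ?L (opp G e) = ?L (opp G f)" using Lopp by blast
		show "\<forall>e\<in>?E. (el \<circ> emap b) (opp G e) ~= (el \<circ> emap b) e" using o1(5) bE by simp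
		show "\<forall>(e, f)\<in>P. ?L e = ?L f" using PbL unfolding P_def by auto
		show "\<forall>e\<in>?E. \<forall>f\<in>?E. ?L e = ?L f -->
			 (ini G e, ini G f) : (near_step G (vl \<circ> vmap b) (el \<circ> emap b) P (?L e))\<^sup>* --> (opp G e, opp G f) : P"
		proof (intro ballI impI)
			fix e f assume ef: "e : ?E" "f : ?E" "?L e = ?L f"
				and path: "(ini G e, ini G f) : (near_step G (vl \<circ> vmap b) (el \<circ> emap b) P (?L e))\<^sup>*"
			have "(vmap b i, vmap b j) : (near_step G1 vl el P1 (?L1 (emap b e)))\<^sup>*"
				if "(i, j) : (near_step G (vl \<circ> vmap b) (el \<circ> emap b) P (?L e))\<^sup>*" for i j
				using that
			proof (induction rule: rtrancl_induct)
				case (step j m)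
				then obtain a c where ac: "j = ini G a" "m = ini G c" "(a, c) : P" "?L a ~= ?L e"
					unfolding near_step_def by auto
				then have acE: "a : ?E" "c : ?E" "(emap b a, emap b c) : P1" unfolding P_def Pb_def by auto
				have "vmap b j = ini G1 (emap b a)" "vmap b m = ini G1 (emap b c)" "?L1 (emap b a) ~= ?L1 (emap b e)"
					using acE(1,2) ac ef(1) bE(2) LL[of a] LL[of e] by simp_all
				then have "(vmap b j, vmap b m) : near_step G1 vl el P1 (?L1 (emap b e))"
					unfolding near_step_def using acE(3) by blast
				then show ?case using step.IH by (rule rtrancl_into_rtrancl[rotated])
			qed simp
			from this[OF path] have "(opp G1 (emap b e), opp G1 (emap b f)) : P1"
				using o1(7)[of "emap b e" "emap b f"] ef bE LL by simp
			then have Pb': "(opp G e, opp G f) : Pb" using ef opE bE by (simp add: Pb_def)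
			\<comment> \<open>For opposites with the label of \<open>e1\<close> the path avoids the label
			  \<open>gs\<close>, hence consists of steps of \<open>S\<close> and stays on one side of the
			  splitting.\<close>
			have "\<sigma> (ini G e) = \<sigma> (ini G f)" if g: "?L (opp G e) = g"
			proof -
				have "?L e = gs" using Lopp[of "opp G e" e1] g ef opE e12 unfolding g_def gs_def by simp
				have "\<sigma> i = \<sigma> j" if "(i, j) : (near_step G (vl \<circ> vmap b) (el \<circ> emap b) P (?L e))\<^sup>*" for i j
					using that
				proof (induction rule: rtrancl_induct)
					case (step j m)
					then obtain a c where ac: "j = ini G a" "m = ini G c" "(a, c) : P" "?L a ~= gs"
						unfolding near_step_def \<open>?L e = gs\<close> by auto
					then have "(a, c) : Pb" "(c, a) : Pb" "?L c ~= gs" using P PbL symD[of P a c] unfolding P_def eqrel_def by auto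
					then have "(j, m) : S" "(m, j) : S" using ac unfolding S_def near_step_def by blast+
					then have "\<sigma> j = \<sigma> m" unfolding \<sigma>_def
						using rtrancl_into_rtrancl[of ?x j S m] rtrancl_into_rtrancl[of ?x m S j] by blast
					then show ?case using step.IH by simp
				qed simp
				then show ?thesis using path by blast
			qed
			then show "(opp G e, opp G f) : P" using Pb' ef opE by (auto simp: P_def)
		qed
		show "bip_forest G P"
			unfolding bip_forest_def
		proof (intro allI impI ballI)
			fix k :: "'e => bit" and e0
			assume V: "\<forall>v. (\<Sum>e | e : ?E & ini G e = v. k e) = 0" and C: "\<forall>c\<in>?E. (\<Sum>e\<in>P `` {c}. k e) = 0"
				and e0: "e0 : ?E"
			have V1: "(\<Sum>e | e : ?E & vmap b (ini G e) = v1. k e) = 0" for v1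
			proof -
				let ?S = "{e. e : ?E & vmap b (ini G e) = v1}" and ?T = "{v : ini G ` ?E. vmap b v = v1}"
				have "(\<Sum>e\<in>?S. k e) = (\<Sum>v\<in>?T. sum k {e : ?S. ini G e = v})"
					by (rule sum.group[symmetric]) (use fin in auto)
				also have "\<dots> = 0"
				proof (rule sum.neutral, rule ballI)
					fix v assume "v : ?T"
					then have "{e : ?S. ini G e = v} = {e. e : ?E & ini G e = v}" by auto
					then show "sum k {e : ?S. ini G e = v} = 0" using V by simp
				qed
				finally show ?thesis .
			qed
			have C1: "(\<Sum>e\<in>Pb `` {c}. k e) = 0" if "c : ?E" for c
			proof (rule sum_zero_saturated[OF _ _ P])
				show "finite (Pb `` {c})" "Pb `` {c} \<subseteq> ?E" using Pb fin unfolding eqrel_def by (auto intro: finite_subset)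
				have tr: "trans Pb" using Pb unfolding eqrel_def by auto
				show "d : Pb `` {c}" if "a : Pb `` {c}" "(a, d) : P" for a d
					using that transD[OF tr, of c a d] unfolding P_def by auto
			qed (use C in auto)
			have pu: "\<forall>f\<in>?E - {e1, e2, opp G e1, opp G e2}. k f = 0" "k e1 = k e2" "k (opp G e1) = k (opp G e2)"
				 "(\<Sum>e | e : ?E & ini G e = w. k e) = k (opp G e1)" using push[OF V1 C1] by auto
			\<comment> \<open>The vertex sum at \<open>w\<close> kills the opposite edges; once they are
			  gone, the class of \<open>e1\<close>, which no longer contains \<open>e2\<close>, kills
			  \<open>e1\<close>.\<close>
			then have s0: "k (opp G e1) = 0" using V by metis
			have "(\<Sum>e\<in>P `` {e1}. k e) = (\<Sum>e\<in>{e1}. k e)"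
			proof (rule sum.mono_neutral_right)
				show "finite (P `` {e1})" "{e1} \<subseteq> P `` {e1}" using P fin e12 unfolding eqrel_def by (auto intro: finite_subset)
				show "\<forall>i\<in>P `` {e1} - {e1}. k i = 0"
				proof
					fix i assume i: "i : P `` {e1} - {e1}"
					then have "i : ?E" "i ~= e2" using P notP unfolding eqrel_def by auto
					then show "k i = 0" using pu s0 i by (cases "i : {opp G e1, opp G e2}") auto
				qed
			qed
			then have "k e1 = 0" using C e12(1) by simp
			then show "k e0 = 0" using pu s0 e0 by (cases "e0 : {e1, e2, opp G e1, opp G e2}") auto
		qed
	qed
	then show ?thesis by blast
qed

section \<open>Pulling origamis back along sequences of folds\<close>

lemma origami_cong:
	assumes "origami G vl el P" "!!e. e : edges G ==> el' e = el e" "!!e. e : edges G ==> vl' (ini G e) = vl (ini G e)"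
	shows "origami G vl' el' P"
proof -
	have sg: "opp G e : edges G" if "e : edges G" for e using assms(1) that unfolding origami_def sgraph_def by blast
	have l: "lab G vl' el' e = lab G vl el e" if "e : edges G" for e using that assms(2,3) by (simp add: lab_def)
	have PE: "P \<subseteq> edges G \<times> edges G" using assms(1) unfolding origami_def eqrel_def by blast
	have n: "near_step G vl' el' P h = near_step G vl el P h" for h
	proof -
		have "(a, b) : P & lab G vl' el' a ~= h \<longleftrightarrow> (a, b) : P & lab G vl el a ~= h" for a b using l[of a] PE by auto
		then show ?thesis unfolding near_step_def by simp
	qed
	note o = assms(1)[unfolded origami_def]
	show ?thesis
		unfolding origami_def n
	proof (intro conjI)
		show "\<forall>e\<in>edges G. \<forall>f\<in>edges G. lab G vl' el' e = lab G vl' el' f --> lab G vl' el' (opp G e) = lab G vl' el' (opp G f)"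
		proof (intro ballI impI)
			fix e f assume h: "e : edges G" "f : edges G" "lab G vl' el' e = lab G vl' el' f"
			then have "lab G vl el e = lab G vl el f" using l by metis
			then have "lab G vl el (opp G e) = lab G vl el (opp G f)" using o h by blast
			then show "lab G vl' el' (opp G e) = lab G vl' el' (opp G f)" using l[OF sg] h by simp
		qed
		show "\<forall>e\<in>edges G. el' (opp G e) ~= el' e" using o assms(2) sg by simp
		show "\<forall>(e, f)\<in>P. lab G vl' el' e = lab G vl' el' f"
		proof clarify
			fix a b assume "(a, b) : P"
			then have "a : edges G" "b : edges G" "lab G vl el a = lab G vl el b" using o PE by auto
			then show "lab G vl' el' a = lab G vl' el' b" using l by metis
		qed
		show "\<forall>e\<in>edges G. \<forall>f\<in>edges G. lab G vl' el' e = lab G vl' el' f -->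
			 (ini G e, ini G f) : (near_step G vl el P (lab G vl' el' e))\<^sup>* --> (opp G e, opp G f) : P"
		proof (intro ballI impI)
			fix e f assume h: "e : edges G" "f : edges G" "lab G vl' el' e = lab G vl' el' f"
				"(ini G e, ini G f) : (near_step G vl el P (lab G vl' el' e))\<^sup>*"
			then have "lab G vl el e = lab G vl el f" "(ini G e, ini G f) : (near_step G vl el P (lab G vl el e))\<^sup>*" using l by metis+
			then show "(opp G e, opp G f) : P" using o h(1,2) by blast
		qed
	qed (use o in blast)+
qed

text \<open>Start of the unfolding: in an immersed graph the labels separate the edges, and with
  singleton classes every class is a leaf of the incidence graph.\<close>

lemma origami_immersion:
	assumes imm: "immersion G X i" and fin: "finite (edges G)"
	shows "origami G id (emap i) (Id_on (edges G))"
proof -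
	have g: "sgraph G" "sgraph X" "!!e. e : edges G ==> emap i e : edges X & emap i (opp G e) = opp X (emap i e)"
		using imm unfolding immersion_def graph_morphism_def by auto
	have inj: "e = f" if "e : edges G" "f : edges G" "lab G id (emap i) e = lab G id (emap i) f" for e f
		using that imm g(1) unfolding immersion_def lab_def sgraph_def by (auto simp: inj_on_def lk_def)
	show ?thesis
		unfolding origami_def
	proof (intro conjI)
		show "\<forall>e\<in>edges G. \<forall>f\<in>edges G. lab G id (emap i) e = lab G id (emap i) f -->
				lab G id (emap i) (opp G e) = lab G id (emap i) (opp G f)" using inj by blast
		show "\<forall>e\<in>edges G. emap i (opp G e) ~= emap i e" using g unfolding sgraph_def by auto
		show "eqrel (edges G) (Id_on (edges G))" unfolding eqrel_def by (auto simp: sym_def trans_def)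
		show "\<forall>e\<in>edges G. \<forall>f\<in>edges G. lab G id (emap i) e = lab G id (emap i) f -->
			 (ini G e, ini G f) : (near_step G id (emap i) (Id_on (edges G)) (lab G id (emap i) e))\<^sup>* -->
			 (opp G e, opp G f) : Id_on (edges G)"
			using inj g(1) unfolding sgraph_def by blast
		show "bip_forest G (Id_on (edges G))"
			unfolding bip_forest_def
		proof (intro allI impI ballI)
			fix k :: "'b => bit" and e
			assume "\<forall>c\<in>edges G. sum k (Id_on (edges G) `` {c}) = 0" "e : edges G"
			moreover have "Id_on (edges G) `` {e} = {e}" using \<open>e : edges G\<close> by auto
			ultimately show "k e = 0" by force
		qed
	qed (use g fin in auto)
qed

text \<open>Surjectivity of \<open>q\<close> on first cohomology: a cocycle of \<open>G\<close> is a
  pull-back from the target up to a coboundary. The values are complex because \<open>m\<close> and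
  \<open>\<phi>\<close> will arise as variations of logarithms.\<close>

definition split_cocycles :: "('v, 'e) sgraph => ('v, 'e, 'w, 'f) gmap => bool" where
	"split_cocycles G q \<longleftrightarrow> (\<forall>n :: 'e => int. (\<forall>e\<in>edges G. n (opp G e) = - n e) -->
		 (\<exists>(m :: 'f => complex) \<phi>. \<forall>e\<in>edges G. of_int (n e) = m (emap q e) + \<phi> (ter G e) - \<phi> (ini G e)))"

text \<open>Folding two edges with equal termini would kill a loop on which some cocycle is nonzero,
  so surjectivity on cohomology excludes it. The property passes to the remaining folds because the
  potential \<open>\<phi>\<close> takes equal values on the two identified termini.\<close>

lemma split_cocycles_fold:
	assumes "fold_map G H b" and sc: "split_cocycles G (gcomp p b)"
	shows "\<exists>e1\<in>edges G. \<exists>e2\<in>edges G. e1 ~= e2 & ini G e1 = ini G e2 & ter G e1 ~= ter G e2 &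
				vmap b (ter G e1) = vmap b (ter G e2) &
				(\<forall>d\<in>edges G. \<forall>d'\<in>edges G.
					 emap b d = emap b d' \<longleftrightarrow>
						 d = d' \<or> {d, d'} = {e1, e2} \<or> {d, d'} = {opp G e1, opp G e2})"
		and "split_cocycles H p"
proof -
	from assms(1) obtain e1 e2 where mor: "graph_morphism G H b" and sv: "vmap b ` verts G = verts H" and se: "emap b ` edges G = edges H"
		and e: "e1 : edges G" "e2 : edges G" "e1 ~= e2" "ini G e1 = ini G e2"
		and vid: "!!x y. x : verts G ==> y : verts G ==> vmap b x = vmap b y \<longleftrightarrow> x = y \<or> {x, y} = {ter G e1, ter G e2}"
		and eid: "!!d d'. d : edges G ==> d' : edges G ==> emap b d = emap b d' \<longleftrightarrow> d = d' \<or> {d, d'} = {e1, e2} \<or> {d, d'} = {opp G e1, opp G e2}"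
		unfolding fold_map_def by metis
	have sG: "sgraph G" "sgraph H" using mor unfolding graph_morphism_def by auto
	have tv: "ter G e1 : verts G" "ter G e2 : verts G" using sG e unfolding ter_def sgraph_def by auto
	have be: "emap b e1 = emap b e2" using eid[of e1 e2] e by blast
	have bopp: "emap b (opp G e1) = opp H (emap b e1)" "emap b (opp G e2) = opp H (emap b e2)"
		using mor e unfolding graph_morphism_def by simp_all
	have ee: "opp G e1 ~= e1" "opp G e1 ~= e2" "opp G (opp G e1) = e1" "opp G (opp G e2) = e2"
		using sG e be bopp mor unfolding sgraph_def graph_morphism_def by metis+
	have ne: "ter G e1 ~= ter G e2"
	proof
		assume t: "ter G e1 = ter G e2"
		\<comment> \<open>The antisymmetrised indicator of \<open>e1\<close>. Going out along
		  \<open>e1\<close> and back along \<open>e2\<close> would be a loop of value 1, whereas a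
		  pull-back cannot distinguish the two edges.\<close>
		define n :: "'b => int" where "n f = of_bool (f = e1) - of_bool (f = opp G e1)" for f
		have "\<forall>f\<in>edges G. n (opp G f) = - n f"
		proof
			fix f assume "f : edges G"
			then have "opp G f = e1 \<longleftrightarrow> f = opp G e1" "opp G f = opp G e1 \<longleftrightarrow> f = e1" using sG e unfolding sgraph_def by metis+
			then show "n (opp G f) = - n f" by (simp add: n_def)
		qed
		then obtain m :: "'f => complex" and \<phi> where m: "\<forall>f\<in>edges G. of_int (n f) = m (emap (gcomp p b) f) + \<phi> (ter G f) - \<phi> (ini G f)"
			using sc unfolding split_cocycles_def by blast
		have "(of_int (n e1) :: complex) = of_int (n e2)"
			using m[rule_format, OF e(1)] m[rule_format, OF e(2)] be t e(4) by (simp add: gcomp_def)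
		then show False using e ee by (auto simp: n_def)
	qed
	show "\<exists>e1\<in>edges G. \<exists>e2\<in>edges G. e1 ~= e2 & ini G e1 = ini G e2 & ter G e1 ~= ter G e2 &
				vmap b (ter G e1) = vmap b (ter G e2) &
				(\<forall>d\<in>edges G. \<forall>d'\<in>edges G. emap b d = emap b d' \<longleftrightarrow>
						 d = d' \<or> {d, d'} = {e1, e2} \<or> {d, d'} = {opp G e1, opp G e2})"
		using e ne vid[OF tv] eid by (intro bexI[of _ e1] bexI[of _ e2] conjI) auto
	show "split_cocycles H p"
		unfolding split_cocycles_def
	proof (intro allI impI)
		fix n1 :: "'d => int" assume n1: "\<forall>e\<in>edges H. n1 (opp H e) = - n1 e"
		have bb: "emap b f : edges H" "opp H (emap b f) = emap b (opp G f)" "ini H (emap b f) = vmap b (ini G f)" if "f : edges G" for f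
			using mor that unfolding graph_morphism_def by auto
		have "\<forall>f\<in>edges G. (n1 \<circ> emap b) (opp G f) = - (n1 \<circ> emap b) f"
		proof
			fix f assume "f : edges G"
			then show "(n1 \<circ> emap b) (opp G f) = - (n1 \<circ> emap b) f" using n1[rule_format, OF bb(1)[of f]] bb(2)[of f] by simp
		qed
		then obtain m :: "'f => complex" and \<phi> where m: "\<forall>f\<in>edges G. of_int ((n1 \<circ> emap b) f) = m (emap (gcomp p b) f) + \<phi> (ter G f) - \<phi> (ini G f)"
			using sc unfolding split_cocycles_def by blast
		\<comment> \<open>Both edges start at the same vertex and have the same image, so comparing the
		  two equations leaves only the termini; hence \<open>\<phi>\<close> descends to
		  \<open>H\<close>.\<close>
		have "\<phi> (ter G e1) = \<phi> (ter G e2)"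
			using m[rule_format, OF e(1)] m[rule_format, OF e(2)] be e(4) by (simp add: gcomp_def)
		then have \<phi>: "\<phi> x = \<phi> y" if "x : verts G" "y : verts G" "vmap b x = vmap b y" for x y
			using vid[OF that(1,2)] that(3) by (auto simp: doubleton_eq_iff)
		define \<psi> where "\<psi> v = \<phi> (inv_into (verts G) (vmap b) v)" for v
		have \<psi>: "\<psi> (vmap b x) = \<phi> x" if "x : verts G" for x
			unfolding \<psi>_def by (rule \<phi>) (use that in \<open>auto intro: inv_into_into f_inv_into_f\<close>)
		show "\<exists>(m :: 'f => complex) \<phi>. \<forall>e\<in>edges H. of_int (n1 e) = m (emap p e) + \<phi> (ter H e) - \<phi> (ini H e)"
		proof (intro exI ballI)
			fix h assume "h : edges H"
			then obtain f where f: "f : edges G" "h = emap b f" using se by auto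
			have "ter H h = vmap b (ter G f)" "ini H h = vmap b (ini G f)"
				using bb[OF f(1)] bb[of "opp G f"] f sG unfolding ter_def sgraph_def by auto
			moreover have "ter G f : verts G" "ini G f : verts G" using f sG unfolding ter_def sgraph_def by auto
			ultimately show "of_int (n1 h) = m (emap p h) + \<psi> (ter H h) - \<psi> (ini H h)"
				using m[rule_format, OF f(1)] f(2) by (simp add: \<psi> gcomp_def)
		qed
	qed
qed

text \<open>Unfolding runs backwards from the last graph; \<open>split_cocycles\<close> provides the
  distinct termini that each unfolding demands and is inherited by the rest of the sequence.\<close>

lemma origami_folds:
	assumes "folds G K q" "finite (edges G)" "split_cocycles G q" "origami K vl el P"
	shows "\<exists>P'. origami G (vl \<circ> vmap q) (el \<circ> emap q) P'"
	using assms
proof (induction arbitrary: P)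
	case (folds_refl G)
	then show ?case by (auto simp: gid_def)
next
	case (folds_step G H b K p)
	have b: "graph_morphism G H b" "emap b ` edges G = edges H"
		using folds_step.hyps(1) unfolding fold_map_def by auto
	then have fin: "finite (edges H)" using folds_step.prems(1) by (metis finite_imageI)
	note sc = split_cocycles_fold[OF folds_step.hyps(1) folds_step.prems(2)]
	obtain P' where P': "origami H (vl \<circ> vmap p) (el \<circ> emap p) P'"
		using folds_step.IH[OF fin sc(2) folds_step.prems(3)] by blast
	from sc(1) obtain e1 e2 where e: "e1 : edges G" "e2 : edges G" "e1 ~= e2" "ini G e1 = ini G e2" "ter G e1 ~= ter G e2"
		 "vmap b (ter G e1) = vmap b (ter G e2)"
		 "\<forall>d\<in>edges G. \<forall>d'\<in>edges G. emap b d = emap b d' \<longleftrightarrow>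
						 d = d' \<or> {d, d'} = {e1, e2} \<or> {d, d'} = {opp G e1, opp G e2}" by blast
	have "\<exists>P. origami G ((vl \<circ> vmap p) \<circ> vmap b) ((el \<circ> emap p) \<circ> emap b) P"
		by (rule origami_unfold[OF b folds_step.prems(1) e(1-6) _ P']) (use e(7) in blast)
	then show ?case by (simp only: gcomp_def comp_assoc gmap.select_convs)
qed

section \<open>Homotopy equivalences of realisations\<close>

lemma edge_point_opp: "sgraph G ==> e : edges G ==> edge_point G (opp G e) (1 - t) = edge_point G e t"
	unfolding sgraph_def by (auto simp: edge_point_def ter_def insert_commute)

lemma topspace_realisation [simp]: "topspace (realisation G) = realisation_points G"
proof
	show "topspace (realisation G) \<subseteq> realisation_points G"
		using openin_realisation[of G] openin_topspace by blast
	have "openin (top_of_set {0..1::real}) {t : {0..1}. edge_point G e t : realisation_points G}" if "e : edges G" for e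
	proof -
		have "{t : {0..1}. edge_point G e t : realisation_points G} = {0..1}"
			using that unfolding realisation_points_def by auto
		then show ?thesis by (metis openin_subtopology_self)
	qed
	then have "openin (realisation G) (realisation_points G)" by (simp add: openin_realisation)
	then show "realisation_points G \<subseteq> topspace (realisation G)" by (rule openin_subset)
qed

lemma edge_point_in: "e : edges G ==> t : {0..1} ==> edge_point G e t : realisation_points G"
	unfolding realisation_points_def by blast

lemma realisation_points_edges:
	assumes "sgraph G" "!!v. v : verts G ==> \<exists>e\<in>edges G. ini G e = v" "x : realisation_points G"
	shows "\<exists>e\<in>edges G. \<exists>t\<in>{0..1}. x = edge_point G e t"
proof -
	consider v where "v : verts G" "x = Inl v" | e t where "e : edges G" "t : {0..1}" "x = edge_point G e t"
		using assms(3) unfolding realisation_points_def by auto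
	then show ?thesis
	proof cases
		case 1
		then obtain e where "e : edges G" "ini G e = v" using assms(2) by blast
		then have "x = edge_point G e 0" using 1 by (simp add: edge_point_def)
		then show ?thesis using \<open>e : edges G\<close> by (intro bexI[of _ e] bexI[of _ 0]) auto
	qed blast
qed

lemma continuous_map_edge_point:
	assumes "e : edges G"
	shows "continuous_map (top_of_set {0..1}) (realisation G) (edge_point G e)"
	unfolding continuous_map_def using assms edge_point_in[OF assms] by (auto simp: openin_realisation)

lemma continuous_map_realisation:
	assumes "!!x. x : realisation_points G ==> f x : topspace T"
		and "!!e. e : edges G ==> continuous_map (top_of_set {0..1}) T (%t. f (edge_point G e t))"
	shows "continuous_map (realisation G) T f"
	unfolding continuous_map_def
proof (intro conjI allI impI)
	show "f : topspace (realisation G) \<rightarrow> topspace T" using assms(1) by auto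
	fix U assume U: "openin T U"
	have "openin (top_of_set {0..1}) {t : {0..1}. edge_point G e t : {x : realisation_points G. f x : U}}"
		if "e : edges G" for e
	proof -
		have "{t : {0..1}. edge_point G e t : {x : realisation_points G. f x : U}} = {t : topspace (top_of_set {0..1}). f (edge_point G e t) : U}"
			using edge_point_in[OF that] by auto
		then show ?thesis using openin_continuous_map_preimage[OF assms(2)[OF that] U] by simp
	qed
	then show "openin (realisation G) {x : topspace (realisation G). f x : U}"
		by (auto simp: openin_realisation)
qed

text \<open>The realisation is a quotient of a disjoint union of intervals, one for each oriented
  edge, as every vertex lies on an edge. A product of a quotient map with the locally compact
  Hausdorff space [0,1] is again a quotient map, so a homotopy may be tested on each square.\<close>

lemma continuous_map_interval_realisation:
	assumes G: "sgraph G" and iso: "!!v. v : verts G ==> \<exists>e\<in>edges G. ini G e = v"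
		and cont: "!!e. e : edges G ==>
			 continuous_map (prod_topology (top_of_set {0..1}) (top_of_set {0..1})) T (%(s, t). H (s :: real, edge_point G e t))"
	shows "continuous_map (prod_topology (top_of_set {0..1}) (realisation G)) T H"
proof -
	define D where "D = prod_topology (discrete_topology (edges G)) (top_of_set {0..1::real})"
	define f where "f = (%(e, t). edge_point G e t)"
	have q: "quotient_map D (realisation G) f"
		unfolding quotient_map_def
	proof (intro conjI allI impI)
		show "f ` topspace D = topspace (realisation G)"
		proof
			show "f ` topspace D \<subseteq> topspace (realisation G)" by (auto simp: f_def D_def intro!: edge_point_in)
			show "topspace (realisation G) \<subseteq> f ` topspace D"
			proof
				fix x assume "x : topspace (realisation G)"
				then obtain e t where "e : edges G" "t : {0..1}" "x = edge_point G e t"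
					using realisation_points_edges[OF G iso, of x] unfolding topspace_realisation by blast
				then show "x : f ` topspace D" by (auto simp: f_def D_def intro!: image_eqI[of _ _ "(e, t)"])
			qed
		qed
		fix U assume U: "U \<subseteq> topspace (realisation G)"
		show "openin D {x : topspace D. f x : U} = openin (realisation G) U"
		proof
			assume o: "openin D {x : topspace D. f x : U}"
			have "openin (top_of_set {0..1}) {t : {0..1}. edge_point G e t : U}" if e: "e : edges G" for e
			proof -
				have "continuous_map (top_of_set {0..1::real}) D (%t. (e, t))"
					unfolding D_def using e by (intro continuous_map_pairedI) auto
				from openin_continuous_map_preimage[OF this o]
				show ?thesis using e by (auto simp: D_def f_def cong: conj_cong)
			qed
			then show "openin (realisation G) U" using U by (simp add: openin_realisation)
		next
			assume o: "openin (realisation G) U"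
			show "openin D {x : topspace D. f x : U}"
			proof (subst openin_subopen, intro ballI)
				fix x assume "x : {x : topspace D. f x : U}"
				then obtain e t where x: "x = (e, t)" "e : edges G" "t : {0..1}" "edge_point G e t : U" by (auto simp: D_def f_def)
				have "openin D ({e} \<times> {t : {0..1}. edge_point G e t : U})"
					unfolding D_def using x o by (intro openin_prod_Times_iff[THEN iffD2]) (auto simp: openin_realisation)
				then show "\<exists>V. openin D V & x : V & V \<subseteq> {x : topspace D. f x : U}"
					using x by (intro exI[of _ "{e} \<times> {t : {0..1}. edge_point G e t : U}"]) (auto simp: D_def f_def)
			qed
		qed
	qed
	have Q: "quotient_map (prod_topology (top_of_set {0..1::real}) D) (prod_topology (top_of_set {0..1}) (realisation G)) (%(x, y). (x, f y))"
	proof (rule quotient_map_prod_right[OF _ _ q])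
		show "locally_compact_space (top_of_set {0..1::real})"
			by (intro compact_imp_locally_compact_space) (simp add: compact_space_subtopology compactin_euclidean_iff)
		show "Hausdorff_space (top_of_set {0..1::real}) \<or> regular_space (top_of_set {0..1::real})"
			by (simp add: Hausdorff_space_subtopology)
	qed
	have "continuous_map (prod_topology (top_of_set {0..1::real}) D) T (H \<circ> (%(x, y). (x, f y)))"
		unfolding continuous_map_def
	proof (intro conjI allI impI)
		show "H \<circ> (%(x, y). (x, f y)) : topspace (prod_topology (top_of_set {0..1}) D) \<rightarrow> topspace T"
		proof
			fix z assume "z : topspace (prod_topology (top_of_set {0..1::real}) D)"
			then obtain s e t where z: "z = (s, e, t)" "s : {0..1}" "e : edges G" "t : {0..1}" by (auto simp: D_def)
			then show "(H \<circ> (%(x, y). (x, f y))) z : topspace T"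
				using continuous_map_funspace[OF cont[OF z(3)]] by (auto simp: f_def Pi_iff)
		qed
		fix U assume U: "openin T U"
		let ?S = "{x : topspace (prod_topology (top_of_set {0..1::real}) D). (H \<circ> (%(x, y). (x, f y))) x : U}"
		show "openin (prod_topology (top_of_set {0..1::real}) D) ?S"
		proof (subst openin_subopen, intro ballI)
			fix z assume zS: "z : ?S"
			then obtain s e t where z: "z = (s, e, t)" "s : {0..1}" "e : edges G" "t : {0..1}" by (auto simp: D_def)
			let ?W = "{x : topspace (prod_topology (top_of_set {0..1::real}) (top_of_set {0..1::real})). (%(s, t). H (s, edge_point G e t)) x : U}"
			have W: "openin (prod_topology (top_of_set {0..1}) (top_of_set {0..1})) ?W"
				using openin_continuous_map_preimage[OF cont[OF z(3)] U] .
			have "(s, t) : ?W" using z zS by (auto simp: f_def)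
			then obtain A B where AB: "openin (top_of_set {0..1}) A" "openin (top_of_set {0..1}) B" "s : A" "t : B" "A \<times> B \<subseteq> ?W"
				using W unfolding openin_prod_topology_alt by meson
			have "openin (prod_topology (top_of_set {0..1::real}) D) (A \<times> {e} \<times> B)"
				unfolding D_def using AB z by (auto simp: openin_prod_Times_iff)
			moreover have "A \<times> {e} \<times> B \<subseteq> ?S"
			proof
				fix y assume "y : A \<times> {e} \<times> B"
				then obtain a b where y: "y = (a, e, b)" "a : A" "b : B" by auto
				then have "(a, b) : ?W" using AB(5) by blast
				then show "y : ?S" using z(3) by (simp add: D_def f_def y)
			qed
			ultimately show "\<exists>V. openin (prod_topology (top_of_set {0..1}) D) V & z : V & V \<subseteq> ?S"
				using z(1) AB(3,4) by (intro exI[of _ "A \<times> {e} \<times> B"] conjI) (assumption | simp)+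
		qed
	qed
	then show ?thesis using continuous_compose_quotient_map_eq[OF Q] by blast
qed

text \<open>A point inside an edge is an unordered pair of representatives \<open>(e, t)\<close> and
  \<open>(opp G e, 1 - t)\<close>; the choice between them does not affect the value once
  \<open>\<phi>\<close> is symmetric as in \<open>glue_edge_point\<close>.\<close>

definition glue :: "('v => 't) => ('e => real => 't) => 'v + ('e \<times> real) set => 't" where
	"glue \<nu> \<phi> p = (case p of Inl v => \<nu> v | Inr A => (case (SOME z. z : A) of (e, t) => \<phi> e t))"

lemma glue_edge_point:
	assumes G: "sgraph G" and e: "e : edges G" and t: "t : {0..1}"
		and ini: "!!e. e : edges G ==> \<phi> e 0 = \<nu> (ini G e)"
		and op: "!!e t. e : edges G ==> t : {0..1} ==> \<phi> (opp G e) (1 - t) = \<phi> e t"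
	shows "glue \<nu> \<phi> (edge_point G e t) = \<phi> e t"
proof -
	have oe: "opp G e : edges G" using G e unfolding sgraph_def by blast
	consider "t = 0" | "t = 1" | "t ~= 0" "t ~= 1" by blast
	then show ?thesis
	proof cases
		case 1 then show ?thesis using ini[OF e] by (simp add: glue_def edge_point_def)
	next
		case 2 then show ?thesis using ini[OF oe] op[OF e, of 1] by (simp add: glue_def edge_point_def ter_def)
	next
		case 3
		have "(SOME z. z : {(e, t), (opp G e, 1 - t)}) : {(e, t), (opp G e, 1 - t)}" by (rule someI[of _ "(e, t)"]) simp
		then have "(SOME z. z : {(e, t), (opp G e, 1 - t)}) = (e, t) \<or> (SOME z. z : {(e, t), (opp G e, 1 - t)}) = (opp G e, 1 - t)" by simp
		then show ?thesis using 3 op[OF e t] by (auto simp: glue_def edge_point_def)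
	qed
qed

lemma realise_map_edge_point:
	assumes "graph_morphism G H q" "e : edges G"
	shows "realise_map q (edge_point G e t) = edge_point H (emap q e) t"
	using assms unfolding graph_morphism_def
	by (auto simp: realise_map_def edge_point_def ter_def sgraph_def)

lemma realise_map_in:
	assumes m: "graph_morphism G H q" and x: "x : realisation_points G"
	shows "realise_map q x : realisation_points H"
proof -
	consider v where "v : verts G" "x = Inl v" | e t where "e : edges G" "t : {0..1}" "x = edge_point G e t"
		using x unfolding realisation_points_def by auto
	then show ?thesis
	proof cases
		case 1 then show ?thesis using m by (auto simp: realise_map_def realisation_points_def graph_morphism_def)
	next
		case 2
		then have "emap q e : edges H" using m by (auto simp: graph_morphism_def)
		then show ?thesis using 2 realise_map_edge_point[OF m] edge_point_in by metis
	qed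
qed

lemma continuous_realise_map:
	assumes m: "graph_morphism G H q"
	shows "continuous_map (realisation G) (realisation H) (realise_map q)"
proof (rule continuous_map_realisation)
	fix e assume e: "e : edges G"
	then have "emap q e : edges H" using m by (auto simp: graph_morphism_def)
	then show "continuous_map (top_of_set {0..1}) (realisation H) (%t. realise_map q (edge_point G e t))"
		unfolding realise_map_edge_point[OF m e] using continuous_map_edge_point by (metis eta_contract_eq)
qed (use realise_map_in[OF m] in simp)

lemma homotopic_edges:
	assumes G: "sgraph G" and iso: "!!v. v : verts G ==> \<exists>e\<in>edges G. ini G e = v"
		and cont: "!!e. e : edges G ==> continuous_map (top_of_set ({0..1} \<times> {0..1})) T (%(s :: real, t). \<phi> e s t)"
		and ini: "!!e s. e : edges G ==> s : {0..1} ==> \<phi> e s 0 = \<nu> s (ini G e)"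
		and op: "!!e s t. e : edges G ==> s : {0..1} ==> t : {0..1} ==> \<phi> (opp G e) s (1 - t) = \<phi> e s t"
		and f: "!!e t. e : edges G ==> t : {0..1} ==> f (edge_point G e t) = \<phi> e 0 t"
		and g: "!!e t. e : edges G ==> t : {0..1} ==> g (edge_point G e t) = \<phi> e 1 t"
	shows "homotopic_with (%x. True) (realisation G) T f g"
proof -
	define H where "H = (%(s, x). glue (\<nu> s) (%e. \<phi> e s) x)"
	have H: "H (s, edge_point G e t) = \<phi> e s t" if "e : edges G" "s : {0..1}" "t : {0..1}" for e s t
		unfolding H_def using glue_edge_point[OF G that(1,3), of "%e. \<phi> e s" "\<nu> s"] ini op that by simp
	have "continuous_map (prod_topology (top_of_set {0..1}) (realisation G)) T H"
	proof (rule continuous_map_interval_realisation[OF G iso])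
		fix e assume e: "e : edges G"
		have "continuous_map (top_of_set ({0..1} \<times> {0..1})) T (%(s, t). H (s, edge_point G e t))"
			by (rule continuous_map_eq[OF cont[OF e]]) (use H e in auto)
		then show "continuous_map (prod_topology (top_of_set {0..1}) (top_of_set {0..1})) T (%(s, t). H (s, edge_point G e t))"
			by (simp add: prod_topology_subtopology_eu)
	qed
	moreover have "H (0, x) = f x" "H (1, x) = g x" if "x : topspace (realisation G)" for x
	proof -
		have "\<exists>e\<in>edges G. \<exists>t\<in>{0..1}. x = edge_point G e t"
			by (rule realisation_points_edges[OF G]) (use iso that in auto)
		then obtain e t where "e : edges G" "t : {0..1}" "x = edge_point G e t" by blast
		then show "H (0, x) = f x" "H (1, x) = g x" using H f g by auto
	qed
	ultimately show ?thesis by (subst homotopic_with) auto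
qed

lemma continuous_map_real_pair:
	assumes "continuous_map euclideanreal T \<psi>" "continuous_on S h"
	shows "continuous_map (top_of_set S) T (%z. \<psi> (h z :: real))"
	using continuous_map_compose[of "top_of_set S" euclideanreal h T \<psi>] assms by (simp add: comp_def)

section \<open>An explicit homotopy inverse of a fold\<close>

locale good_fold_cov = good_fold +
	assumes cover: "!!v. v : verts G ==> \<exists>e\<in>edges G. ini G e = v"
begin

text \<open>Clamping the parameter turns an edge into a path over all reals that rests at its ends,
  so concatenations can be written without range conditions.\<close>

definition ep :: "'b => real => 'a + ('b \<times> real) set" where "ep e t = edge_point G e (max 0 (min 1 t))"
definition ep1 :: "'b => real => 'a + ('b \<times> real) set" where "ep1 e t = edge_point G1 e (max 0 (min 1 t))"

lemma cont_clamp: "continuous_map euclideanreal (top_of_set {0..1}) (%t :: real. max 0 (min 1 t))"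
	by (auto simp: continuous_map_in_subtopology intro!: continuous_intros)

lemma cont_ep: "e : edges G ==> continuous_map euclideanreal (realisation G) (ep e)"
	unfolding ep_def using continuous_map_compose[OF cont_clamp continuous_map_edge_point[of e G]] by (simp add: comp_def)

lemma cont_ep1: "e : edges G1 ==> continuous_map euclideanreal (realisation G1) (ep1 e)"
	unfolding ep1_def using continuous_map_compose[OF cont_clamp continuous_map_edge_point[of e G1]] by (simp add: comp_def)

lemma ep_ends: "t \<le> 0 ==> ep e t = Inl (ini G e)" "1 \<le> t ==> ep e t = Inl (ter G e)"
	"t \<le> 0 ==> ep1 e t = Inl (ini G1 e)" "1 \<le> t ==> ep1 e t = Inl (ter G1 e)"
	by (auto simp: ep_def ep1_def edge_point_def max_def min_def)

lemma ep_opp: "e : edges G ==> ep (opp G e) (1 - t) = ep e t"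
	"e : edges G1 ==> ep1 (opp G e) (1 - t) = ep1 e t"
proof -
	have *: "max 0 (min 1 (1 - t)) = 1 - max 0 (min 1 t)" for t :: real by (auto simp: max_def min_def)
	show "e : edges G ==> ep (opp G e) (1 - t) = ep e t"
		unfolding ep_def * by (rule edge_point_opp[OF G])
	show "e : edges G1 ==> ep1 (opp G e) (1 - t) = ep1 e t"
		unfolding ep1_def * using edge_point_opp[OF sgraph_G1, of e] by simp
qed

text \<open>The path from the terminus of \<open>e2\<close> back along \<open>e2\<close> and out along \<open>e1\<close>; the homotopy inverse
	of the fold drags the terminus of \<open>e2\<close> along it.\<close>

definition c :: "real => 'a + ('b \<times> real) set" where
	"c r = (if r \<le> 1 then ep e2 (1 - r) else ep e1 (r - 1))"

definition tail :: "'b => real => 'a + ('b \<times> real) set" where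
	"tail f r = (if ini G f = ter G e2 then c r else Inl (ini G f))"

text \<open>The edge \<open>f\<close> prolonged beyond both ends by \<open>tail\<close>, that is, by
  the dragging path wherever the end is the terminus of \<open>e2\<close>. Negative parameters lie
  on the tail at the start, parameters above 1 on the tail at the end.\<close>

definition \<psi> :: "'b => real => 'a + ('b \<times> real) set" where
	"\<psi> f \<rho> = (if \<rho> \<le> 0 then tail f (- \<rho>) else if \<rho> \<le> 1 then ep f \<rho> else tail (opp G f) (\<rho> - 1))"

text \<open>At time s the parameter interval [0,1] is stretched affinely onto [-s, 1 + s], so every
  edge follows its dragged ends. The edge \<open>e2\<close> itself runs along \<open>c\<close> from
  1 to s: at time 0 this is \<open>e2\<close>, at time 2 it is \<open>e1\<close>. The clamp makes
  \<open>e2\<close> rest at its ends exactly as long as \<open>e1\<close>, whose tails are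
  constant.\<close>

definition \<phi> :: "'b => real => real => 'a + ('b \<times> real) set" where
	"\<phi> f s t = (if f = e2 then c (1 + max 0 (min 1 (t * (1 + 2 * s) - s)) * (s - 1))
		 else if f = opp G e2 then c (1 + max 0 (min 1 ((1 - t) * (1 + 2 * s) - s)) * (s - 1))
		 else \<psi> f (t * (1 + 2 * s) - s))"

lemma ini_e2: "ini G e2 ~= ter G e2" "ini G e1 ~= ter G e2" "ini G (opp G e2) = ter G e2" "ini G (opp G e1) = ter G e1"
	using ter12 ini12 by (auto simp: ter_def)

lemma c_vals: "c 0 = Inl (ter G e2)" "c 1 = Inl (ini G e2)" "c 2 = Inl (ter G e1)"
	unfolding c_def using ep_ends by auto

lemma cont_c: "continuous_map euclideanreal (realisation G) c"
proof -
	have "continuous_map euclideanreal (realisation G) (%r. if r \<le> 1 then ep e2 (1 - r) else ep e1 (r - 1))"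
	proof (rule continuous_map_cases_le)
		show "continuous_map (subtopology euclideanreal {x : topspace euclideanreal. x \<le> 1}) (realisation G) (%r. ep e2 (1 - r))"
			by (rule continuous_map_real_pair[OF cont_ep[OF e12(2)]]) (intro continuous_intros)
		show "continuous_map (subtopology euclideanreal {x : topspace euclideanreal. 1 \<le> x}) (realisation G) (%r. ep e1 (r - 1))"
			by (rule continuous_map_real_pair[OF cont_ep[OF e12(1)]]) (intro continuous_intros)
	qed (use ep_ends ini12 in auto)
	then show ?thesis unfolding c_def[abs_def] .
qed

lemma cont_tail: "f : edges G ==> continuous_map euclideanreal (realisation G) (tail f)"
	using cont_c G unfolding tail_def[abs_def] by (auto simp: realisation_points_def sgraph_def)

lemma cont_\<psi>:
	assumes f: "f : edges G"
	shows "continuous_map euclideanreal (realisation G) (\<psi> f)"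
proof -
	have of: "opp G f : edges G" using f G unfolding sgraph_def by blast
	have 1: "continuous_map euclideanreal (realisation G) (%\<rho>. if \<rho> \<le> 1 then ep f \<rho> else tail (opp G f) (\<rho> - 1))"
	proof (rule continuous_map_cases_le)
		show "continuous_map (subtopology euclideanreal {x : topspace euclideanreal. x \<le> 1}) (realisation G) (ep f)"
			using cont_ep[OF f] by (rule continuous_map_from_subtopology)
		show "continuous_map (subtopology euclideanreal {x : topspace euclideanreal. 1 \<le> x}) (realisation G) (%\<rho>. tail (opp G f) (\<rho> - 1))"
			by (rule continuous_map_real_pair[OF cont_tail[OF of]]) (intro continuous_intros)
	qed (use ep_ends c_vals in \<open>auto simp: tail_def ter_def\<close>)
	have "continuous_map euclideanreal (realisation G) (%\<rho>. if \<rho> \<le> 0 then tail f (- \<rho>) else if \<rho> \<le> 1 then ep f \<rho> else tail (opp G f) (\<rho> - 1))"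
	proof (rule continuous_map_cases_le)
		show "continuous_map (subtopology euclideanreal {x : topspace euclideanreal. x \<le> 0}) (realisation G) (%\<rho>. tail f (- \<rho>))"
			by (rule continuous_map_real_pair[OF cont_tail[OF f]]) (intro continuous_intros)
		show "continuous_map (subtopology euclideanreal {x : topspace euclideanreal. 0 \<le> x}) (realisation G) (%\<rho>. if \<rho> \<le> 1 then ep f \<rho> else tail (opp G f) (\<rho> - 1))"
			using 1 by (rule continuous_map_from_subtopology)
	qed (use ep_ends c_vals in \<open>auto simp: tail_def\<close>)
	then show ?thesis unfolding \<psi>_def[abs_def] .
qed

lemma \<psi>_opp:
	assumes f: "f : edges G"
	shows "\<psi> (opp G f) (1 - \<rho>) = \<psi> f \<rho>"
proof -
	have oo: "opp G (opp G f) = f" using f G unfolding sgraph_def by blast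
	consider "\<rho> < 0" | "\<rho> = 0" | "0 < \<rho>" "\<rho> < 1" | "\<rho> = 1" | "\<rho> > 1" by linarith
	then show ?thesis
		by cases (use ep_opp(1)[OF f, of \<rho>] oo ep_ends c_vals in \<open>auto simp: \<psi>_def tail_def ter_def\<close>)
qed

lemma cont_\<phi>:
	assumes f: "f : edges G"
	shows "continuous_map (top_of_set S) (realisation G) (%(s, t). \<phi> f (k * s) t)"
proof -
	have "continuous_map (top_of_set S) (realisation G) (%z. c (1 + max 0 (min 1 (snd z * (1 + 2 * (k * fst z)) - k * fst z)) * (k * fst z - 1)))"
		by (rule continuous_map_real_pair[OF cont_c]) (intro continuous_intros)
	moreover have "continuous_map (top_of_set S) (realisation G) (%z. c (1 + max 0 (min 1 ((1 - snd z) * (1 + 2 * (k * fst z)) - k * fst z)) * (k * fst z - 1)))"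
		by (rule continuous_map_real_pair[OF cont_c]) (intro continuous_intros)
	moreover have "continuous_map (top_of_set S) (realisation G) (%z. \<psi> f (snd z * (1 + 2 * (k * fst z)) - k * fst z))"
		by (rule continuous_map_real_pair[OF cont_\<psi>[OF f]]) (intro continuous_intros)
	ultimately show ?thesis unfolding \<phi>_def case_prod_beta by simp
qed

lemma \<phi>_ini:
	assumes f: "f : edges G" and s: "0 \<le> s"
	shows "\<phi> f s 0 = (if ini G f = ter G e2 then c s else Inl (ini G f))"
proof -
	have "max 0 (min 1 (- s)) = 0" "max 0 (min 1 (1 + s)) = 1" using s by auto
	then show ?thesis using s ini_e2 c_vals by (auto simp: \<phi>_def \<psi>_def tail_def)
qed

lemma \<phi>_opp:
	assumes f: "f : edges G"
	shows "\<phi> (opp G f) s (1 - t) = \<phi> f s t"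
proof -
	have r: "(1 - t) * (1 + 2 * s) - s = 1 - (t * (1 + 2 * s) - s)" by (simp add: algebra_simps)
	have e: "opp G f = e2 \<longleftrightarrow> f = opp G e2" "opp G f = opp G e2 \<longleftrightarrow> f = e2"
		using f opp_facts e12 opp_inj[of f "opp G e2"] opp_inj[of f e2] by auto
	show ?thesis
	proof (cases "f = e2 \<or> f = opp G e2")
		case True then show ?thesis using opp_facts by (auto simp: \<phi>_def)
	next
		case False
		have "\<phi> (opp G f) s (1 - t) = \<psi> (opp G f) (1 - (t * (1 + 2 * s) - s))"
			using False unfolding \<phi>_def e r by presburger
		also have "\<dots> = \<phi> f s t" unfolding \<psi>_opp[OF f] using False unfolding \<phi>_def by presburger
		finally show ?thesis .
	qed
qed

lemma \<phi>_0: "f : edges G ==> t : {0..1} ==> \<phi> f 0 t = edge_point G f t"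
proof -
	assume f: "f : edges G" and t: "t : {0..1}"
	have tt: "max 0 (min 1 t) = t" "max 0 (min 1 (1 - t)) = 1 - t" using t by auto
	consider "f = e2" | "f = opp G e2" | "f ~= e2" "f ~= opp G e2" by blast
	then show ?thesis
	proof cases
		case 1 then show ?thesis using t by (simp add: \<phi>_def tt c_def ep_def)
	next
		case 2 then show ?thesis using t edge_point_opp[OF G e12(2), of "1 - t"] opp_facts by (simp add: \<phi>_def tt c_def ep_def)
	next
		case 3 then show ?thesis using t c_vals by (auto simp: \<phi>_def \<psi>_def tt ep_def tail_def edge_point_def)
	qed
qed

text \<open>At the end of the drag the two folded edges trace the same path with the same
  parametrisation, so the final map factors through the quotient; this defines the homotopy inverse
  \<open>g\<close>.\<close>

lemma \<phi>_2_e1: "\<phi> e1 2 t = \<phi> e2 2 t"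
proof -
	define \<rho> where "\<rho> = t * 5 - 2"
	define m where "m = max 0 (min 1 \<rho>)"
	have "\<psi> e1 \<rho> = ep e1 m"
	proof -
		consider "\<rho> \<le> 0" "m = 0" | "0 < \<rho>" "\<rho> \<le> 1" "m = \<rho>" | "1 < \<rho>" "m = 1" unfolding m_def by linarith
		then show ?thesis
		proof cases
			case 1 then show ?thesis using ini_e2 ep_ends(1)[of 0 e1] by (simp add: \<psi>_def tail_def)
		next
			case 2 then show ?thesis by (simp add: \<psi>_def)
		next
			case 3 then show ?thesis using ini_e2 ter12 ep_ends(2)[of 1 e1] by (simp add: \<psi>_def tail_def)
		qed
	qed
	moreover have "c (1 + m) = ep e1 m"
	proof (cases "m = 0")
		case True then show ?thesis using ep_ends(1)[of 0] ini12 by (simp add: c_def)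
	next
		case False
		then have "0 < m" unfolding m_def by linarith
		then show ?thesis by (simp add: c_def)
	qed
	ultimately show ?thesis using e12 by (simp add: \<phi>_def \<rho>_def m_def)
qed

definition g :: "'a + ('b \<times> real) set => 'a + ('b \<times> real) set" where
	"g = glue Inl (%f. \<phi> f 2)"

lemma g_edge:
	assumes "f : edges G1" "t : {0..1}"
	shows "g (edge_point G1 f t) = \<phi> f 2 t"
	unfolding g_def
proof (rule glue_edge_point[OF sgraph_G1 assms])
	show "\<phi> e 2 0 = Inl (ini G1 e)" if "e : edges G1" for e using \<phi>_ini[of e 2] that c_vals by auto
	show "\<phi> (opp G1 e) 2 (1 - t) = \<phi> e 2 t" if "e : edges G1" for e t using \<phi>_opp[of e] that by simp
qed

lemma cont_g: "continuous_map (realisation G1) (realisation G) g"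
proof (rule continuous_map_realisation)
	fix f assume f: "f : edges G1"
	have "continuous_map (top_of_set {0..1}) (realisation G) (\<phi> f 2)"
	proof -
		have "continuous_map (top_of_set {0..1::real}) (top_of_set UNIV) (%t. (2::real, t))"
			by (auto intro!: continuous_intros)
		from continuous_map_compose[OF this cont_\<phi>[of f UNIV 1]] f show ?thesis by (simp add: comp_def)
	qed
	then show "continuous_map (top_of_set {0..1}) (realisation G) (%t. g (edge_point G1 f t))"
		by (rule continuous_map_eq) (use g_edge[OF f] in auto)
next
	fix x assume x: "x : realisation_points G1"
	have cover1: "\<exists>f\<in>edges G1. ini G1 f = v" if v: "v : verts G1" for v
	proof -
		obtain f where f: "f : edges G" "ini G f = v" using v cover[of v] by auto
		have "emap q f : edges G1" "ini G1 (emap q f) = vmap q v" using fold_map_q f unfolding fold_map_def graph_morphism_def by auto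
		moreover have "vmap q v = v" using v by (auto simp: fold_gmap_def)
		ultimately show ?thesis by auto
	qed
	have "\<exists>f\<in>edges G1. \<exists>t\<in>{0..1}. x = edge_point G1 f t"
		by (rule realisation_points_edges[OF sgraph_G1 cover1 x]) simp
	then obtain f t where f: "f : edges G1" "t : {0..1}" "x = edge_point G1 f t" by blast
	have "\<phi> f 2 t : topspace (realisation G)"
		using continuous_map_funspace[OF cont_\<phi>[of f "UNIV" 1]] f(1) by (auto simp: Pi_iff)
	then show "g x : topspace (realisation G)" using g_edge[OF f(1,2)] f(3) by simp
qed

text \<open>In the quotient the dragging path runs back along \<open>e1\<close> and out again. For
  growing s the turning point is pulled towards the terminus, the excursion having length 2 * (1 -
  s); at s = 1 nothing is left.\<close>

definition cb :: "real => real => 'a + ('b \<times> real) set" where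
	"cb s r = ep1 e1 (1 - max 0 (min r (2 * (1 - s) - r)))"

definition tailb :: "real => 'b => real => 'a + ('b \<times> real) set" where
	"tailb s f r = (if ini G f = ter G e2 then cb s r else Inl (ini G f))"

definition \<psi>b :: "real => 'b => real => 'a + ('b \<times> real) set" where
	"\<psi>b s f \<rho> = (if \<rho> \<le> 0 then tailb s f (- \<rho>) else if \<rho> \<le> 1 then ep1 f \<rho> else tailb s (opp G f) (\<rho> - 1))"

text \<open>The homotopy from \<open>realise_map q \<circ> g\<close> to the identity: [0,1] is
  stretched onto the edge together with two excursions of length 2 * (1 - s), which shrink
  away.\<close>

definition \<kappa> :: "'b => real => real => 'a + ('b \<times> real) set" where
	"\<kappa> f s t = \<psi>b s f (t * (1 + 4 * (1 - s)) - 2 * (1 - s))"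

lemma e1_G1: "e1 : edges G1" "ini G1 e1 = ini G e1" "ter G1 e1 = ter G e1"
	using e12(1,3,4) ini_e2(2,4) ter12(1) by (simp_all add: ter_def[of G1])

lemma cb_0: "cb s 0 = Inl (ter G e1)" "cb s (2 * (1 - s)) = Inl (ter G e1)"
	unfolding cb_def using ep_ends(4)[of 1 e1] e1_G1 by (auto simp: min_def max_def)

lemma cont_tailb:
	assumes f: "f : edges G1" and h: "continuous_on S h"
	shows "continuous_map (top_of_set S) (realisation G1) (%z. tailb (fst z) f (h z :: real))"
proof (cases "ini G f = ter G e2")
	case True
	have "continuous_map (top_of_set S) (realisation G1) (%z. ep1 e1 (1 - max 0 (min (h z) (2 * (1 - fst z) - h z))))"
		by (rule continuous_map_real_pair[OF cont_ep1[OF e1_G1(1)]]) (intro continuous_intros h)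
	then show ?thesis using True by (simp add: tailb_def cb_def)
next
	case False
	then have "ini G f : verts G1" using f G unfolding sgraph_def by auto
	then show ?thesis using False by (auto simp: tailb_def realisation_points_def)
qed

lemma cont_\<psi>b:
	assumes f: "f : edges G1" and h: "continuous_on S h"
	shows "continuous_map (top_of_set S) (realisation G1) (%z. \<psi>b (fst z) f (h z :: real))"
proof -
	have of: "opp G f : edges G1" using f sgraph_G1 unfolding sgraph_def by auto
	have hc: "continuous_map (top_of_set S) euclideanreal h" using h by simp
	have st: "subtopology (top_of_set S) {x : topspace (top_of_set S). P x} = top_of_set {x : S. P x}" for P
		by (simp add: subtopology_subtopology Collect_conj_eq Int_absorb2 flip: Int_def)
	have hS: "continuous_on {x : S. P x} h" for P using h by (rule continuous_on_subset) auto
	have 1: "continuous_map (top_of_set S) (realisation G1) (%z. if h z \<le> 1 then ep1 f (h z) else tailb (fst z) (opp G f) (h z - 1))"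
	proof (rule continuous_map_cases_le[OF hc])
		show "continuous_map (subtopology (top_of_set S) {x : topspace (top_of_set S). h x \<le> 1}) (realisation G1) (%z. ep1 f (h z))"
			unfolding st by (rule continuous_map_real_pair[OF cont_ep1[OF f] hS])
		show "continuous_map (subtopology (top_of_set S) {x : topspace (top_of_set S). 1 \<le> h x}) (realisation G1) (%z. tailb (fst z) (opp G f) (h z - 1))"
			unfolding st by (rule cont_tailb[OF of]) (intro continuous_intros hS)
	qed (use ep_ends cb_0 in \<open>auto simp: tailb_def ter_def\<close>)
	have "continuous_map (top_of_set S) (realisation G1) (%z. if h z \<le> 0 then tailb (fst z) f (- h z)
			else if h z \<le> 1 then ep1 f (h z) else tailb (fst z) (opp G f) (h z - 1))"
	proof (rule continuous_map_cases_le[OF hc])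
		show "continuous_map (subtopology (top_of_set S) {x : topspace (top_of_set S). h x \<le> 0}) (realisation G1) (%z. tailb (fst z) f (- h z))"
			unfolding st by (rule cont_tailb[OF f]) (intro continuous_intros hS)
		show "continuous_map (subtopology (top_of_set S) {x : topspace (top_of_set S). 0 \<le> h x}) (realisation G1)
			 (%z. if h z \<le> 1 then ep1 f (h z) else tailb (fst z) (opp G f) (h z - 1))"
			using 1 by (rule continuous_map_from_subtopology)
	qed (use ep_ends cb_0 in \<open>auto simp: tailb_def\<close>)
	then show ?thesis unfolding \<psi>b_def .
qed

lemma \<psi>b_opp:
	assumes f: "f : edges G1"
	shows "\<psi>b s (opp G f) (1 - \<rho>) = \<psi>b s f \<rho>"
proof -
	have oo: "opp G (opp G f) = f" using f G unfolding sgraph_def by auto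
	consider "\<rho> < 0" | "\<rho> = 0" | "0 < \<rho>" "\<rho> < 1" | "\<rho> = 1" | "\<rho> > 1" by linarith
	then show ?thesis
		by cases (use ep_opp(2)[OF f, of \<rho>] oo ep_ends cb_0 in \<open>auto simp: \<psi>b_def tailb_def ter_def\<close>)
qed

lemma q_emap: "f : edges G ==> emap q f : edges G1" "f : edges G1 ==> emap q f = f"
	"v ~= ter G e2 ==> vmap q v = v" "emap q e2 = e1"
	using e12 by (auto simp: fold_gmap_def)

lemma mor_q: "graph_morphism G G1 q" using fold_map_q unfolding fold_map_def by blast

lemma b_ep: "f : edges G ==> realise_map q (ep f t) = ep1 (emap q f) t"
	unfolding ep_def ep1_def by (rule realise_map_edge_point[OF mor_q])

lemma b_c: "r : {0..2} ==> realise_map q (c r) = cb 0 r"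
proof -
	assume r: "r : {0..2}"
	show ?thesis
	proof (cases "r \<le> 1")
		case True
		then have "max 0 (min r (2 - r)) = r" using r by auto
		then show ?thesis using True e12 by (simp add: c_def cb_def b_ep q_emap)
	next
		case False
		then have "max 0 (min r (2 - r)) = 2 - r" using r by auto
		then show ?thesis using False e12 q_emap(2)[OF e1_G1(1)] by (simp add: c_def cb_def b_ep)
	qed
qed

lemma b_\<psi>:
	assumes f: "f : edges G1" and \<rho>: "\<rho> : {-2..3}"
	shows "realise_map q (\<psi> f \<rho>) = \<psi>b 0 f \<rho>"
proof -
	have t: "realise_map q (tail f' r) = tailb 0 f' r" if "r : {0..2}" for f' r
		using b_c[OF that] q_emap(3) by (auto simp: tail_def tailb_def realise_map_def)
	show ?thesis using f \<rho> t b_ep[of f] q_emap(2)[OF f] by (auto simp: \<psi>_def \<psi>b_def)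
qed

lemma homotopy_equivalence_q: "graph_homotopy_equivalence G G1 q"
proof -
	let ?b = "realise_map q"
	have gb: "g (?b (edge_point G f t)) = \<phi> f 2 t" if f: "f : edges G" and t: "t : {0..1}" for f t
	proof -
		have "g (?b (edge_point G f t)) = \<phi> (emap q f) 2 t"
			using realise_map_edge_point[OF mor_q f] g_edge[OF q_emap(1)[OF f] t] by simp
		also have "\<dots> = \<phi> f 2 t"
		proof -
			consider "f = e2" | "f = opp G e2" | "f ~= e2" "f ~= opp G e2" by blast
			then show ?thesis
			proof cases
				case 1 then show ?thesis using \<phi>_2_e1 q_emap by simp
			next
				case 2
				then have "emap q f = opp G e1" by (simp add: fold_gmap_def)
				moreover have "\<phi> (opp G e1) 2 t = \<phi> e1 2 (1 - t)" using \<phi>_opp[OF e12(1), of 2 "1 - t"] by simp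
				moreover have "\<phi> (opp G e2) 2 t = \<phi> e2 2 (1 - t)" using \<phi>_opp[OF e12(2), of 2 "1 - t"] by simp
				ultimately show ?thesis using \<phi>_2_e1 2 by simp
			next
				case 3 then show ?thesis using f q_emap(2)[of f] by simp
			qed
		qed
		finally show ?thesis .
	qed
	have 1: "homotopic_with (%x. True) (realisation G) (realisation G) id (g \<circ> ?b)"
	proof (rule homotopic_edges[OF G cover, where \<phi> = "%f s t. \<phi> f (2 * s) t"
				and \<nu> = "%s v. if v = ter G e2 then c (2 * s) else Inl v"])
		show "continuous_map (top_of_set ({0..1} \<times> {0..1})) (realisation G) (%(s, t). \<phi> e (2 * s) t)" if "e : edges G" for e
			by (rule cont_\<phi>[OF that])
		show "\<phi> e (2 * s) 0 = (if ini G e = ter G e2 then c (2 * s) else Inl (ini G e))" if "e : edges G" "s : {0..1}" for e s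
			using \<phi>_ini[of e "2 * s"] that by simp
		show "\<phi> (opp G e) (2 * s) (1 - t) = \<phi> e (2 * s) t" if "e : edges G" for e s t
			by (rule \<phi>_opp[OF that])
		show "id (edge_point G e t) = \<phi> e (2 * 0) t" if "e : edges G" "t : {0..1}" for e t
			using \<phi>_0[OF that] by simp
		show "(g \<circ> ?b) (edge_point G e t) = \<phi> e (2 * 1) t" if "e : edges G" "t : {0..1}" for e t
			using gb[OF that] by simp
	qed
	have cover1: "\<exists>f\<in>edges G1. ini G1 f = v" if v: "v : verts G1" for v
	proof -
		obtain f where f: "f : edges G" "ini G f = v" using v cover[of v] by auto
		have "emap q f : edges G1" "ini G1 (emap q f) = vmap q v" using mor_q f unfolding graph_morphism_def by auto
		then show ?thesis using q_emap(3)[of v] v by auto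
	qed
	have 2: "homotopic_with (%x. True) (realisation G1) (realisation G1) (?b \<circ> g) id"
	proof (rule homotopic_edges[OF sgraph_G1 cover1, where \<phi> = \<kappa> and \<nu> = "%s. Inl"])
		show "continuous_map (top_of_set ({0..1} \<times> {0..1})) (realisation G1) (%(s, t). \<kappa> e s t)" if "e : edges G1" for e
		proof -
			have "continuous_map (top_of_set ({0..1} \<times> {0..1})) (realisation G1)
					(%z. \<psi>b (fst z) e (snd z * (1 + 4 * (1 - fst z)) - 2 * (1 - fst z)))"
				by (rule cont_\<psi>b[OF that]) (intro continuous_intros)
			then show ?thesis by (simp only: \<kappa>_def case_prod_unfold)
		qed
		show "\<kappa> e s 0 = Inl (ini G1 e)" if "e : edges G1" "s : {0..1}" for e s
			using that cb_0(2)[of s] by (auto simp: \<kappa>_def \<psi>b_def tailb_def)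
		show "\<kappa> (opp G1 e) s (1 - t) = \<kappa> e s t" if "e : edges G1" for e s t
		proof -
			have "(1 - t) * (1 + 4 * (1 - s)) - 2 * (1 - s) = 1 - (t * (1 + 4 * (1 - s)) - 2 * (1 - s))" by (simp add: algebra_simps)
			then show ?thesis unfolding \<kappa>_def fold_graph_simps(4) using \<psi>b_opp[OF that] by presburger
		qed
		show "(?b \<circ> g) (edge_point G1 e t) = \<kappa> e 0 t" if e: "e : edges G1" and t: "t : {0..1}" for e t
		proof -
			have "t * 5 - 2 : {-2..3}" using t by auto
			then show ?thesis using g_edge[OF e t] b_\<psi>[OF e, of "t * 5 - 2"] e by (simp add: \<phi>_def \<kappa>_def)
		qed
		show "id (edge_point G1 e t) = \<kappa> e 1 t" if "e : edges G1" "t : {0..1}" for e t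
		proof -
			have "max 0 (min 1 t) = t" using that by auto
			then show ?thesis using that cb_0 by (auto simp: \<kappa>_def \<psi>b_def tailb_def ep1_def edge_point_def)
		qed
	qed
	show ?thesis
		unfolding graph_homotopy_equivalence_def homotopy_equivalence_map_def
		using mor_q continuous_realise_map[OF mor_q] cont_g homotopic_with_symD[OF 1] 2 by blast
qed

end

section \<open>Homotopy equivalences: composites, and their effect on first cohomology\<close>

lemma realise_map_gcomp: "realise_map (gcomp p q) = realise_map p \<circ> realise_map q"
proof
	fix x show "realise_map (gcomp p q) x = (realise_map p \<circ> realise_map q) x"
		by (cases x) (simp_all add: realise_map_def gcomp_def image_image map_prod_def case_prod_unfold comp_def)
qed

lemma graph_morphism_gcomp: "graph_morphism G H q ==> graph_morphism H K p ==> graph_morphism G K (gcomp p q)"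
	unfolding graph_morphism_def by (auto simp: gcomp_def)

lemma graph_homotopy_equivalence_gcomp:
	assumes "graph_homotopy_equivalence G H q" "graph_homotopy_equivalence H K p"
	shows "graph_homotopy_equivalence G K (gcomp p q)"
proof -
	let ?G = "realisation G" and ?H = "realisation H" and ?K = "realisation K"
	let ?q = "realise_map q" and ?p = "realise_map p"
	from assms(1) obtain q' where q: "graph_morphism G H q" "continuous_map ?G ?H ?q" "continuous_map ?H ?G q'"
		"homotopic_with (%x. True) ?G ?G (q' \<circ> ?q) id" "homotopic_with (%x. True) ?H ?H (?q \<circ> q') id"
		unfolding graph_homotopy_equivalence_def homotopy_equivalence_map_def by blast
	from assms(2) obtain p' where p: "graph_morphism H K p" "continuous_map ?H ?K ?p" "continuous_map ?K ?H p'"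
		"homotopic_with (%x. True) ?H ?H (p' \<circ> ?p) id" "homotopic_with (%x. True) ?K ?K (?p \<circ> p') id"
		unfolding graph_homotopy_equivalence_def homotopy_equivalence_map_def by blast
	have "homotopic_with (%x. True) ?G ?G (q' \<circ> ((p' \<circ> ?p) \<circ> ?q)) (q' \<circ> (id \<circ> ?q))"
		by (rule homotopic_with_compose_continuous_map_left[OF homotopic_with_compose_continuous_map_right[OF p(4) q(2)] q(3)]) auto
	then have 1: "homotopic_with (%x. True) ?G ?G ((q' \<circ> p') \<circ> (?p \<circ> ?q)) id"
		using homotopic_with_trans[OF _ q(4)] by (simp add: comp_assoc)
	have "homotopic_with (%x. True) ?K ?K (?p \<circ> ((?q \<circ> q') \<circ> p')) (?p \<circ> (id \<circ> p'))"
		by (rule homotopic_with_compose_continuous_map_left[OF homotopic_with_compose_continuous_map_right[OF q(5) p(3)] p(2)]) auto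
	then have 2: "homotopic_with (%x. True) ?K ?K ((?p \<circ> ?q) \<circ> (q' \<circ> p')) id"
		using homotopic_with_trans[OF _ p(5)] by (simp add: comp_assoc)
	show ?thesis
		unfolding graph_homotopy_equivalence_def homotopy_equivalence_map_def realise_map_gcomp
		using graph_morphism_gcomp[OF q(1) p(1)] continuous_map_compose[OF q(2) p(2)] continuous_map_compose[OF p(3) q(3)] 1 2 by blast
qed

lemma graph_homotopy_equivalence_gid:
	assumes "sgraph G"
	shows "graph_homotopy_equivalence G G gid"
proof -
	have "realise_map (gid :: ('a, 'b, 'a, 'b) gmap) = id"
	proof
		fix x show "realise_map (gid :: ('a, 'b, 'a, 'b) gmap) x = id x"
			by (cases x) (simp_all add: realise_map_def gid_def prod.map_id0)
	qed
	then show ?thesis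
		using assms unfolding graph_homotopy_equivalence_def homotopy_equivalence_map_def graph_morphism_def
		by (auto simp: gid_def sgraph_def intro!: exI[of _ id])
qed

text \<open>Increment of a continuous logarithm along a path in the punctured plane, with the
  winding in its imaginary part. The choice does not depend on the logarithm by
  \<open>log_variation_eq\<close>.\<close>

definition log_variation :: "(real => complex) => complex" where
	"log_variation c = (SOME d. \<exists>L. continuous_on {0..1} L & (\<forall>t\<in>{0..1}. c t = exp (L t)) & d = L 1 - L 0)"

text \<open>Two logarithms differ by multiples of 2 * pi * i, a set in which distinct points are at
  least 2 * pi apart, so on a connected interval the difference is constant.\<close>

lemma log_variation_eq:
	assumes L: "continuous_on {0..1} L" "!!t. t : {0..1} ==> c t = exp (L t)"
	shows "log_variation c = L 1 - L 0"
proof -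
	have "\<exists>L'. continuous_on {0..1} L' & (\<forall>t\<in>{0..1}. c t = exp (L' t)) & log_variation c = L' 1 - L' 0"
		unfolding log_variation_def by (rule someI_ex) (use L in blast)
	then obtain L' where L': "continuous_on {0..1} L'" "\<forall>t\<in>{0..1}. c t = exp (L' t)" "log_variation c = L' 1 - L' 0" by blast
	have e1: "exp (L t - L' t) = 1" if "t : {0..1}" for t
		using L(2)[OF that] L'(2) that by (simp add: exp_diff)
	have "(%t. L t - L' t) constant_on {0..1}"
	proof (rule continuous_discrete_range_constant)
		show "connected {0..1::real}" by simp
		show "continuous_on {0..1} (%t. L t - L' t)" using L L' by (intro continuous_intros)
		fix x :: real assume x: "x : {0..1}"
		have "2 * pi \<le> cmod (L y - L' y - (L x - L' x))" if y: "y : {0..1}" "L y - L' y ~= L x - L' x" for y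
		proof -
			have "exp (L y - L' y - (L x - L' x)) = 1" using e1[OF x] e1[OF y(1)] by (simp add: exp_diff)
			then obtain n :: int where n: "Re (L y - L' y - (L x - L' x)) = 0" "Im (L y - L' y - (L x - L' x)) = of_int (2 * n) * pi"
				unfolding exp_eq_1 by blast
			have "n ~= 0" using n y(2) by (auto simp: complex_eq_iff)
			then have "1 \<le> \<bar>real_of_int n\<bar>" by linarith
			then have "2 * pi \<le> \<bar>of_int (2 * n) * pi\<bar>" by (simp add: abs_mult)
			then show ?thesis using abs_Im_le_cmod[of "L y - L' y - (L x - L' x)"] n(2) by simp
		qed
		then show "\<exists>e>0. \<forall>y. y : {0..1} & L y - L' y ~= L x - L' x --> e \<le> cmod (L y - L' y - (L x - L' x))"
			by (intro exI[of _ "2 * pi"]) auto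
	qed
	then obtain k where "L t - L' t = k" if "t : {0..1}" for t unfolding constant_on_def by metis
	from this[of 0] this[of 1] have "L 1 - L 0 = L' 1 - L' 0" by (simp add: algebra_simps)
	then show ?thesis using L'(3) by simp
qed

text \<open>The cocycle is turned into a map \<open>r\<close> to the circle. Composed with the
  homotopy from \<open>g \<circ> realise_map q\<close> to the identity, \<open>r\<close> has a
  logarithm on the square over each edge. The top side varies by 2 * pi * i * \<open>n e\<close>,
  the bottom side depends only on \<open>emap q e\<close>, and the vertical sides only on the end
  vertices; closing up around the square gives the splitting.\<close>

lemma split_cocycles_homotopy_equivalence:
	fixes G :: "('v, 'e) sgraph" and K :: "('w, 'f) sgraph"
	assumes he: "graph_homotopy_equivalence G K q"
	shows "split_cocycles G q"
	unfolding split_cocycles_def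
proof (intro allI impI)
	fix n :: "'e => int" assume n: "\<forall>e\<in>edges G. n (opp G e) = - n e"
	from he obtain g where m: "graph_morphism G K q" and g: "continuous_map (realisation K) (realisation G) g"
		"homotopic_with (%x. True) (realisation G) (realisation G) (g \<circ> realise_map q) id"
		unfolding graph_homotopy_equivalence_def homotopy_equivalence_map_def by blast
	have G: "sgraph G" using m unfolding graph_morphism_def by blast
	obtain h where h: "continuous_map (prod_topology (top_of_set {0..1::real}) (realisation G)) (realisation G) h"
		"!!x. h (0, x) = g (realise_map q x)" "!!x. h (1, x) = x"
		using g(2) unfolding homotopic_with_def by auto
	\<comment> \<open>Wraps the edge \<open>e\<close> around the unit circle \<open>n e\<close> times
	  and sends every vertex to 1.\<close>
	define r :: "'v + ('e \<times> real) set => complex" where "r = glue (%_. 1) (%e t. cis (2 * pi * n e * t))"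
	have r: "r (edge_point G e t) = cis (2 * pi * n e * t)" if e: "e : edges G" "t : {0..1}" for e t
		unfolding r_def
	proof (rule glue_edge_point[OF G that])
		fix e and t :: real assume "e : edges G" "t : {0..1}"
		then have "2 * pi * n (opp G e) * (1 - t) = 2 * pi * n e * t + 2 * pi * (- n e)" using n by (simp add: algebra_simps)
		then have "cis (2 * pi * n (opp G e) * (1 - t)) = cis (2 * pi * n e * t) * cis (2 * pi * (- n e))"
			by (metis cis_mult)
		then show "cis (2 * pi * n (opp G e) * (1 - t)) = cis (2 * pi * n e * t)" using cis_multiple_2pi[of "real_of_int (- n e)"] by simp
	qed simp
	have rc: "continuous_map (realisation G) euclidean r"
	proof (rule continuous_map_realisation)
		fix e assume e: "e : edges G"
		have "continuous_map (top_of_set {0..1}) euclidean (%t. cis (2 * pi * n e * t))"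
			by (auto intro!: continuous_intros)
		then show "continuous_map (top_of_set {0..1}) euclidean (%t. r (edge_point G e t))"
			by (rule continuous_map_eq) (use r[OF e] in auto)
	qed simp
	have r0: "r x ~= 0" if "x : realisation_points G" for x
		using that unfolding realisation_points_def
	proof
		assume "x : Inl ` verts G" then show ?thesis by (auto simp: r_def glue_def)
	next
		assume "x : {edge_point G e t |e t. e : edges G & t : {0..1}}"
		then show ?thesis using r by auto
	qed
	have ex: "\<exists>L. continuous_on ({0..1} \<times> {0..1}) L & (\<forall>s\<in>{0..1}. \<forall>t\<in>{0..1}. r (h (s, edge_point G e t)) = exp (L (s, t)))"
		if e: "e : edges G" for e
	proof -
		have hh: "continuous_map (top_of_set ({0..1} \<times> {0..1})) (realisation G) (%z. h (fst z, edge_point G e (snd z)))"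
		proof -
			have "continuous_map (prod_topology (top_of_set {0..1::real}) (top_of_set {0..1})) (prod_topology (top_of_set {0..1}) (realisation G)) (%z. (fst z, edge_point G e (snd z)))"
			proof (rule continuous_map_pairedI[OF continuous_map_fst])
				show "continuous_map (prod_topology (top_of_set {0..1::real}) (top_of_set {0..1})) (realisation G) (%z. edge_point G e (snd z))"
					using continuous_map_compose[OF continuous_map_snd continuous_map_edge_point[OF e]] unfolding comp_def .
			qed
			from continuous_map_compose[OF this h(1)] show ?thesis by (simp add: comp_def prod_topology_subtopology_eu)
		qed
		have "continuous_map (top_of_set ({0..1} \<times> {0..1})) euclidean (%z. r (h (fst z, edge_point G e (snd z))))"
			using continuous_map_compose[OF hh rc] by (simp add: comp_def)
		then have c: "continuous_on ({0..1} \<times> {0..1}) (%z. r (h (fst z, edge_point G e (snd z))))" by simp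
		have cc: "contractible ({0..1::real} \<times> {0..1::real})" by (intro convex_imp_contractible convex_Times) auto
		have nz: "r (h (fst z, edge_point G e (snd z))) ~= 0" if "z : {0..1} \<times> {0..1}" for z
			using continuous_map_funspace[OF hh] that by (intro r0) auto
		obtain L where "continuous_on ({0..1} \<times> {0..1}) L" "!!z. z : {0..1} \<times> {0..1} ==> r (h (fst z, edge_point G e (snd z))) = exp (L z)"
			using continuous_logarithm_on_contractible[OF c cc nz] by blast
		then show ?thesis by (intro exI[of _ L]) auto
	qed
	define m where "m f = log_variation (%t. r (g (edge_point K f t))) / (2 * of_real pi * \<i>)" for f
	define \<phi> where "\<phi> v = log_variation (%s. r (h (s, Inl v))) / (2 * of_real pi * \<i>)" for v
	show "\<exists>(m :: 'f => complex) \<phi>. \<forall>e\<in>edges G. of_int (n e) = m (emap q e) + \<phi> (ter G e) - \<phi> (ini G e)"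
	proof (intro exI ballI)
		fix e assume e: "e : edges G"
		obtain L where L: "continuous_on ({0..1} \<times> {0..1}) L" "!!s t. s : {0..1} ==> t : {0..1} ==> r (h (s, edge_point G e t)) = exp (L (s, t))"
			using ex[OF e] by blast
		have cs: "continuous_on {0..1} (%t. L (s, t))" "continuous_on {0..1} (%t. L (t, s))" if "s : {0..1}" for s
			using that by (auto intro!: continuous_on_compose2[OF L(1)] continuous_intros)
		have bot: "log_variation (%t. r (g (edge_point K (emap q e) t))) = L (0, 1) - L (0, 0)"
			by (rule log_variation_eq[OF cs(1)]) (use L(2)[of 0] h(2) realise_map_edge_point[OF \<open>graph_morphism G K q\<close> e] in auto)
		have top: "log_variation (%t. cis (2 * pi * n e * t)) = L (1, 1) - L (1, 0)"
			by (rule log_variation_eq[OF cs(1)]) (use L(2)[of 1] h(3) r[OF e] in auto)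
		have "log_variation (%t. cis (2 * pi * n e * t)) = of_real (2 * pi * n e * 1) * \<i> - of_real (2 * pi * n e * 0) * \<i>"
			by (rule log_variation_eq) (auto intro!: continuous_intros simp: cis_conv_exp mult_ac)
		then have top': "L (1, 1) - L (1, 0) = 2 * of_real pi * \<i> * of_int (n e)" using top by (simp add: mult_ac)
		have left: "log_variation (%s. r (h (s, Inl (ini G e)))) = L (1, 0) - L (0, 0)"
			by (rule log_variation_eq[OF cs(2)[of 0]]) (use L(2)[of _ 0] in \<open>auto simp: edge_point_def\<close>)
		have right: "log_variation (%s. r (h (s, Inl (ter G e)))) = L (1, 1) - L (0, 1)"
			by (rule log_variation_eq[OF cs(2)[of 1]]) (use L(2)[of _ 1] in \<open>auto simp: edge_point_def\<close>)
		have "m (emap q e) + \<phi> (ter G e) - \<phi> (ini G e) = (L (1, 1) - L (1, 0)) / (2 * of_real pi * \<i>)"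
			unfolding m_def \<phi>_def bot left right by (simp add: add_divide_distrib diff_divide_distrib)
		also have "\<dots> = of_int (n e)" unfolding top' by simp
		finally show "of_int (n e) = m (emap q e) + \<phi> (ter G e) - \<phi> (ini G e)" by simp
	qed
qed

text \<open>The opposites of two foldable edges share a hub, by the path of length zero. With a
  common terminus they would be a double edge of the forest.\<close>

lemma origami_ter_distinct:
	assumes or: "origami G vl el P" and e: "e1 : edges G" "e2 : edges G" "e1 ~= e2" "ini G e1 = ini G e2" "el e1 = el e2"
	shows "ter G e1 ~= ter G e2"
proof
	assume t: "ter G e1 = ter G e2"
	have sG: "sgraph G" "finite (edges G)" "bip_forest G P" and P: "eqrel (edges G) P" using or unfolding origami_def by blast+
	have op: "opp G e1 : edges G" "opp G e2 : edges G" "opp G e1 ~= opp G e2" using sG e unfolding sgraph_def by metis+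
	have l: "lab G vl el e1 = lab G vl el e2" using e by (simp add: lab_def)
	have pp: "(opp G e1, opp G e2) : P"
		using or e l unfolding origami_def by (metis rtrancl.rtrancl_refl)
	define k :: "'b => bit" where "k e = of_bool (e = opp G e1) + of_bool (e = opp G e2)" for e
	have "(\<Sum>e | e : edges G & ini G e = v. k e) = 0" for v
		unfolding k_def sum.distrib using sG op t by (auto simp: of_bool_def ter_def)
	moreover have "(\<Sum>e\<in>P `` {c}. k e) = 0" for c
	proof -
		have "finite (P `` {c})" by (rule finite_subset[OF _ sG(2)]) (use P in \<open>auto simp: eqrel_def\<close>)
		moreover have "sym P" "trans P" using P by (auto simp: eqrel_def)
		then have "(c, opp G e1) : P \<longleftrightarrow> (c, opp G e2) : P"
			using pp symD[of P "opp G e1" "opp G e2"] transD[of P c "opp G e1" "opp G e2"] transD[of P c "opp G e2" "opp G e1"] by blast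
		ultimately show ?thesis unfolding k_def sum.distrib by (auto simp: of_bool_def)
	qed
	moreover have "k (opp G e1) ~= 0" using op by (simp add: k_def)
	ultimately show False using sG(3) op(1) unfolding bip_forest_def by blast
qed

text \<open>Any failure of injectivity is a pair that can be folded: the forest condition separates
  the termini, and the result is an origami with fewer edges. The last clause says that labels
  descend to the folded graph; it later yields injectivity into the fibre product.\<close>

lemma origami_folds_to_immersion:
	fixes G :: "('v, 'e) sgraph"
	assumes "origami G vl (emap p) P" "graph_morphism G X p" "!!v. v : verts G ==> \<exists>e\<in>edges G. ini G e = v"
	shows "\<exists>K q i. folds G K q & immersion K X i & gmap_eq_on G (gcomp i q) p &
		 graph_homotopy_equivalence G K q & (\<forall>v\<in>verts G. \<forall>w\<in>verts G. vmap q v = vmap q w --> vl v = vl w)"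
	using assms
proof (induction "card (edges G)" arbitrary: G P rule: less_induct)
	case less
	have sG: "sgraph G" "sgraph X" "finite (edges G)" using less.prems unfolding graph_morphism_def origami_def by auto
	show ?case
	proof (cases "immersion G X p")
		case True
		then show ?thesis using sG
			by (intro exI[of _ G] exI[of _ gid] exI[of _ p] conjI folds_refl graph_homotopy_equivalence_gid) (auto simp: gmap_eq_on_def gcomp_def gid_def)
	next
		case False
		then obtain a b where ab: "a : edges G" "b : edges G" "a ~= b" "ini G a = ini G b" "emap p a = emap p b"
			using less.prems(2) unfolding immersion_def inj_on_def lk_def by auto
		have "ter G a ~= ter G b" using origami_ter_distinct[OF less.prems(1) ab] .
		\<comment> \<open>Exchange the two edges if the terminus of the second one is the common initial
		  vertex.\<close>
		then obtain e1 e2 where e: "e1 : edges G" "e2 : edges G" "e1 ~= e2" "ini G e1 = ini G e2" "emap p e1 = emap p e2"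
			"ter G e1 ~= ter G e2" "ini G e1 ~= ter G e2" using ab by metis
		have "e1 ~= opp G e2"
			using less.prems(1) e unfolding origami_def by auto
		then interpret F: good_fold_cov G e1 e2
			by unfold_locales (use sG e less.prems(3) in auto)
		let ?G1 = "fold_graph G e1 e2" and ?b = "fold_gmap G e1 e2"
		have or1: "origami ?G1 vl (emap p) (F.P1 P)" by (rule F.origami_G1[OF less.prems(1) e(5)])
		have pt: "vmap p (ter G e1) = vmap p (ter G e2)" "emap p (opp G e1) = emap p (opp G e2)"
			using less.prems(2) e(1,2,5) F.opp_facts(1,2) unfolding graph_morphism_def ter_def by metis+
		have mor1: "graph_morphism ?G1 X p"
			using less.prems(2) F.sgraph_G1 pt(1) unfolding graph_morphism_def by auto
		have cov1: "\<exists>f\<in>edges ?G1. ini ?G1 f = v" if v: "v : verts ?G1" for v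
		proof -
			obtain f where f: "f : edges G" "ini G f = v" using v less.prems(3)[of v] by auto
			have "emap ?b f : edges ?G1" "ini ?G1 (emap ?b f) = vmap ?b v" using F.mor_q f unfolding graph_morphism_def by auto
			then show ?thesis using F.q_emap(3)[of v] v by auto
		qed
		have "card (edges ?G1) < card (edges G)" by (rule psubset_card_mono) (use sG e in auto)
		from less.hyps[OF this or1 mor1 cov1] obtain K q i where K: "folds ?G1 K q" "immersion K X i" "gmap_eq_on ?G1 (gcomp i q) p"
			"graph_homotopy_equivalence ?G1 K q" "\<forall>v\<in>verts ?G1. \<forall>w\<in>verts ?G1. vmap q v = vmap q w --> vl v = vl w" by blast
		have vlt: "vl (ter G e1) = vl (ter G e2)" by (rule F.vl_ter[OF less.prems(1) e(5)])
		have bV: "v : verts G ==> vmap ?b v : verts ?G1" "f : edges G ==> emap ?b f : edges ?G1" for v f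
			using F.mor_q unfolding graph_morphism_def by auto
		have bp: "vmap p (vmap ?b v) = vmap p v" "emap p (emap ?b f) = emap p f" "vl (vmap ?b v) = vl v" for v f
			using pt e(5) vlt by (auto simp: fold_gmap_def)
		show ?thesis
		proof (intro exI conjI)
			show "folds G K (gcomp q ?b)" by (rule folds_step[OF F.fold_map_q K(1)])
			show "immersion K X i" by fact
			show "gmap_eq_on G (gcomp i (gcomp q ?b)) p"
				using K(3) bV bp by (auto simp: gmap_eq_on_def gcomp_def)
			show "graph_homotopy_equivalence G K (gcomp q ?b)"
				by (rule graph_homotopy_equivalence_gcomp[OF F.homotopy_equivalence_q K(4)])
			show "\<forall>v\<in>verts G. \<forall>w\<in>verts G. vmap (gcomp q ?b) v = vmap (gcomp q ?b) w --> vl v = vl w"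
			proof (intro ballI impI)
				fix v w assume "v : verts G" "w : verts G" "vmap (gcomp q ?b) v = vmap (gcomp q ?b) w"
				then show "vl v = vl w" using K(5)[rule_format, OF bV(1)[of v] bV(1)[of w]] bp(3) by (simp add: gcomp_def)
			qed
		qed
	qed
qed

section \<open>Circles and darts\<close>

definition flip :: "('u, 'd) sgraph => 'd => 'd" where
	"flip S d = (THE d'. d' : edges S & d' ~= d & ini S d' = ini S d)"

lemma flip_unique:
	assumes "circles S" "d : edges S"
	shows "\<exists>!d'. d' : edges S & d' ~= d & ini S d' = ini S d"
proof -
	have "card (lk S (ini S d)) = 2" using assms unfolding circles_def sgraph_def by blast
	then obtain x y where xy: "lk S (ini S d) = {x, y}" "x ~= y" by (meson card_2_iff)
	have "d : lk S (ini S d)" using assms by (simp add: lk_def)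
	then have "(d' : edges S & d' ~= d & ini S d' = ini S d) \<longleftrightarrow> d' = (if d = x then y else x)" for d'
		using xy unfolding lk_def by auto
	then show ?thesis by auto
qed

lemma flip:
	assumes "circles S" "d : edges S"
	shows "flip S d : edges S" "flip S d ~= d" "ini S (flip S d) = ini S d"
		"!!d'. d' : edges S ==> ini S d' = ini S d ==> d' = d \<or> d' = flip S d"
	using theI'[OF flip_unique[OF assms]] flip_unique[OF assms] unfolding flip_def[symmetric] by blast+

lemma flip_flip: "circles S ==> d : edges S ==> flip S (flip S d) = d"
	using flip[of S d] flip[of S "flip S d"] by metis

definition dart_step :: "('u, 'd) sgraph => ('d \<times> 'd) set" where
	"dart_step S = {(d, opp S d) | d. d : edges S} \<union> {(d, flip S d) | d. d : edges S}"

text \<open>The number of darts of the circle through \<open>d\<close>, hence twice its number of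
  vertices. The weights \<open>1 / circ_len S d\<close> over the darts of one circle add up to 1,
  which spreads the unit area of a face evenly over its darts.\<close>

definition circ_len :: "('u, 'd) sgraph => 'd => nat" where
	"circ_len S d = card {d'. (d, d') : (dart_step S)\<^sup>*}"

lemma circles_opp:
	assumes "circles S" "d : edges S"
	shows "opp S d : edges S" "opp S (opp S d) = d" "opp S d ~= d" "ini S d : verts S"
	using assms unfolding circles_def sgraph_def by auto

lemma dart_step_edges: "circles S ==> d : edges S ==> (d, d') : (dart_step S)\<^sup>* ==> d' : edges S"
	by (rotate_tac 2, induction rule: rtrancl_induct) (auto simp: dart_step_def flip(1) circles_opp(1))

lemma dart_step_sym:
	assumes "circles S" "(d, d') : (dart_step S)\<^sup>*"
	shows "(d', d) : (dart_step S)\<^sup>*"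
proof -
	have "sym (dart_step S)"
	proof (rule symI)
		fix a b assume "(a, b) : dart_step S"
		then have "a : edges S" "b = opp S a \<or> b = flip S a" unfolding dart_step_def by auto
		then show "(b, a) : dart_step S"
			using assms(1) circles_opp[of S a] flip[of S a] flip_flip[of S a] unfolding dart_step_def by (auto intro: sym)
	qed
	then show ?thesis using assms(2) sym_rtrancl symD by metis
qed

lemma circ_len_cong:
	assumes "circles S" "(d, d') : (dart_step S)\<^sup>*"
	shows "circ_len S d = circ_len S d'"
proof -
	have "{x. (d, x) : (dart_step S)\<^sup>*} = {x. (d', x) : (dart_step S)\<^sup>*}"
		using assms dart_step_sym[OF assms] by (auto intro: rtrancl_trans)
	then show ?thesis by (simp add: circ_len_def)
qed

lemma reach_darts:
	assumes S: "circles S" and d: "d : edges S" "d' : edges S" and r: "(ini S d, ini S d') : reach S"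
	shows "(d, d') : (dart_step S)\<^sup>*"
proof -
	have *: "(d, x) : (dart_step S)\<^sup>*" if "(ini S d, v) : {(ini S e, ter S e) | e. e : edges S}\<^sup>*" "x : edges S" "ini S x = v" for v x
		using that
	proof (induction arbitrary: x rule: rtrancl_induct)
		case base
		then have "x = d \<or> x = flip S d" using flip(4)[OF S d(1)] by auto
		then show ?case using d(1) unfolding dart_step_def by auto
	next
		case (step y z)
		then obtain e where e: "e : edges S" "y = ini S e" "z = ter S e" by auto
		have "(d, e) : (dart_step S)\<^sup>*" using step.IH[of e] e by simp
		moreover have "(e, opp S e) : dart_step S" using e unfolding dart_step_def by auto
		moreover have "x = opp S e \<or> x = flip S (opp S e)"
			using flip(4)[OF S circles_opp(1)[OF S e(1)] step.prems(1)] step.prems(2) e by (simp add: ter_def)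
		then have "(opp S e, x) : (dart_step S)\<^sup>*" using circles_opp(1)[OF S e(1)] unfolding dart_step_def by auto
		ultimately show ?case by (meson rtrancl.rtrancl_into_rtrancl rtrancl_trans)
	qed
	show ?thesis using *[of "ini S d'" d'] r d unfolding reach_def by auto
qed

lemma darts_reach:
	assumes S: "circles S" and d: "d : edges S" and r: "(d, d') : (dart_step S)\<^sup>*"
	shows "(ini S d, ini S d') : reach S"
proof -
	have "(ini S d, ini S d') : {(ini S e, ter S e) | e. e : edges S}\<^sup>*"
		using r
	proof (induction rule: rtrancl_induct)
		case (step y z)
		then have y: "y : edges S" "z = opp S y \<or> z = flip S y" unfolding dart_step_def by auto
		then show ?case
		proof (elim disjE)
			assume "z = opp S y"
			then have "(ini S y, ini S z) : {(ini S e, ter S e) | e. e : edges S}" using y by (auto simp: ter_def)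
			then show ?thesis using step.IH by (rule rtrancl_into_rtrancl[rotated])
		next
			assume "z = flip S y" then show ?thesis using step.IH flip(3)[OF S y(1)] by simp
		qed
	qed simp
	then show ?thesis using circles_opp(4)[OF S] d dart_step_edges[OF S d r] unfolding reach_def by auto
qed

lemma equiv_reach:
	assumes "sgraph G"
	shows "equiv (verts G) (reach G)"
proof -
	have "sym {(ini G e, ter G e) | e. e : edges G}"
		using assms unfolding sym_def ter_def sgraph_def by force
	then have "sym ({(ini G e, ter G e) | e. e : edges G}\<^sup>*)" by (rule sym_rtrancl)
	then show ?thesis unfolding equiv_def reach_def refl_on_def
		by (auto simp: sym_def trans_def intro: rtrancl_trans)
qed

definition nclass :: "'a set => ('a \<times> 'a) set => nat" where
	"nclass A R = card ((%d. R `` {d}) ` A)"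

lemma nclass_kernel:
	assumes "!!a b. a : A ==> (a, b) : R \<longleftrightarrow> b : A & f a = f b"
	shows "nclass A R = card (f ` A)"
proof -
	have "bij_betw (%C. f (SOME a. a : C)) ((%d. R `` {d}) ` A) (f ` A)"
	proof -
		have R: "R `` {a} = {b : A. f a = f b}" if "a : A" for a using assms that by auto
		have s: "f (SOME x. x : R `` {a}) = f a" if "a : A" for a
		proof -
			have "(SOME x. x : R `` {a}) : R `` {a}" by (rule someI[of _ a]) (use R[OF that] that in auto)
			then show ?thesis using R[OF that] by auto
		qed
		show ?thesis
			unfolding bij_betw_def
		proof
			show "inj_on (%C. f (SOME a. a : C)) ((%d. R `` {d}) ` A)"
				by (rule inj_onI) (use s R in auto)
			show "(%C. f (SOME a. a : C)) ` (%d. R `` {d}) ` A = f ` A" using s by (force simp: image_iff)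
		qed
	qed
	then show ?thesis unfolding nclass_def by (rule bij_betw_same_card)
qed

lemma card_geometric_edges:
	assumes "sgraph G" "finite (edges G)"
	shows "card (edges G) = 2 * card ((%e. {e, opp G e}) ` edges G)"
proof -
	let ?C = "(%e. {e, opp G e}) ` edges G"
	have "card (\<Union> ?C) = sum card ?C"
	proof (rule card_Union_disjoint)
		show "pairwise disjnt ?C"
			unfolding pairwise_def disjnt_def
		proof (intro ballI impI)
			fix A B assume "A : ?C" "B : ?C" "A ~= B"
			then obtain a b where ab: "a : edges G" "b : edges G" "A = {a, opp G a}" "B = {b, opp G b}" by auto
			have oo: "opp G (opp G a) = a" "opp G (opp G b) = b" using ab assms unfolding sgraph_def by blast+
			show "A \<inter> B = {}"
			proof (rule ccontr)
				assume "A \<inter> B ~= {}"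
				then have "a = b \<or> a = opp G b \<or> opp G a = b \<or> opp G a = opp G b" unfolding ab(3,4) by blast
				then have "A = B" unfolding ab(3,4) using oo by (metis insert_commute)
				then show False using \<open>A ~= B\<close> by blast
			qed
		qed
	qed auto
	moreover have "\<Union> ?C = edges G" using assms unfolding sgraph_def by auto
	moreover have "sum card ?C = (\<Sum>C\<in>?C. 2)"
		by (rule sum.cong) (use assms in \<open>auto simp: sgraph_def card_insert_if\<close>)
	ultimately show ?thesis by (simp add: mult.commute)
qed

lemma euler_char_half:
	assumes "sgraph G" "finite (edges G)"
	shows "real_of_int (euler_char G) = real (card (verts G)) - real (card (edges G)) / 2"
	using card_geometric_edges[OF assms] by (simp add: euler_char_def)

lemma immersion_flip:
	assumes s: "immersion S T s" and C: "circles S" "circles T" and d: "d : edges S"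
	shows "emap s (flip S d) = flip T (emap s d)"
proof -
	have m: "emap s d : edges T" "emap s (flip S d) : edges T" "ini T (emap s (flip S d)) = ini T (emap s d)"
		using s d flip[OF C(1) d] unfolding immersion_def graph_morphism_def by auto
	have "emap s (flip S d) ~= emap s d"
		using s d flip[OF C(1) d] circles_opp(4)[OF C(1) d] unfolding immersion_def inj_on_def lk_def by auto
	then show ?thesis using flip(4)[OF C(2) m(1,2,3)] by auto
qed

text \<open>The number \<open>n\<close> of darts of \<open>f\<close> above a dart of the image
  circle is invariant under \<open>opp\<close> and \<open>flip\<close>, hence constant along the
  circle and equal to the degree. Each dart upstairs thus carries the share 1 / length.\<close>

lemma cover_degree_sum:
	assumes s: "immersion S T s" and C: "circles S" "circles T" and fin: "finite (edges S)" "finite (edges T)"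
		and f: "f : graph_components S"
	shows "real (cover_degree s f) = (\<Sum>d | d : edges S & ini S d : f. 1 / real (circ_len T (emap s d)))"
proof -
	have sg: "sgraph S" using C unfolding circles_def by blast
	have mor: "graph_morphism S T s" using s unfolding immersion_def by blast
	have eq: "equiv (verts S) (reach S)" by (rule equiv_reach[OF sg])
	define F where "F = {d. d : edges S & ini S d : f}"
	define n where "n d = card {x : F. emap s x = d}" for d
	define u where "u = (SOME u. u : f)"
	have "f ~= {}" using f eq unfolding graph_components_def by (metis in_quotient_imp_non_empty)
	then have u: "u : f" unfolding u_def by (simp add: some_in_eq)
	have fV: "f \<subseteq> verts S" using f eq unfolding graph_components_def by (rule in_quotient_imp_subset[rotated])
	have "card (lk S u) = 2" using C u fV unfolding circles_def by blast
	then obtain d1 where d1: "d1 : edges S" "ini S d1 = u" unfolding lk_def by (metis (mono_tags, lifting) card.empty empty_Collect_eq zero_neq_numeral)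
	define K where "K = {d. (emap s d1, d) : (dart_step T)\<^sup>*}"
	have sE: "emap s d : edges T" "emap s (opp S d) = opp T (emap s d)" "ini T (emap s d) = vmap s (ini S d)" if "d : edges S" for d
		using mor that unfolding graph_morphism_def by auto
	have KE: "K \<subseteq> edges T" unfolding K_def using dart_step_edges[OF C(2) sE(1)[OF d1(1)]] by auto
	have Fin: "finite F" "finite K" using fin KE unfolding F_def by (auto intro: finite_subset)
	obtain w where w: "f = reach S `` {w}" using f unfolding graph_components_def by (rule quotientE)
	then have "(w, u) : reach S" using u by simp
	then have "f = reach S `` {u}" using equiv_class_eq[OF eq] w by simp
	then have Ff: "ini S d : f \<longleftrightarrow> (u, ini S d) : reach S" for d by simp
	have FK: "emap s d : K" if "d : F" for d
	proof -
		have "(d1, d) : (dart_step S)\<^sup>*" using reach_darts[OF C(1) d1(1)] that d1 Ff unfolding F_def by auto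
		then have "(emap s d1, emap s d) : (dart_step T)\<^sup>*"
		proof (induction rule: rtrancl_induct)
			case (step y z)
			then have "y : edges S" "z = opp S y \<or> z = flip S y" unfolding dart_step_def by auto
			then have "(emap s y, emap s z) : dart_step T"
				using sE immersion_flip[OF s C] unfolding dart_step_def by auto
			then show ?case using step.IH by (rule rtrancl_into_rtrancl[rotated])
		qed simp
		then show ?thesis unfolding K_def by simp
	qed
	have Fop: "opp S d : F" "flip S d : F" if "d : F" for d
	proof -
		have d: "d : edges S" "(u, ini S d) : reach S" using that Ff unfolding F_def by auto
		have "(ini S d, ini S (opp S d)) : reach S"
			by (rule darts_reach[OF C(1) d(1)]) (use d in \<open>auto simp: dart_step_def\<close>)
		then have "(u, ini S (opp S d)) : reach S" using d(2) eq unfolding equiv_def by (meson transD)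
		then show "opp S d : F" using Ff circles_opp(1)[OF C(1) d(1)] unfolding F_def by auto
		show "flip S d : F" using that flip[OF C(1) d(1)] unfolding F_def by auto
	qed
	have FE: "x : F ==> x : edges S" for x unfolding F_def by simp
	have A: "opp S (opp S x) = x" "emap s (opp S x) = opp T (emap s x)" "flip S (flip S x) = x" "emap s (flip S x) = flip T (emap s x)" if "x : F" for x
		using circles_opp(2)[OF C(1) FE[OF that]] sE(2)[OF FE[OF that]] flip_flip[OF C(1) FE[OF that]] immersion_flip[OF s C FE[OF that]] by simp_all
	have n1: "n (opp T d) = n d" if "d : edges T" for d
	proof -
		have "bij_betw (opp S) {x : F. emap s x = d} {x : F. emap s x = opp T d}"
			by (rule bij_betw_byWitness[where f' = "opp S"])
				(auto simp: Fop A circles_opp(2)[OF C(2) that])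
		from bij_betw_same_card[OF this] show ?thesis unfolding n_def by simp
	qed
	have n2: "n (flip T d) = n d" if "d : edges T" for d
	proof -
		have "bij_betw (flip S) {x : F. emap s x = d} {x : F. emap s x = flip T d}"
			by (rule bij_betw_byWitness[where f' = "flip S"])
				(auto simp: Fop A flip_flip[OF C(2) that])
		from bij_betw_same_card[OF this] show ?thesis unfolding n_def by simp
	qed
	have nK: "n d = n (emap s d1)" if "d : K" for d
		using that unfolding K_def mem_Collect_eq
	proof (induction rule: rtrancl_induct)
		case (step y z)
		then have "y : edges T" "z = opp T y \<or> z = flip T y" unfolding dart_step_def by auto
		then show ?case using n1 n2 step.IH by auto
	qed simp
	have "cover_degree s f = n (emap s d1)"
	proof -
		have "bij_betw (ini S) {x : F. emap s x = emap s d1} {v : f. vmap s v = vmap s u}"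
			unfolding bij_betw_def
		proof
			show "inj_on (ini S) {x : F. emap s x = emap s d1}"
			proof (rule inj_onI)
				fix x y assume "x : {x : F. emap s x = emap s d1}" "y : {x : F. emap s x = emap s d1}" "ini S x = ini S y"
				then show "x = y" using s circles_opp(4)[OF C(1), of x] unfolding immersion_def inj_on_def lk_def F_def by auto
			qed
			show "ini S ` {x : F. emap s x = emap s d1} = {v : f. vmap s v = vmap s u}"
			proof
				show "ini S ` {x : F. emap s x = emap s d1} \<subseteq> {v : f. vmap s v = vmap s u}"
				proof clarify
					fix x assume x: "x : F" "emap s x = emap s d1"
					then have "vmap s (ini S x) = vmap s (ini S d1)" using sE(3)[of x] sE(3)[of d1] d1 unfolding F_def by auto
					then show "ini S x : f & vmap s (ini S x) = vmap s u" using x d1 unfolding F_def by auto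
				qed
				show "{v : f. vmap s v = vmap s u} \<subseteq> ini S ` {x : F. emap s x = emap s d1}"
				proof clarify
					fix v assume v: "v : f" "vmap s v = vmap s u"
					then have "card (lk S v) = 2" using C fV unfolding circles_def by blast
					then obtain x where x: "x : edges S" "ini S x = v" unfolding lk_def by (metis (mono_tags, lifting) card.empty empty_Collect_eq zero_neq_numeral)
					have "ini T (emap s x) = ini T (emap s d1)" using sE x d1 v by auto
					\<comment> \<open>Two darts start at \<open>v\<close>; one of them lies above
					  \<open>d1\<close>'s image, since their images are flips of each other. This matches vertices
					  above a vertex with darts above a dart.\<close>
					then have "emap s x = emap s d1 \<or> emap s x = flip T (emap s d1)"
						using flip(4)[OF C(2) sE(1)[OF d1(1)] sE(1)[OF x(1)]] by auto
					then have "emap s x = emap s d1 \<or> emap s (flip S x) = emap s d1"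
						using immersion_flip[OF s C x(1)] flip_flip[OF C(2) sE(1)[OF d1(1)]] by auto
					then show "v : ini S ` {x : F. emap s x = emap s d1}"
						using x v flip[OF C(1) x(1)] unfolding F_def by (auto simp: image_iff)
				qed
			qed
		qed
		from bij_betw_same_card[OF this] show ?thesis unfolding n_def cover_degree_def u_def[symmetric] by simp
	qed
	moreover have "card F = n (emap s d1) * card K"
	proof -
		have "card F = (\<Sum>d\<in>K. card {x : F. emap s x = d})"
			using sum.group[OF Fin, of "emap s" "%_. 1 :: nat"] FK by (simp add: image_subset_iff)
		also have "\<dots> = (\<Sum>d\<in>K. n (emap s d1))" using nK unfolding n_def by (intro sum.cong) auto
		finally show ?thesis by simp
	qed
	moreover have "circ_len T (emap s d) = card K" if "d : F" for d
		using circ_len_cong[OF C(2), of "emap s d1" "emap s d"] FK[OF that] unfolding K_def circ_len_def by simp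
	moreover have "card K ~= 0" using Fin(2) unfolding K_def by auto
	ultimately show ?thesis unfolding F_def[symmetric] by simp
qed

section \<open>Blocks of darts\<close>

text \<open>Reading for a complex Y over X: \<open>Q\<close> relates darts over the same edge of Y,
  \<open>P\<close> darts whose edges share an origami class, \<open>N\<close> darts whose opposite
  edges do. Since a dart of Y is determined by its label and its image in X, these relations can be
  carried by darts of X.\<close>

definition flip_rel :: "('d => 'd) => 'd set => ('d \<times> 'd) set" where
	"flip_rel fl A = {(x, fl x) | x. x : A}"

text \<open>Darts over one edge start at one vertex, and so do a dart and its flip. When links are
  connected the classes are precisely the vertices of Y; connectedness is thus built into this
  relation and has no clause in \<open>dart_block\<close>.\<close>

definition vrel :: "('d => 'd) => 'd set => ('d \<times> 'd) set => ('d \<times> 'd) set" where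
	"vrel fl A Q = (Q \<union> flip_rel fl A)\<^sup>*"

definition near_rel :: "('d => 'd) => ('d => 'x) => 'd set => ('d \<times> 'd) set => ('d \<times> 'd) set => 'd => ('d \<times> 'd) set" where
	"near_rel fl W A Q P d = (Q \<union> flip_rel fl A \<union> {(a, b). (a, b) : P & W a ~= W d})\<^sup>*"

text \<open>Connectivity in the link after deleting the vertex represented by the class of
  \<open>c\<close>: a link edge survives if neither of its ends is that vertex.\<close>

definition cut_rel :: "('d => 'd) => 'd set => ('d \<times> 'd) set => 'd => ('d \<times> 'd) set" where
	"cut_rel fl A Q c = (Q \<union> {(x, fl x) | x. x : A & (c, x) \<notin> Q & (c, fl x) \<notin> Q})\<^sup>*"

text \<open>The clause after closure under \<open>fl\<close> is valence at least 2 in the links;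
  next come the nearness condition and the forest condition of an origami; the last clause excludes
  cut vertices. In the forest condition a set \<open>B\<close> of darts represents the chain whose
  coefficient on a class of \<open>Q\<close> is the parity of \<open>B\<close> there.\<close>

definition dart_block ::
	"('d => 'd) => ('d => 'x) => 'd set => ('d \<times> 'd) set => ('d \<times> 'd) set => ('d \<times> 'd) set => bool" where
	"dart_block fl W A Q P N \<longleftrightarrow> finite A & eqrel A Q & eqrel A P & eqrel A N & Q \<subseteq> P & Q \<subseteq> N &
		 (\<forall>(a, b)\<in>P \<union> N. W a = W b) & (\<forall>d\<in>A. fl d : A) & (\<forall>d\<in>A. \<exists>d'. d' ~= d & (d, d') : Q) &
		 (\<forall>d\<in>A. \<forall>d'\<in>A. W d = W d' --> (d, d') : near_rel fl W A Q P d --> (d, d') : N) &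
		 (\<forall>B\<subseteq>A. (\<forall>d\<in>A. even (card (B \<inter> vrel fl A Q `` {d}))) --> (\<forall>d\<in>A. even (card (B \<inter> P `` {d}))) -->
				(\<forall>d\<in>A. even (card (B \<inter> Q `` {d})))) &
		 (\<forall>c\<in>A. \<forall>a\<in>A. \<forall>b\<in>A. (c, a) : vrel fl A Q --> (c, b) : vrel fl A Q --> (c, a) \<notin> Q --> (c, b) \<notin> Q -->
				(a, b) : cut_rel fl A Q c)"

lemma dart_blockD:
	assumes "dart_block fl W A Q P N"
	shows "finite A" "eqrel A Q" "eqrel A P" "eqrel A N" "Q \<subseteq> P" "Q \<subseteq> N" "\<forall>(a, b)\<in>P \<union> N. W a = W b"
		"\<forall>d\<in>A. fl d : A" "\<forall>d\<in>A. \<exists>d'. d' ~= d & (d, d') : Q"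
		"\<forall>d\<in>A. \<forall>d'\<in>A. W d = W d' --> (d, d') : near_rel fl W A Q P d --> (d, d') : N"
		"\<forall>B\<subseteq>A. (\<forall>d\<in>A. even (card (B \<inter> vrel fl A Q `` {d}))) --> (\<forall>d\<in>A. even (card (B \<inter> P `` {d}))) -->
				(\<forall>d\<in>A. even (card (B \<inter> Q `` {d})))"
		"\<forall>c\<in>A. \<forall>a\<in>A. \<forall>b\<in>A. (c, a) : vrel fl A Q --> (c, b) : vrel fl A Q --> (c, a) \<notin> Q --> (c, b) \<notin> Q -->
				(a, b) : cut_rel fl A Q c"
	using assms unfolding dart_block_def by - (elim conjE, assumption)+

lemma eqrelD:
	assumes "eqrel A R"
	shows "R \<subseteq> A \<times> A" "\<forall>a\<in>A. (a, a) : R" "sym R" "trans R"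
	using assms unfolding eqrel_def by - (elim conjE, assumption)+

lemma two_le_card:
	assumes "2 \<le> card S"
	obtains x y where "x : S" "y : S" "x ~= y"
proof -
	obtain T where "T \<subseteq> S" "card T = 2" using obtain_subset_with_card_n[OF assms] by blast
	then show ?thesis using that unfolding card_2_iff by blast
qed

section \<open>Transport of blocks along injections\<close>

lemma rel_image_iff:
	assumes "inj_on s A" "R \<subseteq> A \<times> A" "x : A" "y : A"
	shows "(s x, s y) : map_prod s s ` R \<longleftrightarrow> (x, y) : R"
proof
	assume "(s x, s y) : map_prod s s ` R"
	then obtain u v where uv: "(u, v) : R" "s u = s x" "s v = s y" by auto
	then have "u = x" "v = y" using assms by (auto intro: inj_onD[OF assms(1)])
	then show "(x, y) : R" using uv by simp
qed force

lemma rel_image_Image: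
	assumes "inj_on s A" "R \<subseteq> A \<times> A" "x : A"
	shows "(map_prod s s ` R) `` {s x} = s ` (R `` {x})"
proof (intro set_eqI iffI)
	fix z assume z: "z : (map_prod s s ` R) `` {s x}"
	then obtain u v where "(u, v) : R" "z = s v" by auto
	then have "v : A" "z = s v" using assms(2) by auto
	then show "z : s ` (R `` {x})" using z rel_image_iff[OF assms, of v] by auto
qed force

lemma rtrancl_image_iff:
	assumes "inj_on s A" "R \<subseteq> A \<times> A" "x : A" "y : A"
	shows "(s x, s y) : (map_prod s s ` R)\<^sup>* \<longleftrightarrow> (x, y) : R\<^sup>*"
proof
	have "\<exists>z'\<in>A. z = s z' & (x, z') : R\<^sup>*" if "(s x, z) : (map_prod s s ` R)\<^sup>*" for z
		using that
	proof (induction rule: rtrancl_induct)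
		case base show ?case using assms(3) by auto
	next
		case (step a b)
		then obtain a' where a: "a' : A" "a = s a'" "(x, a') : R\<^sup>*" by auto
		from step(2) obtain u v where uv: "(u, v) : R" "a = s u" "b = s v" by auto
		then have "u = a'" "v : A" using a assms(1,2) by (auto simp: inj_on_def)
		then have "(x, v) : R\<^sup>*" using uv(1) a(3) by (auto intro: rtrancl_into_rtrancl)
		then show ?case using uv(3) \<open>v : A\<close> by blast
	qed
	note * = this
	show "(x, y) : R\<^sup>*" if "(s x, s y) : (map_prod s s ` R)\<^sup>*"
		using *[OF that] inj_onD[OF assms(1), of y] assms(4) by auto
	show "(s x, s y) : (map_prod s s ` R)\<^sup>*" if "(x, y) : R\<^sup>*"
		using that
	proof (induction rule: rtrancl_induct)
		case (step a b)
		then have "(s a, s b) : map_prod s s ` R" by force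
		then show ?case using step.IH by (rule rtrancl_into_rtrancl[rotated])
	qed simp
qed

lemma rtrancl_Image_subset: "R \<subseteq> A \<times> A ==> x : A ==> R\<^sup>* `` {x} \<subseteq> A"
proof
	fix y assume "R \<subseteq> A \<times> A" "x : A" "y : R\<^sup>* `` {x}"
	then have "(x, y) : R\<^sup>*" by simp
	then show "y : A" using \<open>x : A\<close> \<open>R \<subseteq> A \<times> A\<close> by (induction rule: rtrancl_induct) auto
qed

lemma rtrancl_image_Image:
	assumes "inj_on s A" "R \<subseteq> A \<times> A" "x : A"
	shows "(map_prod s s ` R)\<^sup>* `` {s x} = s ` (R\<^sup>* `` {x})"
proof
	have sub: "map_prod s s ` R \<subseteq> s ` A \<times> s ` A" using assms(2) by auto
	show "(map_prod s s ` R)\<^sup>* `` {s x} \<subseteq> s ` (R\<^sup>* `` {x})"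
	proof
		fix z assume z: "z : (map_prod s s ` R)\<^sup>* `` {s x}"
		then have "z : s ` A" using rtrancl_Image_subset[OF sub, of "s x"] assms(3) by auto
		then obtain y where "y : A" "z = s y" by auto
		then show "z : s ` (R\<^sup>* `` {x})" using z rtrancl_image_iff[OF assms, of y] by auto
	qed
	show "s ` (R\<^sup>* `` {x}) \<subseteq> (map_prod s s ` R)\<^sup>* `` {s x}"
	proof
		fix z assume "z : s ` (R\<^sup>* `` {x})"
		then obtain y where "(x, y) : R\<^sup>*" "z = s y" by auto
		then show "z : (map_prod s s ` R)\<^sup>* `` {s x}"
			using rtrancl_image_iff[OF assms, of y] rtrancl_Image_subset[OF assms(2,3)] by auto
	qed
qed

lemma eqrel_image:
	assumes "inj_on s A" "eqrel A R"
	shows "eqrel (s ` A) (map_prod s s ` R)"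
	unfolding eqrel_def
proof (intro conjI)
	have R: "R \<subseteq> A \<times> A" "\<forall>a\<in>A. (a, a) : R" "sym R" "trans R" using assms(2) unfolding eqrel_def by auto
	show "map_prod s s ` R \<subseteq> s ` A \<times> s ` A" using R(1) by auto
	show "\<forall>a\<in>s ` A. (a, a) : map_prod s s ` R" using R(2) rel_image_iff[OF assms(1) R(1)] by auto
	show "sym (map_prod s s ` R)"
	proof (rule symI)
		fix a b assume "(a, b) : map_prod s s ` R"
		then obtain x y where "(x, y) : R" "a = s x" "b = s y" by auto
		then show "(b, a) : map_prod s s ` R" using symD[OF R(3)] by force
	qed
	show "trans (map_prod s s ` R)"
	proof (rule transI)
		fix a b c assume "(a, b) : map_prod s s ` R" "(b, c) : map_prod s s ` R"
		then obtain x y y' z where h: "(x, y) : R" "a = s x" "b = s y" "(y', z) : R" "b = s y'" "c = s z" by auto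
		then have "y = y'" using R(1) assms(1) by (auto simp: inj_on_def)
		then have "(x, z) : R" using h transD[OF R(4)] by blast
		then show "(a, c) : map_prod s s ` R" using h by force
	qed
qed

lemma nclass_image:
	assumes "inj_on s A" "!!x. x : A ==> R `` {x} \<subseteq> A" "!!x. x : A ==> R' `` {s x} = s ` (R `` {x})"
	shows "nclass (s ` A) R' = nclass A R"
proof -
	have "(%d. R' `` {d}) ` s ` A = (%C. s ` C) ` (%d. R `` {d}) ` A"
		unfolding image_image using assms(3) by (intro image_cong) auto
	moreover have "inj_on (%C. s ` C) ((%d. R `` {d}) ` A)"
		by (rule inj_on_subset[OF inj_on_image_Pow[OF assms(1)]]) (use assms(2) in auto)
	ultimately show ?thesis unfolding nclass_def by (simp add: card_image)
qed

text \<open>Used in both directions: to push the darts of Y with one label into X, and to copy a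
  block of X into a complex under construction.\<close>

locale dart_transport =
	fixes fl :: "'d => 'd" and W :: "'d => 'x" and A Q P N and s :: "'d => 'c" and fl' W'
	assumes blk: "dart_block fl W A Q P N" and inj: "inj_on s A"
		and fl': "!!d. d : A ==> fl' (s d) = s (fl d)" and W': "!!d. d : A ==> W' (s d) = W d"
begin

abbreviation "im \<equiv> %R. map_prod s s ` R"

lemma sub: "Q \<subseteq> A \<times> A" "P \<subseteq> A \<times> A" "N \<subseteq> A \<times> A" "flip_rel fl A \<subseteq> A \<times> A" "Q \<union> flip_rel fl A \<subseteq> A \<times> A"
proof -
	note b = dart_blockD[OF blk]
	show 1: "Q \<subseteq> A \<times> A" "P \<subseteq> A \<times> A" "N \<subseteq> A \<times> A" using b(2-4) by (auto dest: eqrelD(1))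
	from b(8) show 2: "flip_rel fl A \<subseteq> A \<times> A" by (auto simp: flip_rel_def)
	show "Q \<union> flip_rel fl A \<subseteq> A \<times> A" using 1 2 by simp
qed

lemma flA: "d : A ==> fl d : A" using dart_blockD(8)[OF blk] by blast

lemma flip_rel_image: "flip_rel fl' (s ` A) = im (flip_rel fl A)"
proof -
	have "map_prod s s ` ((%x. (x, fl x)) ` A) = (%x. (x, fl' x)) ` s ` A"
		unfolding image_image by (rule image_cong) (simp_all add: fl')
	then show ?thesis unfolding flip_rel_def by (simp add: Setcompr_eq_image)
qed

lemma vrel_iff: "x : A ==> y : A ==> (s x, s y) : vrel fl' (s ` A) (im Q) \<longleftrightarrow> (x, y) : vrel fl A Q"
	unfolding vrel_def flip_rel_image image_Un[symmetric] by (rule rtrancl_image_iff[OF inj sub(5)])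

lemma vrel_Image: "x : A ==> vrel fl' (s ` A) (im Q) `` {s x} = s ` (vrel fl A Q `` {x})"
	unfolding vrel_def flip_rel_image image_Un[symmetric] by (rule rtrancl_image_Image[OF inj sub(5)])

lemma vrel_sub: "x : A ==> vrel fl A Q `` {x} \<subseteq> A"
	unfolding vrel_def by (rule rtrancl_Image_subset[OF sub(5)])

lemma nclass_vrel: "nclass (s ` A) (vrel fl' (s ` A) (im Q)) = nclass A (vrel fl A Q)"
	by (rule nclass_image[OF inj vrel_sub vrel_Image])

lemma nclass_Q: "nclass (s ` A) (im Q) = nclass A Q"
	by (rule nclass_image[OF inj _ rel_image_Image[OF inj sub(1)]]) (use sub(1) in auto)

lemma near_iff:
	assumes "x : A" "y : A"
	shows "(s x, s y) : near_rel fl' W' (s ` A) (im Q) (im P) (s x) \<longleftrightarrow> (x, y) : near_rel fl W A Q P x"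
proof -
	have "{(a, b). (a, b) : im P & W' a ~= W' (s x)} = im {(a, b). (a, b) : P & W a ~= W x}"
	proof (intro set_eqI iffI)
		fix z assume "z : {(a, b). (a, b) : im P & W' a ~= W' (s x)}"
		then obtain a b where "(a, b) : P" "z = (s a, s b)" "W' (s a) ~= W' (s x)" by auto
		moreover have "a : A" using sub(2) \<open>(a, b) : P\<close> by auto
		ultimately show "z : im {(a, b). (a, b) : P & W a ~= W x}" using W' assms(1) by force
	next
		fix z assume "z : im {(a, b). (a, b) : P & W a ~= W x}"
		then obtain a b where "(a, b) : P" "z = (s a, s b)" "W a ~= W x" by auto
		moreover have "a : A" using sub(2) \<open>(a, b) : P\<close> by auto
		ultimately show "z : {(a, b). (a, b) : im P & W' a ~= W' (s x)}" using W' assms(1) by force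
	qed
	then show ?thesis
		unfolding near_rel_def flip_rel_image
		using rtrancl_image_iff[OF inj _ assms, of "Q \<union> flip_rel fl A \<union> {(a, b). (a, b) : P & W a ~= W x}"] sub
		by (simp add: image_Un) blast
qed

lemma cut_iff:
	assumes "c : A" "x : A" "y : A"
	shows "(s x, s y) : cut_rel fl' (s ` A) (im Q) (s c) \<longleftrightarrow> (x, y) : cut_rel fl A Q c"
proof -
	let ?F = "{(x, fl x) | x. x : A & (c, x) \<notin> Q & (c, fl x) \<notin> Q}"
	have "{(x, fl' x) | x. x : s ` A & (s c, x) \<notin> im Q & (s c, fl' x) \<notin> im Q} = im ?F"
	proof (intro set_eqI iffI)
		fix z assume "z : {(x, fl' x) | x. x : s ` A & (s c, x) \<notin> im Q & (s c, fl' x) \<notin> im Q}"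
		then obtain u where u: "u : A" "z = (s u, fl' (s u))" "(s c, s u) \<notin> im Q" "(s c, fl' (s u)) \<notin> im Q" by auto
		then have "(u, fl u) : ?F" using rel_image_iff[OF inj sub(1) assms(1)] flA[of u] fl'[of u] by auto
		then show "z : im ?F" using u fl'[of u] by (auto intro!: image_eqI[of _ _ "(u, fl u)"])
	next
		fix z assume "z : im ?F"
		then obtain u where u: "u : A" "z = (s u, s (fl u))" "(c, u) \<notin> Q" "(c, fl u) \<notin> Q" by auto
		then show "z : {(x, fl' x) | x. x : s ` A & (s c, x) \<notin> im Q & (s c, fl' x) \<notin> im Q}"
			using rel_image_iff[OF inj sub(1) assms(1)] flA[of u] fl'[of u] by (auto intro!: exI[of _ "s u"])
	qed
	then show ?thesis
		unfolding cut_rel_def using rtrancl_image_iff[OF inj _ assms(2,3), of "Q \<union> ?F"] sub(1) flA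
		by (simp add: image_Un) blast
qed

lemma dart_block_image: "dart_block fl' W' (s ` A) (im Q) (im P) (im N)"
	unfolding dart_block_def
proof (intro conjI)
	note b = dart_blockD[OF blk]
	show "finite (s ` A)" using b(1) by blast
	show "eqrel (s ` A) (im Q)" "eqrel (s ` A) (im P)" "eqrel (s ` A) (im N)" using b(2-4) eqrel_image[OF inj] by blast+
	show "im Q \<subseteq> im P" "im Q \<subseteq> im N" using b(5,6) by blast+
	show "\<forall>(a, b)\<in>im P \<union> im N. W' a = W' b"
	proof clarify
		fix a b' assume "(a, b') : im P \<union> im N"
		then obtain x y where xy: "(x, y) : P \<union> N" "a = s x" "b' = s y" by auto
		then have "x : A" "y : A" "W x = W y" using b(7) sub(2,3) by blast+
		then show "W' a = W' b'" using W' xy by simp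
	qed
	show "\<forall>d\<in>s ` A. fl' d : s ` A" using fl' flA by auto
	show "\<forall>d\<in>s ` A. \<exists>d'. d' ~= d & (d, d') : im Q"
	proof clarify
		fix d assume d: "d : A"
		then obtain d' where d': "d' ~= d" "(d, d') : Q" using b(9) by blast
		then have "s d' ~= s d" using d inj sub(1) by (auto simp: inj_on_def)
		then show "\<exists>d'. d' ~= s d & (s d, d') : im Q" using d' by force
	qed
	show "\<forall>d\<in>s ` A. \<forall>d'\<in>s ` A. W' d = W' d' --> (d, d') : near_rel fl' W' (s ` A) (im Q) (im P) d --> (d, d') : im N"
	proof clarify
		fix d d' assume h: "d : A" "d' : A" "W' (s d) = W' (s d')" "(s d, s d') : near_rel fl' W' (s ` A) (im Q) (im P) (s d)"
		have "(d, d') : near_rel fl W A Q P d" using h near_iff by blast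
		moreover have "W d = W d'" using h(1-3) W' by simp
		ultimately have "(d, d') : N" using b(10) h(1,2) by blast
		then show "(s d, s d') : im N" by force
	qed
	have card: "card (s ` B0 \<inter> s ` C) = card (B0 \<inter> C)" if "B0 \<subseteq> A" "C \<subseteq> A" for B0 C
	proof -
		have "s ` B0 \<inter> s ` C = s ` (B0 \<inter> C)" using inj_on_image_Int[OF inj that] by simp
		then show ?thesis using card_image[OF inj_on_subset[OF inj]] that by (metis inf.coboundedI1)
	qed
	show "\<forall>B\<subseteq>s ` A. (\<forall>d\<in>s ` A. even (card (B \<inter> vrel fl' (s ` A) (im Q) `` {d}))) -->
		 (\<forall>d\<in>s ` A. even (card (B \<inter> im P `` {d}))) --> (\<forall>d\<in>s ` A. even (card (B \<inter> im Q `` {d})))"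
	proof (intro allI impI)
		fix B assume B: "B \<subseteq> s ` A" and V: "\<forall>d\<in>s ` A. even (card (B \<inter> vrel fl' (s ` A) (im Q) `` {d}))"
			and PP: "\<forall>d\<in>s ` A. even (card (B \<inter> im P `` {d}))"
		obtain B0 where B0: "B0 \<subseteq> A" "B = s ` B0" using B by (meson subset_imageE)
		have "even (card (B0 \<inter> vrel fl A Q `` {d}))" if "d : A" for d
			using V that card[OF B0(1) vrel_sub[OF that]] vrel_Image[OF that] B0 by auto
		moreover have "even (card (B0 \<inter> P `` {d}))" if "d : A" for d
		proof -
			have "P `` {d} \<subseteq> A" using sub(2) by auto
			then show ?thesis using PP that card[OF B0(1), of "P `` {d}"] rel_image_Image[OF inj sub(2) that] B0 by auto
		qed
		ultimately have "\<forall>d\<in>A. even (card (B0 \<inter> Q `` {d}))" using b(11) B0(1) by blast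
		then show "\<forall>d\<in>s ` A. even (card (B \<inter> im Q `` {d}))"
		proof (intro ballI)
			fix d assume Q: "\<forall>d\<in>A. even (card (B0 \<inter> Q `` {d}))" and "d : s ` A"
			then obtain x where x: "x : A" "d = s x" by auto
			have "Q `` {x} \<subseteq> A" using sub(1) by auto
			then show "even (card (B \<inter> im Q `` {d}))"
				using Q x card[OF B0(1), of "Q `` {x}"] rel_image_Image[OF inj sub(1) x(1)] B0(2) by simp
		qed
	qed
	show "\<forall>c\<in>s ` A. \<forall>a\<in>s ` A. \<forall>b\<in>s ` A. (c, a) : vrel fl' (s ` A) (im Q) --> (c, b) : vrel fl' (s ` A) (im Q) -->
		 (c, a) \<notin> im Q --> (c, b) \<notin> im Q --> (a, b) : cut_rel fl' (s ` A) (im Q) c"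
	proof clarify
		fix c a b' assume h: "c : A" "a : A" "b' : A" "(s c, s a) : vrel fl' (s ` A) (im Q)" "(s c, s b') : vrel fl' (s ` A) (im Q)"
			"(s c, s a) \<notin> im Q" "(s c, s b') \<notin> im Q"
		have "(c, a) : vrel fl A Q" "(c, b') : vrel fl A Q" "(c, a) \<notin> Q" "(c, b') \<notin> Q"
			using h vrel_iff rel_image_iff[OF inj sub(1)] by blast+
		then have "(a, b') : cut_rel fl A Q c" using b(12) h(1-3) by blast
		then show "(s a, s b') : cut_rel fl' (s ` A) (im Q) (s c)" using cut_iff h by simp
	qed
qed

end

section \<open>Complexes over X with labelled vertices\<close>

locale labelled_complex =
	fixes X :: "('w, 'f, 'x, 'c) two_complex" and Y :: "('v, 'e, 'u, 'd) branched_complex"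
		and p :: "('v, 'e, 'w, 'f) gmap" and s :: "('u, 'd, 'x, 'c) gmap" and vl :: "'v => 'o"
	assumes X: "two_complex X" "finite_complex X" and Y: "two_complex Y" "finite_complex Y"
		and p: "graph_morphism (skel Y) (skel X) p" and s: "immersion (bdry Y) (bdry X) s"
		and comm: "gmap_eq_on (bdry Y) (gcomp p (att Y)) (gcomp (att X) s)"
		\<comment> \<open>The combinatorial form of injectivity into the fibre product with the folded
		  graph. It embeds the darts of each label into the finite set of darts of X.\<close>
		and lift_inj: "!!d d'. d : edges (bdry Y) ==> d' : edges (bdry Y) ==>
			 vl (ini (skel Y) (emap (att Y) d)) = vl (ini (skel Y) (emap (att Y) d')) ==> emap s d = emap s d' ==> d = d'"
		and cov: "!!e. e : edges (skel Y) ==> \<exists>d\<in>edges (bdry Y). emap (att Y) d = e"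
		and covv: "!!v. v : verts (skel Y) ==> \<exists>e\<in>edges (skel Y). ini (skel Y) e = v"
begin

abbreviation "D \<equiv> edges (bdry Y)"
abbreviation "E \<equiv> edges (skel Y)"
abbreviation "w \<equiv> emap (att Y)"
abbreviation "fl \<equiv> flip (bdry Y)"
abbreviation "W d \<equiv> emap p (w d)"
abbreviation "org d \<equiv> ini (skel Y) (w d)"

definition "Dv v = {d : D. vl (org d) = v}"
definition "Qv v = {(d, d'). d : Dv v & d' : Dv v & w d = w d'}"
definition "Pv P v = {(d, d'). d : Dv v & d' : Dv v & (w d, w d') : P}"
definition "Nv P v = {(d, d'). d : Dv v & d' : Dv v & (opp (skel Y) (w d), opp (skel Y) (w d')) : P}"

lemma circY: "circles (bdry Y)" and circX: "circles (bdry X)"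
	using X Y unfolding two_complex_def by auto

lemma sgY: "sgraph (skel Y)" and sgX: "sgraph (skel X)"
	using X Y unfolding two_complex_def by auto

lemma finD: "finite D" "finite E" "finite (verts (skel Y))"
	using Y unfolding finite_complex_def finite_sgraph_def by auto

lemma wE: "d : D ==> w d : E" "d : D ==> w (opp (bdry Y) d) = opp (skel Y) (w d)"
	"d : D ==> org d = vmap (att Y) (ini (bdry Y) d)" "d : D ==> org d : verts (skel Y)"
	using Y sgY unfolding two_complex_def immersion_def graph_morphism_def sgraph_def by auto

lemma flD: assumes "d : D" shows "fl d : D" "fl d ~= d" "fl (fl d) = d" "org (fl d) = org d" "w (fl d) ~= w d"
proof -
	note f = flip[OF circY assms]
	show "fl d : D" "fl d ~= d" using f by auto
	show "fl (fl d) = d" by (rule flip_flip[OF circY assms])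
	show "org (fl d) = org d" using wE(3)[OF assms] wE(3)[OF f(1)] f(3) by simp
	have "inj_on w (lk (bdry Y) (ini (bdry Y) d))"
		using Y circles_opp(4)[OF circY assms] unfolding two_complex_def immersion_def by blast
	moreover have "d : lk (bdry Y) (ini (bdry Y) d)" "fl d : lk (bdry Y) (ini (bdry Y) d)" using assms f by (auto simp: lk_def)
	ultimately show "w (fl d) ~= w d" using f(2) by (auto dest: inj_onD)
qed

lemma DvD: "d : Dv v ==> d : D" "d : Dv v ==> vl (org d) = v" "d : D ==> d : Dv (vl (org d))"
	by (auto simp: Dv_def)

lemma flDv: "d : Dv v ==> fl d : Dv v"
	using flD by (auto simp: Dv_def)

lemma link_simps:
	"verts (link Y y) = lk (skel Y) y" "edges (link Y y) = {d : D. org d = y}"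
	"ini (link Y y) d = w (fl d)" "opp (link Y y) d = fl d"
	unfolding link_def Let_def flip_def[symmetric] using wE(1) by (auto simp: lk_def)

lemma link_ter: "d : D ==> ter (link Y y) d = w d"
	unfolding ter_def link_simps using flD by simp

lemma eqrel_Qv: "eqrel (Dv v) (Qv v)"
	unfolding eqrel_def by (auto simp: Qv_def intro!: symI transI)

lemma eqrel_Pv:
	assumes "eqrel E P" shows "eqrel (Dv v) (Pv P v)" "eqrel (Dv v) (Nv P v)"
proof -
	have o: "d : Dv v ==> w d : E" "d : Dv v ==> opp (skel Y) (w d) : E" for d
		using wE(1)[of d] DvD(1)[of d v] sgY unfolding sgraph_def by blast+
	note P = eqrelD[OF assms]
	show "eqrel (Dv v) (Pv P v)" "eqrel (Dv v) (Nv P v)"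
		unfolding eqrel_def Pv_def Nv_def using o P(2) by (auto intro!: symI transI dest: symD[OF P(3)] transD[OF P(4)])
qed

lemma Qv_at: "(a, b) : Qv v ==> org a = org b" by (auto simp: Qv_def)

lemma vrel_at:
	assumes "a : Dv v" "(a, b) : vrel fl (Dv v) (Qv v)"
	shows "b : Dv v & org a = org b"
	using assms(2) unfolding vrel_def
proof (induction rule: rtrancl_induct)
	case base show ?case using assms(1) by simp
next
	case (step b c)
	then consider "(b, c) : Qv v" | "c = fl b" unfolding flip_rel_def by auto
	then show ?case
	proof cases
		case 1 then show ?thesis using step.IH by (auto simp: Qv_def)
	next
		case 2 then show ?thesis using step.IH flDv[of b v] flD(4)[of b] DvD(1)[of b v] by simp
	qed
qed

definition "conn_links \<longleftrightarrow> (\<forall>v. \<forall>a\<in>Dv v. \<forall>b\<in>Dv v. org a = org b --> (a, b) : vrel fl (Dv v) (Qv v))"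

lemma of_nat_bit: "(of_nat n :: bit) = 0 \<longleftrightarrow> even n"
	by (induction n) auto

text \<open>Link vertices are edges of Y at \<open>y\<close>, link edges are darts crossing from
  \<open>w (fl x)\<close> to \<open>w x\<close>. A path in the link therefore alternates flips with
  changes of dart over one edge. The flag \<open>ct\<close> treats the link with the vertex
  \<open>w c\<close> deleted at the same time.\<close>

lemma link_path:
	assumes irr: "graph_connected L" and L: "L = (if ct then delete_vertex (link Y y) (w c) else link Y y)"
		and ab: "a : D" "b : D" "org a = y" "org b = y" and c: "ct ==> w a ~= w c & w b ~= w c"
		and R: "R = Qv (vl y) \<union> {(x, fl x) | x. x : Dv (vl y) & (ct --> w x ~= w c & w (fl x) ~= w c)}"
	shows "(a, b) : R\<^sup>*"
proof -
	have Lv: "w a : verts L" "w b : verts L" using ab c wE(1) by (auto simp: L link_simps lk_def delete_vertex_def)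
	then have "(w a, w b) : {(ini L e, ter L e) | e. e : edges L}\<^sup>*"
		using irr unfolding graph_connected_def reach_def by blast
	then have path: "(w a, w b) : {(ini L e, ter L e) | e. e : edges L}\<^sup>*" .
	have "\<forall>d\<in>D. org d = y --> w d = e --> (a, d) : R\<^sup>*" if "(w a, e) : {(ini L e, ter L e) | e. e : edges L}\<^sup>*" for e
		using that
	proof (induction rule: rtrancl_induct)
		case base
		have "(a, d) : R" if "d : D" "org d = y" "w d = w a" for d
			using that ab by (auto simp: R Qv_def Dv_def)
		then show ?case by (auto simp: r_into_rtrancl)
	next
		case (step z z')
		then obtain x where x: "x : edges L" "z = ini L x" "z' = ter L x" by auto
		have xD: "x : D" "org x = y" and xc: "ct ==> w x ~= w c & w (fl x) ~= w c"
			using x(1) link_ter[of x] by (auto simp: L delete_vertex_def link_simps split: if_splits)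
		have "ini L x = w (fl x)" "ter L x = w x"
			using link_ter[OF xD(1), of y] by (auto simp: L delete_vertex_def link_simps ter_def)
		then have z: "z = w (fl x)" "z' = w x" using x by auto
		have "(a, fl x) : R\<^sup>*" using step.IH flD[OF xD(1)] xD z by simp
		moreover have "(fl x, x) : R"
		proof -
			have "fl x : Dv (vl y)" using flDv[of x "vl y"] xD by (simp add: Dv_def)
			then show ?thesis using xc flD(3)[OF xD(1)] by (auto simp: R intro!: exI[of _ "fl x"])
		qed
		ultimately have ax: "(a, x) : R\<^sup>*" by (rule rtrancl_into_rtrancl)
		have "(x, d) : R" if "d : D" "org d = y" "w d = w x" for d
			using that xD by (auto simp: R Qv_def Dv_def)
		then show ?case using ax z by (auto intro: rtrancl_into_rtrancl)
	qed
	from this[OF path] ab show ?thesis by blast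
qed

lemma card_class:
	fixes k :: "'e => bit"
	assumes k: "!!e. e : E ==> k e = of_nat (card {d : B. w d = e})" and B: "B \<subseteq> D" and S: "S \<subseteq> E"
	shows "(\<Sum>e\<in>S. k e) = of_nat (card {d : B. w d : S})"
proof -
	have fin: "finite {d : B. w d : S}" "finite S" using B S finD by (auto intro: finite_subset)
	have "(\<Sum>e\<in>S. card {d : {d : B. w d : S}. w d = e}) = card {d : B. w d : S}"
		using sum.group[OF fin, of w "%_. 1 :: nat"] by (simp add: image_subset_iff)
	moreover have "(\<Sum>e\<in>S. k e) = (\<Sum>e\<in>S. of_nat (card {d : {d : B. w d : S}. w d = e}))"
	proof (rule sum.cong[OF refl])
		fix e assume e: "e : S"
		then have "{d : {d : B. w d : S}. w d = e} = {d : B. w d = e}" by auto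
		then show "k e = of_nat (card {d : {d : B. w d : S}. w d = e})" using k[of e] e S by auto
	qed
	ultimately show ?thesis by (simp only: of_nat_sum[symmetric])
qed

lemma vrel_Image_org:
	assumes "conn_links" "a : Dv v"
	shows "vrel fl (Dv v) (Qv v) `` {a} = {b : D. org b = org a}"
proof (intro set_eqI iffI)
	fix b assume "b : vrel fl (Dv v) (Qv v) `` {a}"
	then show "b : {b : D. org b = org a}" using vrel_at[OF assms(2), of b] DvD(1)[of b v] by simp
next
	fix b assume b: "b : {b : D. org b = org a}"
	then have "b : Dv v" using DvD(2)[OF assms(2)] by (simp add: Dv_def)
	then have "(a, b) : vrel fl (Dv v) (Qv v)" using assms b unfolding conn_links_def by auto
	then show "b : vrel fl (Dv v) (Qv v) `` {a}" by simp
qed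

text \<open>All conditions are local in the label: links lie at one vertex, a near path keeps the
  label of its start, and a set of darts with one label gives a chain of the whole complex by
  counting over edges modulo 2.\<close>

lemma blocks_of_origami:
	assumes or: "origami (skel Y) vl (emap p) P" and irr: "visibly_irreducible Y"
	shows "conn_links" "dart_block fl (%d. W d) (Dv v) (Qv v) (Pv P v) (Nv P v)"
proof -
	note o = or[unfolded origami_def]
	have PE: "eqrel E P" using o by blast
	have Pl: "lab (skel Y) vl (emap p) e = lab (skel Y) vl (emap p) f" if "(e, f) : P" for e f using o that by blast
	have ir: "card (lk (link Y y) x) \<ge> 2" "graph_connected (link Y y)" "\<not> cut_vertex (link Y y) x'"
		if "y : verts (skel Y)" "x : lk (skel Y) y" for y x x'
		using irr that unfolding visibly_irreducible_def link_simps by blast+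
	have lkw: "d : D ==> w d : lk (skel Y) (org d)" for d using wE(1) by (simp add: lk_def)
	show cl: "conn_links"
		unfolding conn_links_def
	proof (intro allI ballI impI)
		fix v a b assume ab: "a : Dv v" "b : Dv v" "org a = org b"
		have aD: "a : D" "b : D" "vl (org a) = v" using ab DvD by auto
		show "(a, b) : vrel fl (Dv v) (Qv v)"
			unfolding vrel_def flip_rel_def
			by (rule link_path[where ct = False and y = "org a" and c = a, OF ir(2)[OF wE(4)[OF aD(1)] lkw[OF aD(1)]]])
				(use aD ab in auto)
	qed
	show "dart_block fl (%d. W d) (Dv v) (Qv v) (Pv P v) (Nv P v)"
		unfolding dart_block_def
	proof (intro conjI)
		show "finite (Dv v)" using finD unfolding Dv_def by auto
		show "eqrel (Dv v) (Qv v)" "eqrel (Dv v) (Pv P v)" "eqrel (Dv v) (Nv P v)" using eqrel_Qv eqrel_Pv[OF PE] by auto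
		have "(w a, w a) : P" "(opp (skel Y) (w a), opp (skel Y) (w a)) : P" if "a : Dv v" for a
			using eqrelD(2)[OF PE] wE(1)[OF DvD(1)[OF that]] sgY unfolding sgraph_def by auto
		then show "Qv v \<subseteq> Pv P v" "Qv v \<subseteq> Nv P v" unfolding Qv_def Pv_def Nv_def by auto
		show "\<forall>(a, b)\<in>Pv P v \<union> Nv P v. W a = W b"
		proof clarify
			fix a b assume "(a, b) : Pv P v \<union> Nv P v"
			then consider "(w a, w b) : P" | "(opp (skel Y) (w a), opp (skel Y) (w b)) : P" "a : D" "b : D"
				unfolding Pv_def Nv_def Dv_def by auto
			then show "W a = W b"
			proof cases
				case 1 then show ?thesis using Pl by (auto simp: lab_def)
			next
				case 2
				have "emap p (opp (skel Y) (w a)) = opp (skel X) (W a)" "emap p (opp (skel Y) (w b)) = opp (skel X) (W b)"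
					"W a : edges (skel X)" "W b : edges (skel X)"
					using p wE(1) 2 unfolding graph_morphism_def by auto
				moreover have "emap p (opp (skel Y) (w a)) = emap p (opp (skel Y) (w b))" using Pl[OF 2(1)] by (simp add: lab_def)
				ultimately show ?thesis using sgX unfolding sgraph_def by metis
			qed
		qed
		show "\<forall>d\<in>Dv v. fl d : Dv v" using flDv by blast
		show "\<forall>d\<in>Dv v. \<exists>d'. d' ~= d & (d, d') : Qv v"
		proof
			fix d assume d: "d : Dv v"
			note dD = DvD(1)[OF d]
			have "2 \<le> card (lk (link Y (org d)) (w d))" using ir(1) lkw[OF dD] wE(4)[OF dD] by blast
			then obtain x y where xy: "x : lk (link Y (org d)) (w d)" "y : lk (link Y (org d)) (w d)" "x ~= y"
				by (rule two_le_card)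
			then have "x : D" "y : D" "w (fl x) = w d" "w (fl y) = w d" "org x = org d" "org y = org d" unfolding lk_def link_simps by auto
			moreover from this have "fl x ~= fl y" using xy(3) flD(3) by metis
			\<comment> \<open>Two distinct flips lie over the edge of \<open>d\<close>, so at least one of
			  them is a dart other than \<open>d\<close>.\<close>
			ultimately have "fl x ~= d & fl x : Dv v & w (fl x) = w d \<or> fl y ~= d & fl y : Dv v & w (fl y) = w d"
				using d flD(1,4) unfolding Dv_def by auto
			then show "\<exists>d'. d' ~= d & (d, d') : Qv v" using d unfolding Qv_def by auto
		qed
		show "\<forall>d\<in>Dv v. \<forall>d'\<in>Dv v. W d = W d' --> (d, d') : near_rel fl (%d. W d) (Dv v) (Qv v) (Pv P v) d --> (d, d') : Nv P v"
		proof (intro ballI impI)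
			fix d d' assume d: "d : Dv v" "d' : Dv v" "W d = W d'" and n: "(d, d') : near_rel fl (%d. W d) (Dv v) (Qv v) (Pv P v) d"
			let ?l = "lab (skel Y) vl (emap p)"
			have l: "?l (w d) = ?l (w d')" using d DvD(2) by (simp add: lab_def)
			have "(org d, org x) : (near_step (skel Y) vl (emap p) P (?l (w d)))\<^sup>*" if "(d, x) : near_rel fl (%d. W d) (Dv v) (Qv v) (Pv P v) d" for x
				using that unfolding near_rel_def
			proof (induction rule: rtrancl_induct)
				case (step y z)
				then consider "(y, z) : Qv v" | "y : D" "z = fl y" | "(y, z) : Pv P v" "W y ~= W d" by (auto simp: flip_rel_def Dv_def)
				then show ?case
				proof cases
					case 1 then show ?thesis using step.IH Qv_at by metis
				next
					case 2 then show ?thesis using step.IH flD(4) by simp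
				next
					case 3
					then have "(org y, org z) : near_step (skel Y) vl (emap p) P (?l (w d))"
						unfolding near_step_def Pv_def lab_def by auto
					then show ?thesis using step.IH by (rule rtrancl_into_rtrancl[rotated])
				qed
			qed simp
			from this[OF n] have "(opp (skel Y) (w d), opp (skel Y) (w d')) : P"
				using o wE(1)[OF DvD(1)[OF d(1)]] wE(1)[OF DvD(1)[OF d(2)]] l by blast
			then show "(d, d') : Nv P v" using d unfolding Nv_def by auto
		qed
		show "\<forall>B\<subseteq>Dv v. (\<forall>d\<in>Dv v. even (card (B \<inter> vrel fl (Dv v) (Qv v) `` {d}))) -->
			 (\<forall>d\<in>Dv v. even (card (B \<inter> Pv P v `` {d}))) --> (\<forall>d\<in>Dv v. even (card (B \<inter> Qv v `` {d})))"
		proof (intro allI impI)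
			fix B assume B: "B \<subseteq> Dv v" and V: "\<forall>d\<in>Dv v. even (card (B \<inter> vrel fl (Dv v) (Qv v) `` {d}))"
				and PP: "\<forall>d\<in>Dv v. even (card (B \<inter> Pv P v `` {d}))"
			\<comment> \<open>A set of darts becomes a chain: the coefficient of an edge is the parity of the
			  darts of \<open>B\<close> above it.\<close>
			define k :: "'e => bit" where "k e = of_nat (card {d : B. w d = e})" for e
			have BD: "B \<subseteq> D" using B DvD by auto
			note cc = card_class[OF k_def BD]
			have "(\<Sum>e | e : E & ini (skel Y) e = y. k e) = 0" for y
			proof -
				have "even (card {d : B. org d = y})"
				proof (cases "{d : B. org d = y} = {}")
					case False
					then obtain d where "d : B" "org d = y" by auto
					then have "B \<inter> vrel fl (Dv v) (Qv v) `` {d} = {d : B. org d = y}" "d : Dv v"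
						using vrel_Image_org[OF cl, of d v] B BD by auto
					then show ?thesis using V by metis
				next
					case True show ?thesis unfolding True by simp
				qed
				moreover have "{d : B. w d : {e. e : E & ini (skel Y) e = y}} = {d : B. org d = y}" using BD wE(1) by auto
				ultimately show ?thesis using cc[of "{e. e : E & ini (skel Y) e = y}"] of_nat_bit by simp
			qed
			moreover have "(\<Sum>e\<in>P `` {c}. k e) = 0" for c
			proof -
				have "even (card {d : B. (c, w d) : P})"
				proof (cases "{d : B. (c, w d) : P} = {}")
					case False
					then obtain d where d: "d : B" "(c, w d) : P" by auto
					have "(w d, c) : P" using symD[OF eqrelD(3)[OF PE] d(2)] .
					then have "(c, w x) : P \<longleftrightarrow> (w d, w x) : P" for x
						using transD[OF eqrelD(4)[OF PE], of "w d" c "w x"] transD[OF eqrelD(4)[OF PE], of c "w d" "w x"] d(2) by blast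
					then have "B \<inter> Pv P v `` {d} = {d : B. (c, w d) : P}" using d B unfolding Pv_def by auto
					then show ?thesis using PP d(1) B by (metis subsetD)
				next
					case True show ?thesis unfolding True by simp
				qed
				moreover have "P `` {c} \<subseteq> E" using eqrelD(1)[OF PE] by auto
				ultimately show ?thesis using cc[of "P `` {c}"] of_nat_bit by simp
			qed
			ultimately have k0: "k e = 0" if "e : E" for e using o that unfolding bip_forest_def by blast
			show "\<forall>d\<in>Dv v. even (card (B \<inter> Qv v `` {d}))"
			proof
				fix d assume d: "d : Dv v"
				then have "B \<inter> Qv v `` {d} = {x : B. w x = w d}" using B unfolding Qv_def by auto
				then show "even (card (B \<inter> Qv v `` {d}))" using k0[OF wE(1)[OF DvD(1)[OF d]]] of_nat_bit unfolding k_def by simp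
			qed
		qed
		show "\<forall>c\<in>Dv v. \<forall>a\<in>Dv v. \<forall>b\<in>Dv v. (c, a) : vrel fl (Dv v) (Qv v) --> (c, b) : vrel fl (Dv v) (Qv v) -->
				(c, a) \<notin> Qv v --> (c, b) \<notin> Qv v --> (a, b) : cut_rel fl (Dv v) (Qv v) c"
		proof (intro ballI impI)
			fix c a b assume h: "c : Dv v" "a : Dv v" "b : Dv v" "(c, a) : vrel fl (Dv v) (Qv v)" "(c, b) : vrel fl (Dv v) (Qv v)"
				"(c, a) \<notin> Qv v" "(c, b) \<notin> Qv v"
			have D: "a : D" "b : D" "c : D" "org a = org c" "org b = org c" "vl (org c) = v" "w a ~= w c" "w b ~= w c"
			proof -
				show "a : D" "b : D" "c : D" using DvD(1)[OF h(1)] DvD(1)[OF h(2)] DvD(1)[OF h(3)] by auto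
				show "org a = org c" "org b = org c" using vrel_at[OF h(1,4)] vrel_at[OF h(1,5)] by auto
				show "vl (org c) = v" by (rule DvD(2)[OF h(1)])
				show "w a ~= w c" "w b ~= w c" using h(1-3,6,7) by (auto simp: Qv_def)
			qed
			have "graph_connected (delete_vertex (link Y (org c)) (w c))"
				using ir(3)[OF wE(4)[OF D(3)] lkw[OF D(3)]] lkw[OF D(3)] unfolding cut_vertex_def link_simps by blast
			note lp = link_path[where ct = True and y = "org c" and c = c, OF this _ D(1,2,4,5)]
			have R: "cut_rel fl (Dv v) (Qv v) c = (Qv v \<union> {(x, fl x) | x. x : Dv v & (True --> w x ~= w c & w (fl x) ~= w c)})\<^sup>*"
				unfolding cut_rel_def Qv_def using h(1) flDv[of _ v] by (intro arg_cong[where f = rtrancl]) auto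
			show "(a, b) : cut_rel fl (Dv v) (Qv v) c"
				unfolding R by (rule lp) (use D in auto)
		qed
	qed
qed

end

section \<open>From blocks back to origamis and irreducible links\<close>

context labelled_complex begin

lemma conn_linksD:
	assumes "conn_links" "a : D" "b : D" "org a = org b" "vl (org a) = v"
	shows "(a, b) : vrel fl (Dv v) (Qv v)"
proof -
	have "a : Dv v" "b : Dv v" using assms by (simp_all add: Dv_def)
	then show ?thesis using assms(1,4) unfolding conn_links_def by blast
qed

lemma sum_bit: "finite S ==> (\<Sum>e\<in>S. k e :: bit) = of_nat (card {e : S. k e = 1})"
proof (induction S rule: finite_induct)
	case (insert x F)
	have "{e : insert x F. k e = 1} = (if k x = 1 then insert x {e : F. k e = 1} else {e : F. k e = 1})" by auto
	then show ?case using insert by (cases "k x") (auto simp: card_insert_if)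
qed simp

text \<open>Global conditions are recovered from the blocks because both tests localise: a near path
  stays within one label, and a cycle of the incidence graph restricts to a cycle over each label,
  since vertices and classes have well-defined labels.\<close>

lemma origami_of_blocks:
	assumes cl: "conn_links"
		and blk: "!!d. d : D ==> dart_block fl (%d. W d) (Dv (vl (org d))) (Qv (vl (org d))) (Pv P (vl (org d))) (Nv P (vl (org d)))"
		and PE: "eqrel E P" and Pl: "!!e f. (e, f) : P ==> lab (skel Y) vl (emap p) e = lab (skel Y) vl (emap p) f"
		and lo: "!!e f. e : E ==> f : E ==> lab (skel Y) vl (emap p) e = lab (skel Y) vl (emap p) f ==>
				vl (ini (skel Y) (opp (skel Y) e)) = vl (ini (skel Y) (opp (skel Y) f))"
	shows "origami (skel Y) vl (emap p) P"
	unfolding origami_def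
proof (intro conjI)
	let ?l = "lab (skel Y) vl (emap p)"
	have pE: "emap p e : edges (skel X)" "emap p (opp (skel Y) e) = opp (skel X) (emap p e)" if "e : E" for e
		using p that unfolding graph_morphism_def by auto
	show "sgraph (skel Y)" "finite E" "eqrel E P" using sgY finD PE by auto
	show "\<forall>e\<in>E. \<forall>f\<in>E. ?l e = ?l f --> ?l (opp (skel Y) e) = ?l (opp (skel Y) f)"
	proof (intro ballI impI)
		fix e f assume h: "e : E" "f : E" "?l e = ?l f"
		then have "emap p e = emap p f" by (simp add: lab_def)
		then show "?l (opp (skel Y) e) = ?l (opp (skel Y) f)" using lo[OF h] pE(2)[OF h(1)] pE(2)[OF h(2)] by (simp add: lab_def)
	qed
	show "\<forall>e\<in>E. emap p (opp (skel Y) e) ~= emap p e" using pE sgX unfolding sgraph_def by auto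
	show "\<forall>(e, f)\<in>P. ?l e = ?l f" using Pl by blast
	show "\<forall>e\<in>E. \<forall>f\<in>E. ?l e = ?l f --> (ini (skel Y) e, ini (skel Y) f) : (near_step (skel Y) vl (emap p) P (?l e))\<^sup>* -->
		 (opp (skel Y) e, opp (skel Y) f) : P"
	proof (intro ballI impI)
		fix e f assume ef: "e : E" "f : E" "?l e = ?l f"
			and path: "(ini (skel Y) e, ini (skel Y) f) : (near_step (skel Y) vl (emap p) P (?l e))\<^sup>*"
		obtain d d' where d: "d : D" "w d = e" "d' : D" "w d' = f" using cov ef by metis
		define v where "v = vl (org d)"
		define R where "R = near_rel fl (%d. W d) (Dv v) (Qv v) (Pv P v) d"
		have vR: "vrel fl (Dv v) (Qv v) \<subseteq> R" unfolding vrel_def R_def near_rel_def by (rule rtrancl_mono) auto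
		have tR: "(a, c) : R" if "(a, b) : R" "(b, c) : R" for a b c
			using that unfolding R_def near_rel_def by (rule rtrancl_trans)
		have cR: "(a, b) : R" if "a : D" "b : D" "org a = org b" "vl (org a) = v" for a b
			using conn_linksD[OF cl that] vR by blast
		\<comment> \<open>Related edges have equal labels, so the path never leaves the label
		  \<open>v\<close> and can be followed among darts of a single block.\<close>
		have "vl y = v & (\<forall>x\<in>D. org x = y --> (d, x) : R)" if "(ini (skel Y) e, y) : (near_step (skel Y) vl (emap p) P (?l e))\<^sup>*" for y
			using that
		proof (induction rule: rtrancl_induct)
			case base show ?case using d cR v_def by auto
		next
			case (step y z)
			then obtain a b where ab: "y = ini (skel Y) a" "z = ini (skel Y) b" "(a, b) : P" "?l a ~= ?l e"
				unfolding near_step_def by auto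
			have abE: "a : E" "b : E" using eqrelD(1)[OF PE] ab(3) by auto
			obtain \<alpha> \<beta> where \<alpha>: "\<alpha> : D" "w \<alpha> = a" "\<beta> : D" "w \<beta> = b" using cov abE by metis
			have la: "?l a = ?l b" by (rule Pl[OF ab(3)])
			then have vz: "vl z = v" using step.IH ab by (simp add: lab_def)
			have "(d, \<alpha>) : R" using step.IH \<alpha> ab by auto
			moreover have "(\<alpha>, \<beta>) : R"
			proof -
				have "\<alpha> : Dv v" "\<beta> : Dv v" using \<alpha> step.IH vz ab by (auto simp: Dv_def)
				moreover have "W \<alpha> ~= W d" using ab(4) \<alpha> d step.IH ab(1) v_def by (auto simp: lab_def)
				ultimately have "(\<alpha>, \<beta>) : {(a, b). (a, b) : Pv P v & W a ~= W d}" using ab(3) \<alpha> by (auto simp: Pv_def)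
				then show ?thesis unfolding R_def near_rel_def by auto
			qed
			ultimately have "(d, \<beta>) : R" by (rule tR)
			moreover have "(\<beta>, x) : R" if "x : D" "org x = z" for x using cR[of \<beta> x] that \<alpha> ab vz by auto
			ultimately show ?case using vz tR by blast
		qed
		from this[OF path] have dd: "vl (org d') = v" "(d, d') : R" using d by auto
		have Dd: "d : Dv v" "d' : Dv v" using d dd v_def by (auto simp: Dv_def)
		have "(d, d') : Nv P v"
			using dart_blockD(10)[OF blk[OF d(1)]] Dd dd(2) ef(3) d(2,4) unfolding v_def[symmetric] R_def lab_def by auto
		then show "(opp (skel Y) e, opp (skel Y) f) : P" using d unfolding Nv_def by simp
	qed
	show "bip_forest (skel Y) P"
		unfolding bip_forest_def
	proof (intro allI impI ballI)
		fix k :: "'e => bit" and e0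
		assume V: "\<forall>v. (\<Sum>e | e : E & ini (skel Y) e = v. k e) = 0" and C: "\<forall>c\<in>E. (\<Sum>e\<in>P `` {c}. k e) = 0" and e0: "e0 : E"
		define r where "r e = (SOME d. d : D & w d = e)" for e
		have r: "r e : D & w (r e) = e" if "e : E" for e
			unfolding r_def by (rule someI_ex) (use cov[OF that] in blast)
		define d0 where "d0 = r e0"
		have d0: "d0 : D" "w d0 = e0" using r[OF e0] d0_def by auto
		define v where "v = vl (org d0)"
		\<comment> \<open>One chosen dart for each edge of the support with label \<open>v\<close>; its
		  parities over edges are the coefficients of \<open>k\<close>.\<close>
		define B where "B = r ` {e : E. vl (ini (skel Y) e) = v & k e = 1}"
		have B: "B \<subseteq> Dv v" using r unfolding B_def Dv_def by auto
		have r1: "r e : D" and r2: "w (r e) = e" if "e : E" for e using r[OF that] by auto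
		have rinj: "inj_on r E" by (rule inj_on_inverseI[where g = w]) (rule r2)
		have cB: "card (B \<inter> {d : D. Z (w d)}) = card {e : {e : E. Z e}. k e = 1}"
			if Z: "!!e. e : E ==> Z e ==> vl (ini (skel Y) e) = v" for Z
		proof -
			have "B \<inter> {d : D. Z (w d)} = r ` {e : {e : E. Z e}. k e = 1}"
			proof (intro set_eqI iffI)
				fix x assume "x : B \<inter> {d : D. Z (w d)}"
				then obtain e where "e : E" "k e = 1" "x = r e" "Z (w x)" unfolding B_def by auto
				then show "x : r ` {e : {e : E. Z e}. k e = 1}" using r2[of e] by auto
			next
				fix x assume "x : r ` {e : {e : E. Z e}. k e = 1}"
				then obtain e where e: "e : E" "k e = 1" "x = r e" "Z e" by auto
				then have "x : B" unfolding B_def using Z[OF e(1,4)] by auto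
				then show "x : B \<inter> {d : D. Z (w d)}" using e r1[OF e(1)] r2[OF e(1)] by simp
			qed
			then show ?thesis using card_image[OF inj_on_subset[OF rinj], of "{e : {e : E. Z e}. k e = 1}"] by auto
		qed
		have fE: "finite {e : E. Z e}" for Z using finD by simp
		have 1: "\<forall>d\<in>Dv v. even (card (B \<inter> vrel fl (Dv v) (Qv v) `` {d}))"
		proof
			fix d assume d: "d : Dv v"
			have "card (B \<inter> {x : D. ini (skel Y) (w x) = org d}) = card {e : {e : E. ini (skel Y) e = org d}. k e = 1}"
				by (rule cB) (use DvD(2)[OF d] in auto)
			moreover have "even (card {e : {e : E. ini (skel Y) e = org d}. k e = 1})"
				using V[rule_format, of "org d"] unfolding sum_bit[OF fE] of_nat_bit .
			ultimately show "even (card (B \<inter> vrel fl (Dv v) (Qv v) `` {d}))" unfolding vrel_Image_org[OF cl d] by simp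
		qed
		have 2: "\<forall>d\<in>Dv v. even (card (B \<inter> Pv P v `` {d}))"
		proof
			fix d assume d: "d : Dv v"
			have "card (B \<inter> {x : D. (w d, w x) : P}) = card {e : {e : E. (w d, e) : P}. k e = 1}"
				by (rule cB) (use DvD(2)[OF d] Pl in \<open>auto simp: lab_def\<close>)
			moreover have "P `` {w d} = {e : E. (w d, e) : P}" using eqrelD(1)[OF PE] by auto
			then have "even (card {e : {e : E. (w d, e) : P}. k e = 1})"
				using C[rule_format, OF wE(1)[OF DvD(1)[OF d]]] by (simp only: sum_bit[OF fE] of_nat_bit)
			moreover have "B \<inter> Pv P v `` {d} = B \<inter> {x : D. (w d, w x) : P}" using d B unfolding Pv_def Dv_def by auto
			ultimately show "even (card (B \<inter> Pv P v `` {d}))" by simp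
		qed
		have "even (card (B \<inter> Qv v `` {d0}))"
			using dart_blockD(11)[OF blk[OF d0(1)]] 1 2 B DvD(3)[OF d0(1)] unfolding v_def[symmetric] by blast
		moreover have "B \<inter> Qv v `` {d0} = (if k e0 = 1 then {d0} else {})"
		proof -
			have u: "x = d0 & k e0 = 1" if "x : B" "w x = w d0" for x
				using that r d0 unfolding B_def d0_def by auto
			have m: "d0 : B" if "k e0 = 1" using that e0 d0 unfolding B_def d0_def v_def by auto
			have "d0 : Dv v" using d0 v_def by (simp add: Dv_def)
			then have "B \<inter> Qv v `` {d0} = {x : B. w x = w d0}" using B unfolding Qv_def by auto
			also have "\<dots> = (if k e0 = 1 then {d0} else {})"
			proof (cases "k e0 = 1")
				case True then show ?thesis using u m by auto
			next
				case False
				then have "{x : B. w x = w d0} = {}" using u by blast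
				then show ?thesis using False by simp
			qed
			finally show ?thesis .
		qed
		ultimately show "k e0 = 0" by (auto split: if_splits)
	qed
qed

lemma link_path_conv:
	assumes R: "(a, b) : (Qv (vl y) \<union> {(x, fl x) | x. x : Dv (vl y) & (ct --> w x ~= w c & w (fl x) ~= w c)})\<^sup>*"
		and L: "L = (if ct then delete_vertex (link Y y) (w c) else link Y y)" and a: "a : D" "org a = y"
	shows "(w a, w b) : {(ini L e, ter L e) | e. e : edges L}\<^sup>* & b : D & org b = y"
	using R
proof (induction rule: rtrancl_induct)
	case base show ?case using a by simp
next
	case (step b z)
	then consider "(b, z) : Qv (vl y)" | "z = fl b" "b : Dv (vl y)" "ct --> w b ~= w c & w (fl b) ~= w c" by auto
	then show ?case
	proof cases
		case 1
		then have "w b = w z" "z : D" by (auto simp: Qv_def Dv_def)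
		then show ?thesis using step.IH by auto
	next
		case 2
		have b: "b : D" "org b = y" using step.IH by auto
		note f = flD[OF b(1)]
		have "fl b : edges (link Y y)" using f b unfolding link_simps by simp
		then have "fl b : edges L"
			using 2(3) link_ter[OF f(1), of y] f(3) by (auto simp: L delete_vertex_def link_simps)
		moreover have "ini L (fl b) = w b" "ter L (fl b) = w (fl b)"
			using link_ter[OF f(1), of y] f(3) by (auto simp: L delete_vertex_def link_simps ter_def)
		ultimately have "(w b, w z) : {(ini L e, ter L e) | e. e : edges L}" using 2(1) by (metis (mono_tags, lifting) mem_Collect_eq)
		then have "(w a, w z) : {(ini L e, ter L e) | e. e : edges L}\<^sup>*"
			using step.IH by (meson rtrancl_into_rtrancl)
		then show ?thesis using f b 2(1) by simp
	qed
qed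

lemma visibly_irreducible_of_blocks:
	assumes cl: "conn_links"
		and blk: "!!d. d : D ==> dart_block fl (%d. W d) (Dv (vl (org d))) (Qv (vl (org d))) (Pv P (vl (org d))) (Nv P (vl (org d)))"
	shows "visibly_irreducible Y"
	unfolding visibly_irreducible_def
proof (intro ballI)
	fix y assume y: "y : verts (skel Y)"
	let ?L = "link Y y"
	obtain d where d: "d : D" "org d = y" using covv[OF y] cov by blast
	note f = flD[OF d(1)]
	have wl: "x : D ==> org x = y ==> w x : lk (skel Y) y" for x using wE(1) by (simp add: lk_def)
	have lw: "\<exists>x\<in>D. org x = y & w x = e" if "e : lk (skel Y) y" for e using cov[of e] that by (auto simp: lk_def)
	have fin: "finite_sgraph ?L" unfolding finite_sgraph_def link_simps using finD by (auto simp: lk_def)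
	have V: "(a, b) : vrel fl (Dv (vl y)) (Qv (vl y))" if "a : D" "b : D" "org a = y" "org b = y" for a b
		by (rule conn_linksD[OF cl that(1,2)]) (use that in simp_all)
	have c2: "2 \<le> card (verts ?L)"
	proof -
		have "{w d, w (fl d)} \<subseteq> verts ?L" using wl[OF d] wl[OF f(1)] f(4) d unfolding link_simps by auto
		moreover have "card {w d, w (fl d)} = 2" using f(5) by auto
		ultimately show ?thesis using fin unfolding finite_sgraph_def by (metis card_mono)
	qed
	have val: "2 \<le> card (lk ?L x)" if x: "x : verts ?L" for x
	proof -
		obtain a where a: "a : D" "org a = y" "w a = x" using lw x unfolding link_simps by blast
		obtain b where b: "b ~= a" "(a, b) : Qv (vl y)"
			using dart_blockD(9)[OF blk[OF a(1)]] DvD(3)[OF a(1)] a(2) by auto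
		then have b': "b : D" "w b = x" "org b = y" using a unfolding Qv_def Dv_def by auto
		have "{fl a, fl b} \<subseteq> lk ?L x" using flD[OF a(1)] flD[OF b'(1)] a b' unfolding lk_def link_simps by auto
		moreover have "fl a ~= fl b" using flD(3)[OF a(1)] flD(3)[OF b'(1)] b(1) by metis
		then have "card {fl a, fl b} = 2" by simp
		moreover have "finite (lk ?L x)" using fin unfolding finite_sgraph_def lk_def by auto
		ultimately show ?thesis by (metis card_mono)
	qed
	have conn: "graph_connected ?L"
		unfolding graph_connected_def
	proof (intro conjI ballI)
		show "verts ?L ~= {}" using c2 by auto
		fix e e' assume e: "e : verts ?L" "e' : verts ?L"
		obtain a b where ab: "a : D" "org a = y" "w a = e" "b : D" "org b = y" "w b = e'" using lw e unfolding link_simps by metis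
		have "(w a, w b) : {(ini ?L e, ter ?L e) | e. e : edges ?L}\<^sup>*"
			using link_path_conv[where ct = False and c = a and a = a and b = b and y = y and L = ?L] V[OF ab(1,4,2,5)] ab
			unfolding vrel_def flip_rel_def by simp
		then show "(e, e') : reach ?L" using ab e unfolding reach_def by simp
	qed
	have nocut: "\<not> cut_vertex ?L x" for x
	proof
		assume "cut_vertex ?L x"
		then have x: "x : verts ?L" "\<not> graph_connected (delete_vertex ?L x)" unfolding cut_vertex_def by auto
		obtain c where c: "c : D" "org c = y" "w c = x" using lw x(1) unfolding link_simps by blast
		let ?L' = "delete_vertex ?L (w c)"
		have vL': "verts ?L' = lk (skel Y) y - {w c}" by (simp add: delete_vertex_def link_simps)
		have "graph_connected ?L'"
			unfolding graph_connected_def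
		proof (intro conjI ballI)
			show "verts ?L' ~= {}" unfolding vL' using wl[of "fl c"] flD[OF c(1)] c by auto
			fix e e' assume e: "e : verts ?L'" "e' : verts ?L'"
			then have "e : lk (skel Y) y" "e' : lk (skel Y) y" unfolding vL' by auto
			then obtain a b where ab: "a : D" "org a = y" "w a = e" "b : D" "org b = y" "w b = e'" using lw by metis
			have DD: "a : Dv (vl y)" "b : Dv (vl y)" "c : Dv (vl y)" using ab c by (auto simp: Dv_def)
			have "(c, a) \<notin> Qv (vl y)" "(c, b) \<notin> Qv (vl y)" using ab e unfolding vL' Qv_def by auto
			then have "(a, b) : cut_rel fl (Dv (vl y)) (Qv (vl y)) c"
				using dart_blockD(12)[OF blk[OF c(1)]] DD V c(1,2) ab by simp
			moreover have "cut_rel fl (Dv (vl y)) (Qv (vl y)) c = (Qv (vl y) \<union> {(x, fl x) | x. x : Dv (vl y) & (True --> w x ~= w c & w (fl x) ~= w c)})\<^sup>*"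
				unfolding cut_rel_def Qv_def using DD(3) flDv[of _ "vl y"] by (intro arg_cong[where f = rtrancl]) auto
			ultimately have "(w a, w b) : {(ini ?L' e, ter ?L' e) | e. e : edges ?L'}\<^sup>*"
				using link_path_conv[where ct = True and c = c and a = a and b = b and y = y and L = ?L'] ab by simp
			then show "(e, e') : reach ?L'" using ab e unfolding reach_def by simp
		qed
		then show False using x(2) c(3) by simp
	qed
	show "finite_sgraph ?L & 2 \<le> card (verts ?L) & (\<forall>x\<in>verts ?L. 2 \<le> card (lk ?L x)) & graph_connected ?L & (\<forall>x. \<not> cut_vertex ?L x)"
		using fin c2 val conn nocut by blast
qed

end

section \<open>Systems of blocks\<close>

type_synonym 'c block = "('c \<times> 'c) set \<times> ('c \<times> 'c) set \<times> ('c \<times> 'c) set"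

text \<open>Only the three relations are stored: \<open>Q\<close> is reflexive on the set of darts,
  which is therefore its domain.\<close>

definition xblock :: "('w, 'f, 'x, 'c) two_complex => 'c block => bool" where
	"xblock X b = (case b of (Q, P, N) => Domain Q ~= {} & Domain Q \<subseteq> edges (bdry X) &
		 (\<exists>v. \<forall>d\<in>Domain Q. ini (skel X) (emap (att X) d) = v) &
		 dart_block (flip (bdry X)) (emap (att X)) (Domain Q) Q P N)"

definition bedges :: "('w, 'f, 'x, 'c) two_complex => 'c block => 'f set" where
	"bedges X b = emap (att X) ` Domain (fst b)"

text \<open>Passing to the opposite edge exchanges \<open>P\<close> and \<open>N\<close>, as
  \<open>N\<close> is \<open>P\<close> read on opposite edges. The quantifiers run over all darts
  above \<open>e\<close>, so the pairs with \<open>d = d'\<close> force both blocks to contain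
  corresponding darts.\<close>

definition compat :: "('w, 'f, 'x, 'c) two_complex => 'c block => 'f => 'c block => bool" where
	"compat X b e b' = (case b of (Q, P, N) => case b' of (Q', P', N') => e : bedges X b &
		 (\<forall>d\<in>edges (bdry X). \<forall>d'\<in>edges (bdry X). emap (att X) d = e --> emap (att X) d' = e -->
				((d, d') : Q \<longleftrightarrow> (opp (bdry X) d, opp (bdry X) d') : Q') &
				((d, d') : P \<longleftrightarrow> (opp (bdry X) d, opp (bdry X) d') : N') &
				((d, d') : N \<longleftrightarrow> (opp (bdry X) d, opp (bdry X) d') : P')))"

text \<open>\<open>V\<close> with \<open>mate\<close> is the folded graph: the edge above
  \<open>e\<close> at \<open>v\<close> ends at \<open>mate v e\<close>, and the last equation says
  that its opposite leads back.\<close>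

definition dsystem :: "('w, 'f, 'x, 'c) two_complex => 'o set => ('o => 'c block) => ('o => 'f => 'o) => bool" where
	"dsystem X V \<beta> mate \<longleftrightarrow> finite V & V ~= {} & (\<forall>v\<in>V. xblock X (\<beta> v)) &
		 (\<forall>v\<in>V. \<forall>e\<in>bedges X (\<beta> v). mate v e : V & compat X (\<beta> v) e (\<beta> (mate v e)) & mate (mate v e) (opp (skel X) e) = v)"

text \<open>An oriented edge belongs to the block of its initial vertex, so each geometric edge is
  counted as two halves.\<close>

definition block_chi :: "('w, 'f, 'x, 'c) two_complex => 'c block => real" where
	"block_chi X b = real (nclass (Domain (fst b)) (vrel (flip (bdry X)) (Domain (fst b)) (fst b)))
		 - real (nclass (Domain (fst b)) (fst b)) / 2"

definition block_area :: "('w, 'f, 'x, 'c) two_complex => 'c block => real" where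
	"block_area X b = (\<Sum>d\<in>Domain (fst b). 1 / real (circ_len (bdry X) d))"

lemma eqrel_Domain: "eqrel A Q ==> Domain Q = A"
	using eqrelD[of A Q] by fastforce

section \<open>Euler characteristic and area as sums over labels\<close>

context labelled_complex begin

lemma org_image: "org ` Dv v = {y : verts (skel Y). vl y = v}"
proof (intro set_eqI iffI)
	fix y assume "y : org ` Dv v"
	then obtain d where "d : Dv v" "y = org d" by auto
	then show "y : {y : verts (skel Y). vl y = v}" using wE(4)[OF DvD(1)] DvD(2) by auto
next
	fix y assume y: "y : {y : verts (skel Y). vl y = v}"
	then obtain d where "d : D" "org d = y" using covv cov by blast
	then show "y : org ` Dv v" using y DvD(3)[of d] by auto
qed

lemma w_image: "w ` Dv v = {e : E. vl (ini (skel Y) e) = v}"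
proof (intro set_eqI iffI)
	fix e assume "e : w ` Dv v"
	then obtain d where "d : Dv v" "e = w d" by auto
	then show "e : {e : E. vl (ini (skel Y) e) = v}" using wE(1)[OF DvD(1)] DvD(2) by auto
next
	fix e assume e: "e : {e : E. vl (ini (skel Y) e) = v}"
	then obtain d where "d : D" "w d = e" using cov by blast
	then show "e : w ` Dv v" using e DvD(3)[of d] by auto
qed

lemma euler_char_blocks:
	assumes "conn_links"
	shows "real_of_int (euler_char (skel Y)) = (\<Sum>v\<in>vl ` verts (skel Y).
		 real (nclass (Dv v) (vrel fl (Dv v) (Qv v))) - real (nclass (Dv v) (Qv v)) / 2)"
proof -
	have fV: "finite (vl ` verts (skel Y))" using finD by simp
	have 1: "nclass (Dv v) (vrel fl (Dv v) (Qv v)) = card {y : verts (skel Y). vl y = v}" for v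
		unfolding org_image[symmetric]
	proof (rule nclass_kernel)
		fix a b assume "a : Dv v"
		then show "(a, b) : vrel fl (Dv v) (Qv v) \<longleftrightarrow> b : Dv v & org a = org b"
			using vrel_at[of a v b] conn_linksD[OF assms, of a b v] DvD(1)[of a v] DvD(1)[of b v] DvD(2)[of a v] by blast
	qed
	have 2: "nclass (Dv v) (Qv v) = card {e : E. vl (ini (skel Y) e) = v}" for v
		unfolding w_image[symmetric] by (rule nclass_kernel) (auto simp: Qv_def)
	have "card (verts (skel Y)) = (\<Sum>v\<in>vl ` verts (skel Y). card {y : verts (skel Y). vl y = v})"
		using sum.group[OF finD(3) fV, of vl "%_. 1 :: nat"] by simp
	moreover have "card E = (\<Sum>v\<in>vl ` verts (skel Y). card {e : E. vl (ini (skel Y) e) = v})"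
	proof -
		have "(%e. vl (ini (skel Y) e)) ` E \<subseteq> vl ` verts (skel Y)" using sgY unfolding sgraph_def by auto
		from sum.group[OF finD(2) fV this, of "%_. 1 :: nat"] show ?thesis by simp
	qed
	ultimately show ?thesis
		unfolding euler_char_half[OF sgY finD(2)] 1 2 by (simp add: sum_subtractf sum_divide_distrib)
qed

lemma total_area_blocks:
	assumes area: "!!f. f : faces Y ==> area Y f = real (cover_degree s f)"
	shows "total_area Y = (\<Sum>v\<in>vl ` verts (skel Y). \<Sum>d\<in>Dv v. 1 / real (circ_len (bdry X) (emap s d)))"
proof -
	let ?S = "bdry Y" and ?h = "%d. 1 / real (circ_len (bdry X) (emap s d))"
	have sg: "sgraph ?S" using circY unfolding circles_def by blast
	note eq = equiv_reach[OF sg]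
	have fS: "finite (verts ?S)" and fX: "finite (edges (bdry X))" using X Y unfolding finite_complex_def finite_sgraph_def by auto
	have fF: "finite (faces Y)" unfolding faces_def graph_components_def by (rule finite_quotient[OF fS]) (use eq in \<open>auto simp: equiv_def reach_def\<close>)
	have "total_area Y = (\<Sum>f\<in>faces Y. \<Sum>d | d : D & ini ?S d : f. ?h d)"
		unfolding total_area_def
	proof (rule sum.cong[OF refl])
		fix f assume f: "f : faces Y"
		show "area Y f = (\<Sum>d | d : D & ini ?S d : f. ?h d)"
			using area[OF f] cover_degree_sum[OF s circY circX finD(1) fX] f unfolding faces_def by simp
	qed
	also have "\<dots> = (\<Sum>f\<in>faces Y. sum ?h {d : D. reach ?S `` {ini ?S d} = f})"
	proof (intro sum.cong refl)
		fix f assume "f : faces Y"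
		then obtain u where u: "u : verts ?S" "f = reach ?S `` {u}" unfolding faces_def graph_components_def by (auto elim: quotientE)
		have "ini ?S d : f \<longleftrightarrow> reach ?S `` {ini ?S d} = f" if "d : D" for d
			using u eq_equiv_class_iff[OF eq, of u "ini ?S d"] circles_opp(4)[OF circY that] by auto
		then show "{d. d : D & ini ?S d : f} = {d : D. reach ?S `` {ini ?S d} = f}" by blast
	qed
	also have "\<dots> = sum ?h D"
		by (rule sum.group[OF finD(1) fF]) (use circles_opp(4)[OF circY] in \<open>auto simp: faces_def graph_components_def quotient_def\<close>)
	also have "\<dots> = (\<Sum>v\<in>vl ` verts (skel Y). sum ?h {d : D. vl (org d) = v})"
		by (rule sum.group[symmetric]) (use finD wE(4) in auto)
	finally show ?thesis unfolding Dv_def .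
qed

end

lemma standard_simps [simp]:
	"skel (standard X) = skel X" "bdry (standard X) = bdry X" "att (standard X) = att X" "area (standard X) f = 1"
	by (auto simp: standard_def two_complex.defs)

lemma standard_complex [simp]:
	"finite_complex (standard X) = finite_complex X" "two_complex (standard X) = two_complex X"
	by (simp_all add: finite_complex_def two_complex_def)

text \<open>Labels are the vertices of the folded graph, and the origami comes from undoing the
  folds. The block of a label collects the darts of Y over that vertex and is pushed into X by
  \<open>dart_transport\<close>.\<close>

lemma Irred_dsystem:
	fixes X :: "('w, 'f, 'x, 'c) two_complex" and Y :: "(nat, nat, nat, nat) branched_complex"
	assumes irr: "(Y, p, s) : Irred (standard X)"
	shows "\<exists>(V :: nat set) \<beta> mate. dsystem X V \<beta> mate &
		 real_of_int (euler_char (skel Y)) = (\<Sum>v\<in>V. block_chi X (\<beta> v)) & total_area Y = (\<Sum>v\<in>V. block_area X (\<beta> v))"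
proof -
	have ess: "essential Y (standard X) p s" and ne: "verts (skel Y) ~= {}" and vis: "visibly_irreducible Y"
		using irr unfolding Irred_def by auto
	have bm: "branched_morphism Y (standard X) p s" and fin: "finite_complex Y" "finite_complex X"
		using ess unfolding essential_def by auto
	obtain G q i where G: "folds (skel Y) G q" "immersion G (skel X) i" "gmap_eq_on (skel Y) (gcomp i q) p"
		"graph_homotopy_equivalence (skel Y) G q" and
		iso: "graph_isomorphism (bdry Y) (image_graph (bdry Y) (fibre_product G (bdry X) i (att X)) (gpair (gcomp q (att Y)) s)) (gpair (gcomp q (att Y)) s)"
		using ess unfolding essential_def Let_def standard_simps by blast
	have tc: "two_complex Y" "two_complex X" and p: "graph_morphism (skel Y) (skel X) p" and s: "immersion (bdry Y) (bdry X) s"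
		and comm: "gmap_eq_on (bdry Y) (gcomp p (att Y)) (gcomp (att X) s)"
		and area: "!!f. f : faces Y ==> area Y f = real (cover_degree s f)"
		using bm unfolding branched_morphism_def branched_complex_def by auto
	have q: "graph_morphism (skel Y) G q" using G(4) unfolding graph_homotopy_equivalence_def by blast
	have cY: "circles (bdry Y)" using tc unfolding two_complex_def by blast
	have att: "graph_morphism (bdry Y) (skel Y) (att Y)" using tc unfolding two_complex_def immersion_def by blast
	have finE: "finite (edges (skel Y))" "finite (verts (skel Y))" using fin unfolding finite_complex_def finite_sgraph_def by auto
	have finG: "finite (edges G)"
		using G(1) finE(1)
	proof (induction rule: folds.induct)
		case (folds_step G H q K p)
		then show ?case unfolding fold_map_def by (metis finite_imageI)
	qed
	obtain P where "origami (skel Y) (id \<circ> vmap q) (emap i \<circ> emap q) P"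
		using origami_folds[OF G(1) finE(1) split_cocycles_homotopy_equivalence[OF G(4)] origami_immersion[OF G(2) finG]] by blast
	then have or: "origami (skel Y) (vmap q) (emap p) P"
		by (rule origami_cong) (use G(3) in \<open>auto simp: gmap_eq_on_def gcomp_def\<close>)
	interpret L: labelled_complex X Y p s "vmap q"
	proof
		show "two_complex X" "finite_complex X" "two_complex Y" "finite_complex Y" "graph_morphism (skel Y) (skel X) p"
			"immersion (bdry Y) (bdry X) s" "gmap_eq_on (bdry Y) (gcomp p (att Y)) (gcomp (att X) s)" by fact+
		\<comment> \<open>Equal labels and equal images give edges of \<open>G\<close> at one vertex with
		  one image, which the immersion \<open>i\<close> identifies; injectivity into the fibre product
		  then identifies the darts.\<close>
		show "d = d'" if d: "d : edges (bdry Y)" "d' : edges (bdry Y)"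
			"vmap q (ini (skel Y) (emap (att Y) d)) = vmap q (ini (skel Y) (emap (att Y) d'))" "emap s d = emap s d'" for d d'
		proof -
			have w: "emap (att Y) d : edges (skel Y)" "emap (att Y) d' : edges (skel Y)" using att d unfolding graph_morphism_def by auto
			let ?a = "emap q (emap (att Y) d)" and ?b = "emap q (emap (att Y) d')"
			have ab: "?a : edges G" "?b : edges G" "ini G ?a = ini G ?b" using q w d(3) unfolding graph_morphism_def by auto
			have "emap i ?a = emap (att X) (emap s d)" "emap i ?b = emap (att X) (emap s d')"
				using G(3) comm w d(1,2) unfolding gmap_eq_on_def gcomp_def by auto
			then have "emap i ?a = emap i ?b" using d(4) by simp
			moreover have "ini G ?a : verts G" using ab(1) q unfolding graph_morphism_def sgraph_def by blast
			ultimately have "?a = ?b" using G(2) ab unfolding immersion_def inj_on_def lk_def by auto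
			moreover have "inj_on (%d. (emap q (emap (att Y) d), emap s d)) (edges (bdry Y))"
				using iso unfolding graph_isomorphism_def bij_betw_def by (simp add: gpair_def gcomp_def)
			ultimately show ?thesis using d by (auto dest: inj_onD)
		qed
		show "\<exists>d\<in>edges (bdry Y). emap (att Y) d = e" if e: "e : edges (skel Y)" for e
		proof -
			let ?L = "link Y (ini (skel Y) e)"
			have "ini (skel Y) e : verts (skel Y)" using att e unfolding graph_morphism_def sgraph_def by blast
			moreover have "e : verts ?L" using e by (simp add: link_def Let_def lk_def)
			ultimately have "2 \<le> card (lk ?L e)" using vis unfolding visibly_irreducible_def by blast
			then obtain d where "d : lk ?L e" by (rule two_le_card)
			then have "d : edges (bdry Y)" "emap (att Y) (flip (bdry Y) d) = e" by (auto simp: link_def Let_def lk_def flip_def)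
			then show ?thesis using flip(1)[OF cY] by blast
		qed
		show "\<exists>e\<in>edges (skel Y). ini (skel Y) e = v" if "v : verts (skel Y)" for v
		proof -
			have "2 \<le> card (verts (link Y v))" using vis that unfolding visibly_irreducible_def by blast
			then obtain e where "e : verts (link Y v)" by (rule two_le_card)
			then show ?thesis by (auto simp: link_def Let_def lk_def)
		qed
	qed
	note blk = L.blocks_of_origami[OF or vis]
	let ?S = "%R. map_prod (emap s) (emap s) ` R"
	have sX: "emap s d : edges (bdry X)" "emap s (opp (bdry Y) d) = opp (bdry X) (emap s d)" if "d : L.D" for d
		using s that unfolding immersion_def graph_morphism_def by auto
	have sW: "emap (att X) (emap s d) = L.W d" if "d : L.D" for d
		using comm that unfolding gmap_eq_on_def gcomp_def by auto
	have tr: "dart_transport L.fl (%d. L.W d) (L.Dv v) (L.Qv v) (L.Pv P v) (L.Nv P v) (emap s) (flip (bdry X)) (emap (att X))" for v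
	proof
		show "dart_block L.fl (%d. L.W d) (L.Dv v) (L.Qv v) (L.Pv P v) (L.Nv P v)" by (rule blk(2))
		show "inj_on (emap s) (L.Dv v)"
		proof (rule inj_onI)
			fix a b assume h: "a : L.Dv v" "b : L.Dv v" "emap s a = emap s b"
			show "a = b" by (rule L.lift_inj[OF L.DvD(1)[OF h(1)] L.DvD(1)[OF h(2)] _ h(3)]) (simp add: L.DvD(2)[OF h(1)] L.DvD(2)[OF h(2)])
		qed
		show "flip (bdry X) (emap s d) = emap s (L.fl d)" if "d : L.Dv v" for d
			using immersion_flip[OF s L.circY L.circX L.DvD(1)[OF that]] by simp
		show "emap (att X) (emap s d) = L.W d" if "d : L.Dv v" for d using sW[OF L.DvD(1)[OF that]] .
	qed
	define V where "V = vmap q ` verts (skel Y)"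
	define \<beta> where "\<beta> v = (?S (L.Qv v), ?S (L.Pv P v), ?S (L.Nv P v))" for v
	\<comment> \<open>The terminus of the edge above \<open>e\<close> at \<open>v\<close>. Any dart may
	  be used to find it, since equally labelled edges have equally labelled opposites
	  (\<open>matev\<close>).\<close>
	define mate where "mate v e = vmap q (ini (skel Y) (opp (skel Y) (L.w (SOME d. d : L.Dv v & L.W d = e))))" for v e
	have DomQ: "Domain (?S (L.Qv v)) = emap s ` L.Dv v" for v
		using eqrel_Domain[OF L.eqrel_Qv[of v]] by force
	have matev: "mate v e = vmap q (L.org (opp (bdry Y) d))" if d: "d : L.Dv v" "L.W d = e" for v e d
	proof -
		let ?d = "SOME d. d : L.Dv v & L.W d = e"
		have "?d : L.Dv v & L.W ?d = e" by (rule someI[of _ d]) (use d in blast)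
		then have d': "?d : L.Dv v" "L.W ?d = e" by auto
		have "lab (skel Y) (vmap q) (emap p) (L.w ?d) = lab (skel Y) (vmap q) (emap p) (L.w d)"
			using L.DvD(2)[OF d'(1)] L.DvD(2)[OF d(1)] d'(2) d(2) by (simp add: lab_def)
		moreover have "\<forall>e\<in>edges (skel Y). \<forall>f\<in>edges (skel Y). lab (skel Y) (vmap q) (emap p) e = lab (skel Y) (vmap q) (emap p) f -->
				lab (skel Y) (vmap q) (emap p) (opp (skel Y) e) = lab (skel Y) (vmap q) (emap p) (opp (skel Y) f)"
			using or unfolding origami_def by blast
		ultimately have "lab (skel Y) (vmap q) (emap p) (opp (skel Y) (L.w ?d)) = lab (skel Y) (vmap q) (emap p) (opp (skel Y) (L.w d))"
			using L.wE(1)[OF L.DvD(1)[OF d'(1)]] L.wE(1)[OF L.DvD(1)[OF d(1)]] by blast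
		then show ?thesis unfolding mate_def using L.wE(2)[OF L.DvD(1)[OF d(1)]] by (simp add: lab_def)
	qed
	have oppY: "opp (bdry Y) d : L.D" "opp (bdry Y) (opp (bdry Y) d) = d" if "d : L.D" for d
		using circles_opp[OF L.circY that] by auto
	have Wopp: "L.W (opp (bdry Y) d) = opp (skel X) (L.W d)" if "d : L.D" for d
		using L.wE(1,2)[OF that] p unfolding graph_morphism_def by auto
	have be: "e : bedges X (\<beta> v) \<longleftrightarrow> (\<exists>d\<in>L.Dv v. L.W d = e)" for e v
		using sW L.DvD(1)[of _ v] unfolding bedges_def \<beta>_def by (auto simp: DomQ image_iff)
	have Dmate: "d : L.Dv v \<longleftrightarrow> opp (bdry Y) d : L.Dv (mate v e)"
		if e: "e : bedges X (\<beta> v)" and d: "d : L.D" "L.W d = e" for d e v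
	proof
		assume "d : L.Dv v"
		then show "opp (bdry Y) d : L.Dv (mate v e)" using matev[of d v e] d oppY by (simp add: L.Dv_def)
	next
		assume o: "opp (bdry Y) d : L.Dv (mate v e)"
		obtain d0 where d0: "d0 : L.Dv v" "L.W d0 = e" using e be by blast
		have D0: "d0 : L.D" by (rule L.DvD(1)[OF d0(1)])
		have o0: "opp (bdry Y) d0 : L.Dv (mate v e)" using matev[OF d0] oppY[OF D0] by (simp add: L.Dv_def)
		have "mate (mate v e) (opp (skel X) e) = vmap q (L.org (opp (bdry Y) (opp (bdry Y) d0)))"
			by (rule matev[OF o0]) (use Wopp[OF D0] d0 in simp)
		moreover have "mate (mate v e) (opp (skel X) e) = vmap q (L.org (opp (bdry Y) (opp (bdry Y) d)))"
			by (rule matev[OF o]) (use Wopp[OF d(1)] d in simp)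
		ultimately show "d : L.Dv v" using oppY(2)[OF D0] oppY(2)[OF d(1)] L.DvD(2)[OF d0(1)] d(1) by (simp add: L.Dv_def)
	qed
	have memS: "(a, b) : ?S (L.Qv v) \<longleftrightarrow> (\<exists>d d'. d : L.Dv v & d' : L.Dv v & emap s d = a & emap s d' = b & L.w d = L.w d')"
		"(a, b) : ?S (L.Pv P v) \<longleftrightarrow> (\<exists>d d'. d : L.Dv v & d' : L.Dv v & emap s d = a & emap s d' = b & (L.w d, L.w d') : P)"
		"(a, b) : ?S (L.Nv P v) \<longleftrightarrow> (\<exists>d d'. d : L.Dv v & d' : L.Dv v & emap s d = a & emap s d' = b & (opp (skel Y) (L.w d), opp (skel Y) (L.w d')) : P)"
		for a b v unfolding L.Qv_def L.Pv_def L.Nv_def by force+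
	\<comment> \<open>Taking opposites is a bijection between the darts over \<open>e\<close> in the
	  block of \<open>v\<close> and those over the opposite edge in the block of its mate; all three
	  clauses of \<open>compat\<close> are instances.\<close>
	have swap: "(\<exists>d d'. d : L.Dv v & d' : L.Dv v & emap s d = a & emap s d' = b & Z d d') \<longleftrightarrow>
			(\<exists>d d'. d : L.Dv (mate v e) & d' : L.Dv (mate v e) & emap s d = opp (bdry X) a & emap s d' = opp (bdry X) b & Z' d d')"
		if e: "e : bedges X (\<beta> v)" and ab: "a : edges (bdry X)" "b : edges (bdry X)" "emap (att X) a = e" "emap (att X) b = e"
			and Z: "!!d d'. d : L.D ==> d' : L.D ==> Z d d' = Z' (opp (bdry Y) d) (opp (bdry Y) d')" for v e a b Z Z'
	proof
		assume "\<exists>d d'. d : L.Dv v & d' : L.Dv v & emap s d = a & emap s d' = b & Z d d'"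
		then obtain d d' where h: "d : L.Dv v" "d' : L.Dv v" "emap s d = a" "emap s d' = b" "Z d d'" by blast
		note D = L.DvD(1)[OF h(1)] L.DvD(1)[OF h(2)]
		show "\<exists>d d'. d : L.Dv (mate v e) & d' : L.Dv (mate v e) & emap s d = opp (bdry X) a & emap s d' = opp (bdry X) b & Z' d d'"
			using Dmate[OF e D(1)] Dmate[OF e D(2)] sW[OF D(1)] sW[OF D(2)] sX(2)[OF D(1)] sX(2)[OF D(2)] Z[OF D] h ab
			by (intro exI[of _ "opp (bdry Y) d"] exI[of _ "opp (bdry Y) d'"]) auto
	next
		assume "\<exists>d d'. d : L.Dv (mate v e) & d' : L.Dv (mate v e) & emap s d = opp (bdry X) a & emap s d' = opp (bdry X) b & Z' d d'"
		then obtain c c' where h: "c : L.Dv (mate v e)" "c' : L.Dv (mate v e)" "emap s c = opp (bdry X) a" "emap s c' = opp (bdry X) b" "Z' c c'" by blast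
		note C = L.DvD(1)[OF h(1)] L.DvD(1)[OF h(2)]
		define d d' where "d = opp (bdry Y) c" and "d' = opp (bdry Y) c'"
		have D: "d : L.D" "d' : L.D" "opp (bdry Y) d = c" "opp (bdry Y) d' = c'" using oppY[OF C(1)] oppY[OF C(2)] d_def d'_def by auto
		have sd: "emap s d = a" "emap s d' = b"
			using sX(2)[OF C(1)] sX(2)[OF C(2)] h circles_opp(2)[OF L.circX ab(1)] circles_opp(2)[OF L.circX ab(2)] d_def d'_def by auto
		then have "L.W d = e" "L.W d' = e" using sW[OF D(1)] sW[OF D(2)] ab by auto
		then have "d : L.Dv v" "d' : L.Dv v" using Dmate[OF e D(1)] Dmate[OF e D(2)] D h by auto
		moreover have "Z d d'" using Z[OF D(1,2)] D h by simp
		ultimately show "\<exists>d d'. d : L.Dv v & d' : L.Dv v & emap s d = a & emap s d' = b & Z d d'" using sd by blast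
	qed
	have oo: "opp (skel Y) (opp (skel Y) (L.w d)) = L.w d" if "d : L.D" for d
		using L.sgY L.wE(1)[OF that] unfolding sgraph_def by blast
	have wopp_inj: "L.w d = L.w d' \<longleftrightarrow> L.w (opp (bdry Y) d) = L.w (opp (bdry Y) d')" if "d : L.D" "d' : L.D" for d d'
		using L.wE(2)[OF that(1)] L.wE(2)[OF that(2)] oo[OF that(1)] oo[OF that(2)] by metis
	have sys: "dsystem X V \<beta> mate"
		unfolding dsystem_def
	proof (intro conjI ballI)
		show "finite V" "V ~= {}" using finE ne unfolding V_def by auto
		fix v assume v: "v : V"
		interpret T: dart_transport L.fl "%d. L.W d" "L.Dv v" "L.Qv v" "L.Pv P v" "L.Nv P v" "emap s" "flip (bdry X)" "emap (att X)" by (rule tr)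
		have "L.Dv v ~= {}" using v L.org_image[of v] unfolding V_def by auto
		moreover have "ini (skel X) (emap (att X) (emap s d)) = vmap i v" if "d : L.Dv v" for d
		proof -
			note d = L.DvD(1)[OF that]
			have "ini (skel X) (L.W d) = vmap p (L.org d)" using p L.wE(1)[OF d] unfolding graph_morphism_def by auto
			also have "\<dots> = vmap i (vmap q (L.org d))" using G(3) L.wE(4)[OF d] unfolding gmap_eq_on_def gcomp_def by auto
			finally show ?thesis using sW[OF d] L.DvD(2)[OF that] by simp
		qed
		ultimately show "xblock X (\<beta> v)"
			unfolding xblock_def \<beta>_def prod.case DomQ using T.dart_block_image sX(1) L.DvD(1)[of _ v] by auto
		fix e assume e: "e : bedges X (\<beta> v)"
		obtain d where d: "d : L.Dv v" "L.W d = e" using e be by blast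
		note dD = L.DvD(1)[OF d(1)]
		have od: "opp (bdry Y) d : L.Dv (mate v e)" using Dmate[OF e dD d(2)] d(1) by blast
		show "mate v e : V" using matev[OF d] L.wE(4)[OF oppY(1)[OF dD]] unfolding V_def by auto
		have "mate (mate v e) (opp (skel X) e) = vmap q (L.org (opp (bdry Y) (opp (bdry Y) d)))"
			by (rule matev[OF od]) (use Wopp[OF dD] d in simp)
		then show "mate (mate v e) (opp (skel X) e) = v" using oppY(2)[OF dD] L.DvD(2)[OF d(1)] by simp
		show "compat X (\<beta> v) e (\<beta> (mate v e))"
			unfolding compat_def \<beta>_def prod.case
		proof (intro conjI ballI impI)
			show "e : bedges X (?S (L.Qv v), ?S (L.Pv P v), ?S (L.Nv P v))" using e unfolding \<beta>_def .
			fix a b assume ab: "a : edges (bdry X)" "b : edges (bdry X)" "emap (att X) a = e" "emap (att X) b = e"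
			show "((a, b) : ?S (L.Qv v)) = ((opp (bdry X) a, opp (bdry X) b) : ?S (L.Qv (mate v e)))"
				unfolding memS by (rule swap[OF e ab]) (rule wopp_inj)
			show "((a, b) : ?S (L.Pv P v)) = ((opp (bdry X) a, opp (bdry X) b) : ?S (L.Nv P (mate v e)))"
				unfolding memS by (rule swap[OF e ab]) (simp add: L.wE(2) oo)
			show "((a, b) : ?S (L.Nv P v)) = ((opp (bdry X) a, opp (bdry X) b) : ?S (L.Pv P (mate v e)))"
				unfolding memS by (rule swap[OF e ab]) (simp add: L.wE(2))
		qed
	qed
	have "real_of_int (euler_char (skel Y)) = (\<Sum>v\<in>V. block_chi X (\<beta> v))"
		unfolding L.euler_char_blocks[OF blk(1)] V_def
	proof (rule sum.cong[OF refl])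
		fix v
		interpret T: dart_transport L.fl "%d. L.W d" "L.Dv v" "L.Qv v" "L.Pv P v" "L.Nv P v" "emap s" "flip (bdry X)" "emap (att X)" by (rule tr)
		show "real (nclass (L.Dv v) (vrel L.fl (L.Dv v) (L.Qv v))) - real (nclass (L.Dv v) (L.Qv v)) / 2 = block_chi X (\<beta> v)"
			unfolding block_chi_def \<beta>_def fst_conv DomQ T.nclass_vrel T.nclass_Q ..
	qed
	have ta: "total_area Y = (\<Sum>v\<in>vmap q ` verts (skel Y). \<Sum>d\<in>L.Dv v. 1 / real (circ_len (bdry X) (emap s d)))"
		by (rule L.total_area_blocks) (rule area)
	have "total_area Y = (\<Sum>v\<in>V. block_area X (\<beta> v))"
		unfolding ta V_def
	proof (rule sum.cong[OF refl])
		fix v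
		interpret T: dart_transport L.fl "%d. L.W d" "L.Dv v" "L.Qv v" "L.Pv P v" "L.Nv P v" "emap s" "flip (bdry X)" "emap (att X)" by (rule tr)
		show "(\<Sum>d\<in>L.Dv v. 1 / real (circ_len (bdry X) (emap s d))) = block_area X (\<beta> v)"
			unfolding block_area_def \<beta>_def fst_conv DomQ by (simp add: sum.reindex[OF T.inj])
	qed
	with \<open>real_of_int (euler_char (skel Y)) = (\<Sum>v\<in>V. block_chi X (\<beta> v))\<close> show ?thesis using sys by blast
qed

section \<open>Realising a system of blocks by an essential map\<close>

lemma graph_isomorphism_image:
	assumes S: "sgraph S" and F: "!!e. e : edges S ==> ini F (emap h e) = vmap h (ini S e)" "!!e. e : edges S ==> opp F (emap h e) = emap h (opp S e)"
		and inj: "inj_on (vmap h) (verts S)" "inj_on (emap h) (edges S)"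
	shows "graph_isomorphism S (image_graph S F h) h"
proof -
	have S': "ini S e : verts S" "opp S e : edges S" "opp S (opp S e) = e" "opp S e ~= e" if "e : edges S" for e
		using S that unfolding sgraph_def by auto
	have "emap h (opp S e) ~= emap h e" if "e : edges S" for e
		using inj_onD[OF inj(2) _ S'(2)[OF that] that] S'(4)[OF that] by blast
	then have "sgraph (image_graph S F h)"
		unfolding sgraph_def image_graph_def using F S' by auto
	then show ?thesis
		unfolding graph_isomorphism_def graph_morphism_def bij_betw_def using S F inj S' by (auto simp: image_graph_def)
qed

text \<open>Labels are constant on the fibres of the folding \<open>q\<close>, so
  \<open>lift_inj\<close> makes the map to the fibre product injective on darts, and then on
  vertices; an injective map of graphs is an isomorphism onto its image.\<close>

lemma (in labelled_complex) essential:
	assumes or: "origami (skel Y) vl (emap p) P" and area: "!!f. f : faces Y ==> area Y f = real (cover_degree s f)"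
	shows "essential Y (standard X) p s"
proof -
	obtain K q i where K: "folds (skel Y) K q" "immersion K (skel X) i" "gmap_eq_on (skel Y) (gcomp i q) p"
		"graph_homotopy_equivalence (skel Y) K q" "\<forall>v\<in>verts (skel Y). \<forall>w\<in>verts (skel Y). vmap q v = vmap q w --> vl v = vl w"
		using origami_folds_to_immersion[OF or p covv] by blast
	have q: "graph_morphism (skel Y) K q" using K(4) unfolding graph_homotopy_equivalence_def by blast
	have qE: "ini K (emap q e) = vmap q (ini (skel Y) e)" "opp K (emap q e) = emap q (opp (skel Y) e)" if "e : E" for e
		using q that unfolding graph_morphism_def by auto
	have sE: "ini (bdry X) (emap s d) = vmap s (ini (bdry Y) d)" "opp (bdry X) (emap s d) = emap s (opp (bdry Y) d)" "emap s d : edges (bdry X)" if "d : D" for d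
		using s that unfolding immersion_def graph_morphism_def by auto
	let ?h = "gpair (gcomp q (att Y)) s"
	have inj: "d = d'" if d: "d : D" "d' : D" "vmap q (org d) = vmap q (org d')" "emap s d = emap s d'" for d d'
		using lift_inj[OF d(1,2) _ d(4)] K(5) wE(4)[OF d(1)] wE(4)[OF d(2)] d(3) by blast
	have "graph_isomorphism (bdry Y) (image_graph (bdry Y) (fibre_product K (bdry X) i (att X)) ?h) ?h"
	proof (rule graph_isomorphism_image)
		show "sgraph (bdry Y)" using circY unfolding circles_def by blast
		fix e assume e: "e : edges (bdry Y)"
		show "ini (fibre_product K (bdry X) i (att X)) (emap ?h e) = vmap ?h (ini (bdry Y) e)"
			using e qE(1)[OF wE(1)[OF e]] wE(3)[OF e] sE[OF e] by (simp add: fibre_product_def gpair_def gcomp_def)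
		show "opp (fibre_product K (bdry X) i (att X)) (emap ?h e) = emap ?h (opp (bdry Y) e)"
			using e qE(2)[OF wE(1)[OF e]] wE(2)[OF e] sE[OF e] by (simp add: fibre_product_def gpair_def gcomp_def)
	next
		show "inj_on (emap ?h) (edges (bdry Y))"
		proof (rule inj_onI)
			fix d d' assume h: "d : D" "d' : D" "emap ?h d = emap ?h d'"
			then have "emap q (w d) = emap q (w d')" "emap s d = emap s d'" by (auto simp: gpair_def gcomp_def)
			then show "d = d'" using inj[OF h(1,2)] qE(1)[OF wE(1)[OF h(1)]] qE(1)[OF wE(1)[OF h(2)]] by simp
		qed
		show "inj_on (vmap ?h) (verts (bdry Y))"
		proof (rule inj_onI)
			fix u u' assume h: "u : verts (bdry Y)" "u' : verts (bdry Y)" "vmap ?h u = vmap ?h u'"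
			then have qs: "vmap q (vmap (att Y) u) = vmap q (vmap (att Y) u')" "vmap s u = vmap s u'" by (auto simp: gpair_def gcomp_def)
			have "2 \<le> card (lk (bdry Y) u)" "2 \<le> card (lk (bdry Y) u')" using circY h unfolding circles_def by simp_all
			then obtain d c where d: "d : lk (bdry Y) u" "c : lk (bdry Y) u'" by (meson two_le_card)
			then have D: "d : D" "ini (bdry Y) d = u" "c : D" "ini (bdry Y) c = u'" by (auto simp: lk_def)
			\<comment> \<open>Darts at \<open>u\<close> and \<open>u'\<close> have images starting at one
			  vertex of a circle, so after flipping one of them if necessary the images agree.\<close>
			have "emap s c = emap s d \<or> emap s c = flip (bdry X) (emap s d)"
				by (rule flip(4)[OF circX sE(3)[OF D(1)] sE(3)[OF D(3)]]) (use sE D qs in simp)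
			then have "emap s c = emap s d \<or> emap s (fl c) = emap s d"
				using immersion_flip[OF s circY circX D(3)] flip_flip[OF circX sE(3)[OF D(1)]] by auto
			then obtain c' where c': "c' : D" "ini (bdry Y) c' = u'" "emap s c' = emap s d"
				using D flip(1,3)[OF circY D(3)] by auto
			have "d = c'" by (rule inj[OF D(1) c'(1)]) (use wE(3)[OF D(1)] wE(3)[OF c'(1)] D c' qs in auto)
			then show "u = u'" using D c' by simp
		qed
	qed
	moreover have "branched_morphism Y (standard X) p s"
		unfolding branched_morphism_def branched_complex_def using X Y p s comm area by simp
	ultimately show ?thesis
		unfolding essential_def Let_def using K X Y by (auto simp del: standard_complex) simp
qed

lemma min_class:
	fixes A :: "nat set"
	assumes "eqrel A R" "finite A" "d : A"
	shows "Min (R `` {d}) : A" "(d, Min (R `` {d})) : R" "d' : A ==> Min (R `` {d}) = Min (R `` {d'}) \<longleftrightarrow> (d, d') : R"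
proof -
	note R = eqrelD[OF assms(1)]
	have m: "(x, Min (R `` {x})) : R" if "x : A" for x
	proof -
		have "finite (R `` {x})" "R `` {x} ~= {}" using R(1,2) that assms(2) by (auto intro: finite_subset)
		from Min_in[OF this] show ?thesis by simp
	qed
	show md: "(d, Min (R `` {d})) : R" by (rule m[OF assms(3)])
	then show "Min (R `` {d}) : A" using R(1) by auto
	assume d': "d' : A"
	show "Min (R `` {d}) = Min (R `` {d'}) \<longleftrightarrow> (d, d') : R"
	proof
		assume "Min (R `` {d}) = Min (R `` {d'})"
		then show "(d, d') : R" using md m[OF d'] transD[OF R(4)] symD[OF R(3)] by metis
	next
		assume dd: "(d, d') : R"
		have "R `` {d} = R `` {d'}" using dd symD[OF R(3) dd] transD[OF R(4), of d d'] transD[OF R(4), of d' d] by blast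
		then show "Min (R `` {d}) = Min (R `` {d'})" by simp
	qed
qed

declare DomainE [rule del]

text \<open>The complex is made of copies (v, d) of the darts of the blocks. Its edges are classes
  of \<open>Q\<close> and its vertices are classes of \<open>vrel\<close>, each named by the least
  dart in it; pairs are coded as numbers because \<open>Irred\<close> has its domains there.\<close>

locale dart_system =
	fixes X :: "(nat, nat, nat, nat) two_complex" and V :: "nat set" and \<beta> :: "nat => nat block" and mate
	assumes X: "two_complex X" "finite_complex X" and sys: "dsystem X V \<beta> mate"
begin

abbreviation "pe v d \<equiv> prod_encode (v, d)"
abbreviation "f1 x \<equiv> fst (prod_decode x)"
abbreviation "f2 x \<equiv> snd (prod_decode x)"
abbreviation "Q v \<equiv> fst (\<beta> v)"
abbreviation "P v \<equiv> fst (snd (\<beta> v))"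
abbreviation "N v \<equiv> snd (snd (\<beta> v))"
abbreviation "A v \<equiv> Domain (Q v)"
abbreviation "wX \<equiv> emap (att X)"
abbreviation "iS \<equiv> ini (bdry X)"
abbreviation "oS \<equiv> opp (bdry X)"
abbreviation "oE \<equiv> opp (skel X)"
abbreviation "fX \<equiv> flip (bdry X)"

text \<open>A reflexive transitive closure is reflexive on the whole type; the restriction makes it
  an equivalence on the darts of the block.\<close>

definition "VR v = vrel fX (A v) (Q v) \<inter> A v \<times> A v"
definition "mQ v d = Min (Q v `` {d})"
definition "mV v d = Min (VR v `` {d})"

lemma circX: "circles (bdry X)" and sgX: "sgraph (skel X)" and immX: "immersion (bdry X) (skel X) (att X)"
	using X unfolding two_complex_def by auto

lemma V: "finite V" "V ~= {}" using sys unfolding dsystem_def by auto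

lemma blk:
	assumes "v : V"
	shows "A v \<subseteq> edges (bdry X)" "A v ~= {}" "dart_block fX wX (A v) (Q v) (P v) (N v)"
		"!!d d'. d : A v ==> d' : A v ==> ini (skel X) (wX d) = ini (skel X) (wX d')"
proof -
	have x: "xblock X (\<beta> v)" using sys assms unfolding dsystem_def by blast
	show "A v \<subseteq> edges (bdry X)" "A v ~= {}" "dart_block fX wX (A v) (Q v) (P v) (N v)"
		using x unfolding xblock_def case_prod_beta by auto
	obtain y where "\<forall>d\<in>A v. ini (skel X) (wX d) = y" using x unfolding xblock_def case_prod_beta by blast
	then show "ini (skel X) (wX d) = ini (skel X) (wX d')" if "d : A v" "d' : A v" for d d' using that by simp
qed

lemma fA: "v : V ==> finite (A v)" using dart_blockD(1)[OF blk(3)] .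
lemma eqQ: "v : V ==> eqrel (A v) (Q v)" using dart_blockD(2)[OF blk(3)] .
lemma eqP: "v : V ==> eqrel (A v) (P v)" using dart_blockD(3)[OF blk(3)] .
lemma eqN: "v : V ==> eqrel (A v) (N v)" using dart_blockD(4)[OF blk(3)] .
lemma flA: "v : V ==> d : A v ==> fX d : A v" using dart_blockD(8)[OF blk(3)] by blast
lemma AD: "v : V ==> d : A v ==> d : edges (bdry X)" using blk(1) by blast
lemma QP: "v : V ==> Q v \<subseteq> P v" using dart_blockD(5)[OF blk(3)] .
lemma PNW: "v : V ==> (a, b) : P v ==> wX a = wX b" "v : V ==> (a, b) : N v ==> wX a = wX b"
	using dart_blockD(7)[OF blk(3)] by blast+
lemma QW: "v : V ==> (a, b) : Q v ==> wX a = wX b" using QP PNW by blast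

lemma wXE: "d : edges (bdry X) ==> wX d : edges (skel X)" "d : edges (bdry X) ==> wX (oS d) = oE (wX d)"
	"d : edges (bdry X) ==> ini (skel X) (wX d) = vmap (att X) (iS d)"
	using immX unfolding immersion_def graph_morphism_def by auto

lemma oSD: "d : edges (bdry X) ==> oS d : edges (bdry X)" "d : edges (bdry X) ==> oS (oS d) = d" "d : edges (bdry X) ==> oS d ~= d"
	using circles_opp[OF circX] by auto

lemma eqVR: assumes v: "v : V" shows "eqrel (A v) (VR v)"
proof -
	have "sym (Q v \<union> flip_rel fX (A v))"
	proof (rule symI)
		fix a b assume "(a, b) : Q v \<union> flip_rel fX (A v)"
		then consider "(a, b) : Q v" | "a : A v" "b = fX a" unfolding flip_rel_def by blast
		then show "(b, a) : Q v \<union> flip_rel fX (A v)"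
		proof cases
			case 1 then show ?thesis using symD[OF eqrelD(3)[OF eqQ[OF v]]] by blast
		next
			case 2
			then have "a = fX b" "b : A v" using flip_flip[OF circX AD[OF v]] flA[OF v] by auto
			then show ?thesis unfolding flip_rel_def by blast
		qed
	qed
	then have "sym (vrel fX (A v) (Q v))" unfolding vrel_def by (rule sym_rtrancl)
	moreover have "trans (vrel fX (A v) (Q v))" unfolding vrel_def by (rule trans_rtrancl)
	ultimately show ?thesis unfolding eqrel_def VR_def
		by (auto intro!: symI transI dest: symD transD simp: vrel_def)
qed

lemma mQ: "v : V ==> d : A v ==> mQ v d : A v" "v : V ==> d : A v ==> (d, mQ v d) : Q v"
	"v : V ==> d : A v ==> d' : A v ==> mQ v d = mQ v d' \<longleftrightarrow> (d, d') : Q v"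
	unfolding mQ_def using min_class[OF eqQ fA] by blast+

lemma mV: "v : V ==> d : A v ==> mV v d : A v" "v : V ==> d : A v ==> (d, mV v d) : VR v"
	"v : V ==> d : A v ==> d' : A v ==> mV v d = mV v d' \<longleftrightarrow> (d, d') : VR v"
	unfolding mV_def using min_class[OF eqVR fA] by blast+

lemma mQ_idem: "v : V ==> d : A v ==> mQ v (mQ v d) = mQ v d"
	using mQ(3)[of v d "mQ v d"] mQ(1,2)[of v d] by auto

lemma wX_mQ: "v : V ==> d : A v ==> wX (mQ v d) = wX d"
	using QW[OF _ mQ(2)] by metis

lemma QVR: assumes "v : V" "(a, b) : Q v" shows "(a, b) : VR v"
	using assms eqrelD(1)[OF eqQ[OF assms(1)]] unfolding VR_def vrel_def by auto

lemma mV_mQ: assumes "v : V" "d : A v" shows "mV v (mQ v d) = mV v d"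
	using mV(3)[OF assms mQ(1)[OF assms]] QVR[OF assms(1) mQ(2)[OF assms]] by simp

lemma mV_fX: assumes "v : V" "d : A v" shows "mV v (fX d) = mV v d"
proof -
	have "(d, fX d) : VR v" using assms flA[OF assms] unfolding VR_def vrel_def flip_rel_def by auto
	then show ?thesis using mV(3)[OF assms flA[OF assms]] by simp
qed

lemma mate:
	assumes v: "v : V" and d: "d : A v"
	shows "mate v (wX d) : V" "oS d : A (mate v (wX d))" "mate (mate v (wX d)) (oE (wX d)) = v"
		"d' : A v ==> wX d' = wX d ==> (d, d') : Q v \<longleftrightarrow> (oS d, oS d') : Q (mate v (wX d))"
		"d' : A v ==> wX d' = wX d ==> (d, d') : N v \<longleftrightarrow> (oS d, oS d') : P (mate v (wX d))"
proof -
	have be: "wX d : bedges X (\<beta> v)" using d unfolding bedges_def by simp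
	then have c: "compat X (\<beta> v) (wX d) (\<beta> (mate v (wX d)))" and "mate v (wX d) : V" "mate (mate v (wX d)) (oE (wX d)) = v"
		using sys v unfolding dsystem_def by blast+
	then show "mate v (wX d) : V" "mate (mate v (wX d)) (oE (wX d)) = v" by auto
	have c': "((d, d') : Q v \<longleftrightarrow> (oS d, oS d') : Q (mate v (wX d))) & ((d, d') : N v \<longleftrightarrow> (oS d, oS d') : P (mate v (wX d)))"
		if "d' : A v" "wX d' = wX d" for d'
		using c AD[OF v d] AD[OF v that(1)] that(2) unfolding compat_def case_prod_beta by blast
	show "oS d : A (mate v (wX d))" using c'[OF d refl] eqrelD(2)[OF eqQ[OF v]] d by blast
	show "d' : A v ==> wX d' = wX d ==> (d, d') : Q v \<longleftrightarrow> (oS d, oS d') : Q (mate v (wX d))"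
		"d' : A v ==> wX d' = wX d ==> (d, d') : N v \<longleftrightarrow> (oS d, oS d') : P (mate v (wX d))" using c' by blast+
qed

lemma mQ_oS:
	assumes v: "v : V" and d: "d : A v" "d' : A v" "(d, d') : Q v"
	shows "mQ (mate v (wX d)) (oS d) = mQ (mate v (wX d)) (oS d')"
proof -
	have w: "wX d' = wX d" using QW[OF v d(3)] by simp
	have "oS d' : A (mate v (wX d))" using mate(2)[OF v d(2)] w by simp
	then show ?thesis using mQ(3)[OF mate(1)[OF v d(1)] mate(2)[OF v d(1)]] mate(4)[OF v d(1,2) w] d(3) by simp
qed

definition Ysk :: "(nat, nat) sgraph" where
	"Ysk = \<lparr>verts = {pe v (mV v d) | v d. v : V & d : A v}, edges = {pe v (mQ v d) | v d. v : V & d : A v},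
		 ini = (%x. pe (f1 x) (mV (f1 x) (f2 x))),
		 opp = (%x. pe (mate (f1 x) (wX (f2 x))) (mQ (mate (f1 x) (wX (f2 x))) (oS (f2 x))))\<rparr>"

definition Ybd :: "(nat, nat) sgraph" where
	"Ybd = \<lparr>verts = {pe v (iS d) | v d. v : V & d : A v}, edges = {pe v d | v d. v : V & d : A v},
		 ini = (%x. pe (f1 x) (iS (f2 x))), opp = (%x. pe (mate (f1 x) (wX (f2 x))) (oS (f2 x)))\<rparr>"

text \<open>The vertex map sees only a vertex of a circle. The two darts starting there are flips of
  each other and give the same vertex class, so the choice is harmless
  (\<open>Yatt_vmap\<close>).\<close>

definition Yatt :: "(nat, nat, nat, nat) gmap" where
	"Yatt = \<lparr>vmap = (%x. pe (f1 x) (mV (f1 x) (SOME d. d : A (f1 x) & iS d = f2 x))), emap = (%x. pe (f1 x) (mQ (f1 x) (f2 x)))\<rparr>"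

definition sM :: "(nat, nat, nat, nat) gmap" where "sM = \<lparr>vmap = (%x. f2 x), emap = (%x. f2 x)\<rparr>"
definition pM :: "(nat, nat, nat, nat) gmap" where "pM = \<lparr>vmap = (%x. ini (skel X) (wX (f2 x))), emap = (%x. wX (f2 x))\<rparr>"

text \<open>The areas are forced: over faces of area 1 a branched morphism must have area equal to
  degree.\<close>

definition Y :: "(nat, nat, nat, nat) branched_complex" where
	"Y = \<lparr>skel = Ysk, bdry = Ybd, att = Yatt, area = (%f. real (cover_degree sM f))\<rparr>"

lemma Y_simps [simp]:
	"skel Y = Ysk" "bdry Y = Ybd" "att Y = Yatt" "area Y f = real (cover_degree sM f)"
	"ini Ysk (pe v d) = pe v (mV v d)" "opp Ysk (pe v d) = pe (mate v (wX d)) (mQ (mate v (wX d)) (oS d))"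
	"ini Ybd (pe v d) = pe v (iS d)" "opp Ybd (pe v d) = pe (mate v (wX d)) (oS d)"
	"emap Yatt (pe v d) = pe v (mQ v d)" "vmap sM (pe v d) = d" "emap sM (pe v d) = d"
	"vmap pM (pe v d) = ini (skel X) (wX d)" "emap pM (pe v d) = wX d"
	by (simp_all add: Y_def Ysk_def Ybd_def Yatt_def sM_def pM_def)

lemma Y_edges: "x : edges Ybd \<longleftrightarrow> (\<exists>v d. x = pe v d & v : V & d : A v)" "x : verts Ybd \<longleftrightarrow> (\<exists>v d. x = pe v (iS d) & v : V & d : A v)"
	"x : edges Ysk \<longleftrightarrow> (\<exists>v d. x = pe v (mQ v d) & v : V & d : A v)" "x : verts Ysk \<longleftrightarrow> (\<exists>v d. x = pe v (mV v d) & v : V & d : A v)"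
	by (auto simp: Ysk_def Ybd_def)

lemma pe_in: "pe v d : edges Ybd \<longleftrightarrow> v : V & d : A v" using Y_edges(1) by auto

lemma Yatt_vmap:
	assumes v: "v : V" and d: "d : A v"
	shows "vmap Yatt (pe v (iS d)) = pe v (mV v d)"
proof -
	define c where "c = (SOME c. c : A v & iS c = iS d)"
	have "c : A v & iS c = iS d" unfolding c_def by (rule someI[of _ d]) (use d in simp)
	then have "c = d \<or> c = fX d" using flip(4)[OF circX AD[OF v d]] AD[OF v] by blast
	then have "mV v c = mV v d" using mV_fX[OF v d] by auto
	then show ?thesis by (simp add: Yatt_def c_def)
qed

lemma lkY:
	assumes v: "v : V" and d: "d : A v"
	shows "lk Ybd (pe v (iS d)) = {pe v d, pe v (fX d)}"
proof (intro set_eqI iffI)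
	fix x assume "x : lk Ybd (pe v (iS d))"
	then obtain c where c: "x = pe v c" "c : A v" "iS c = iS d" by (auto simp: lk_def Y_edges)
	then have "c = d \<or> c = fX d" using flip(4)[OF circX AD[OF v d] AD[OF v c(2)]] by blast
	then show "x : {pe v d, pe v (fX d)}" using c by auto
next
	fix x assume "x : {pe v d, pe v (fX d)}"
	then show "x : lk Ybd (pe v (iS d))" using flA[OF v d] v d flip(3)[OF circX AD[OF v d]] by (auto simp: lk_def pe_in)
qed

lemma sgraph_Ybd: "sgraph Ybd"
	unfolding sgraph_def
proof (intro ballI)
	fix x assume "x : edges Ybd"
	then obtain v d where x: "x = pe v d" "v : V" "d : A v" using Y_edges(1) by blast
	note m = mate[OF x(2,3)] and D = AD[OF x(2,3)]
	show "ini Ybd x : verts Ybd & opp Ybd x : edges Ybd & opp Ybd (opp Ybd x) = x & opp Ybd x ~= x"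
		using x m(1-3) oSD[OF D] wXE(2)[OF D] Y_edges(2) by (auto simp: pe_in)
qed

lemma finite_Y: "finite (verts Ybd)" "finite (edges Ybd)" "finite (verts Ysk)" "finite (edges Ysk)"
proof -
	have f: "finite (Sigma V A)" using V(1) fA by auto
	have "verts Ybd = (%(v, d). pe v (iS d)) ` Sigma V A" "edges Ybd = (%(v, d). pe v d) ` Sigma V A"
		"verts Ysk = (%(v, d). pe v (mV v d)) ` Sigma V A" "edges Ysk = (%(v, d). pe v (mQ v d)) ` Sigma V A"
		unfolding Ybd_def Ysk_def by force+
	then show "finite (verts Ybd)" "finite (edges Ybd)" "finite (verts Ysk)" "finite (edges Ysk)" using f by simp_all
qed

lemma circles_Ybd: "circles Ybd"
	unfolding circles_def
proof (intro conjI ballI)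
	show "sgraph Ybd" by (rule sgraph_Ybd)
	fix u assume "u : verts Ybd"
	then obtain v d where x: "u = pe v (iS d)" "v : V" "d : A v" using Y_edges(2) by blast
	then show "card (lk Ybd u) = 2" using lkY flip(2)[OF circX AD[OF x(2,3)]] by auto
next
	fix C assume "C : graph_components Ybd"
	then have "C \<subseteq> verts Ybd" unfolding graph_components_def by (rule in_quotient_imp_subset[OF equiv_reach[OF sgraph_Ybd]])
	then show "finite C" using finite_Y(1) by (rule finite_subset)
qed

lemma sgraph_Ysk: "sgraph Ysk"
	unfolding sgraph_def
proof (intro ballI)
	fix x assume "x : edges Ysk"
	then obtain v d0 where x0: "x = pe v (mQ v d0)" "v : V" "d0 : A v" using Y_edges(3) by blast
	define d where "d = mQ v d0"
	have x: "x = pe v d" "v : V" "d : A v" "mQ v d = d" using x0 mQ(1) mQ_idem unfolding d_def by auto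
	note m = mate[OF x(2,3)] and D = AD[OF x(2,3)]
	let ?v = "mate v (wX d)"
	let ?m = "mQ ?v (oS d)"
	have mm: "?m : A ?v" "(oS d, ?m) : Q ?v" using mQ(1,2)[OF m(1,2)] by auto
	have w: "wX ?m = oE (wX d)" using wX_mQ[OF m(1,2)] wXE(2)[OF D] by simp
	have "mQ (mate ?v (wX (oS d))) (oS (oS d)) = mQ (mate ?v (wX (oS d))) (oS ?m)" by (rule mQ_oS[OF m(1,2) mm])
	then have "mQ v (oS ?m) = d" using m(3) wXE(2)[OF D] oSD(2)[OF D] x(4) by simp
	moreover have "oE (wX d) ~= wX d" using sgX wXE(1)[OF D] unfolding sgraph_def by blast
	then have "opp Ysk x ~= x" using w x by auto
	ultimately show "ini Ysk x : verts Ysk & opp Ysk x : edges Ysk & opp Ysk (opp Ysk x) = x & opp Ysk x ~= x"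
		using x m w Y_edges(3,4) by auto
qed

lemma immersion_Yatt: "immersion Ybd Ysk Yatt"
	unfolding immersion_def graph_morphism_def
proof (intro conjI ballI)
	show "sgraph Ybd" "sgraph Ysk" by (rule sgraph_Ybd sgraph_Ysk)+
	fix u assume "u : verts Ybd"
	then obtain v d where x: "u = pe v (iS d)" "v : V" "d : A v" using Y_edges(2) by blast
	then show "vmap Yatt u : verts Ysk" using Yatt_vmap Y_edges(4) by auto
	show "inj_on (emap Yatt) (lk Ybd u)"
	proof -
		have D: "d : edges (bdry X)" by (rule AD[OF x(2,3)])
		note f = flip[OF circX D]
		have "inj_on wX (lk (bdry X) (iS d))" using immX circles_opp(4)[OF circX D] unfolding immersion_def by blast
		then have "wX d ~= wX (fX d)" using f D by (auto simp: lk_def inj_on_def)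
		then have "mQ v d ~= mQ v (fX d)" using mQ(3)[OF x(2,3) flA[OF x(2,3)]] QW[OF x(2)] by blast
		then show ?thesis using x lkY[OF x(2,3)] by (auto simp: inj_on_def)
	qed
next
	fix x assume "x : edges Ybd"
	then obtain v d where x: "x = pe v d" "v : V" "d : A v" using Y_edges(1) by blast
	show "emap Yatt x : edges Ysk" "ini Ysk (emap Yatt x) = vmap Yatt (ini Ybd x)"
		using x Y_edges(3) mV_mQ[OF x(2,3)] Yatt_vmap[OF x(2,3)] by auto
	show "opp Ysk (emap Yatt x) = emap Yatt (opp Ybd x)"
		using x wX_mQ[OF x(2,3)] mQ_oS[OF x(2,3) mQ(1,2)[OF x(2,3)]] by simp
qed

lemma morphism_pM: "graph_morphism Ysk (skel X) pM"
	unfolding graph_morphism_def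
proof (intro conjI ballI)
	show "sgraph Ysk" "sgraph (skel X)" by (rule sgraph_Ysk sgX)+
	fix y assume "y : verts Ysk"
	then obtain v d where x: "y = pe v (mV v d)" "v : V" "d : A v" using Y_edges(4) by blast
	then show "vmap pM y : verts (skel X)" using wXE(1)[OF AD[OF x(2) mV(1)[OF x(2,3)]]] sgX unfolding sgraph_def by auto
next
	fix x assume "x : edges Ysk"
	then obtain v d0 where x0: "x = pe v (mQ v d0)" "v : V" "d0 : A v" using Y_edges(3) by blast
	define d where "d = mQ v d0"
	have x: "x = pe v d" "v : V" "d : A v" using x0 mQ(1) unfolding d_def by auto
	note D = AD[OF x(2,3)]
	show "emap pM x : edges (skel X)" using x wXE(1)[OF D] by simp
	show "ini (skel X) (emap pM x) = vmap pM (ini Ysk x)"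
		using x blk(4)[OF x(2,3) mV(1)[OF x(2,3)]] by simp
	show "oE (emap pM x) = emap pM (opp Ysk x)"
		using x wX_mQ[OF mate(1,2)[OF x(2,3)]] wXE(2)[OF D] by simp
qed

lemma immersion_sM: "immersion Ybd (bdry X) sM"
	unfolding immersion_def graph_morphism_def
proof (intro conjI ballI)
	show "sgraph Ybd" "sgraph (bdry X)" using sgraph_Ybd circX unfolding circles_def by auto
	fix u assume "u : verts Ybd"
	then obtain v d where x: "u = pe v (iS d)" "v : V" "d : A v" using Y_edges(2) by blast
	then show "vmap sM u : verts (bdry X)" using circles_opp(4)[OF circX AD[OF x(2,3)]] by simp
	show "inj_on (emap sM) (lk Ybd u)" using x lkY[OF x(2,3)] by (auto simp: inj_on_def)
next
	fix x assume "x : edges Ybd"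
	then obtain v d where x: "x = pe v d" "v : V" "d : A v" using Y_edges(1) by blast
	then show "emap sM x : edges (bdry X)" "iS (emap sM x) = vmap sM (ini Ybd x)" "oS (emap sM x) = emap sM (opp Ybd x)"
		using AD[OF x(2,3)] by auto
qed

lemma labelled: "labelled_complex X Y pM sM (%x. f1 x)"
proof
	show "two_complex X" "finite_complex X" by (rule X)+
	show "two_complex Y" unfolding two_complex_def using sgraph_Ysk circles_Ybd immersion_Yatt by simp
	show "finite_complex Y" unfolding finite_complex_def finite_sgraph_def using finite_Y by simp
	show "graph_morphism (skel Y) (skel X) pM" using morphism_pM by simp
	show "immersion (bdry Y) (bdry X) sM" using immersion_sM by simp
	show "gmap_eq_on (bdry Y) (gcomp pM (att Y)) (gcomp (att X) sM)"
		unfolding gmap_eq_on_def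
	proof (intro conjI ballI)
		fix u assume "u : verts (bdry Y)"
		then obtain v d where x: "u = pe v (iS d)" "v : V" "d : A v" using Y_edges(2) by auto
		then show "vmap (gcomp pM (att Y)) u = vmap (gcomp (att X) sM) u"
			using Yatt_vmap[OF x(2,3)] blk(4)[OF x(2,3) mV(1)[OF x(2,3)]] wXE(3)[OF AD[OF x(2,3)]] by (simp add: gcomp_def)
	next
		fix x assume "x : edges (bdry Y)"
		then obtain v d where x: "x = pe v d" "v : V" "d : A v" using Y_edges(1) by auto
		then show "emap (gcomp pM (att Y)) x = emap (gcomp (att X) sM) x"
			using wX_mQ[OF x(2,3)] by (simp add: gcomp_def)
	qed
	show "d = d'" if "d : edges (bdry Y)" "d' : edges (bdry Y)" "f1 (ini (skel Y) (emap (att Y) d)) = f1 (ini (skel Y) (emap (att Y) d'))"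
		 "emap sM d = emap sM d'" for d d' using that Y_edges(1) by auto
	show "\<exists>d\<in>edges (bdry Y). emap (att Y) d = e" if e: "e : edges (skel Y)" for e
	proof -
		obtain v d where "e = pe v (mQ v d)" "v : V" "d : A v" using e Y_edges(3) by auto
		then show ?thesis by (intro bexI[of _ "pe v d"]) (auto simp: pe_in)
	qed
	show "\<exists>e\<in>edges (skel Y). ini (skel Y) e = y" if y: "y : verts (skel Y)" for y
	proof -
		obtain v d where x: "y = pe v (mV v d)" "v : V" "d : A v" using y Y_edges(4) by auto
		then show ?thesis using mV_mQ[OF x(2,3)] Y_edges(3) by (intro bexI[of _ "pe v (mQ v d)"]) auto
	qed
qed

sublocale L: labelled_complex X Y pM sM "%x. f1 x" by (rule labelled)

text \<open>The global origami is the union of the relations \<open>P\<close> of the blocks, which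
  is consistent since \<open>Q v\<close> is contained in \<open>P v\<close>.\<close>

definition "Pr = {(pe v (mQ v d), pe v (mQ v d')) | v d d'. v : V & (d, d') : P v}"

lemma PrI: "v : V ==> d : A v ==> d' : A v ==> (pe v (mQ v d), pe v (mQ v d')) : Pr \<longleftrightarrow> (d, d') : P v"
proof
	assume v: "v : V" and d: "d : A v" "d' : A v" and r: "(pe v (mQ v d), pe v (mQ v d')) : Pr"
	then obtain c c' where c: "mQ v d = mQ v c" "mQ v d' = mQ v c'" "(c, c') : P v" unfolding Pr_def by auto
	note P = eqrelD[OF eqP[OF v]]
	have "c : A v" "c' : A v" using c(3) P(1) by auto
	then have "(d, c) : P v" "(d', c') : P v" using c mQ(3)[OF v] d QP[OF v] by auto
	then show "(d, d') : P v" using c(3) transD[OF P(4)] symD[OF P(3)] by metis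
qed (auto simp: Pr_def)

lemma PrD: "(x, y) : Pr ==> \<exists>v d d'. x = pe v (mQ v d) & y = pe v (mQ v d') & v : V & d : A v & d' : A v & (d, d') : P v"
	unfolding Pr_def using eqrelD(1)[OF eqP] by blast

lemma eqrel_Pr: "eqrel L.E Pr"
	unfolding eqrel_def
proof (intro conjI)
	show "Pr \<subseteq> L.E \<times> L.E" using PrD Y_edges(3) by fastforce
	show "\<forall>e\<in>L.E. (e, e) : Pr"
	proof
		fix e assume "e : L.E"
		then obtain v d where x: "e = pe v (mQ v d)" "v : V" "d : A v" using Y_edges(3) by auto
		then show "(e, e) : Pr" using PrI[OF x(2,3,3)] eqrelD(2)[OF eqP[OF x(2)]] by simp
	qed
	show "sym Pr"
	proof (rule symI)
		fix x y assume "(x, y) : Pr"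
		then obtain v d d' where h: "x = pe v (mQ v d)" "y = pe v (mQ v d')" "v : V" "(d, d') : P v" using PrD by blast
		then have "(d', d) : P v" using symD[OF eqrelD(3)[OF eqP[OF h(3)]]] by blast
		then show "(y, x) : Pr" using h unfolding Pr_def by blast
	qed
	show "trans Pr"
	proof (rule transI)
		fix x y z assume "(x, y) : Pr" "(y, z) : Pr"
		then obtain v d d' v' c c' where h: "x = pe v (mQ v d)" "y = pe v (mQ v d')" "v : V" "d : A v" "d' : A v" "(d, d') : P v"
			"y = pe v' (mQ v' c)" "z = pe v' (mQ v' c')" "c : A v'" "c' : A v'" "(c, c') : P v'" using PrD by meson
		then have v: "v' = v" and "mQ v d' = mQ v c" by auto
		then have "(d', c) : Q v" using mQ(3)[OF h(3,5), of c] h(9) by simp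
		then have dc: "(d', c) : P v" using QP[OF h(3)] by blast
		note tr = transD[OF eqrelD(4)[OF eqP[OF h(3)]]]
		have "(d, c') : P v" using tr[OF tr[OF h(6) dc]] h(11) v by simp
		then show "(x, z) : Pr" using h v unfolding Pr_def by blast
	qed
qed

lemma Dv_eq: assumes v: "v : V" shows "L.Dv v = (%d. pe v d) ` A v"
	using v unfolding L.Dv_def by (auto simp: Y_edges image_iff)

lemma fl_eq: assumes v: "v : V" "d : A v" shows "L.fl (pe v d) = pe v (fX d)"
proof -
	have "pe v (fX d) = pe v d \<or> pe v (fX d) = flip Ybd (pe v d)"
		by (rule flip(4)[OF circles_Ybd]) (use v flA[OF v] flip(3)[OF circX AD[OF v]] in \<open>auto simp: pe_in\<close>)
	then show ?thesis using flip(2)[OF circX AD[OF v]] by auto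
qed

lemma transport: assumes v: "v : V"
	shows "dart_transport fX wX (A v) (Q v) (P v) (N v) (%d. pe v d) L.fl (%d. L.W d)"
proof
	show "dart_block fX wX (A v) (Q v) (P v) (N v)" by (rule blk(3)[OF v])
	show "inj_on (%d. pe v d) (A v)" by (simp add: inj_on_def)
	show "L.fl (pe v d) = pe v (fX d)" if "d : A v" for d by (rule fl_eq[OF v that])
	show "L.W (pe v d) = wX d" if "d : A v" for d using wX_mQ[OF v that] by simp
qed

text \<open>The third identity is where compatibility enters: relating opposite edges at
  \<open>v\<close> means relating edges in the block of the mate, and there \<open>P\<close> is the
  relation \<open>N\<close> of \<open>v\<close>. Darts over different edges of X are related on
  neither side.\<close>

lemma rel_eq: assumes v: "v : V"
	shows "L.Qv v = map_prod (%d. pe v d) (%d. pe v d) ` Q v" "L.Pv Pr v = map_prod (%d. pe v d) (%d. pe v d) ` P v"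
		"L.Nv Pr v = map_prod (%d. pe v d) (%d. pe v d) ` N v"
proof -
	have eqI: "R = map_prod (%d. pe v d) (%d. pe v d) ` R0"
		if R: "R \<subseteq> L.Dv v \<times> L.Dv v" "R0 \<subseteq> A v \<times> A v" "!!d d'. d : A v ==> d' : A v ==> (pe v d, pe v d') : R \<longleftrightarrow> (d, d') : R0" for R R0
	proof (intro set_eqI iffI)
		fix z assume "z : R"
		then obtain d d' where "z = (pe v d, pe v d')" "d : A v" "d' : A v" using R(1) unfolding Dv_eq[OF v] by auto
		then show "z : map_prod (%d. pe v d) (%d. pe v d) ` R0" using R(3) \<open>z : R\<close> by auto
	next
		fix z assume "z : map_prod (%d. pe v d) (%d. pe v d) ` R0"
		then obtain d d' where "z = (pe v d, pe v d')" "(d, d') : R0" by auto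
		then show "z : R" using R(2,3) by auto
	qed
	have mem: "pe v d : L.Dv v" if "d : A v" for d using that unfolding Dv_eq[OF v] by simp
	show "L.Qv v = map_prod (%d. pe v d) (%d. pe v d) ` Q v"
		by (rule eqI) (use mem mQ(3)[OF v] eqrelD(1)[OF eqQ[OF v]] in \<open>auto simp: L.Qv_def\<close>)
	show "L.Pv Pr v = map_prod (%d. pe v d) (%d. pe v d) ` P v"
		by (rule eqI) (use mem PrI[OF v] eqrelD(1)[OF eqP[OF v]] in \<open>auto simp: L.Pv_def\<close>)
	show "L.Nv Pr v = map_prod (%d. pe v d) (%d. pe v d) ` N v"
	proof (rule eqI)
		show "L.Nv Pr v \<subseteq> L.Dv v \<times> L.Dv v" by (auto simp: L.Nv_def)
		show "N v \<subseteq> A v \<times> A v" by (rule eqrelD(1)[OF eqN[OF v]])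
		fix d d' assume d: "d : A v" "d' : A v"
		have o: "opp (skel Y) (L.w (pe v c)) = pe (mate v (wX c)) (mQ (mate v (wX c)) (oS c))" if "c : A v" for c
			using wX_mQ[OF v that] mQ_oS[OF v that mQ(1,2)[OF v that]] by simp
		have "(pe (mate v (wX d)) (mQ (mate v (wX d)) (oS d)), pe (mate v (wX d')) (mQ (mate v (wX d')) (oS d'))) : Pr \<longleftrightarrow> (d, d') : N v"
		proof (cases "wX d' = wX d")
			case True
			then have "oS d' : A (mate v (wX d))" using mate(2)[OF v d(2)] by simp
			then show ?thesis using True PrI[OF mate(1,2)[OF v d(1)]] mate(5)[OF v d True] by simp
		next
			case False
			have "(d, d') \<notin> N v" using PNW(2)[OF v] False by metis
			moreover have "(pe (mate v (wX d)) (mQ (mate v (wX d)) (oS d)), pe (mate v (wX d')) (mQ (mate v (wX d')) (oS d'))) \<notin> Pr"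
			proof
				assume r: "(pe (mate v (wX d)) (mQ (mate v (wX d)) (oS d)), pe (mate v (wX d')) (mQ (mate v (wX d')) (oS d'))) : Pr"
				then have mm: "mate v (wX d) = mate v (wX d')" using PrD by fastforce
				then have "(oS d, oS d') : P (mate v (wX d))" using r PrI[OF mate(1,2)[OF v d(1)]] mate(2)[OF v d(2)] by simp
				then have "wX (oS d) = wX (oS d')" by (rule PNW(1)[OF mate(1)[OF v d(1)]])
				then have "oE (wX d) = oE (wX d')" using wXE(2) AD[OF v d(1)] AD[OF v d(2)] by simp
				then show False using False sgX wXE(1)[OF AD[OF v d(1)]] wXE(1)[OF AD[OF v d(2)]] unfolding sgraph_def by metis
			qed
			ultimately show ?thesis by blast
		qed
		then show "(pe v d, pe v d') : L.Nv Pr v \<longleftrightarrow> (d, d') : N v" unfolding L.Nv_def mem_Collect_eq case_prod_conv o[OF d(1)] o[OF d(2)] using mem[OF d(1)] mem[OF d(2)] by blast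
	qed
qed

lemma vls: "(%x. f1 x) ` verts (skel Y) = V"
proof
	show "(%x. f1 x) ` verts (skel Y) \<subseteq> V" using Y_edges(4) by auto
	show "V \<subseteq> (%x. f1 x) ` verts (skel Y)"
	proof
		fix v assume v: "v : V"
		then obtain d where "d : A v" using blk(2) by blast
		then show "v : (%x. f1 x) ` verts (skel Y)" using v Y_edges(4) by (auto intro!: image_eqI[of _ _ "pe v (mV v d)"])
	qed
qed

lemma Y_Irred: "(Y, pM, sM) : Irred (standard X)"
	"real_of_int (euler_char (skel Y)) = (\<Sum>v\<in>V. block_chi X (\<beta> v))" "total_area Y = (\<Sum>v\<in>V. block_area X (\<beta> v))"
proof -
	have cl: "L.conn_links"
		unfolding L.conn_links_def
	proof (intro allI ballI impI)
		fix v a b assume h: "a : L.Dv v" "b : L.Dv v" "L.org a = L.org b"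
		have v: "v : V" using L.wE(4)[OF L.DvD(1)[OF h(1)]] L.DvD(2)[OF h(1)] vls by auto
		interpret T: dart_transport fX wX "A v" "Q v" "P v" "N v" "%d. pe v d" L.fl "%d. L.W d" by (rule transport[OF v])
		obtain d d' where d: "a = pe v d" "b = pe v d'" "d : A v" "d' : A v" using h unfolding Dv_eq[OF v] by auto
		then have "mV v d = mV v d'" using h(3) mV_mQ[OF v] by simp
		then have "(d, d') : vrel fX (A v) (Q v)" using mV(3)[OF v d(3,4)] unfolding VR_def by simp
		then show "(a, b) : vrel L.fl (L.Dv v) (L.Qv v)" unfolding rel_eq[OF v] Dv_eq[OF v] d using T.vrel_iff d by simp
	qed
	have blk': "dart_block L.fl (%d. L.W d) (L.Dv v) (L.Qv v) (L.Pv Pr v) (L.Nv Pr v)" if v: "v : V" for v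
	proof -
		interpret T: dart_transport fX wX "A v" "Q v" "P v" "N v" "%d. pe v d" L.fl "%d. L.W d" by (rule transport[OF v])
		show ?thesis unfolding rel_eq[OF v] Dv_eq[OF v] by (rule T.dart_block_image)
	qed
	have blk'': "dart_block L.fl (%d. L.W d) (L.Dv (f1 (L.org d))) (L.Qv (f1 (L.org d))) (L.Pv Pr (f1 (L.org d))) (L.Nv Pr (f1 (L.org d)))"
		if d: "d : L.D" for d by (rule blk') (use L.wE(4)[OF d] vls in auto)
	have eform: "\<exists>v d. e = pe v d & v : V & d : A v" if "e : L.E" for e using that Y_edges(3) mQ(1) by auto
	have or: "origami (skel Y) (%x. f1 x) (emap pM) Pr"
	proof (rule L.origami_of_blocks[OF cl blk'' eqrel_Pr])
		show "lab (skel Y) (%x. f1 x) (emap pM) e = lab (skel Y) (%x. f1 x) (emap pM) f" if ef: "(e, f) : Pr" for e f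
		proof -
			obtain v d d' where "e = pe v (mQ v d)" "f = pe v (mQ v d')" "v : V" "d : A v" "d' : A v" "(d, d') : P v" using PrD[OF ef] by blast
			then show ?thesis using PNW(1) wX_mQ by (auto simp: lab_def)
		qed
		show "f1 (ini (skel Y) (opp (skel Y) e)) = f1 (ini (skel Y) (opp (skel Y) f))"
			if ef: "e : L.E" "f : L.E" "lab (skel Y) (%x. f1 x) (emap pM) e = lab (skel Y) (%x. f1 x) (emap pM) f" for e f
		proof -
			obtain v d v' d' where "e = pe v d" "f = pe v' d'" using eform ef(1,2) by meson
			then show ?thesis using ef(3) by (auto simp: lab_def)
		qed
	qed
	have "essential Y (standard X) pM sM" by (rule L.essential[OF or]) simp
	moreover have "visibly_irreducible Y" by (rule L.visibly_irreducible_of_blocks[OF cl blk''])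
	moreover have "verts (skel Y) ~= {}" using vls V by auto
	ultimately show "(Y, pM, sM) : Irred (standard X)" unfolding Irred_def by blast
	show "real_of_int (euler_char (skel Y)) = (\<Sum>v\<in>V. block_chi X (\<beta> v))"
		unfolding L.euler_char_blocks[OF cl] vls
	proof (rule sum.cong[OF refl])
		fix v assume v: "v : V"
		interpret T: dart_transport fX wX "A v" "Q v" "P v" "N v" "%d. pe v d" L.fl "%d. L.W d" by (rule transport[OF v])
		show "real (nclass (L.Dv v) (vrel L.fl (L.Dv v) (L.Qv v))) - real (nclass (L.Dv v) (L.Qv v)) / 2 = block_chi X (\<beta> v)"
			unfolding block_chi_def rel_eq[OF v] Dv_eq[OF v] T.nclass_vrel T.nclass_Q ..
	qed
	have ta: "total_area Y = (\<Sum>v\<in>(%x. f1 x) ` verts (skel Y). \<Sum>d\<in>L.Dv v. 1 / real (circ_len (bdry X) (emap sM d)))"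
		by (rule L.total_area_blocks) simp
	show "total_area Y = (\<Sum>v\<in>V. block_area X (\<beta> v))"
		unfolding ta vls
	proof (rule sum.cong[OF refl])
		fix v assume v: "v : V"
		show "(\<Sum>d\<in>L.Dv v. 1 / real (circ_len (bdry X) (emap sM d))) = block_area X (\<beta> v)"
			unfolding block_area_def Dv_eq[OF v] by (simp add: sum.reindex inj_on_def)
	qed
qed

end

section \<open>Linear programming\<close>

text \<open>Eliminating one variable after another produces finitely many nonnegative row
  combinations that annihilate the matrix and decide feasibility. They depend on the matrix alone
  and serve every right-hand side at once, which is what permits a right-hand side with a
  parameter.\<close>

lemma fourier_motzkin:
	fixes A :: "'i => 'j => 'a :: linordered_field"
	assumes I: "finite I" and J: "finite J"
	shows "\<exists>\<Lambda> :: ('i => 'a) set. finite \<Lambda> & (\<forall>l\<in>\<Lambda>. \<forall>i\<in>I. 0 \<le> l i) & (\<forall>l\<in>\<Lambda>. \<forall>j\<in>J. (\<Sum>i\<in>I. l i * A i j) = 0) &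
		 (\<forall>b. (\<forall>l\<in>\<Lambda>. 0 \<le> (\<Sum>i\<in>I. l i * b i)) --> (\<exists>y. \<forall>i\<in>I. (\<Sum>j\<in>J. A i j * y j) \<le> b i))"
	using J
proof (induction J rule: finite_induct)
	case empty
	define u :: "'i => 'i => 'a" where "u i k = (if k = i then 1 else 0)" for i k
	have ub: "(\<Sum>k\<in>I. u i k * b k) = b i" if "i : I" for i and b :: "'i => 'a"
	proof -
		have "(\<Sum>k\<in>I. u i k * b k) = (\<Sum>k\<in>I. if k = i then b k else 0)" by (rule sum.cong) (auto simp: u_def)
		then show ?thesis using I that by simp
	qed
	show ?case
	proof (intro exI[of _ "u ` I"] conjI allI impI)
		show "finite (u ` I)" using I by simp
		show "\<forall>l\<in>u ` I. \<forall>i\<in>I. 0 \<le> l i" by (simp add: u_def)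
		show "\<forall>l\<in>u ` I. \<forall>j\<in>{}. (\<Sum>i\<in>I. l i * A i j) = 0" by simp
		fix b assume "\<forall>l\<in>u ` I. 0 \<le> (\<Sum>i\<in>I. l i * b i)"
		then show "\<exists>y. \<forall>i\<in>I. (\<Sum>j\<in>{}. A i j * y j) \<le> b i" by (simp add: ub)
	qed
next
	case (insert j J)
	obtain L :: "('i => 'a) set" where L: "finite L" "\<forall>l\<in>L. \<forall>i\<in>I. 0 \<le> l i" "\<forall>l\<in>L. \<forall>j\<in>J. (\<Sum>i\<in>I. l i * A i j) = 0"
		"\<forall>b. (\<forall>l\<in>L. 0 \<le> (\<Sum>i\<in>I. l i * b i)) --> (\<exists>y. \<forall>i\<in>I. (\<Sum>j\<in>J. A i j * y j) \<le> b i)"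
		using insert.IH by - (elim exE conjE, rule that, assumption+)
	define c where "c l = (\<Sum>i\<in>I. l i * A i j)" for l
	define dt where "dt l b = (\<Sum>i\<in>I. l i * b i)" for l b :: "'i => 'a"
	\<comment> \<open>A combination of a row with positive and a row with negative entry in column
	  \<open>j\<close>, with nonnegative weights, in which this column cancels.\<close>
	define mx where "mx p n = (%i. c p * n i - c n * p i)" for p n :: "'i => 'a"
	have dt_mx: "dt (mx p n) b = c p * dt n b - c n * dt p b" for p n b
		unfolding dt_def mx_def by (simp add: sum_subtractf sum_distrib_left algebra_simps)
	define L' where "L' = {l : L. c l = 0} \<union> (%(p, n). mx p n) ` ({l : L. c l > 0} \<times> {l : L. c l < 0})"
	have L'cases: "l : {l : L. c l = 0} \<or> (\<exists>p n. p : L & c p > 0 & n : L & c n < 0 & l = mx p n)" if "l : L'" for l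
		using that unfolding L'_def by auto
	show ?case
	proof (intro exI[of _ L'] conjI ballI allI impI)
		show "finite L'" unfolding L'_def using L(1) by auto
		fix l assume l: "l : L'"
		show "0 \<le> l i" if "i : I" for i
			using L'cases[OF l]
		proof
			assume "\<exists>p n. p : L & c p > 0 & n : L & c n < 0 & l = mx p n"
			then obtain p n where h: "p : L" "c p > 0" "n : L" "c n < 0" "l = mx p n" by blast
			then have "0 \<le> c p * n i" "c n * p i \<le> 0" using L(2) that by (auto intro: mult_nonpos_nonneg)
			then show ?thesis unfolding h(5) mx_def by simp
		qed (use L(2) that in auto)
		show "(\<Sum>i\<in>I. l i * A i j') = 0" if "j' : insert j J" for j'
			using L'cases[OF l]
		proof
			assume "l : {l : L. c l = 0}" then show ?thesis using that L(3) by (auto simp: c_def)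
		next
			assume "\<exists>p n. p : L & c p > 0 & n : L & c n < 0 & l = mx p n"
			then obtain p n where h: "p : L" "n : L" "l = mx p n" by blast
			then show ?thesis using that L(3) dt_mx[of p n "%i. A i j'"] unfolding dt_def by (auto simp: c_def)
		qed
	next
		fix b assume b: "\<forall>l\<in>L'. 0 \<le> (\<Sum>i\<in>I. l i * b i)"
		have pn: "c n * dt p b \<le> c p * dt n b" if "p : L" "c p > 0" "n : L" "c n < 0" for p n
		proof -
			have "mx p n : L'" unfolding L'_def using that by auto
			then have "0 \<le> dt (mx p n) b" using b unfolding dt_def by blast
			then show ?thesis unfolding dt_mx by simp
		qed
		\<comment> \<open>Rows with \<open>c l > 0\<close> bound t from above, rows with
		  \<open>c l < 0\<close> from below; by \<open>pn\<close> no lower bound exceeds an upper one. The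
		  tightest bound of a nonempty kind is taken.\<close>
		have "\<exists>t. \<forall>l\<in>L. 0 \<le> dt l b - t * c l"
		proof (cases "{l : L. c l > 0} = {}")
			case True
			show ?thesis
			proof (cases "{l : L. c l < 0} = {}")
				case t2: True
				then have "c l = 0" if "l : L" for l using True that by (metis (mono_tags, lifting) empty_Collect_eq linorder_neqE_linordered_idom)
				moreover have "0 \<le> dt l b" if "l : L" "c l = 0" for l using b that unfolding L'_def dt_def by auto
				ultimately show ?thesis by auto
			next
				case False
				define t where "t = Max ((%l. dt l b / c l) ` {l : L. c l < 0})"
				have "0 \<le> dt l b - t * c l" if l: "l : L" for l
				proof (cases "c l < 0")
					case True
					then have "dt l b / c l \<le> t" unfolding t_def using L(1) l by (intro Max_ge) auto
					then show ?thesis using True by (simp add: neg_divide_le_eq)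
				next
					case False
					then have "c l = 0" using \<open>{l : L. c l > 0} = {}\<close> l by (metis (mono_tags, lifting) empty_Collect_eq linorder_neqE_linordered_idom)
					then show ?thesis using b l unfolding L'_def dt_def by auto
				qed
				then show ?thesis by blast
			qed
		next
			case False
			define S where "S = (%l. dt l b / c l) ` {l : L. c l > 0}"
			have S: "finite S" "S ~= {}" using L(1) False unfolding S_def by auto
			define t where "t = Min S"
			obtain p where p: "p : L" "c p > 0" "t = dt p b / c p" using Min_in[OF S] unfolding t_def S_def by auto
			have "0 \<le> dt l b - t * c l" if l: "l : L" for l
			proof -
				consider "c l > 0" | "c l = 0" | "c l < 0" by linarith
				then show ?thesis
				proof cases
					case 1
					then have "t \<le> dt l b / c l" unfolding t_def S_def using L(1) l by (intro Min_le) auto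
					then show ?thesis using 1 by (simp add: pos_le_divide_eq)
				next
					case 2 then show ?thesis using b l unfolding L'_def dt_def by auto
				next
					case 3
					have "c l * dt p b \<le> c p * dt l b" by (rule pn[OF p(1,2) l 3])
					then have "t * c l \<le> dt l b" unfolding p(3) using p(2) by (simp add: field_simps)
					then show ?thesis by simp
				qed
			qed
			then show ?thesis by blast
		qed
		then obtain t where t: "\<forall>l\<in>L. 0 \<le> dt l b - t * c l" by blast
		have "\<forall>l\<in>L. 0 \<le> (\<Sum>i\<in>I. l i * (b i - A i j * t))"
		proof
			fix l assume "l : L"
			have "(\<Sum>i\<in>I. l i * (b i - A i j * t)) = dt l b - t * c l"
				unfolding dt_def c_def by (simp add: right_diff_distrib sum_subtractf sum_distrib_left mult_ac)
			then show "0 \<le> (\<Sum>i\<in>I. l i * (b i - A i j * t))" using t \<open>l : L\<close> by simp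
		qed
		from L(4)[rule_format, of "%i. b i - A i j * t", OF this[rule_format]]
		obtain y where y: "\<forall>i\<in>I. (\<Sum>j\<in>J. A i j * y j) \<le> b i - A i j * t" by auto
		have "\<forall>i\<in>I. (\<Sum>k\<in>insert j J. A i k * (y(j := t)) k) \<le> b i"
		proof
			fix i assume i: "i : I"
			have "(\<Sum>k\<in>J. A i k * (y(j := t)) k) = (\<Sum>k\<in>J. A i k * y k)"
				by (rule sum.cong) (use insert.hyps in auto)
			then show "(\<Sum>k\<in>insert j J. A i k * (y(j := t)) k) \<le> b i" using y i insert.hyps by (simp add: algebra_simps)
		qed
		then show "\<exists>y. \<forall>i\<in>I. (\<Sum>k\<in>insert j J. A i k * y k) \<le> b i" by blast
	qed
qed

lemma common_denominator:
	fixes f :: "'a => rat"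
	assumes "finite S" "!!x. x : S ==> 0 \<le> f x"
	shows "\<exists>M :: nat. M > 0 & (\<forall>x\<in>S. \<exists>n :: nat. of_nat M * f x = of_nat n)"
	using assms
proof (induction S rule: finite_induct)
	case (insert x S)
	then obtain M :: nat where M: "M > 0" "\<forall>x\<in>S. \<exists>n :: nat. of_nat M * f x = of_nat n" by auto
	obtain p q where pq: "quotient_of (f x) = (p, q)" by fastforce
	have q: "q > 0" "f x = of_int p / of_int q" using quotient_of_denom_pos[OF pq] quotient_of_div[OF pq] by auto
	have p: "p \<ge> 0" using insert.prems[of x] q by (simp add: zero_le_divide_iff)
	have 1: "of_nat (M * nat q) * f x = of_nat (M * nat p)" using q p by simp
	have 2: "\<exists>n :: nat. of_nat (M * nat q) * f y = of_nat n" if y: "y : S" for y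
	proof -
		obtain n :: nat where "of_nat M * f y = of_nat n" using M y by blast
		then have "of_nat (M * nat q) * f y = of_nat (n * nat q)" by simp
		then show ?thesis by blast
	qed
	show ?case
	proof (rule exI[of _ "M * nat q"], intro conjI ballI)
		show "0 < M * nat q" using M(1) q(1) by simp
		fix y assume "y : insert x S"
		then show "\<exists>n :: nat. of_nat (M * nat q) * f y = of_nat n" using 1 2 by blast
	qed
qed auto

text \<open>A price \<open>y b e\<close> is attached to each side of a block. Compatible sides have
  prices with sum at most 0, so summing over a closed system leaves chi at most a times
  area.\<close>

definition lp_dual :: "'b set => ('b => 'f set) => ('b => 'f => 'b => bool) => ('f => 'f) => ('b => rat) => ('b => rat) => rat => ('b => 'f => rat) => bool" where
	"lp_dual B Ed cp st chi ar a y \<longleftrightarrow> (\<forall>b\<in>B. chi b - a * ar b \<le> (\<Sum>e\<in>Ed b. y b e)) &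
		 (\<forall>b\<in>B. \<forall>b'\<in>B. \<forall>e. cp b e b' --> y b e + y b' (st e) \<le> 0)"

text \<open>\<open>x\<close> counts copies of blocks and \<open>z\<close> counts glueings. The
  symmetry of \<open>z\<close> lets the copies be paired off; the last clause says that the ratio
  \<open>a\<close> is attained.\<close>

definition lp_primal :: "'b set => ('b => 'f set) => ('b => 'f => 'b => bool) => ('f => 'f) => ('b => rat) => ('b => rat) => rat =>
		('b => nat) => ('b => 'f => 'b => nat) => bool" where
	"lp_primal B Ed cp st chi ar a x z \<longleftrightarrow> (\<forall>b\<in>B. \<forall>e\<in>Ed b. (\<Sum>b'\<in>B. z b e b') = x b) &
		 (\<forall>b\<in>B. \<forall>b'\<in>B. \<forall>e\<in>Ed b. z b e b' ~= 0 --> cp b e b' & z b' (st e) b = z b e b') &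
		 (\<exists>b\<in>B. x b ~= 0) & (\<Sum>b\<in>B. of_nat (x b) * chi b) = a * (\<Sum>b\<in>B. of_nat (x b) * ar b)"

text \<open>The rows are the blocks and the compatible triples, and the right-hand side is affine in
  \<open>a\<close>. By \<open>fourier_motzkin\<close> the dual is feasible at \<open>a\<close> iff
  \<open>ta l \<le> a * al l\<close> for finitely many multipliers. The least such \<open>a\<close>
  is the largest quotient, and a multiplier attaining it becomes, after clearing denominators, the
  primal solution.\<close>

lemma lp_duality:
	fixes B :: "'b set" and Ed :: "'b => 'f set"
	assumes B: "finite B" and Ed: "!!b. b : B ==> finite (Ed b)"
		and cpE: "!!b e b'. b : B ==> b' : B ==> cp b e b' ==> e : Ed b"
		and cps: "!!b e b'. b : B ==> b' : B ==> cp b e b' ==> cp b' (st e) b"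
		and st: "!!b e. b : B ==> e : Ed b ==> st (st e) = e"
		and ar: "!!b. b : B ==> ar b > 0"
		and nd: "\<not> (\<exists>y. lp_dual B Ed cp st chi ar a1 y)"
	shows "\<exists>a y x z. lp_dual B Ed cp st chi ar a y & lp_primal B Ed cp st chi ar a x z"
proof -
	define C where "C = {(b, e, b'). b : B & b' : B & cp b e b'}"
	have "C \<subseteq> B \<times> (\<Union>b\<in>B. Ed b) \<times> B" using cpE unfolding C_def by auto
	then have C: "finite C" by (rule finite_subset) (use B Ed in auto)
	define J where "J = Sigma B Ed"
	have J: "finite J" unfolding J_def using B Ed by auto
	define I :: "('b + 'b \<times> 'f \<times> 'b) set" where "I = Inl ` B \<union> Inr ` C"
	have I: "finite I" unfolding I_def using B C by auto
	define A :: "('b + 'b \<times> 'f \<times> 'b) => 'b \<times> 'f => rat" where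
		"A i j = (case i of Inl b => - of_bool (fst j = b) | Inr (b, e, b') => of_bool (j = (b, e)) + of_bool (j = (b', st e)))" for i j
	obtain L where L: "finite L" "!!l i. l : L ==> i : I ==> 0 \<le> l i" "!!l j. l : L ==> j : J ==> (\<Sum>i\<in>I. l i * A i j) = 0"
		"!!b. (\<forall>l\<in>L. 0 \<le> (\<Sum>i\<in>I. l i * b i)) ==> \<exists>y. \<forall>i\<in>I. (\<Sum>j\<in>J. A i j * y j) \<le> b i"
	proof -
		obtain L where "finite L" "\<forall>l\<in>L. \<forall>i\<in>I. 0 \<le> l i" "\<forall>l\<in>L. \<forall>j\<in>J. (\<Sum>i\<in>I. l i * A i j) = 0"
			"\<forall>b. (\<forall>l\<in>L. 0 \<le> (\<Sum>i\<in>I. l i * b i)) --> (\<exists>y. \<forall>i\<in>I. (\<Sum>j\<in>J. A i j * y j) \<le> b i)"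
			using fourier_motzkin[OF I J, of A] by - (elim exE conjE, rule that, assumption+)
		then show ?thesis by (intro that[of L]) simp_all
	qed
	have sumI: "(\<Sum>i\<in>I. h i) = (\<Sum>b\<in>B. h (Inl b)) + (\<Sum>c\<in>C. h (Inr c))" for h :: "('b + 'b \<times> 'f \<times> 'b) => rat"
		unfolding I_def by (subst sum.union_disjoint) (use B C in \<open>auto simp: sum.reindex\<close>)
	define rhs where "rhs a i = (case i of Inl b => a * ar b - chi b | Inr c => 0)" for a :: rat and i :: "'b + 'b \<times> 'f \<times> 'b"
	define al where "al l = (\<Sum>b\<in>B. l (Inl b) * ar b)" for l :: "('b + 'b \<times> 'f \<times> 'b) => rat"
	define ta where "ta l = (\<Sum>b\<in>B. l (Inl b) * chi b)" for l :: "('b + 'b \<times> 'f \<times> 'b) => rat"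
	have drhs: "(\<Sum>i\<in>I. l i * rhs a i) = a * al l - ta l" for l a
		unfolding sumI rhs_def al_def ta_def by (simp add: right_diff_distrib sum_subtractf sum_distrib_left mult_ac)
	have dual: "\<exists>y. lp_dual B Ed cp st chi ar a y" if T: "\<forall>l\<in>L. ta l \<le> a * al l" for a
	proof -
		obtain y where y: "\<forall>i\<in>I. (\<Sum>j\<in>J. A i j * y j) \<le> rhs a i" using L(4)[of "rhs a"] T unfolding drhs by auto
		have "lp_dual B Ed cp st chi ar a (%b e. y (b, e))"
			unfolding lp_dual_def
		proof (intro conjI ballI allI impI)
			fix b assume b: "b : B"
			have "(\<Sum>j\<in>J. A (Inl b) j * y j) = (\<Sum>b1\<in>B. \<Sum>e\<in>Ed b1. - (if b1 = b then y (b1, e) else 0))"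
				unfolding J_def using B Ed by (subst sum.Sigma) (auto simp: A_def intro!: sum.cong)
			also have "\<dots> = (\<Sum>b1\<in>B. if b1 = b then - (\<Sum>e\<in>Ed b. y (b, e)) else 0)"
				by (rule sum.cong) (auto simp: sum_negf)
			also have "\<dots> = - (\<Sum>e\<in>Ed b. y (b, e))" using B b by simp
			finally have "(\<Sum>j\<in>J. A (Inl b) j * y j) = - (\<Sum>e\<in>Ed b. y (b, e))" .
			moreover have "(\<Sum>j\<in>J. A (Inl b) j * y j) \<le> rhs a (Inl b)" using y b unfolding I_def by blast
			ultimately show "chi b - a * ar b \<le> (\<Sum>e\<in>Ed b. y (b, e))" by (simp add: rhs_def)
		next
			fix b b' e assume h: "b : B" "b' : B" "cp b e b'"
			have j: "(b, e) : J" "(b', st e) : J" unfolding J_def using h cpE[OF h] cpE[OF h(2,1) cps[OF h]] by auto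
			have "(\<Sum>j\<in>J. A (Inr (b, e, b')) j * y j) = (\<Sum>j\<in>J. (if j = (b, e) then y j else 0)) + (\<Sum>j\<in>J. if j = (b', st e) then y j else 0)"
				unfolding sum.distrib[symmetric] by (rule sum.cong) (auto simp: A_def distrib_right)
			also have "\<dots> = y (b, e) + y (b', st e)" using j J by simp
			finally have "(\<Sum>j\<in>J. A (Inr (b, e, b')) j * y j) = y (b, e) + y (b', st e)" .
			moreover have "(\<Sum>j\<in>J. A (Inr (b, e, b')) j * y j) \<le> rhs a (Inr (b, e, b'))" using y h unfolding I_def C_def by blast
			ultimately show "y (b, e) + y (b', st e) \<le> 0" by (simp add: rhs_def)
		qed
		then show ?thesis by blast
	qed
	have al0: "al l \<ge> 0" "al l = 0 ==> ta l = 0" if l: "l : L" for l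
	proof -
		have nn: "0 \<le> l (Inl b) * ar b" if "b : B" for b using L(2)[OF l] ar[OF that] that by (auto simp: I_def intro: mult_nonneg_nonneg)
		show "al l \<ge> 0" unfolding al_def by (rule sum_nonneg) (rule nn)
		assume "al l = 0"
		then have "\<forall>b\<in>B. l (Inl b) * ar b = 0" unfolding al_def using sum_nonneg_eq_0_iff[OF B, of "%b. l (Inl b) * ar b"] nn by simp
		then have "\<forall>b\<in>B. l (Inl b) = 0" using ar by fastforce
		then show "ta l = 0" unfolding ta_def by simp
	qed
	define S where "S = (%l. ta l / al l) ` {l : L. al l > 0}"
	\<comment> \<open>If no multiplier had positive area weight, all weights on blocks would vanish and
	  the dual would be feasible for every value, in particular for \<open>a1\<close>.\<close>
	have "S ~= {}"
	proof
		assume "S = {}"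
		then have "\<not> al l > 0" if "l : L" for l using that unfolding S_def by blast
		then have "al l = 0 & ta l = 0" if "l : L" for l using al0[OF that] that by (meson antisym not_le)
		then have "\<forall>l\<in>L. ta l \<le> a1 * al l" by simp
		then show False using dual nd by blast
	qed
	have S: "finite S" "S ~= {}" using L(1) \<open>S ~= {}\<close> unfolding S_def by auto
	define a where "a = Max S"
	obtain l where l: "l : L" "al l > 0" "a = ta l / al l" using Max_in[OF S] unfolding a_def S_def by auto
	have "\<forall>l\<in>L. ta l \<le> a * al l"
	proof
		fix l assume l: "l : L"
		show "ta l \<le> a * al l"
		proof (cases "al l > 0")
			case True
			then have "ta l / al l \<le> a" unfolding a_def S_def using L(1) l by (intro Max_ge) auto
			then show ?thesis using True by (simp add: pos_divide_le_eq)
		next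
			case False then show ?thesis using al0[OF l] by (simp add: antisym not_less)
		qed
	qed
	then obtain y where y: "lp_dual B Ed cp st chi ar a y" using dual by blast
	obtain M :: nat where M: "M > 0" "\<forall>i\<in>I. \<exists>n :: nat. of_nat M * l i = of_nat n"
	proof -
		have "\<exists>M :: nat. M > 0 & (\<forall>i\<in>I. \<exists>n :: nat. of_nat M * l i = of_nat n)" by (rule common_denominator[OF I]) (rule L(2)[OF l(1)])
		then show ?thesis by - (elim exE conjE, rule that)
	qed
	define n where "n i = (SOME n :: nat. of_nat M * l i = of_nat n)" for i
	have n: "of_nat (n i) = of_nat M * l i" if "i : I" for i
		unfolding n_def using someI_ex[OF M(2)[rule_format, OF that]] by simp
	define x where "x b = n (Inl b)" for b
	define z0 where "z0 b e b' = (if (b, e, b') : C then n (Inr (b, e, b')) else 0)" for b e b'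
	\<comment> \<open>A triple and its reverse describe the same glueing from its two sides, and a
	  multiplier may put weight on either; adding both makes \<open>z\<close> symmetric.\<close>
	define z where "z b e b' = z0 b e b' + z0 b' (st e) b" for b e b'
	have xl: "of_nat (x b) = of_nat M * l (Inl b)" if "b : B" for b unfolding x_def by (rule n) (use that in \<open>auto simp: I_def\<close>)
	have "lp_primal B Ed cp st chi ar a x z"
		unfolding lp_primal_def
	proof (intro conjI ballI impI)
		fix b e assume be: "b : B" "e : Ed b"
		have j: "(b, e) : J" using be unfolding J_def by simp
		have "0 = (\<Sum>b1\<in>B. l (Inl b1) * A (Inl b1) (b, e)) + (\<Sum>c\<in>C. l (Inr c) * A (Inr c) (b, e))"
			using L(3)[OF l(1) j] unfolding sumI by simp
		also have "(\<Sum>b1\<in>B. l (Inl b1) * A (Inl b1) (b, e)) = (\<Sum>b1\<in>B. if b = b1 then - l (Inl b1) else 0)"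
			by (rule sum.cong) (auto simp: A_def)
		also have "\<dots> = - l (Inl b)" using B be by simp
		finally have lb: "l (Inl b) = (\<Sum>c\<in>C. l (Inr c) * A (Inr c) (b, e))" by simp
		have s1: "(\<Sum>c\<in>C. if (fst c, fst (snd c)) = (b, e) then of_nat (n (Inr c)) else 0) = (\<Sum>b'\<in>B. of_nat (z0 b e b') :: rat)"
		proof -
			have "(\<Sum>c\<in>C. if (fst c, fst (snd c)) = (b, e) then of_nat (n (Inr c)) else 0 :: rat) = (\<Sum>c\<in>(%b'. (b, e, b')) ` {b' : B. (b, e, b') : C}. of_nat (n (Inr c)))"
				by (rule sum.mono_neutral_cong_right) (use C in \<open>auto simp: C_def\<close>)
			also have "\<dots> = (\<Sum>b'\<in>{b' : B. (b, e, b') : C}. of_nat (n (Inr (b, e, b'))))" by (subst sum.reindex) (auto simp: inj_on_def)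
			also have "\<dots> = (\<Sum>b'\<in>B. of_nat (z0 b e b'))" by (rule sum.mono_neutral_cong_left) (use B in \<open>auto simp: z0_def\<close>)
			finally show ?thesis .
		qed
		have s2: "(\<Sum>c\<in>C. if (snd (snd c), st (fst (snd c))) = (b, e) then of_nat (n (Inr c)) else 0) = (\<Sum>b'\<in>B. of_nat (z0 b' (st e) b) :: rat)"
		proof -
			have C': "e' = st e" if c: "(b', e', b) : C" and e: "st e' = e" for b' e'
			proof -
				have h: "b' : B" "b : B" "cp b' e' b" using c unfolding C_def by simp_all
				from st[OF h(1) cpE[OF h]] e show ?thesis by simp
			qed
			have "(\<Sum>c\<in>C. if (snd (snd c), st (fst (snd c))) = (b, e) then of_nat (n (Inr c)) else 0 :: rat) = (\<Sum>c\<in>(%b'. (b', st e, b)) ` {b' : B. (b', st e, b) : C}. of_nat (n (Inr c)))"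
				
			proof (rule sum.mono_neutral_cong_right[OF C])
				show "(%b'. (b', st e, b)) ` {b' : B. (b', st e, b) : C} \<subseteq> C" by auto
				show "\<forall>c\<in>C - (%b'. (b', st e, b)) ` {b' : B. (b', st e, b) : C}. (if (snd (snd c), st (fst (snd c))) = (b, e) then of_nat (n (Inr c)) else 0 :: rat) = 0"
				proof
					fix c assume c: "c : C - (%b'. (b', st e, b)) ` {b' : B. (b', st e, b) : C}"
					obtain b' e' b'' where cc: "c = (b', e', b'')" by (cases c)
					have "\<not> (b'' = b & st e' = e)"
					proof
						assume eq: "b'' = b & st e' = e"
						then have "e' = st e" using c C'[of b' e'] cc by simp
						moreover have "b' : B" using c cc unfolding C_def by simp
						ultimately show False using c cc eq by auto
					qed
					then show "(if (snd (snd c), st (fst (snd c))) = (b, e) then of_nat (n (Inr c)) else 0 :: rat) = 0" using cc by auto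
				qed
			qed (use st[OF be] in auto)
			also have "\<dots> = (\<Sum>b'\<in>{b' : B. (b', st e, b) : C}. of_nat (n (Inr (b', st e, b))))" by (subst sum.reindex) (auto simp: inj_on_def)
			also have "\<dots> = (\<Sum>b'\<in>B. of_nat (z0 b' (st e) b))" by (rule sum.mono_neutral_cong_left) (use B in \<open>auto simp: z0_def\<close>)
			finally show ?thesis .
		qed
		have "(of_nat (x b) :: rat) = (\<Sum>c\<in>C. of_nat M * (l (Inr c) * A (Inr c) (b, e)))"
			unfolding xl[OF be(1)] lb by (simp add: sum_distrib_left)
		also have "\<dots> = (\<Sum>c\<in>C. (if (fst c, fst (snd c)) = (b, e) then of_nat (n (Inr c)) else 0) + (if (snd (snd c), st (fst (snd c))) = (b, e) then of_nat (n (Inr c)) else 0))"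
		proof (rule sum.cong[OF refl])
			fix c assume c: "c : C"
			have "of_nat (n (Inr c)) = of_nat M * l (Inr c)" by (rule n) (use c in \<open>auto simp: I_def\<close>)
			then show "of_nat M * (l (Inr c) * A (Inr c) (b, e)) = (if (fst c, fst (snd c)) = (b, e) then of_nat (n (Inr c)) else 0) + (if (snd (snd c), st (fst (snd c))) = (b, e) then of_nat (n (Inr c)) else 0)"
				by (cases c) (auto simp: A_def)
		qed
		also have "\<dots> = of_nat (\<Sum>b'\<in>B. z b e b')" unfolding sum.distrib s1 s2 z_def by simp
		finally show "(\<Sum>b'\<in>B. z b e b') = x b" by (metis of_nat_eq_iff)
	next
		fix b b' e assume h: "b : B" "b' : B" "e : Ed b" "z b e b' ~= 0"
		have ss: "st (st e) = e" by (rule st[OF h(1,3)])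
		have "cp b e b' \<or> cp b' (st e) b" using h(4) unfolding z_def z0_def C_def by (auto split: if_splits)
		then show "cp b e b'" using cps[OF h(2,1), of "st e"] ss by auto
		show "z b' (st e) b = z b e b'" unfolding z_def ss by simp
	next
		have M0: "(of_nat M :: rat) > 0" using M(1) by simp
		have s: "(\<Sum>b\<in>B. of_nat (x b) * f b) = of_nat M * (\<Sum>b\<in>B. l (Inl b) * f b)" for f :: "'b => rat"
			unfolding sum_distrib_left by (rule sum.cong) (use xl in auto)
		show "(\<Sum>b\<in>B. of_nat (x b) * chi b) = a * (\<Sum>b\<in>B. of_nat (x b) * ar b)"
			unfolding s al_def[symmetric] ta_def[symmetric] l(3) using l(2) by simp
		show "\<exists>b\<in>B. x b ~= 0"
		proof (rule ccontr)
			assume "\<not> (\<exists>b\<in>B. x b ~= 0)"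
			then have "(\<Sum>b\<in>B. of_nat (x b) * ar b) = 0" by simp
			then show False unfolding s al_def[symmetric] using M0 l(2) by simp
		qed
	qed
	then show ?thesis using y by blast
qed

section \<open>Computable functions\<close>

text \<open>Functions are reduced to one argument, further ones being packed by
  \<open>prod_encode\<close>; this explains the premises about
  \<open>%p. f (cfst p) (csnd p)\<close> in the closure rules.\<close>

definition computable :: "(nat => nat) => bool" where
	"computable f \<longleftrightarrow> (\<exists>r. \<forall>x. computes r [x] (f x))"

definition computable2 :: "(nat => nat => nat) => bool" where
	"computable2 f \<longleftrightarrow> (\<exists>r. \<forall>x y. computes r [x, y] (f x y))"

definition decidable :: "(nat => bool) => bool" where
	"decidable P \<longleftrightarrow> computable (%x. of_bool (P x))"

lemma computes_Comp1: "computes g xs y ==> computes f [y] z ==> computes (Comp f [g]) xs z"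
	by (rule computes.intros(4)[where ys = "[y]"]) auto

lemma computes_Comp2: "computes g xs y ==> computes g' xs y' ==> computes f [y, y'] z ==> computes (Comp f [g, g']) xs z"
	by (rule computes.intros(4)[where ys = "[y, y']"]) auto

lemma computes_Proj0: "computes (Proj 0) (x # xs) x"
	using computes.intros(3)[of 0 "x # xs"] by simp

lemma computes_Proj1: "computes (Proj 1) (x # y # xs) y"
	using computes.intros(3)[of 1 "x # y # xs"] by simp

lemma computes_Proj2: "computes (Proj 2) (x # y # z # xs) z"
	using computes.intros(3)[of 2 "x # y # z # xs"] by simp

lemma computable_id: "computable (%x. x)"
	unfolding computable_def by (rule exI[of _ "Proj 0"]) (simp add: computes_Proj0)

lemma computable_Suc: "computable f ==> computable (%x. Suc (f x))"
	unfolding computable_def by (metis computes.intros(2) computes_Comp1)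

lemma computable_const: "computable (%x. k)"
proof (induction k)
	case 0 show ?case unfolding computable_def using computes.intros(1) by blast
next
	case (Suc k) then show ?case by (rule computable_Suc)
qed

lemma computable_comp: "computable g ==> computable f ==> computable (%x. g (f x))"
	unfolding computable_def by (metis computes_Comp1)

lemma computable2_comp:
	assumes "computable2 h" "computable f" "computable g"
	shows "computable (%x. h (f x) (g x))"
proof -
	obtain rh rf rg where "\<forall>x y. computes rh [x, y] (h x y)" "\<forall>x. computes rf [x] (f x)" "\<forall>x. computes rg [x] (g x)"
		using assms unfolding computable_def computable2_def by blast
	then have "computes (Comp rh [rf, rg]) [x] (h (f x) (g x))" for x by (intro computes_Comp2) auto
	then show ?thesis unfolding computable_def by blast
qed

lemma computable2_fst: "computable f ==> computable2 (%x y. f x)"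
	unfolding computable_def computable2_def using computes_Comp1[OF computes_Proj0] by blast

lemma computable2_snd: "computable f ==> computable2 (%x y. f y)"
	unfolding computable_def computable2_def using computes_Comp1[OF computes_Proj1] by blast

lemma computable2_comp2:
	assumes "computable2 h" "computable2 f" "computable2 g"
	shows "computable2 (%x y. h (f x y) (g x y))"
proof -
	obtain rh rf rg where "\<forall>x y. computes rh [x, y] (h x y)" "\<forall>x y. computes rf [x, y] (f x y)" "\<forall>x y. computes rg [x, y] (g x y)"
		using assms unfolding computable2_def by blast
	then have "computes (Comp rh [rf, rg]) [x, y] (h (f x y) (g x y))" for x y by (intro computes_Comp2) auto
	then show ?thesis unfolding computable2_def by blast
qed

lemma computable_primrec:
	assumes f: "computable2 f"
	shows "computable (rec_nat a (%n y. f y n))"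
proof -
	obtain ra where ra: "\<forall>x. computes ra [x] a" using computable_const unfolding computable_def by blast
	obtain rf where rf: "\<forall>x y. computes rf [x, y] (f x y)" using f unfolding computable2_def by blast
	have "computes (PrimRec ra (Comp rf [Proj 0, Proj 1])) [n, x] (rec_nat a (%n y. f y n) n)" for n x
	proof (induction n)
		case 0 show ?case using ra by (simp add: computes.intros(5))
	next
		case (Suc n)
		have "computes (Comp rf [Proj 0, Proj 1]) [rec_nat a (%n y. f y n) n, n, x] (f (rec_nat a (%n y. f y n) n) n)"
			by (intro computes_Comp2[OF computes_Proj0 computes_Proj1]) (use rf in auto)
		from computes.intros(6)[OF Suc this] show ?case by simp
	qed
	then have "computes (Comp (PrimRec ra (Comp rf [Proj 0, Proj 1])) [Proj 0, Proj 0]) [n] (rec_nat a (%n y. f y n) n)" for n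
		by (intro computes_Comp2[OF computes_Proj0 computes_Proj0])
	then show ?thesis unfolding computable_def by blast
qed

lemma computable2_add: "computable2 (+)"
proof -
	have "computes (PrimRec (Proj 0) (Comp Succ [Proj 0])) [n, x] (n + x)" for n x
	proof (induction n)
		case 0 show ?case by (simp add: computes.intros(5) computes_Proj0)
	next
		case (Suc n)
		have "computes (Comp Succ [Proj 0]) [n + x, n, x] (Suc (n + x))" by (intro computes_Comp1[OF computes_Proj0] computes.intros(2))
		from computes.intros(6)[OF Suc this] show ?case by simp
	qed
	then show ?thesis unfolding computable2_def by blast
qed

lemmas computable_add = computable2_comp[OF computable2_add]

lemma computable2_sub: "computable2 (-)"
proof -
	have pred: "computable (%n. n - 1)"
	proof -
		have "computable (rec_nat 0 (%n y. n))" using computable_primrec[OF computable2_snd[OF computable_id]] .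
		moreover have "rec_nat 0 (%n y. n) = (%n :: nat. n - 1)"
		proof
			fix n :: nat show "rec_nat 0 (%n y. n) n = n - 1" by (cases n) auto
		qed
		ultimately show ?thesis by simp
	qed
	then obtain rp where rp: "\<forall>x. computes rp [x] (x - 1)" unfolding computable_def by blast
	have "computes (PrimRec (Proj 0) (Comp rp [Proj 0])) [n, x] (x - n)" for n x
	proof (induction n)
		case 0 show ?case by (simp add: computes.intros(5) computes_Proj0)
	next
		case (Suc n)
		have "computes (Comp rp [Proj 0]) [x - n, n, x] (x - n - 1)" by (rule computes_Comp1[OF computes_Proj0]) (use rp in blast)
		from computes.intros(6)[OF Suc this] show ?case by simp
	qed
	then have "computes (Comp (PrimRec (Proj 0) (Comp rp [Proj 0])) [Proj 1, Proj 0]) [x, y] (x - y)" for x y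
		by (intro computes_Comp2[OF computes_Proj1 computes_Proj0])
	then show ?thesis unfolding computable2_def by blast
qed

lemmas computable_sub = computable2_comp[OF computable2_sub]

lemma computable2_mult: "computable2 (*)"
proof -
	obtain ra where ra: "\<forall>x y. computes ra [x, y] (x + y)" using computable2_add unfolding computable2_def by blast
	have "computes (PrimRec Zero (Comp ra [Proj 0, Proj 2])) [n, x] (n * x)" for n x
	proof (induction n)
		case 0 show ?case by (simp add: computes.intros)
	next
		case (Suc n)
		have "computes (Comp ra [Proj 0, Proj 2]) [n * x, n, x] (n * x + x)" by (intro computes_Comp2[OF computes_Proj0 computes_Proj2]) (use ra in blast)
		from computes.intros(6)[OF Suc this] show ?case by (simp add: add.commute)
	qed
	then show ?thesis unfolding computable2_def by blast
qed

lemmas computable_mult = computable2_comp[OF computable2_mult]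

lemma computable2_eq: "computable2 (%x y. of_bool (x = y))"
proof -
	have z: "computable (%n. 1 - n)" by (intro computable_sub computable_const computable_id)
	have "computable2 (%x y. 1 - ((x - y) + (y - x)))"
		by (intro computable2_comp2[OF computable2_sub] computable2_comp2[OF computable2_add] computable2_fst[OF computable_const]
				computable2_fst[OF computable_id] computable2_snd[OF computable_id])
	moreover have "(%x y. 1 - ((x - y) + (y - x))) = (%x y :: nat. of_bool (x = y) :: nat)" by (intro ext) auto
	ultimately show ?thesis by simp
qed

section \<open>The pairing function and its inverses\<close>

lemma triangle_rec: "triangle n = rec_nat 0 (%n y. y + Suc n) n"
	by (induction n) auto

lemma computable_triangle: "computable triangle"
proof -
	have "computable (rec_nat 0 (%n y. y + Suc n))"
		by (intro computable_primrec computable2_comp2[OF computable2_add] computable2_fst[OF computable_id] computable2_snd computable_Suc computable_id)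
	then show ?thesis using triangle_rec by presburger
qed

lemma computable_pair: "computable f ==> computable g ==> computable (%x. prod_encode (f x, g x))"
	unfolding prod_encode_def case_prod_conv
	by (intro computable_add computable_comp[OF computable_triangle])

definition cfst :: "nat => nat" where "cfst x = fst (prod_decode x)"
definition csnd :: "nat => nat" where "csnd x = snd (prod_decode x)"

lemma cfst_pair [simp]: "cfst (prod_encode (a, b)) = a" and csnd_pair [simp]: "csnd (prod_encode (a, b)) = b"
	by (simp_all add: cfst_def csnd_def)

lemma pair_cfst_csnd [simp]: "prod_encode (cfst x, csnd x) = x"
	by (simp add: cfst_def csnd_def)

text \<open>\<open>cfst z + csnd z\<close> is the index of the diagonal that contains z in the
  Cantor enumeration. It grows by one exactly when the next triangular number is reached, which is a
  primitive recursion; both projections follow from it by subtraction.\<close>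

lemma diagonal_rec: "cfst z + csnd z = rec_nat 0 (%n y. y + of_bool (triangle (Suc y) = Suc n)) z"
proof (induction z)
	case 0
	have "prod_decode 0 = (0, 0)" by (simp add: prod_decode_def prod_decode_aux.simps)
	then show ?case by (simp add: cfst_def csnd_def)
next
	case (Suc z)
	let ?k = "cfst z + csnd z"
	have z: "z = triangle ?k + cfst z" using pair_cfst_csnd[of z] by (simp add: prod_encode_def)
	show ?case
	proof (cases "csnd z")
		case 0
		then have "Suc z = prod_encode (0, Suc ?k)" using z by (simp add: prod_encode_def)
		then have "cfst (Suc z) + csnd (Suc z) = Suc ?k" by (simp only: cfst_pair csnd_pair add_0)
		moreover have "triangle (Suc ?k) = Suc z" using 0 z by simp
		ultimately show ?thesis unfolding nat.rec Suc.IH[symmetric] by simp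
	next
		case (Suc m)
		then have "Suc z = prod_encode (Suc (cfst z), m)" using z by (simp add: prod_encode_def)
		then have "cfst (Suc z) + csnd (Suc z) = ?k" unfolding \<open>Suc z = prod_encode (Suc (cfst z), m)\<close> cfst_pair csnd_pair using Suc by simp
		moreover have "triangle (Suc ?k) ~= Suc z" using Suc z by simp
		ultimately show ?thesis unfolding nat.rec Suc.IH[symmetric] by simp
	qed
qed

lemma computable_diagonal: "computable (%z. cfst z + csnd z)"
proof -
	have "computable2 (%y n. y + of_bool (triangle (Suc y) = Suc n))"
		by (intro computable2_comp2[OF computable2_add] computable2_comp2[OF computable2_eq] computable2_fst computable2_snd
				computable_comp[OF computable_triangle] computable_Suc computable_id)
	from computable_primrec[OF this, of 0] show ?thesis unfolding diagonal_rec .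
qed

lemma computable_cfst: "computable f ==> computable (%x. cfst (f x))"
proof -
	have "cfst z = z - triangle (cfst z + csnd z)" for z
		using pair_cfst_csnd[of z] by (simp add: prod_encode_def)
	moreover have "computable (%z. z - triangle (cfst z + csnd z))"
		by (intro computable_sub computable_id computable_comp[OF computable_triangle] computable_diagonal)
	ultimately have "computable cfst" by presburger
	then show "computable f ==> computable (%x. cfst (f x))" by (rule computable_comp)
qed

lemma computable_csnd: "computable f ==> computable (%x. csnd (f x))"
proof -
	have "computable (%z. (cfst z + csnd z) - cfst z)"
		by (intro computable_sub computable_diagonal computable_cfst computable_id)
	then have "computable csnd" by simp
	then show "computable f ==> computable (%x. csnd (f x))" by (rule computable_comp)
qed

lemma computable_pair_fun: "computable (%p. f (cfst p) (csnd p)) ==> computable a ==> computable b ==> computable (%x. f (a x) (b x))"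
	using computable_comp[of "%p. f (cfst p) (csnd p)", OF _ computable_pair[of a b]] by simp

lemma computable_rec:
	assumes "computable n" "computable b" "computable (%p. h (cfst p) (cfst (csnd p)) (csnd (csnd p)))"
	shows "computable (%x. rec_nat (b x) (h x) (n x))"
proof -
	obtain rn rb rh where r: "\<forall>x. computes rn [x] (n x)" "\<forall>x. computes rb [x] (b x)"
		"\<forall>p. computes rh [p] (h (cfst p) (cfst (csnd p)) (csnd (csnd p)))" using assms unfolding computable_def by blast
	have "computable2 (%x y. prod_encode (x, y))"
		unfolding prod_encode_def case_prod_conv
		by (intro computable2_comp2[OF computable2_add] computable2_fst computable_id)
			 (use computable2_comp2[OF computable2_fst[OF computable_triangle] computable2_add computable2_fst[OF computable_id]] in simp)
	then obtain rp where rp: "!!x y. computes rp [x, y] (prod_encode (x, y))" unfolding computable2_def by blast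
	let ?g = "Comp rh [Comp rp [Proj 2, Comp rp [Proj 1, Proj 0]]]"
	have g: "computes ?g [y, i, x] (h x i y)" for y i x
	proof -
		have "computes (Comp rp [Proj 2, Comp rp [Proj 1, Proj 0]]) [y, i, x] (prod_encode (x, prod_encode (i, y)))"
			by (rule computes_Comp2[OF computes_Proj2 computes_Comp2[OF computes_Proj1 computes_Proj0 rp] rp])
		from computes_Comp1[OF this r(3)[rule_format]] show ?thesis by simp
	qed
	have "computes (PrimRec rb ?g) [m, x] (rec_nat (b x) (h x) m)" for m x
	proof (induction m)
		case 0 show ?case using r(2) by (simp add: computes.intros(5))
	next
		case (Suc m)
		from computes.intros(6)[OF Suc g] show ?case by simp
	qed
	then have "computes (Comp (PrimRec rb ?g) [rn, Proj 0]) [x] (rec_nat (b x) (h x) (n x))" for x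
		by (rule computes_Comp2[OF r(1)[rule_format] computes_Proj0])
	then show ?thesis unfolding computable_def by blast
qed

lemma computable_sum:
	assumes "computable n" "computable (%p. f (cfst p) (csnd p))"
	shows "computable (%x. \<Sum>i<n x. f x i)"
proof -
	have "(\<Sum>i<m. f x i) = rec_nat 0 (%i y. y + f x i) m" for x m by (induction m) auto
	moreover have "computable (%x. rec_nat 0 (%i y. y + f x i) (n x))"
		by (rule computable_rec[OF assms(1) computable_const], rule computable_add,
				intro computable_csnd computable_id, rule computable_pair_fun[OF assms(2)]) (intro computable_csnd computable_cfst computable_id)+
	ultimately show ?thesis by presburger
qed

section \<open>Decidable predicates and bounded quantifiers\<close>

lemma computable_of_bool: "decidable P ==> computable (%x. of_bool (P x))"
	by (simp add: decidable_def)

lemma decidable_eq: "computable f ==> computable g ==> decidable (%x. f x = g x)"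
	unfolding decidable_def by (rule computable2_comp[OF computable2_eq])

lemma decidable_not: "decidable P ==> decidable (%x. \<not> P x)"
proof -
	assume "decidable P"
	then have "computable (%x. 1 - of_bool (P x))" by (intro computable_sub computable_const computable_of_bool)
	moreover have "(%x. 1 - of_bool (P x)) = (%x. of_bool (\<not> P x) :: nat)" by auto
	ultimately show ?thesis by (simp add: decidable_def)
qed

lemma decidable_conj: "decidable P ==> decidable R ==> decidable (%x. P x & R x)"
proof -
	assume "decidable P" "decidable R"
	then have "computable (%x. of_bool (P x) * of_bool (R x))" by (intro computable_mult computable_of_bool)
	then show ?thesis by (simp add: decidable_def of_bool_conj)
qed

lemma decidable_disj: "decidable P ==> decidable R ==> decidable (%x. P x \<or> R x)"
proof -
	assume "decidable P" "decidable R"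
	then have "decidable (%x. \<not> (\<not> P x & \<not> R x))" by (intro decidable_not decidable_conj)
	then show ?thesis by simp
qed

lemma decidable_imp: "decidable P ==> decidable R ==> decidable (%x. P x --> R x)"
	unfolding imp_conv_disj by (intro decidable_disj decidable_not)

lemma decidable_iff: "decidable P ==> decidable R ==> decidable (%x. P x \<longleftrightarrow> R x)"
	unfolding iff_conv_conj_imp by (intro decidable_conj decidable_imp)

lemma decidable_le: "computable f ==> computable g ==> decidable (%x. f x \<le> g x)"
proof -
	assume "computable f" "computable g"
	then have "decidable (%x. f x - g x = 0)" by (intro decidable_eq computable_sub computable_const)
	then show ?thesis by simp
qed

lemma decidable_less: "computable f ==> computable g ==> decidable (%x. f x < g x)"
	unfolding Suc_le_eq[symmetric] by (intro decidable_le computable_Suc)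

lemma decidable_ball: "computable n ==> decidable (%p. P (cfst p) (csnd p)) ==> decidable (%x. \<forall>i<n x. P x i)"
proof -
	assume "computable n" "decidable (%p. P (cfst p) (csnd p))"
	then have "decidable (%x. (\<Sum>i<n x. of_bool (\<not> P x i)) = (0 :: nat))"
		by (intro decidable_eq computable_const computable_sum computable_of_bool decidable_not)
	moreover have "(\<Sum>i<n x. of_bool (\<not> P x i)) = (0 :: nat) \<longleftrightarrow> (\<forall>i<n x. P x i)" for x
		by (subst sum_eq_0_iff) auto
	ultimately show ?thesis by (simp only:)
qed

lemma decidable_bex: "computable n ==> decidable (%p. P (cfst p) (csnd p)) ==> decidable (%x. \<exists>i<n x. P x i)"
proof -
	assume "computable n" "decidable (%p. P (cfst p) (csnd p))"
	then have "decidable (%x. \<not> (\<forall>i<n x. \<not> P x i))" by (intro decidable_not decidable_ball)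
	then show ?thesis by simp
qed

lemma computable_if: "decidable P ==> computable f ==> computable g ==> computable (%x. if P x then f x else g x)"
proof -
	assume "decidable P" "computable f" "computable g"
	then have "computable (%x. of_bool (P x) * f x + of_bool (\<not> P x) * g x)"
		by (intro computable_add computable_mult computable_of_bool decidable_not)
	moreover have "(%x. of_bool (P x) * f x + of_bool (\<not> P x) * g x) = (%x. if P x then f x else g x)" by auto
	ultimately show ?thesis by simp
qed

lemma computable_power2: "computable f ==> computable (%x. 2 ^ f x)"
proof -
	assume f: "computable f"
	have "2 ^ m = rec_nat 1 (%i y :: nat. y + y) m" for m by (induction m) auto
	moreover have "computable (%x. rec_nat 1 (%i y. y + y) (f x))"
		by (rule computable_rec[OF f computable_const]) (intro computable_add computable_csnd computable_id)
	ultimately show ?thesis by presburger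
qed

text \<open>A binary digit read off without division: odd quotient and remainder are bounded
  witnesses.\<close>

lemma set_decode_iff: "k : set_decode n \<longleftrightarrow> (\<exists>q<Suc n. \<exists>r<2 ^ k. n = (2 * q + 1) * 2 ^ k + r)"
proof
	assume "k : set_decode n"
	then have o: "odd (n div 2 ^ k)" by (simp add: set_decode_def)
	define q where "q = n div 2 ^ k div 2"
	have "n div 2 ^ k = 2 * q + 1" using o unfolding q_def by simp
	then have "n = (2 * q + 1) * 2 ^ k + n mod 2 ^ k" by (metis div_mult_mod_eq)
	moreover have "q \<le> n" unfolding q_def by (meson div_le_dividend le_trans)
	ultimately show "\<exists>q<Suc n. \<exists>r<2 ^ k. n = (2 * q + 1) * 2 ^ k + r"
		by (intro exI[of _ q] exI[of _ "n mod 2 ^ k"] conjI) auto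
next
	assume "\<exists>q<Suc n. \<exists>r<2 ^ k. n = (2 * q + 1) * 2 ^ k + r"
	then obtain q r where "r < 2 ^ k" "n = (2 * q + 1) * 2 ^ k + r" by blast
	then have "n div 2 ^ k = (2 * q + 1) + r div 2 ^ k"
		using div_mult_self1[of "2 ^ k" r "2 * q + 1"] by (simp add: add.commute)
	then have "n div 2 ^ k = 2 * q + 1" using \<open>r < 2 ^ k\<close> by simp
	then show "k : set_decode n" by (simp add: set_decode_def)
qed

lemma decidable_comp: "decidable P ==> computable f ==> decidable (%x. P (f x))"
	unfolding decidable_def by (rule computable_comp)

lemma decidable_pair_fun: "decidable (%p. P (cfst p) (csnd p)) ==> computable a ==> computable b ==> decidable (%x. P (a x) (b x))"
	using decidable_comp[of "%p. P (cfst p) (csnd p)", OF _ computable_pair[of a b]] by simp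

lemma decidable_set_decode: "computable f ==> computable g ==> decidable (%x. f x : set_decode (g x))"
proof (rule decidable_pair_fun[of "%a b. a : set_decode b"])
	show "decidable (%p. cfst p : set_decode (csnd p))"
		unfolding set_decode_iff
		by (intro decidable_bex decidable_eq computable_Suc computable_power2 computable_add computable_mult computable_const
				computable_cfst computable_csnd computable_id)
qed

definition ctl :: "nat => nat" where "ctl z = (if z = 0 then 0 else csnd (z - 1))"
definition cdrop :: "nat => nat => nat" where "cdrop z i = rec_nat z (%_ y. ctl y) i"
definition cnth :: "nat => nat => nat" where "cnth z i = cfst (cdrop z i - 1)"
text \<open>A code is zero exactly for the empty list and is at least the length of its list, so
  counting nonempty tails up to the code is enough.\<close>

definition clen :: "nat => nat" where "clen z = (\<Sum>i<z. of_bool (cdrop z i ~= 0))"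

lemma cdrop_list_encode: "cdrop (list_encode xs) i = list_encode (drop i xs)"
proof (induction i)
	case (Suc i)
	have "ctl (list_encode ys) = list_encode (tl ys)" for ys by (cases ys) (auto simp: ctl_def)
	then show ?case using Suc by (simp add: cdrop_def drop_Suc tl_drop)
qed (simp add: cdrop_def)

lemma cnth_list_encode: "i < length xs ==> cnth (list_encode xs) i = xs ! i"
	by (simp add: cnth_def cdrop_list_encode Cons_nth_drop_Suc[symmetric])

lemma length_le_list_encode: "length xs \<le> list_encode xs"
	by (induction xs) (auto intro: order_trans[OF _ le_prod_encode_2])

lemma clen_list_encode: "clen (list_encode xs) = length xs"
proof -
	have "list_encode ys ~= 0 \<longleftrightarrow> ys ~= []" for ys by (cases ys) auto
	then have "clen (list_encode xs) = (\<Sum>i<list_encode xs. if i < length xs then 1 else 0)"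
		unfolding clen_def cdrop_list_encode by (intro sum.cong) (auto simp: not_le)
	also have "\<dots> = (\<Sum>i<length xs. 1)"
		using length_le_list_encode[of xs] by (intro sum.mono_neutral_cong_right) auto
	finally show ?thesis by simp
qed

lemma computable_cdrop: "computable f ==> computable g ==> computable (%x. cdrop (f x) (g x))"
	unfolding cdrop_def ctl_def
	by (intro computable_rec computable_if decidable_eq computable_const computable_csnd computable_sub computable_id)

lemma computable_cnth: "computable f ==> computable g ==> computable (%x. cnth (f x) (g x))"
	unfolding cnth_def by (intro computable_cfst computable_sub computable_const computable_cdrop)

lemma computable_clen: "computable f ==> computable (%x. clen (f x))"
proof (rule computable_comp[of clen])
	show "computable clen"
		unfolding clen_def
		by (intro computable_sum computable_of_bool decidable_not decidable_eq computable_const computable_cdrop computable_cfst computable_csnd computable_id)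
qed

lemma set_encode_less: "S \<subseteq> {..<n} ==> set_encode S < 2 ^ n"
proof -
	assume S: "S \<subseteq> {..<n}"
	then have "finite S" by (auto intro: finite_subset)
	then have "set_encode S \<le> set_encode {..<n}" using S by (intro subset_decode_imp_le) simp
	also have "set_encode {..<n} < 2 ^ n" by (induction n) (auto simp: lessThan_Suc)
	finally show ?thesis .
qed

text \<open>Reachability inside \<open>{..<n}\<close> is expressed by quantifying over all closed subsets, coded as bit sets.\<close>

lemma rtrancl_closed_iff:
	assumes R: "R \<subseteq> {..<n} \<times> {..<n}" and a: "a < n"
	shows "(a, b) : R\<^sup>* \<longleftrightarrow> (\<forall>z<2 ^ n. a : set_decode z --> (\<forall>i<n. \<forall>j<n. (i, j) : R --> i : set_decode z --> j : set_decode z) --> b : set_decode z)"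
proof
	assume "(a, b) : R\<^sup>*"
	then show "\<forall>z<2 ^ n. a : set_decode z --> (\<forall>i<n. \<forall>j<n. (i, j) : R --> i : set_decode z --> j : set_decode z) --> b : set_decode z"
	proof (induction rule: rtrancl_induct)
		case (step y z)
		then have "y < n" "z < n" using R by auto
		then show ?case using step by blast
	qed simp
next
	assume h: "\<forall>z<2 ^ n. a : set_decode z --> (\<forall>i<n. \<forall>j<n. (i, j) : R --> i : set_decode z --> j : set_decode z) --> b : set_decode z"
	define S where "S = {x. x < n & (a, x) : R\<^sup>*}"
	have S: "finite S" "S \<subseteq> {..<n}" unfolding S_def by auto
	have "set_encode S < 2 ^ n" by (rule set_encode_less[OF S(2)])
	moreover have "a : set_decode (set_encode S)" using S a by (simp add: S_def)
	moreover have "\<forall>i<n. \<forall>j<n. (i, j) : R --> i : set_decode (set_encode S) --> j : set_decode (set_encode S)"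
		using S(1) by (auto simp: S_def intro: rtrancl_into_rtrancl)
	ultimately have "b : set_decode (set_encode S)" using h by blast
	then show "(a, b) : R\<^sup>*" using S by (simp add: S_def)
qed

text \<open>Unbounded minimisation. The function may be undefined where there is no witness, and
  where there is one its value is \<open>g\<close> of some witness; uniqueness of the result has to
  come from the meaning of \<open>P\<close>.\<close>

lemma computes_search:
	assumes "decidable (%p. P (cfst p) (csnd p))" "computable g"
	shows "\<exists>r. \<forall>x. (\<exists>w. P x w) --> (\<exists>w. P x w & computes r [x] (g w))"
proof -
	have "computable (%p. of_bool (\<not> P (cfst p) (csnd p)))" using decidable_not[OF assms(1)] unfolding decidable_def .
	then obtain rf where rf: "!!p. computes rf [p] (of_bool (\<not> P (cfst p) (csnd p)))" unfolding computable_def by blast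
	have "computable2 (%x y. prod_encode (x, y))"
		unfolding prod_encode_def case_prod_conv
		by (intro computable2_comp2[OF computable2_add] computable2_fst computable_id)
			 (use computable2_comp2[OF computable2_fst[OF computable_triangle] computable2_add computable2_fst[OF computable_id]] in simp)
	then obtain rp where rp: "!!x y. computes rp [x, y] (prod_encode (x, y))" unfolding computable2_def by blast
	obtain rg where rg: "!!x. computes rg [x] (g x)" using assms(2) unfolding computable_def by blast
	let ?f = "Comp rf [Comp rp [Proj 1, Proj 0]]"
	have f: "computes ?f [w, x] (of_bool (\<not> P x w))" for w x
		using computes_Comp1[OF computes_Comp2[OF computes_Proj1 computes_Proj0 rp] rf] by simp
	have "\<exists>w. P x w & computes (Comp rg [Mu ?f]) [x] (g w)" if ex: "\<exists>w. P x w" for x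
	proof -
		define w where "w = (LEAST w. P x w)"
		have w: "P x w" "!!i. i < w ==> \<not> P x i" unfolding w_def using LeastI_ex[OF ex] not_less_Least by blast+
		have "computes (Mu ?f) [x] w"
		proof (rule computes.intros(7))
			show "computes ?f [w, x] 0" using f[of w x] w(1) by simp
			show "\<forall>i<w. \<exists>y. computes ?f [i, x] (Suc y)"
			proof (intro allI impI)
				fix i assume "i < w"
				then show "\<exists>y. computes ?f [i, x] (Suc y)" using f[of i x] w(2)[of i] by (intro exI[of _ 0]) simp
			qed
		qed
		from computes_Comp1[OF this rg] w(1) show ?thesis by blast
	qed
	then show ?thesis by blast
qed

section \<open>Isomorphic complexes\<close>

text \<open>The algorithm sees a complex through a numbering of its cells, so elements of
  \<open>Irred\<close> have to be moved between X and its numbered copy.\<close>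

definition complex_iso ::
		"('v, 'e, 'u, 'd) two_complex => ('w, 'f, 'x, 'c) two_complex => ('v, 'e, 'w, 'f) gmap => ('u, 'd, 'x, 'c) gmap => bool" where
	"complex_iso X Z f g \<longleftrightarrow> graph_isomorphism (skel X) (skel Z) f & graph_isomorphism (bdry X) (bdry Z) g &
		 gmap_eq_on (bdry X) (gcomp f (att X)) (gcomp (att Z) g)"

lemma graph_isomorphismD:
	assumes "graph_isomorphism G H f"
	shows "sgraph G" "sgraph H" "!!v. v : verts G ==> vmap f v : verts H" "!!e. e : edges G ==> emap f e : edges H"
		"!!e. e : edges G ==> ini H (emap f e) = vmap f (ini G e)" "!!e. e : edges G ==> opp H (emap f e) = emap f (opp G e)"
		"inj_on (vmap f) (verts G)" "inj_on (emap f) (edges G)" "vmap f ` verts G = verts H" "emap f ` edges G = edges H"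
	using assms unfolding graph_isomorphism_def graph_morphism_def bij_betw_def by simp_all

lemma graph_isomorphismI:
	assumes H: "sgraph H" and bij: "bij_betw (vmap f) (verts G) (verts H)" "bij_betw (emap f) (edges G) (edges H)"
		and G: "!!e. e : edges G ==> ini G e : verts G" "!!e. e : edges G ==> opp G e : edges G"
		and f: "!!e. e : edges G ==> ini H (emap f e) = vmap f (ini G e)" "!!e. e : edges G ==> opp H (emap f e) = emap f (opp G e)"
	shows "graph_isomorphism G H f"
proof -
	have fE: "emap f e : edges H" if "e : edges G" for e using bij(2) that unfolding bij_betw_def by auto
	have "opp G (opp G e) = e & opp G e ~= e" if e: "e : edges G" for e
	proof -
		have "emap f (opp G (opp G e)) = emap f e" "emap f (opp G e) ~= emap f e"
			using H fE[OF e] unfolding sgraph_def f(2)[OF e, symmetric] f(2)[OF G(2)[OF e], symmetric] by auto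
		then show ?thesis using bij(2) e G(2) unfolding bij_betw_def inj_on_def by metis
	qed
	then have "sgraph G" unfolding sgraph_def using G by blast
	then show ?thesis unfolding graph_isomorphism_def graph_morphism_def using H bij f fE bij_betwE[OF bij(1)] by auto
qed

lemma graph_isomorphism_inverse:
	assumes "graph_isomorphism G H f"
	shows "graph_isomorphism H G \<lparr>vmap = inv_into (verts G) (vmap f), emap = inv_into (edges G) (emap f)\<rparr>" (is "graph_isomorphism H G ?g")
proof (rule graph_isomorphismI)
	note f = graph_isomorphismD[OF assms]
	show "sgraph G" by (rule f(1))
	show "bij_betw (vmap ?g) (verts H) (verts G)" "bij_betw (emap ?g) (edges H) (edges G)"
		using assms unfolding graph_isomorphism_def by (simp_all add: bij_betw_inv_into)
	fix e assume "e : edges H"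
	then obtain d where d: "d : edges G" "e = emap f d" using f(10) by auto
	have G: "ini G d : verts G" "opp G d : edges G" using f(1) d unfolding sgraph_def by auto
	show "ini H e : verts H" "opp H e : edges H" using f(2) \<open>e : edges H\<close> unfolding sgraph_def by auto
	show "ini G (emap ?g e) = vmap ?g (ini H e)" using d f(5,7,8) G by simp
	show "opp G (emap ?g e) = emap ?g (opp H e)" using d f(6,7,8) G by simp
qed

lemma complex_iso_inverse:
	assumes iso: "complex_iso X Z f g" and X: "two_complex X"
	shows "complex_iso Z X \<lparr>vmap = inv_into (verts (skel X)) (vmap f), emap = inv_into (edges (skel X)) (emap f)\<rparr>
		\<lparr>vmap = inv_into (verts (bdry X)) (vmap g), emap = inv_into (edges (bdry X)) (emap g)\<rparr>"
proof -
	have f: "graph_isomorphism (skel X) (skel Z) f" and g: "graph_isomorphism (bdry X) (bdry Z) g"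
		and c: "gmap_eq_on (bdry X) (gcomp f (att X)) (gcomp (att Z) g)" using iso unfolding complex_iso_def by simp_all
	note F = graph_isomorphismD[OF f] and G = graph_isomorphismD[OF g]
	have aX: "vmap (att X) u : verts (skel X)" "emap (att X) d : edges (skel X)" if "u : verts (bdry X)" "d : edges (bdry X)" for u d
		using X that unfolding two_complex_def immersion_def graph_morphism_def by auto
	have aV: "vmap (att X) u : verts (skel X)" if "u : verts (bdry X)" for u
		using X that unfolding two_complex_def immersion_def graph_morphism_def by auto
	have aE: "emap (att X) d : edges (skel X)" if "d : edges (bdry X)" for d
		using X that unfolding two_complex_def immersion_def graph_morphism_def by auto
	have "inv_into (verts (skel X)) (vmap f) (vmap (att Z) u) = vmap (att X) (inv_into (verts (bdry X)) (vmap g) u)" if u: "u : verts (bdry Z)" for u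
	proof -
		obtain w where w: "w : verts (bdry X)" "u = vmap g w" using u G(9) by auto
		then have "vmap (att Z) u = vmap f (vmap (att X) w)" using c unfolding gmap_eq_on_def gcomp_def by simp
		then show ?thesis using w F(7) G(7) aV[OF w(1)] by simp
	qed
	moreover have "inv_into (edges (skel X)) (emap f) (emap (att Z) u) = emap (att X) (inv_into (edges (bdry X)) (emap g) u)" if u: "u : edges (bdry Z)" for u
	proof -
		obtain w where w: "w : edges (bdry X)" "u = emap g w" using u G(10) by auto
		then have "emap (att Z) u = emap f (emap (att X) w)" using c unfolding gmap_eq_on_def gcomp_def by simp
		then show ?thesis using w F(8) G(8) aE[OF w(1)] by simp
	qed
	ultimately show ?thesis
		unfolding complex_iso_def gmap_eq_on_def using graph_isomorphism_inverse[OF f] graph_isomorphism_inverse[OF g] by (simp add: gcomp_def)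
qed

lemma immersion_gcomp_isomorphism:
	assumes i: "immersion G H i" and f: "graph_isomorphism H K f"
	shows "immersion G K (gcomp f i)"
proof -
	note F = graph_isomorphismD[OF f]
	have I: "sgraph G" "!!v. v : verts G ==> vmap i v : verts H" "!!e. e : edges G ==> emap i e : edges H"
		"!!e. e : edges G ==> ini H (emap i e) = vmap i (ini G e)" "!!e. e : edges G ==> opp H (emap i e) = emap i (opp G e)"
		"!!v. v : verts G ==> inj_on (emap i) (lk G v)"
		using i unfolding immersion_def graph_morphism_def by auto
	have "inj_on (emap f \<circ> emap i) (lk G v)" if "v : verts G" for v
		by (rule comp_inj_on[OF I(6)[OF that]], rule inj_on_subset[OF F(8)]) (use I(3) in \<open>auto simp: lk_def\<close>)
	then show ?thesis
		unfolding immersion_def graph_morphism_def gcomp_def using I(1-5) F(2-6) by simp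
qed

text \<open>The domain and its folding are untouched; only the immersion of the folded graph is
  composed with the isomorphism.\<close>

lemma essential_iso:
	assumes iso: "complex_iso X Z f g" and Z: "two_complex Z" "finite_complex Z" and X: "two_complex X"
		and ess: "essential Y (standard X) p s"
	shows "essential Y (standard Z) (gcomp f p) (gcomp g s)"
proof -
	have f: "graph_isomorphism (skel X) (skel Z) f" and g: "graph_isomorphism (bdry X) (bdry Z) g"
		and c: "gmap_eq_on (bdry X) (gcomp f (att X)) (gcomp (att Z) g)" using iso unfolding complex_iso_def by simp_all
	note F = graph_isomorphismD[OF f] and Gi = graph_isomorphismD[OF g]
	have bm: "branched_morphism Y (standard X) p s" and fin: "finite_complex Y"
		using ess unfolding essential_def by blast+
	obtain K q i where K: "folds (skel Y) K q" "immersion K (skel X) i" "gmap_eq_on (skel Y) (gcomp i q) p"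
		"graph_homotopy_equivalence (skel Y) K q"
		"graph_isomorphism (bdry Y) (image_graph (bdry Y) (fibre_product K (bdry X) i (att X)) (gpair (gcomp q (att Y)) s)) (gpair (gcomp q (att Y)) s)"
		using ess unfolding essential_def Let_def standard_simps by - (elim conjE exE, rule that)
	have Yb: "branched_complex Y" and p: "graph_morphism (skel Y) (skel X) p" and s: "immersion (bdry Y) (bdry X) s"
		and comm: "gmap_eq_on (bdry Y) (gcomp p (att Y)) (gcomp (att X) s)"
		and ar: "!!f. f : faces Y ==> area Y f = real (cover_degree s f)"
		using bm unfolding branched_morphism_def by (auto simp: standard_def two_complex.extend_def)
	have att: "graph_morphism (bdry Y) (skel Y) (att Y)" using Yb unfolding branched_complex_def two_complex_def immersion_def by simp
	have sM: "sgraph (bdry Y)" "!!v. v : verts (bdry Y) ==> vmap s v : verts (bdry X)" "!!e. e : edges (bdry Y) ==> emap s e : edges (bdry X)"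
		"!!e. e : edges (bdry Y) ==> ini (bdry X) (emap s e) = vmap s (ini (bdry Y) e)" "!!e. e : edges (bdry Y) ==> opp (bdry X) (emap s e) = emap s (opp (bdry Y) e)"
		using s unfolding immersion_def graph_morphism_def by auto
	have fp: "graph_morphism (skel Y) (skel Z) (gcomp f p)"
		using p F(2-6) unfolding graph_morphism_def gcomp_def by simp
	have gs: "immersion (bdry Y) (bdry Z) (gcomp g s)" by (rule immersion_gcomp_isomorphism[OF s g])
	have comm': "gmap_eq_on (bdry Y) (gcomp (gcomp f p) (att Y)) (gcomp (att Z) (gcomp g s))"
		using comm c sM(2,3) unfolding gmap_eq_on_def gcomp_def by simp
	have cd: "cover_degree (gcomp g s) h = cover_degree s h" if "h : faces Y" for h
	proof -
		have "h \<subseteq> verts (bdry Y)" "h ~= {}"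
			using that unfolding faces_def graph_components_def reach_def quotient_def by auto
		then have hv: "vmap s u : verts (bdry X)" if "u : h" for u using sM(2) that by blast
		have u0: "(SOME u. u : h) : h" using \<open>h ~= {}\<close> by (simp add: some_in_eq)
		have "{u : h. vmap g (vmap s u) = vmap g (vmap s (SOME u. u : h))} = {u : h. vmap s u = vmap s (SOME u. u : h)}"
			using hv u0 by (auto dest: inj_onD[OF Gi(7)])
		then show ?thesis unfolding cover_degree_def gcomp_def by simp
	qed
	have bm': "branched_morphism Y (standard Z) (gcomp f p) (gcomp g s)"
		unfolding branched_morphism_def using Yb Z fp gs comm' cd ar
		by (simp add: branched_complex_def)
	have q: "graph_morphism (skel Y) K q" using K(4) unfolding graph_homotopy_equivalence_def by blast
	let ?h = "gpair (gcomp q (att Y)) (gcomp g s)"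
	note I = graph_isomorphismD[OF K(5)]
	have "graph_isomorphism (bdry Y) (image_graph (bdry Y) (fibre_product K (bdry Z) (gcomp f i) (att Z)) ?h) ?h"
	proof (rule graph_isomorphism_image[OF sM(1)])
		fix e assume e: "e : edges (bdry Y)"
		have a: "emap (att Y) e : edges (skel Y)" "ini (skel Y) (emap (att Y) e) = vmap (att Y) (ini (bdry Y) e)" "opp (skel Y) (emap (att Y) e) = emap (att Y) (opp (bdry Y) e)"
			using att e unfolding graph_morphism_def by auto
		have b: "ini K (emap q x) = vmap q (ini (skel Y) x)" "opp K (emap q x) = emap q (opp (skel Y) x)" if "x : edges (skel Y)" for x
			using q that unfolding graph_morphism_def by auto
		show "ini (fibre_product K (bdry Z) (gcomp f i) (att Z)) (emap ?h e) = vmap ?h (ini (bdry Y) e)"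
			using a b[OF a(1)] sM(3,4)[OF e] Gi(5) by (simp add: fibre_product_def gpair_def gcomp_def)
		show "opp (fibre_product K (bdry Z) (gcomp f i) (att Z)) (emap ?h e) = emap ?h (opp (bdry Y) e)"
			using a b[OF a(1)] sM(3,5)[OF e] Gi(6) by (simp add: fibre_product_def gpair_def gcomp_def)
	next
		show "inj_on (vmap ?h) (verts (bdry Y))"
			using I(7) sM(2) unfolding inj_on_def gpair_def gcomp_def by (auto dest: inj_onD[OF Gi(7)])
		show "inj_on (emap ?h) (edges (bdry Y))"
			using I(8) sM(3) unfolding inj_on_def gpair_def gcomp_def by (auto dest: inj_onD[OF Gi(8)])
	qed
	moreover have "immersion K (skel Z) (gcomp f i)" by (rule immersion_gcomp_isomorphism[OF K(2) f])
	moreover have "gmap_eq_on (skel Y) (gcomp (gcomp f i) q) (gcomp f p)"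
		using K(3) unfolding gmap_eq_on_def gcomp_def by simp
	ultimately show ?thesis
		unfolding essential_def Let_def standard_simps using bm' fin Z(2) K(1,4) by auto
qed

lemma two_complex_iso:
	assumes iso: "complex_iso X Z f g" and Z: "two_complex Z" "finite_complex Z" and aV: "!!u. u : verts (bdry X) ==> vmap (att X) u : verts (skel X)"
		and aE: "!!d. d : edges (bdry X) ==> emap (att X) d : edges (skel X)"
	shows "two_complex X" "finite_complex X"
proof -
	have f: "graph_isomorphism (skel X) (skel Z) f" and g: "graph_isomorphism (bdry X) (bdry Z) g"
		and c: "gmap_eq_on (bdry X) (gcomp f (att X)) (gcomp (att Z) g)" using iso unfolding complex_iso_def by simp_all
	note F = graph_isomorphismD[OF f] and G = graph_isomorphismD[OF g]
	show fin: "finite_complex X"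
		using Z(2) finite_image_iff[OF F(7)] finite_image_iff[OF F(8)] finite_image_iff[OF G(7)] finite_image_iff[OF G(8)]
		unfolding finite_complex_def finite_sgraph_def F(9,10) G(9,10) by simp
	have cE: "emap f (emap (att X) d) = emap (att Z) (emap g d)" if "d : edges (bdry X)" for d
		using c that unfolding gmap_eq_on_def gcomp_def by simp
	have cV: "vmap f (vmap (att X) d) = vmap (att Z) (vmap g d)" if "d : verts (bdry X)" for d
		using c that unfolding gmap_eq_on_def gcomp_def by simp
	have aZ: "graph_morphism (bdry Z) (skel Z) (att Z)" "!!v. v : verts (bdry Z) ==> inj_on (emap (att Z)) (lk (bdry Z) v)"
		using Z(1) unfolding two_complex_def immersion_def by auto
	have sX: "ini (bdry X) d : verts (bdry X)" "opp (bdry X) d : edges (bdry X)" if "d : edges (bdry X)" for d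
		using G(1) that unfolding sgraph_def by auto
	have sS: "ini (skel X) d : verts (skel X)" "opp (skel X) d : edges (skel X)" if "d : edges (skel X)" for d
		using F(1) that unfolding sgraph_def by auto
	have lkX: "emap g ` lk (bdry X) u = lk (bdry Z) (vmap g u)" if u: "u : verts (bdry X)" for u
	proof
		show "emap g ` lk (bdry X) u \<subseteq> lk (bdry Z) (vmap g u)" using G(4,5) by (auto simp: lk_def)
		show "lk (bdry Z) (vmap g u) \<subseteq> emap g ` lk (bdry X) u"
		proof
			fix e assume e: "e : lk (bdry Z) (vmap g u)"
			then obtain d where d: "d : edges (bdry X)" "e = emap g d" using G(10) by (auto simp: lk_def)
			then have "vmap g (ini (bdry X) d) = vmap g u" using e G(5) by (simp add: lk_def)
			then have "ini (bdry X) d = u" using inj_onD[OF G(7)] sX(1)[OF d(1)] u by blast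
			then show "e : emap g ` lk (bdry X) u" using d by (auto simp: lk_def)
		qed
	qed
	have injl: "inj_on (emap g) (lk (bdry X) u)" for u by (rule inj_on_subset[OF G(8)]) (auto simp: lk_def)
	have "card (lk (bdry X) u) = 2" if u: "u : verts (bdry X)" for u
	proof -
		have "card (lk (bdry X) u) = card (lk (bdry Z) (vmap g u))" using card_image[OF injl] lkX[OF u] by metis
		then show ?thesis using Z(1) G(3)[OF u] unfolding two_complex_def circles_def by simp
	qed
	moreover have "finite C" if "C : graph_components (bdry X)" for C
	proof -
		have "C \<subseteq> verts (bdry X)" using that unfolding graph_components_def reach_def quotient_def by auto
		then show ?thesis using fin unfolding finite_complex_def finite_sgraph_def by (auto intro: finite_subset)
	qed
	ultimately have "circles (bdry X)" unfolding circles_def using G(1) by simp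
	moreover have "graph_morphism (bdry X) (skel X) (att X)"
		unfolding graph_morphism_def
	proof (intro conjI ballI)
		show "sgraph (bdry X)" "sgraph (skel X)" by (rule G(1), rule F(1))
		show "vmap (att X) v : verts (skel X)" if "v : verts (bdry X)" for v by (rule aV[OF that])
		fix e assume e: "e : edges (bdry X)"
		show "emap (att X) e : edges (skel X)" by (rule aE[OF e])
		have z: "ini (skel Z) (emap (att Z) (emap g e)) = vmap (att Z) (vmap g (ini (bdry X) e))"
			"opp (skel Z) (emap (att Z) (emap g e)) = emap (att Z) (emap g (opp (bdry X) e))"
			using aZ(1) G(4-6)[OF e] unfolding graph_morphism_def by auto
		have "vmap f (ini (skel X) (emap (att X) e)) = vmap f (vmap (att X) (ini (bdry X) e))"
			using F(5)[OF aE[OF e]] cE[OF e] cV[OF sX(1)[OF e]] z by simp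
		then show "ini (skel X) (emap (att X) e) = vmap (att X) (ini (bdry X) e)"
			using inj_onD[OF F(7)] sS(1)[OF aE[OF e]] aV[OF sX(1)[OF e]] by blast
		have "emap f (opp (skel X) (emap (att X) e)) = emap f (emap (att X) (opp (bdry X) e))"
			using F(6)[OF aE[OF e]] cE[OF e] cE[OF sX(2)[OF e]] z by simp
		then show "opp (skel X) (emap (att X) e) = emap (att X) (opp (bdry X) e)"
			using inj_onD[OF F(8)] sS(2)[OF aE[OF e]] aE[OF sX(2)[OF e]] by blast
	qed
	moreover have "inj_on (emap (att X)) (lk (bdry X) u)" if u: "u : verts (bdry X)" for u
	proof (rule inj_onI)
		fix a b assume h: "a : lk (bdry X) u" "b : lk (bdry X) u" "emap (att X) a = emap (att X) b"
		then have "emap (att Z) (emap g a) = emap (att Z) (emap g b)" using cE by (metis (no_types, lifting) lk_def mem_Collect_eq)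
		moreover have "emap g a : lk (bdry Z) (vmap g u)" "emap g b : lk (bdry Z) (vmap g u)" using lkX[OF u] h by blast+
		ultimately have "emap g a = emap g b" using inj_onD[OF aZ(2)[OF G(3)[OF u]]] by blast
		then show "a = b" using inj_onD[OF injl] h by blast
	qed
	ultimately show "two_complex X" unfolding two_complex_def immersion_def using F(1) by simp
qed

lemma Irred_iso:
	assumes "complex_iso X Z f g" "two_complex Z" "finite_complex Z" "two_complex X" "(Y, p, s) : Irred (standard X)"
	shows "(Y, gcomp f p, gcomp g s) : Irred (standard Z)"
	using assms(5) essential_iso[OF assms(1-4)] unfolding Irred_def by auto

declare DomainE [elim!]

section \<open>Duality for systems of blocks\<close>

lemma bedgesD:
	assumes "two_complex X" "xblock X b" "e : bedges X b"
	shows "e : edges (skel X)" "opp (skel X) (opp (skel X) e) = e"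
proof -
	obtain d where "d : edges (bdry X)" "e = emap (att X) d" using assms(2,3) unfolding bedges_def xblock_def by (auto split: prod.splits)
	then show "e : edges (skel X)" using assms(1) unfolding two_complex_def immersion_def graph_morphism_def by auto
	then show "opp (skel X) (opp (skel X) e) = e" using assms(1) unfolding two_complex_def sgraph_def by blast
qed

lemma finite_bedges: "xblock X b ==> finite (bedges X b)"
proof -
	assume "xblock X b"
	then have "finite (Domain (fst b))" unfolding xblock_def by (auto split: prod.splits dest: dart_blockD(1))
	then show ?thesis unfolding bedges_def by simp
qed

lemma compat_sym:
	assumes X: "two_complex X" and b: "xblock X b" and c: "compat X b e b'"
	shows "opp (skel X) e : bedges X b'" "compat X b' (opp (skel X) e) b"
proof -
	obtain Q P N where bq: "b = (Q, P, N)" by (cases b)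
	obtain Q' P' N' where bq': "b' = (Q', P', N')" by (cases b')
	let ?w = "emap (att X)" and ?o = "opp (bdry X)"
	have e: "e : bedges X b" and C: "!!d d'. d : edges (bdry X) ==> d' : edges (bdry X) ==> ?w d = e ==> ?w d' = e ==>
			((d, d') : Q \<longleftrightarrow> (?o d, ?o d') : Q') & ((d, d') : P \<longleftrightarrow> (?o d, ?o d') : N') & ((d, d') : N \<longleftrightarrow> (?o d, ?o d') : P')"
		using c unfolding compat_def bq bq' prod.case by blast+
	have w: "?w d : edges (skel X)" "opp (skel X) (?w d) = ?w (?o d)" if "d : edges (bdry X)" for d
		using X that unfolding two_complex_def immersion_def graph_morphism_def by auto
	have o: "?o d : edges (bdry X)" "?o (?o d) = d" if "d : edges (bdry X)" for d
		using X that unfolding two_complex_def circles_def sgraph_def by auto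
	have sub: "Domain Q \<subseteq> edges (bdry X)" and blk: "dart_block (flip (bdry X)) ?w (Domain Q) Q P N"
		using b unfolding xblock_def bq by auto
	obtain d where d: "d : Domain Q" "?w d = e" using e unfolding bedges_def bq by auto
	have dE: "d : edges (bdry X)" using d sub by blast
	have "(d, d) : Q" using eqrelD(2)[OF dart_blockD(2)[OF blk]] d by blast
	then have "(?o d, ?o d) : Q'" using C[OF dE dE d(2) d(2)] by blast
	then have "?o d : Domain Q'" by blast
	moreover have "?w (?o d) = opp (skel X) e" using w(2)[OF dE] d(2) by simp
	ultimately show 1: "opp (skel X) e : bedges X b'" unfolding bedges_def bq' by (metis fst_conv image_eqI)
	have ee: "opp (skel X) (opp (skel X) e) = e" by (rule bedgesD(2)[OF X b e])
	show "compat X b' (opp (skel X) e) b"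
		unfolding compat_def bq bq' prod.case
	proof (intro conjI ballI impI)
		show "opp (skel X) e : bedges X (Q', P', N')" using 1 unfolding bq' .
		fix a a' assume h: "a : edges (bdry X)" "a' : edges (bdry X)" "?w a = opp (skel X) e" "?w a' = opp (skel X) e"
		have "?w (?o a) = e" "?w (?o a') = e" using w(2)[OF h(1)] w(2)[OF h(2)] h ee by simp_all
		from C[OF o(1)[OF h(1)] o(1)[OF h(2)] this] o(2)[OF h(1)] o(2)[OF h(2)]
		show "(a, a') : Q' \<longleftrightarrow> (?o a, ?o a') : Q" "(a, a') : P' \<longleftrightarrow> (?o a, ?o a') : N" "(a, a') : N' \<longleftrightarrow> (?o a, ?o a') : P" by simp_all
	qed
qed

text \<open>Crossing an edge is an involution on pairs (v, e). Twice the sum is therefore a sum of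
  paired prices, each at most 0.\<close>

lemma weak_duality:
	fixes y :: "'o => 'f => real" and X :: "('w, 'f, 'x, 'c) two_complex"
	assumes X: "two_complex X" and sys: "dsystem X V \<beta> mate"
		and y: "!!v e. v : V ==> e : bedges X (\<beta> v) ==> y v e + y (mate v e) (opp (skel X) e) \<le> 0"
	shows "(\<Sum>v\<in>V. \<Sum>e\<in>bedges X (\<beta> v). y v e) \<le> 0"
proof -
	have V: "finite V" "!!v. v : V ==> xblock X (\<beta> v)" using sys unfolding dsystem_def by auto
	have m: "mate v e : V" "compat X (\<beta> v) e (\<beta> (mate v e))" "mate (mate v e) (opp (skel X) e) = v" if "v : V" "e : bedges X (\<beta> v)" for v e
		using sys that unfolding dsystem_def by auto
	define T where "T = Sigma V (%v. bedges X (\<beta> v))"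
	define g where "g = (%(v, e). (mate v e, opp (skel X) e))"
	define h where "h = (%(v, e). y v e)"
	have gT: "g t : T" "g (g t) = t" if "t : T" for t
	proof -
		obtain v e where t: "t = (v, e)" "v : V" "e : bedges X (\<beta> v)" using \<open>t : T\<close> unfolding T_def by auto
		have ve: "mate v e : V" "opp (skel X) e : bedges X (\<beta> (mate v e))" using m[OF t(2,3)] compat_sym(1)[OF X V(2)[OF t(2)] m(2)[OF t(2,3)]] by auto
		then show "g t : T" unfolding T_def g_def t(1) by simp
		show "g (g t) = t" unfolding g_def t(1) using m(3)[OF t(2,3)] bedgesD(2)[OF X V(2)[OF t(2)] t(3)] by simp
	qed
	have "sum h T = (\<Sum>t\<in>T. h (g t))" by (rule sum.reindex_bij_witness[of _ g g]) (use gT in auto)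
	then have "2 * sum h T = (\<Sum>t\<in>T. h t + h (g t))" by (simp add: sum.distrib)
	also have "\<dots> \<le> 0" by (rule sum_nonpos) (use y in \<open>auto simp: T_def h_def g_def\<close>)
	finally have "sum h T \<le> 0" by simp
	moreover have "sum h T = (\<Sum>v\<in>V. \<Sum>e\<in>bedges X (\<beta> v). y v e)"
		unfolding T_def h_def by (subst sum.Sigma) (use V in \<open>auto intro: finite_bedges\<close>)
	ultimately show ?thesis by simp
qed

text \<open>Take \<open>x b\<close> copies of each block. As the glueings across \<open>e\<close>
  sum to \<open>x b\<close>, the copies can be matched bijectively (\<open>g\<close>) with pairs
  consisting of a neighbouring block and an index.\<close>

lemma dsystem_of_primal:
	fixes X :: "('w, 'f, 'x, 'c) two_complex" and dec :: "'b => 'c block"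
	assumes X: "two_complex X" and B: "finite B" "!!b. b : B ==> xblock X (dec b)"
		and pr: "lp_primal B (%b. bedges X (dec b)) (%b e b'. compat X (dec b) e (dec b')) (opp (skel X)) chi ar a x z"
	shows "\<exists>(k :: nat) \<beta> mate. dsystem X {..<k} (%v. dec (\<beta> v)) mate & (\<forall>v<k. \<beta> v : B) &
		 (\<forall>f :: 'b => real. (\<Sum>v<k. f (\<beta> v)) = (\<Sum>b\<in>B. of_nat (x b) * f b))"
proof -
	let ?E = "%b. bedges X (dec b)" and ?o = "opp (skel X)"
	have z: "(\<Sum>b'\<in>B. z b e b') = x b" if "b : B" "e : ?E b" for b e
		using pr that unfolding lp_primal_def by blast
	have zc: "compat X (dec b) e (dec b')" "z b' (?o e) b = z b e b'" if "b : B" "b' : B" "e : ?E b" "z b e b' ~= 0" for b b' e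
		using pr that unfolding lp_primal_def by blast+
	obtain b0 where b0: "b0 : B" "x b0 ~= 0" using pr unfolding lp_primal_def by blast
	define T where "T b e = Sigma B (%b'. {..<z b e b'})" for b e
	define g where "g b e = (SOME h. bij_betw h {..<x b} (T b e))" for b e
	have g: "bij_betw (g b e) {..<x b} (T b e)" if be: "b : B" "e : ?E b" for b e
	proof -
		have "finite (T b e)" unfolding T_def using B by simp
		moreover have "card (T b e) = x b" unfolding T_def using B z[OF be] by simp
		ultimately have "\<exists>h. bij_betw h {..<x b} (T b e)" by (intro finite_same_card_bij) auto
		then show ?thesis unfolding g_def by (rule someI_ex)
	qed
	define V where "V = Sigma B (%b. {..<x b})"
	have V: "finite V" "(b0, 0) : V" unfolding V_def using B b0 by auto
	\<comment> \<open>If \<open>g\<close> matches copy i of b with (b', j), the mate is the copy of b'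
	  that is matched with (b, j) across the opposite edge; symmetry of \<open>z\<close> makes j a
	  legal index there.\<close>
	define m where "m p e = (fst (g (fst p) e (snd p)), inv_into {..<x (fst (g (fst p) e (snd p)))} (g (fst (g (fst p) e (snd p))) (?o e)) (fst p, snd (g (fst p) e (snd p))))" for p e
	have mp: "m p e : V & compat X (dec (fst p)) e (dec (fst (m p e))) & m (m p e) (?o e) = p" if p: "p : V" "e : ?E (fst p)" for p e
	proof -
		obtain b i where bi: "p = (b, i)" "b : B" "i < x b" using p(1) unfolding V_def by auto
		have e: "e : ?E b" using p(2) bi by simp
		obtain b' j where bj: "g b e i = (b', j)" by (cases "g b e i")
		have "(b', j) : T b e" using bij_betwE[OF g[OF bi(2) e]] bi(3) bj by force
		then have b': "b' : B" "j < z b e b'" unfolding T_def by auto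
		then have zz: "compat X (dec b) e (dec b')" "z b' (?o e) b = z b e b'" using zc[OF bi(2) b'(1) e] by auto
		have oe: "?o e : ?E b'" by (rule compat_sym(1)[OF X B(2)[OF bi(2)] zz(1)])
		have oo: "?o (?o e) = e" by (rule bedgesD(2)[OF X B(2)[OF bi(2)] e])
		have bjT: "(b, j) : T b' (?o e)" unfolding T_def using bi(2) b'(2) zz(2) by simp
		define i' where "i' = inv_into {..<x b'} (g b' (?o e)) (b, j)"
		have gi: "g b' (?o e) ` {..<x b'} = T b' (?o e)" using g[OF b'(1) oe] unfolding bij_betw_def by simp
		have i': "i' < x b'" "g b' (?o e) i' = (b, j)"
			using inv_into_into[of "(b, j)" "g b' (?o e)" "{..<x b'}"] f_inv_into_f[of "(b, j)" "g b' (?o e)" "{..<x b'}"] bjT unfolding gi i'_def by simp_all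
		have mpe: "m p e = (b', i')" unfolding m_def bi(1) fst_conv snd_conv bj i'_def ..
		have "inv_into {..<x b} (g b e) (b', j) = i"
			using inv_into_f_f[of "g b e" "{..<x b}" i] g[OF bi(2) e] bi(3) bj unfolding bij_betw_def by simp
		then have "m (b', i') (?o e) = (b, i)" unfolding m_def fst_conv snd_conv i'(2) oo by simp
		then show ?thesis unfolding mpe using zz(1) bi b'(1) i'(1) by (simp add: V_def)
	qed
	obtain h where h: "bij_betw h {0..<card V} V" using ex_bij_betw_nat_finite[OF V(1)] by blast
	define k where "k = card V"
	have hk: "bij_betw h {..<k} V" using h unfolding k_def atLeast0LessThan .
	have kpos: "k > 0" unfolding k_def using V card_gt_0_iff by blast
	have hV: "h v : V" if "v < k" for v using bij_betwE[OF hk] that by simp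
	define mt where "mt v e = inv_into {..<k} h (m (h v) e)" for v e
	have hinv: "inv_into {..<k} h t < k" "h (inv_into {..<k} h t) = t" if "t : V" for t
		using that hk inv_into_into[of t h "{..<k}"] f_inv_into_f[of t h "{..<k}"] unfolding bij_betw_def by simp_all
	have hB: "fst (h v) : B" if "v < k" for v using hV[OF that] unfolding V_def by auto
	have "dsystem X {..<k} (%v. dec (fst (h v))) mt"
		unfolding dsystem_def
	proof (intro conjI ballI)
		show "finite {..<k}" "{..<k} ~= {}" using kpos by auto
		fix v assume v: "v : {..<k}"
		show "xblock X (dec (fst (h v)))" using B(2) hB v by simp
		fix e assume e: "e : ?E (fst (h v))"
		have M: "m (h v) e : V" "compat X (dec (fst (h v))) e (dec (fst (m (h v) e)))" "m (m (h v) e) (?o e) = h v"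
			using mp[OF hV e] v by simp_all
		show "mt v e : {..<k}" unfolding mt_def using hinv(1)[OF M(1)] by simp
		show "compat X (dec (fst (h v))) e (dec (fst (h (mt v e))))" unfolding mt_def hinv(2)[OF M(1)] by (rule M(2))
		show "mt (mt v e) (?o e) = v" unfolding mt_def hinv(2)[OF M(1)] M(3)
			using hk v unfolding bij_betw_def by (simp add: inv_into_f_f)
	qed
	moreover have "(\<Sum>v<k. f (fst (h v))) = (\<Sum>b\<in>B. of_nat (x b) * f b)" for f :: "'b => real"
	proof -
		have "(\<Sum>v<k. f (fst (h v))) = (\<Sum>p\<in>V. f (fst p))" by (rule sum.reindex_bij_betw[OF hk])
		also have "\<dots> = (\<Sum>b\<in>B. \<Sum>i<x b. f b)" unfolding V_def by (subst sum.Sigma[OF B(1)]) (auto simp: split_def)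
		finally show ?thesis by simp
	qed
	ultimately show ?thesis using hB by (intro exI[of _ k] exI[of _ "%v. fst (h v)"] exI[of _ mt]) simp
qed

section \<open>Coded complexes and blocks\<close>

definition "cN c = clen (csnd (cnth c 1))"
definition "cE c = clen (csnd (cnth c 0))"
definition "cini c e = cfst (cnth (csnd (cnth c 0)) e)"
definition "copp c e = csnd (cnth (csnd (cnth c 0)) e)"
definition "cbini c d = cfst (cnth (csnd (cnth c 1)) d)"
definition "cbopp c d = csnd (cnth (csnd (cnth c 1)) d)"
definition "cA c u = cnth (cnth c 2) u"
definition "cW c d = cnth (cnth c 3) d"

text \<open>Every number decodes to something of this type; only for codes of complexes is the
  result a complex, whose cells are positions in the enumerations.\<close>

definition cX :: "nat => (nat, nat, nat, nat) two_complex" where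
	"cX c = \<lparr>skel = \<lparr>verts = {..<cfst (cnth c 0)}, edges = {..<cE c}, ini = cini c, opp = copp c\<rparr>,
		 bdry = \<lparr>verts = {..<cfst (cnth c 1)}, edges = {..<cN c}, ini = cbini c, opp = cbopp c\<rparr>,
		 att = \<lparr>vmap = cA c, emap = cW c\<rparr>\<rparr>"

lemma cX_simps [simp]:
	"verts (skel (cX c)) = {..<cfst (cnth c 0)}" "edges (skel (cX c)) = {..<cE c}" "ini (skel (cX c)) = cini c" "opp (skel (cX c)) = copp c"
	"verts (bdry (cX c)) = {..<cfst (cnth c 1)}" "edges (bdry (cX c)) = {..<cN c}" "ini (bdry (cX c)) = cbini c" "opp (bdry (cX c)) = cbopp c"
	"vmap (att (cX c)) = cA c" "emap (att (cX c)) = cW c"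
	by (simp_all add: cX_def)

text \<open>A total version of \<^const>\<open>flip\<close>: the sum has exactly one nonzero term if the code is that of a complex.\<close>

definition "cF c d = (let s = (\<Sum>i<cN c. of_bool (i ~= d & cbini c i = cbini c d) * i) in if s < cN c then s else d)"

text \<open>A relation is the bit set of its pair codes. The restriction to \<open>cN c\<close>
  makes every number decode to a relation on darts.\<close>

definition "crel c q = {(i, j). i < cN c & j < cN c & prod_encode (i, j) : set_decode q}"

definition "bQ c b = crel c (cfst b)"
definition "bP c b = crel c (cfst (csnd b))"
definition "bN c b = crel c (csnd (csnd b))"
definition cdec :: "nat => nat => nat block" where "cdec c b = (bQ c b, bP c b, bN c b)"

text \<open>Stated with the total function \<open>cF\<close>, so that it is decidable for all
  numbers; for codes of complexes it agrees with \<open>xblock\<close>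
  (\<open>cblock_iff\<close>).\<close>

definition "cblock c b \<longleftrightarrow> (\<exists>d<cN c. d : Domain (bQ c b)) &
	 (\<forall>d<cN c. \<forall>d'<cN c. d : Domain (bQ c b) --> d' : Domain (bQ c b) --> cini c (cW c d) = cini c (cW c d')) &
	 dart_block (cF c) (cW c) (Domain (bQ c b)) (bQ c b) (bP c b) (bN c b)"

lemma cF_less: "d < cN c ==> cF c d < cN c"
	by (simp add: cF_def Let_def)

lemma crel_sub: "crel c q \<subseteq> {..<cN c} \<times> {..<cN c}"
	by (auto simp: crel_def)

section \<open>Decidability of the block conditions\<close>

lemmas comp1 = computable_id computable_Suc computable_add computable_mult computable_sub computable_const computable_cfst computable_csnd
	computable_pair computable_cnth computable_clen computable_power2 computable_sum computable_of_bool computable_if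
	decidable_eq decidable_less decidable_le decidable_ball decidable_bex decidable_conj decidable_disj decidable_imp decidable_not decidable_iff
	decidable_set_decode

lemma computable_cN: "computable f ==> computable (%x. cN (f x))"
	and computable_cE: "computable f ==> computable (%x. cE (f x))"
	and computable_cini: "computable f ==> computable g ==> computable (%x. cini (f x) (g x))"
	and computable_copp: "computable f ==> computable g ==> computable (%x. copp (f x) (g x))"
	and computable_cbini: "computable f ==> computable g ==> computable (%x. cbini (f x) (g x))"
	and computable_cbopp: "computable f ==> computable g ==> computable (%x. cbopp (f x) (g x))"
	and computable_cW: "computable f ==> computable g ==> computable (%x. cW (f x) (g x))"
	unfolding cN_def cE_def cini_def copp_def cbini_def cbopp_def cW_def by (intro comp1; assumption)+

lemmas comp2 = comp1 computable_cN computable_cE computable_cini computable_copp computable_cbini computable_cbopp computable_cW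

lemma computable_cF:
	assumes "computable f" "computable g"
	shows "computable (%x. cF (f x) (g x))"
	unfolding cF_def Let_def by (intro comp2 computable_comp[OF assms(1)] computable_comp[OF assms(2)])

lemma decidable_crel:
	assumes "computable c" "computable q" "computable a" "computable b"
	shows "decidable (%x. (a x, b x) : crel (c x) (q x))"
	unfolding crel_def mem_Collect_eq case_prod_conv by (intro comp2 assms)

lemma decidable_bQ: "computable c ==> computable q ==> computable a ==> computable b ==> decidable (%x. (a x, b x) : bQ (c x) (q x))"
	and decidable_bP: "computable c ==> computable q ==> computable a ==> computable b ==> decidable (%x. (a x, b x) : bP (c x) (q x))"
	and decidable_bN: "computable c ==> computable q ==> computable a ==> computable b ==> decidable (%x. (a x, b x) : bN (c x) (q x))"
	unfolding bQ_def bP_def bN_def by (intro decidable_crel comp1; assumption)+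

lemmas comp3 = comp2 computable_cF decidable_bQ decidable_bP decidable_bN

lemma Domain_bounded: "R \<subseteq> {..<n} \<times> {..<n} ==> d : Domain R \<longleftrightarrow> (\<exists>j<n. (d, j) : R)"
	by auto

lemma bsub: "bQ c b \<subseteq> {..<cN c} \<times> {..<cN c}" "bP c b \<subseteq> {..<cN c} \<times> {..<cN c}" "bN c b \<subseteq> {..<cN c} \<times> {..<cN c}"
	unfolding bQ_def bP_def bN_def by (rule crel_sub)+

lemma decidable_Dom:
	assumes "computable c" "computable b" "computable d"
	shows "decidable (%x. d x : Domain (bQ (c x) (b x)))"
	unfolding Domain_bounded[OF bsub(1)] by (intro comp3 computable_comp[OF assms(1)] computable_comp[OF assms(2)] computable_comp[OF assms(3)])

lemma decidable_rtrancl: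
	assumes n: "computable n" and R: "!!x. R x \<subseteq> {..<n x} \<times> {..<n x}"
		and dec: "decidable (%p. (cfst (csnd p), csnd (csnd p)) : R (cfst p))" and a: "computable a" and b: "computable b"
	shows "decidable (%x. (a x, b x) : (R x)\<^sup>*)"
proof -
	have D: "decidable (%p. (g p, h p) : R (f p))" if "computable f" "computable g" "computable h" for f g h
		using decidable_comp[OF dec computable_pair[OF that(1) computable_pair[OF that(2,3)]]] by simp
	\<comment> \<open>Outside the range no pair starts at \<open>a x\<close>, which leaves only
	  equality; inside it the test by closed subsets applies.\<close>
	have "(a x, b x) : (R x)\<^sup>* \<longleftrightarrow> a x = b x \<or> (a x < n x & (\<forall>z<2 ^ n x. a x : set_decode z -->
		(\<forall>i<n x. \<forall>j<n x. (i, j) : R x --> i : set_decode z --> j : set_decode z) --> b x : set_decode z))" for x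
	proof (cases "a x < n x")
		case True then show ?thesis using rtrancl_closed_iff[OF R True, of "b x"] by auto
	next
		case False
		then have "(a x, y) \<notin> R x" for y using R[of x] by auto
		then have "(a x, b x) : (R x)\<^sup>* \<longleftrightarrow> a x = b x" by (auto elim: converse_rtranclE)
		then show ?thesis using False by simp
	qed
	moreover have "decidable (%x. a x = b x \<or> (a x < n x & (\<forall>z<2 ^ n x. a x : set_decode z -->
		(\<forall>i<n x. \<forall>j<n x. (i, j) : R x --> i : set_decode z --> j : set_decode z) --> b x : set_decode z)))"
		by (intro comp1 D computable_comp[OF n] computable_comp[OF a] computable_comp[OF b])
	ultimately show ?thesis by (simp only:)
qed

lemma flip_rel_iff: "(a, b) : flip_rel fl A \<longleftrightarrow> a : A & b = fl a"
	by (auto simp: flip_rel_def)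

lemma Dom_less: "d : Domain (bQ c b) ==> d < cN c"
	using bsub(1) by blast

lemma flip_rel_sub: "flip_rel (cF c) (Domain (bQ c b)) \<subseteq> {..<cN c} \<times> {..<cN c}"
	by (auto simp: flip_rel_iff dest!: Dom_less intro: cF_less)

lemmas comp4 = comp3 decidable_Dom

lemma decidable_vrel:
	assumes "computable c" "computable b" "computable d" "computable d'"
	shows "decidable (%x. (d x, d' x) : vrel (cF (c x)) (Domain (bQ (c x) (b x))) (bQ (c x) (b x)))"
	unfolding vrel_def
proof (rule decidable_rtrancl[where n = "%x. cN (c x)"])
	show "bQ (c x) (b x) \<union> flip_rel (cF (c x)) (Domain (bQ (c x) (b x))) \<subseteq> {..<cN (c x)} \<times> {..<cN (c x)}" for x
		by (rule Un_least[OF bsub(1) flip_rel_sub])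
qed (unfold Un_iff flip_rel_iff, (intro comp4 computable_comp[OF assms(1)] computable_comp[OF assms(2)] assms)+)

lemma decidable_near_rel:
	assumes "computable c" "computable b" "computable e" "computable d" "computable d'"
	shows "decidable (%x. (d x, d' x) : near_rel (cF (c x)) (cW (c x)) (Domain (bQ (c x) (b x))) (bQ (c x) (b x)) (bP (c x) (b x)) (e x))"
	unfolding near_rel_def
proof (rule decidable_rtrancl[where n = "%x. cN (c x)"])
	show "bQ (c x) (b x) \<union> flip_rel (cF (c x)) (Domain (bQ (c x) (b x))) \<union> {(a, b'). (a, b') : bP (c x) (b x) & cW (c x) a ~= cW (c x) (e x)} \<subseteq> {..<cN (c x)} \<times> {..<cN (c x)}" for x
		by (intro Un_least bsub(1) flip_rel_sub) (use bsub(2)[of "c x" "b x"] in auto)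
qed (unfold Un_iff flip_rel_iff mem_Collect_eq case_prod_conv, (intro comp4 computable_comp[OF assms(1)] computable_comp[OF assms(2)] computable_comp[OF assms(3)] assms)+)

lemma decidable_cut_rel:
	assumes "computable c" "computable b" "computable e" "computable d" "computable d'"
	shows "decidable (%x. (d x, d' x) : cut_rel (cF (c x)) (Domain (bQ (c x) (b x))) (bQ (c x) (b x)) (e x))"
proof -
	have eq: "{(y, cF (c x) y) | y. y : Domain (bQ (c x) (b x)) & (e x, y) \<notin> bQ (c x) (b x) & (e x, cF (c x) y) \<notin> bQ (c x) (b x)} =
		{(y, z). y : Domain (bQ (c x) (b x)) & z = cF (c x) y & (e x, y) \<notin> bQ (c x) (b x) & (e x, cF (c x) y) \<notin> bQ (c x) (b x)}" for x by auto
	show ?thesis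
		unfolding cut_rel_def eq
	proof (rule decidable_rtrancl[where n = "%x. cN (c x)"])
		show "bQ (c x) (b x) \<union> {(y, z). y : Domain (bQ (c x) (b x)) & z = cF (c x) y & (e x, y) \<notin> bQ (c x) (b x) & (e x, cF (c x) y) \<notin> bQ (c x) (b x)} \<subseteq> {..<cN (c x)} \<times> {..<cN (c x)}" for x
			by (intro Un_least bsub(1)) (auto dest!: Dom_less intro: cF_less)
	qed (unfold Un_iff mem_Collect_eq case_prod_conv, (intro comp4 computable_comp[OF assms(1)] computable_comp[OF assms(2)] computable_comp[OF assms(3)] assms)+)
qed

lemmas comp5 = comp4 decidable_vrel decidable_near_rel decidable_cut_rel

lemma even_card_iff: "even (card (B \<inter> R `` {d})) \<longleftrightarrow> (\<exists>q<Suc (\<Sum>i<n. of_bool (i : B & (d, i) : R)). (\<Sum>i<n. of_bool (i : B & (d, i) : R)) = 2 * q)"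
	if "B \<subseteq> {..<n}" for B :: "nat set"
proof -
	have "card (B \<inter> R `` {d}) = (\<Sum>i<n. of_bool (i : B & (d, i) : R))"
	proof -
		have "(\<Sum>i<n. of_bool (i : B & (d, i) : R)) = card ({..<n} \<inter> {i. i : B & (d, i) : R})" by (simp add: sum_of_bool_eq)
		also have "{..<n} \<inter> {i. i : B & (d, i) : R} = B \<inter> R `` {d}" using that by auto
		finally show ?thesis by simp
	qed
	moreover have "even m \<longleftrightarrow> (\<exists>q<Suc m. m = 2 * q)" for m :: nat by (auto elim!: evenE)
	ultimately show ?thesis by metis
qed

lemma all_subsets_iff:
	assumes "A \<subseteq> {..<n}"
	shows "(\<forall>B\<subseteq>A. P B) \<longleftrightarrow> (\<forall>z<2 ^ n. (\<forall>i<Suc z. i : set_decode z --> i : A) --> P (set_decode z))"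
proof
	have lt: "i < Suc z" if "i : set_decode z" for i z
	proof -
		have "z div 2 ^ i ~= 0" using that by (auto simp: set_decode_def intro: odd_pos)
		then have "2 ^ i \<le> z" by (metis div_less not_le)
		then show ?thesis using less_exp[of i] by linarith
	qed
	show "\<forall>z<2 ^ n. (\<forall>i<Suc z. i : set_decode z --> i : A) --> P (set_decode z)" if "\<forall>B\<subseteq>A. P B"
		using that lt by blast
	assume h: "\<forall>z<2 ^ n. (\<forall>i<Suc z. i : set_decode z --> i : A) --> P (set_decode z)"
	show "\<forall>B\<subseteq>A. P B"
	proof (intro allI impI)
		fix B assume B: "B \<subseteq> A"
		then have "finite B" "set_encode B < 2 ^ n" using assms by (auto intro: finite_subset set_encode_less)
		then show "P B" using h[rule_format, of "set_encode B"] B by auto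
	qed
qed

lemma eqrel_bounded:
	assumes "R \<subseteq> {..<n} \<times> {..<n}" "A \<subseteq> {..<n}"
	shows "eqrel A R \<longleftrightarrow> (\<forall>i<n. i : A --> (i, i) : R) & (\<forall>i<n. \<forall>j<n. (i, j) : R --> i : A & j : A & (j, i) : R) &
		 (\<forall>i<n. \<forall>j<n. \<forall>k<n. (i, j) : R --> (j, k) : R --> (i, k) : R)"
proof
	assume e: "eqrel A R"
	show "(\<forall>i<n. i : A --> (i, i) : R) & (\<forall>i<n. \<forall>j<n. (i, j) : R --> i : A & j : A & (j, i) : R) &
		 (\<forall>i<n. \<forall>j<n. \<forall>k<n. (i, j) : R --> (j, k) : R --> (i, k) : R)"
	proof -
		have 1: "(i, i) : R" if "i : A" for i by (rule bspec[OF eqrelD(2)[OF e] that])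
		have 2: "i : A" "j : A" "(j, i) : R" if ij: "(i, j) : R" for i j
			using subsetD[OF eqrelD(1)[OF e] ij] symD[OF eqrelD(3)[OF e] ij] by simp_all
		have 3: "(i, k) : R" if "(i, j) : R" "(j, k) : R" for i j k by (rule transD[OF eqrelD(4)[OF e] that])
		show ?thesis by (intro conjI allI impI) (rule 1 2 3, assumption+)+
	qed
next
	assume H: "(\<forall>i<n. i : A --> (i, i) : R) & (\<forall>i<n. \<forall>j<n. (i, j) : R --> i : A & j : A & (j, i) : R) &
		 (\<forall>i<n. \<forall>j<n. \<forall>k<n. (i, j) : R --> (j, k) : R --> (i, k) : R)"
	have h: "(i, i) : R" if "i < n" "i : A" for i using conjunct1[OF H] that by blast
	have h2: "i : A & j : A & (j, i) : R" if "i < n" "j < n" "(i, j) : R" for i j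
		using conjunct1[OF conjunct2[OF H]] that by blast
	have h3: "(i, k) : R" if "i < n" "j < n" "k < n" "(i, j) : R" "(j, k) : R" for i j k
		using conjunct2[OF conjunct2[OF H]] that by blast
	have b: "i < n" "j < n" if "(i, j) : R" for i j using that assms(1) by auto
	show "eqrel A R"
		unfolding eqrel_def
	proof (intro conjI ballI symI transI subrelI)
		show "(i, j) : A \<times> A" "(j, i) : R" if "(i, j) : R" for i j using h2[OF b[OF that] that] by blast+
		show "(i, i) : R" if "i : A" for i using h[of i] that assms(2) by blast
		show "(i, k) : R" if "(i, j) : R" "(j, k) : R" for i j k by (rule h3[OF b[OF that(1)] b(2)[OF that(2)] that])
	qed
qed

text \<open>For decidability every quantifier must be bounded: subsets become bit sets below
  \<open>2 ^ n\<close>, and evenness becomes the existence of a half below the successor of the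
  count.\<close>

lemma dart_block_bounded:
	assumes A: "A \<subseteq> {..<n}" and Q: "Q \<subseteq> {..<n} \<times> {..<n}" and P: "P \<subseteq> {..<n} \<times> {..<n}" and N: "N \<subseteq> {..<n} \<times> {..<n}"
	shows "dart_block fl W A Q P N \<longleftrightarrow> eqrel A Q & eqrel A P & eqrel A N &
		 (\<forall>a<n. \<forall>b<n. ((a, b) : Q --> (a, b) : P & (a, b) : N) & ((a, b) : P \<or> (a, b) : N --> W a = W b)) &
		 (\<forall>d<n. d : A --> fl d : A & (\<exists>d'<n. d' ~= d & (d, d') : Q)) &
		 (\<forall>d<n. \<forall>d'<n. d : A --> d' : A --> W d = W d' --> (d, d') : near_rel fl W A Q P d --> (d, d') : N) &
		 (\<forall>z<2 ^ n. (\<forall>i<Suc z. i : set_decode z --> i : A) -->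
				(\<forall>d<n. d : A --> (\<exists>q<Suc (\<Sum>i<n. of_bool (i : set_decode z & (d, i) : vrel fl A Q)). (\<Sum>i<n. of_bool (i : set_decode z & (d, i) : vrel fl A Q)) = 2 * q)) -->
				(\<forall>d<n. d : A --> (\<exists>q<Suc (\<Sum>i<n. of_bool (i : set_decode z & (d, i) : P)). (\<Sum>i<n. of_bool (i : set_decode z & (d, i) : P)) = 2 * q)) -->
				(\<forall>d<n. d : A --> (\<exists>q<Suc (\<Sum>i<n. of_bool (i : set_decode z & (d, i) : Q)). (\<Sum>i<n. of_bool (i : set_decode z & (d, i) : Q)) = 2 * q))) &
		 (\<forall>c<n. \<forall>a<n. \<forall>b<n. c : A --> a : A --> b : A --> (c, a) : vrel fl A Q --> (c, b) : vrel fl A Q --> (c, a) \<notin> Q --> (c, b) \<notin> Q -->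
				(a, b) : cut_rel fl A Q c)"
proof -
	have A1: "(\<forall>d\<in>A. H d) \<longleftrightarrow> (\<forall>d<n. d : A --> H d)" for H using A by auto
	have f: "finite A" using A by (rule finite_subset) simp
	have R1: "Q \<subseteq> P & Q \<subseteq> N & (\<forall>(a, b)\<in>P \<union> N. W a = W b) \<longleftrightarrow>
		(\<forall>a<n. \<forall>b<n. ((a, b) : Q --> (a, b) : P & (a, b) : N) & ((a, b) : P \<or> (a, b) : N --> W a = W b))"
	proof -
		have b: "a < n" "b < n" if "(a, b) : Q \<or> (a, b) : P \<or> (a, b) : N" for a b using that Q P N by auto
		show ?thesis unfolding subset_iff split_paired_All Ball_def case_prod_conv Un_iff using b by blast
	qed
	have R2: "(\<forall>d\<in>A. fl d : A) & (\<forall>d\<in>A. \<exists>d'. d' ~= d & (d, d') : Q) \<longleftrightarrow> (\<forall>d<n. d : A --> fl d : A & (\<exists>d'<n. d' ~= d & (d, d') : Q))"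
	proof -
		have "(\<exists>d'. d' ~= d & (d, d') : Q) \<longleftrightarrow> (\<exists>d'<n. d' ~= d & (d, d') : Q)" for d using Q by blast
		then show ?thesis unfolding A1 by blast
	qed
	have R3: "(\<forall>d\<in>A. \<forall>d'\<in>A. W d = W d' --> H d d') \<longleftrightarrow> (\<forall>d<n. \<forall>d'<n. d : A --> d' : A --> W d = W d' --> H d d')" for H
		using A by auto
	have R4: "(\<forall>c\<in>A. \<forall>a\<in>A. \<forall>b\<in>A. H c a b) \<longleftrightarrow> (\<forall>c<n. \<forall>a<n. \<forall>b<n. c : A --> a : A --> b : A --> H c a b)" for H
		using A by auto
	have z: "(\<forall>d<n. d : A --> even (card (set_decode z \<inter> R `` {d}))) \<longleftrightarrow>
		 (\<forall>d<n. d : A --> (\<exists>q<Suc (\<Sum>i<n. of_bool (i : set_decode z & (d, i) : R)). (\<Sum>i<n. of_bool (i : set_decode z & (d, i) : R)) = 2 * q))"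
		if "z < 2 ^ n" for z R
	proof -
		have "set_decode z \<subseteq> {..<n}"
		proof
			fix i assume "i : set_decode z"
			then have "z div 2 ^ i ~= 0" by (auto simp: set_decode_def intro: odd_pos)
			then have "2 ^ i \<le> z" by (metis div_less not_le)
			then have "(2 :: nat) ^ i < 2 ^ n" using that by linarith
			then show "i : {..<n}" by simp
		qed
		note ec = even_card_iff[OF this]
		show ?thesis unfolding ec by (rule refl)
	qed
	have R5: "(\<forall>B\<subseteq>A. (\<forall>d\<in>A. even (card (B \<inter> vrel fl A Q `` {d}))) --> (\<forall>d\<in>A. even (card (B \<inter> P `` {d}))) -->
				(\<forall>d\<in>A. even (card (B \<inter> Q `` {d})))) \<longleftrightarrow> (\<forall>z<2 ^ n. (\<forall>i<Suc z. i : set_decode z --> i : A) -->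
				(\<forall>d<n. d : A --> (\<exists>q<Suc (\<Sum>i<n. of_bool (i : set_decode z & (d, i) : vrel fl A Q)). (\<Sum>i<n. of_bool (i : set_decode z & (d, i) : vrel fl A Q)) = 2 * q)) -->
				(\<forall>d<n. d : A --> (\<exists>q<Suc (\<Sum>i<n. of_bool (i : set_decode z & (d, i) : P)). (\<Sum>i<n. of_bool (i : set_decode z & (d, i) : P)) = 2 * q)) -->
				(\<forall>d<n. d : A --> (\<exists>q<Suc (\<Sum>i<n. of_bool (i : set_decode z & (d, i) : Q)). (\<Sum>i<n. of_bool (i : set_decode z & (d, i) : Q)) = 2 * q)))"
		unfolding all_subsets_iff[OF A] A1 by (simp only: z cong: imp_cong)
	show ?thesis
		unfolding dart_block_def R1[symmetric] R2[symmetric] R3[symmetric] R4[symmetric] R5[symmetric] using f by (simp only: conj_assoc simp_thms)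
qed

lemma decidable_eqrel:
	assumes "computable c" "computable b"
	shows "decidable (%x. eqrel (Domain (bQ (c x) (b x))) (bQ (c x) (b x)))" "decidable (%x. eqrel (Domain (bQ (c x) (b x))) (bP (c x) (b x)))"
		"decidable (%x. eqrel (Domain (bQ (c x) (b x))) (bN (c x) (b x)))"
proof -
	have D: "Domain (bQ c b) \<subseteq> {..<cN c}" for c b using Dom_less by auto
	show "decidable (%x. eqrel (Domain (bQ (c x) (b x))) (bQ (c x) (b x)))" "decidable (%x. eqrel (Domain (bQ (c x) (b x))) (bP (c x) (b x)))"
		"decidable (%x. eqrel (Domain (bQ (c x) (b x))) (bN (c x) (b x)))"
		unfolding eqrel_bounded[OF bsub(1) D] eqrel_bounded[OF bsub(2) D] eqrel_bounded[OF bsub(3) D]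
		by (intro comp5 computable_comp[OF assms(1)] computable_comp[OF assms(2)])+
qed

lemma decidable_cblock:
	assumes "computable c" "computable b"
	shows "decidable (%x. cblock (c x) (b x))"
proof -
	have D: "Domain (bQ c b) \<subseteq> {..<cN c}" for c b using Dom_less by auto
	show ?thesis
		unfolding cblock_def dart_block_bounded[OF D bsub]
		by (intro decidable_eqrel comp5 computable_comp[OF assms(1)] computable_comp[OF assms(2)])
qed

declare DomainE [rule del]

lemma flip_cF:
	assumes X: "two_complex (cX c)" and d: "d < cN c"
	shows "flip (bdry (cX c)) d = cF c d"
proof -
	have S: "circles (bdry (cX c))" using X unfolding two_complex_def by simp
	let ?f = "flip (bdry (cX c)) d"
	have f: "?f < cN c" "?f ~= d" "cbini c ?f = cbini c d" "!!i. i < cN c ==> cbini c i = cbini c d ==> i = d \<or> i = ?f"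
		using flip[OF S, of d] d by auto
	have "(\<Sum>i<cN c. of_bool (i ~= d & cbini c i = cbini c d) * i) = (\<Sum>i<cN c. if i = ?f then i else 0)"
		by (rule sum.cong) (use f in auto)
	also have "\<dots> = ?f" using f(1) by simp
	finally show ?thesis using f(1) by (simp add: cF_def Let_def)
qed

lemma flip_rel_cong: "(!!d. d : A ==> fl d = fl' d) ==> flip_rel fl A = flip_rel fl' A"
	unfolding flip_rel_def by auto

lemma dart_block_cong:
	assumes fl: "!!d. d : A ==> fl d = fl' d"
	shows "dart_block fl W A Q P N \<longleftrightarrow> dart_block fl' W A Q P N"
proof -
	have "flip_rel fl A = flip_rel fl' A" unfolding flip_rel_def using fl by auto
	moreover have "{(x, fl x) | x. x : A & (c, x) \<notin> Q & (c, fl x) \<notin> Q} = {(x, fl' x) | x. x : A & (c, x) \<notin> Q & (c, fl' x) \<notin> Q}" for c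
		using fl by auto
	moreover have "(\<forall>d\<in>A. fl d : A) \<longleftrightarrow> (\<forall>d\<in>A. fl' d : A)" using fl by auto
	ultimately show ?thesis unfolding dart_block_def vrel_def near_rel_def cut_rel_def by simp
qed

lemma cblock_iff:
	assumes X: "two_complex (cX c)"
	shows "cblock c b \<longleftrightarrow> xblock (cX c) (cdec c b)"
proof -
	let ?A = "Domain (bQ c b)"
	have "(\<exists>v. \<forall>d\<in>?A. cini c (cW c d) = v) \<longleftrightarrow> (\<forall>d<cN c. \<forall>d'<cN c. d : ?A --> d' : ?A --> cini c (cW c d) = cini c (cW c d'))"
		using Dom_less by metis
	moreover have "(\<exists>d<cN c. d : ?A) \<longleftrightarrow> ?A ~= {} & ?A \<subseteq> {..<cN c}" using Dom_less by blast
	moreover have "dart_block (flip (bdry (cX c))) (cW c) ?A (bQ c b) (bP c b) (bN c b) \<longleftrightarrow> dart_block (cF c) (cW c) ?A (bQ c b) (bP c b) (bN c b)"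
		by (rule dart_block_cong) (use flip_cF[OF X] Dom_less in blast)
	ultimately show ?thesis unfolding cblock_def xblock_def cdec_def prod.case cX_simps by blast
qed

section \<open>Bounds on codes, and counting formulas\<close>

lemma prod_encode_mono: "a \<le> a' ==> b \<le> b' ==> prod_encode (a, b) \<le> prod_encode (a', b')"
proof -
	assume h: "a \<le> a'" "b \<le> b'"
	then have "triangle (a + b) \<le> triangle (a' + b')" unfolding triangle_def by (intro div_le_mono mult_le_mono) auto
	then show ?thesis using h by (simp add: prod_encode_def)
qed

text \<open>Some code of any relation on the darts is below \<open>cM c\<close>, and some code of
  any block is below \<open>cK c\<close>. A block may have several codes; the dual inequalities are
  imposed on all of them.\<close>

definition "cM c = 2 ^ Suc (prod_encode (cN c, cN c))"
definition "cK c = Suc (prod_encode (cM c, prod_encode (cM c, cM c)))"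

lemma crel_code:
	assumes "R \<subseteq> {..<cN c} \<times> {..<cN c}"
	shows "\<exists>q<cM c. crel c q = R"
proof (intro exI[of _ "set_encode (prod_encode ` R)"] conjI)
	have f: "finite (prod_encode ` R)" using assms finite_subset by blast
	have "prod_encode ` R \<subseteq> {..<Suc (prod_encode (cN c, cN c))}"
	proof
		fix x assume "x : prod_encode ` R"
		then obtain i j where "x = prod_encode (i, j)" "i < cN c" "j < cN c" using assms by auto
		then show "x : {..<Suc (prod_encode (cN c, cN c))}" using prod_encode_mono[of i "cN c" j "cN c"] by simp
	qed
	then show "set_encode (prod_encode ` R) < cM c" unfolding cM_def by (rule set_encode_less)
	have "(prod_encode (i, j) : prod_encode ` R) \<longleftrightarrow> (i, j) : R" for i j by (auto simp: prod_encode_eq)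
	then show "crel c (set_encode (prod_encode ` R)) = R" unfolding crel_def using f assms by auto
qed

lemma xblock_code:
	assumes b: "xblock (cX c) blk"
	shows "\<exists>b<cK c. cdec c b = blk"
proof -
	obtain Q P N where Q: "blk = (Q, P, N)" by (cases blk)
	have D: "Domain Q \<subseteq> {..<cN c}" and blk: "dart_block (flip (bdry (cX c))) (cW c) (Domain Q) Q P N"
		using b unfolding Q xblock_def by simp_all
	have "R \<subseteq> {..<cN c} \<times> {..<cN c}" if "eqrel (Domain Q) R" for R using eqrelD(1)[OF that] D by blast
	then obtain q p n where q: "q < cM c" "crel c q = Q" "p < cM c" "crel c p = P" "n < cM c" "crel c n = N"
		using crel_code dart_blockD(2-4)[OF blk] by metis
	have "prod_encode (q, prod_encode (p, n)) < cK c"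
		unfolding cK_def less_Suc_eq_le using q by (intro prod_encode_mono) auto
	moreover have "cdec c (prod_encode (q, prod_encode (p, n))) = blk"
		using q by (simp add: cdec_def bQ_def bP_def bN_def Q)
	ultimately show ?thesis by blast
qed

definition "cEb c b e \<longleftrightarrow> (\<exists>d<cN c. d : Domain (bQ c b) & cW c d = e)"

definition "ccompat c b e b' \<longleftrightarrow> cEb c b e & (\<forall>d<cN c. \<forall>d'<cN c. cW c d = e --> cW c d' = e -->
	 ((d, d') : bQ c b \<longleftrightarrow> (cbopp c d, cbopp c d') : bQ c b') & ((d, d') : bP c b \<longleftrightarrow> (cbopp c d, cbopp c d') : bN c b') &
	 ((d, d') : bN c b \<longleftrightarrow> (cbopp c d, cbopp c d') : bP c b'))"

lemma cEb_iff: "cEb c b e \<longleftrightarrow> e : bedges (cX c) (cdec c b)"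
proof -
	have "(\<exists>d<cN c. d : Domain (bQ c b) & cW c d = e) \<longleftrightarrow> (\<exists>d\<in>Domain (bQ c b). e = cW c d)" using Dom_less[of _ c b] by metis
	then show ?thesis unfolding cEb_def bedges_def cdec_def by (simp only: fst_conv cX_simps image_iff)
qed

lemma ccompat_iff: "ccompat c b e b' \<longleftrightarrow> compat (cX c) (cdec c b) e (cdec c b')"
	unfolding ccompat_def compat_def cEb_iff cdec_def prod.case cX_simps Ball_def lessThan_iff by blast

text \<open>Each class is counted at its least element, recognised by having no smaller related
  number.\<close>

lemma nclass_count:
	assumes R: "eqrel A (R \<inter> A \<times> A)" and A: "A \<subseteq> {..<n :: nat}" and RA: "!!a. a : A ==> R `` {a} \<subseteq> A"
	shows "nclass A R = (\<Sum>d<n. of_bool (d : A & (\<forall>d'<d. (d, d') \<notin> R)))"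
proof -
	have fA: "finite A" using A by (rule finite_subset) simp
	define m where "m d = Min ((R \<inter> A \<times> A) `` {d})" for d
	note mc = min_class[OF R fA, folded m_def]
	have RR: "(a, b) : R \<longleftrightarrow> (a, b) : R \<inter> A \<times> A" if "a : A" for a b using RA[OF that] that by auto
	have "nclass A R = card (m ` A)"
		by (rule nclass_kernel) (use mc(3) RR in blast)
	also have "m ` A = {d : A. \<forall>d'<d. (d, d') \<notin> R}"
	proof
		have le: "m d \<le> d'" if "d : A" "(d, d') : R" for d d'
		proof -
			have "finite ((R \<inter> A \<times> A) `` {d})" using fA by (auto intro: finite_subset[of _ A])
			then show ?thesis unfolding m_def using RR[OF that(1)] that(2) by (intro Min_le) auto
		qed
		show "m ` A \<subseteq> {d : A. \<forall>d'<d. (d, d') \<notin> R}"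
		proof
			fix x assume "x : m ` A"
			then obtain d where d: "d : A" "x = m d" by blast
			have xA: "x : A" using mc(1)[OF d(1)] d(2) by simp
			have "m x = x" using mc(3)[OF d(1) xA] mc(2)[OF d(1)] d(2) by simp
			then have "\<not> d' < x" if "(x, d') : R" for d' using le[OF xA that] by simp
			then show "x : {d : A. \<forall>d'<d. (d, d') \<notin> R}" using xA by blast
		qed
		show "{d : A. \<forall>d'<d. (d, d') \<notin> R} \<subseteq> m ` A"
		proof
			fix d assume d: "d : {d : A. \<forall>d'<d. (d, d') \<notin> R}"
			then have dd: "(d, d) : R" "(d, m d) : R" using mc(2)[of d] eqrelD(2)[OF R] by auto
			then have "m d = d" using le[of d d] d by (metis (mono_tags, lifting) mem_Collect_eq nat_less_le)
			then show "d : m ` A" using d by force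
		qed
	qed
	also have "card {d : A. \<forall>d'<d. (d, d') \<notin> R} = (\<Sum>d<n. of_bool (d : A & (\<forall>d'<d. (d, d') \<notin> R)))"
	proof -
		have "{..<n} \<inter> {d. d : A & (\<forall>d'<d. (d, d') \<notin> R)} = {d : A. \<forall>d'<d. (d, d') \<notin> R}" using A by auto
		then show ?thesis by (simp add: sum_of_bool_eq)
	qed
	finally show ?thesis .
qed

definition "cV c b = (\<Sum>d<cN c. of_bool (d : Domain (bQ c b) & (\<forall>d'<d. (d, d') \<notin> vrel (cF c) (Domain (bQ c b)) (bQ c b))) :: nat)"
definition "cQ c b = (\<Sum>d<cN c. of_bool (d : Domain (bQ c b) & (\<forall>d'<d. (d, d') \<notin> bQ c b)) :: nat)"

lemma block_chi_code:
	assumes X: "two_complex (cX c)" and b: "cblock c b"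
	shows "block_chi (cX c) (cdec c b) = real (cV c b) - real (cQ c b) / 2"
proof -
	let ?A = "Domain (bQ c b)" and ?Q = "bQ c b" and ?F = "flip (bdry (cX c))"
	have blk: "dart_block (cF c) (cW c) ?A ?Q (bP c b) (bN c b)" using b unfolding cblock_def by simp
	have A: "?A \<subseteq> {..<cN c}" using Dom_less by blast
	note Q = eqrelD[OF dart_blockD(2)[OF blk]]
	have S: "circles (bdry (cX c))" using X unfolding two_complex_def by simp
	have F: "?F d = cF c d" "cF c d : ?A" "cF c (cF c d) = d" if "d : ?A" for d
	proof -
		have d: "d < cN c" using that by (rule Dom_less)
		show "?F d = cF c d" by (rule flip_cF[OF X d])
		show "cF c d : ?A" using dart_blockD(8)[OF blk] that by blast
		show "cF c (cF c d) = d" using flip_flip[OF S, of d] flip_cF[OF X d] flip_cF[OF X cF_less[OF d]] d by simp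
	qed
	have "flip_rel ?F ?A = flip_rel (cF c) ?A" by (rule flip_rel_cong[OF F(1)])
	then have vr: "vrel ?F ?A ?Q = vrel (cF c) ?A ?Q" unfolding vrel_def by simp
	have sub: "?Q \<union> flip_rel (cF c) ?A \<subseteq> ?A \<times> ?A" by (rule Un_least[OF Q(1)]) (use F(2) in \<open>auto simp: flip_rel_def\<close>)
	have "sym (flip_rel (cF c) ?A)" unfolding sym_def flip_rel_iff using F(2,3) by metis
	then have sy: "sym (vrel (cF c) ?A ?Q)" unfolding vrel_def using Q(3) by (intro sym_rtrancl sym_Un)
	have tr: "trans (vrel (cF c) ?A ?Q)" unfolding vrel_def by (rule trans_rtrancl)
	have "eqrel ?A (vrel (cF c) ?A ?Q \<inter> ?A \<times> ?A)"
		unfolding eqrel_def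
	proof (intro conjI ballI)
		show "(a, a) : vrel (cF c) ?A ?Q \<inter> ?A \<times> ?A" if "a : ?A" for a using that by (simp add: vrel_def)
		show "sym (vrel (cF c) ?A ?Q \<inter> ?A \<times> ?A)" using sy unfolding sym_def by simp
		show "trans (vrel (cF c) ?A ?Q \<inter> ?A \<times> ?A)" using tr unfolding trans_def by (metis IntD1 IntD2 IntI mem_Sigma_iff)
	qed simp
	from nclass_count[OF this A] have 1: "nclass ?A (vrel (cF c) ?A ?Q) = cV c b"
		unfolding cV_def using rtrancl_Image_subset[OF sub] unfolding vrel_def by blast
	have "?Q \<inter> ?A \<times> ?A = ?Q" using Q(1) by blast
	with nclass_count[of ?A ?Q, OF _ A] dart_blockD(2)[OF blk] Q(1) have 2: "nclass ?A ?Q = cQ c b"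
		unfolding cQ_def by auto
	show ?thesis unfolding block_chi_def cdec_def fst_conv vr 1 2 ..
qed

definition "cL c d = (\<Sum>d'<cN c. of_bool ((d, d') : {(i, j). i < cN c & j < cN c & (j = cbopp c i \<or> j = cF c i)}\<^sup>*) :: nat)"

lemma circ_len_code:
	assumes X: "two_complex (cX c)" and d: "d < cN c"
	shows "circ_len (bdry (cX c)) d = cL c d" "0 < cL c d"
proof -
	have S: "circles (bdry (cX c))" using X unfolding two_complex_def by simp
	have o: "cbopp c i < cN c" if "i < cN c" for i using circles_opp(1)[OF S, of i] that by simp
	have eq: "dart_step (bdry (cX c)) = {(i, j). i < cN c & j < cN c & (j = cbopp c i \<or> j = cF c i)}"
		unfolding dart_step_def using o flip_cF[OF X] cF_less by auto
	have "{d'. (d, d') : (dart_step (bdry (cX c)))\<^sup>*} = {..<cN c} \<inter> {d'. (d, d') : (dart_step (bdry (cX c)))\<^sup>*}"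
		using dart_step_edges[OF S, of d] d by auto
	then show 1: "circ_len (bdry (cX c)) d = cL c d"
		unfolding circ_len_def cL_def eq[symmetric] by (simp add: sum_of_bool_eq)
	have "d : {..<cN c} \<inter> {d'. (d, d') : (dart_step (bdry (cX c)))\<^sup>*}" using d by simp
	then show "0 < cL c d" unfolding 1[symmetric] circ_len_def
		using \<open>{d'. (d, d') : (dart_step (bdry (cX c)))\<^sup>*} = {..<cN c} \<inter> {d'. (d, d') : (dart_step (bdry (cX c)))\<^sup>*}\<close>
		by (metis card_gt_0_iff empty_iff finite_Int finite_lessThan)
qed

definition "coprime_code n d \<longleftrightarrow> (\<forall>j<Suc d. \<forall>q<Suc d. \<forall>q'<Suc n. d = j * q --> n = j * q' --> j = 1)"

lemma coprime_code_iff: "0 < d ==> coprime_code n d \<longleftrightarrow> coprime n d"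
proof
	assume d: "0 < d" and c: "coprime_code n d"
	show "coprime n d"
	proof (rule coprimeI)
		fix j assume j: "j dvd n" "j dvd d"
		then obtain q q' where q: "d = j * q" "n = j * q'" by (auto elim!: dvdE)
		have j0: "j > 0" using q d by (metis gr0I mult_0)
		have q0: "q > 0" using q d by (metis gr0I mult_0_right)
		have "j < Suc d" "q < Suc d" "q' < Suc n" unfolding q less_Suc_eq_le using j0 q0 by simp_all
		then have "j = 1" using c[unfolded coprime_code_def, rule_format, of j q q'] q by simp
		then show "is_unit j" by simp
	qed
next
	assume "0 < d" and c: "coprime n d"
	show "coprime_code n d"
		unfolding coprime_code_def
	proof (intro allI impI)
		fix j q q' assume "d = j * q" "n = j * q'"
		then have "j dvd n" "j dvd d" by (metis dvd_triv_left)+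
		then show "j = 1" using coprime_common_divisor_nat[OF c] by blast
	qed
qed

text \<open>The rational number with code \<open>prod_encode (k, 2 * d)\<close> is \<open>1 + (p1 - p2) * U / (2 * S)\<close>.\<close>

definition "ratcheck k d S p1 p2 U \<longleftrightarrow> 0 < d & (\<exists>n<Suc k.
	 (k = 2 * n & coprime_code n d & n * (2 * S) + d * p2 * U = d * (2 * S) + d * p1 * U) \<or>
	 (k = 2 * n + 1 & coprime_code (Suc n) d & d * p2 * U = Suc n * (2 * S) + d * (2 * S) + d * p1 * U))"

lemma rat_code_fraction:
	assumes "0 < d" "coprime i (int d)"
	shows "rat_code (of_int i / of_nat d) = prod_encode (int_encode i, 2 * d)"
proof -
	have "(of_int i / of_nat d :: rat) = Fract i (int d)" by (simp add: Fract_of_int_quotient)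
	then have "quotient_of (of_int i / of_nat d) = (i, int d)"
		using assms by (simp add: quotient_of_Fract normalize_stable)
	then show ?thesis by (simp add: rat_code_def int_encode_def sum_encode_def)
qed

lemma int_encode_cases: "int_encode (int n) = 2 * n" "int_encode (- int (Suc n)) = 2 * n + 1"
	by (simp_all add: int_encode_def sum_encode_def)

lemma ratcheck_sound:
	assumes S: "0 < S" and r: "ratcheck k d S p1 p2 U"
	shows "\<exists>M. rat_code M = prod_encode (k, 2 * d) & 2 * of_nat S * M = 2 * of_nat S + (of_nat p1 - of_nat p2) * of_nat U"
proof -
	have d: "0 < d" using r unfolding ratcheck_def by simp
	have "\<exists>i. k = int_encode i & coprime i (int d) & i * (2 * int S) = int d * (2 * int S) + int d * (int p1 - int p2) * int U"
	proof -
		from r obtain n where "(k = 2 * n & coprime_code n d & n * (2 * S) + d * p2 * U = d * (2 * S) + d * p1 * U) \<or>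
			 (k = 2 * n + 1 & coprime_code (Suc n) d & d * p2 * U = Suc n * (2 * S) + d * (2 * S) + d * p1 * U)"
			unfolding ratcheck_def by blast
		then show ?thesis
		proof
			assume h: "k = 2 * n & coprime_code n d & n * (2 * S) + d * p2 * U = d * (2 * S) + d * p1 * U"
			then have "int (n * (2 * S) + d * p2 * U) = int (d * (2 * S) + d * p1 * U)" by simp
			then show ?thesis using h d by (intro exI[of _ "int n"]) (simp add: int_encode_cases coprime_code_iff algebra_simps)
		next
			assume h: "k = 2 * n + 1 & coprime_code (Suc n) d & d * p2 * U = Suc n * (2 * S) + d * (2 * S) + d * p1 * U"
			then have "int (d * p2 * U) = int (Suc n * (2 * S) + d * (2 * S) + d * p1 * U)" by simp
			moreover have "coprime (- int (Suc n)) (int d)" using h d coprime_code_iff by (metis coprime_int_iff coprime_minus_left_iff)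
			ultimately show ?thesis using h by (intro exI[of _ "- int (Suc n)"] conjI) (simp only: int_encode_cases, assumption, simp add: algebra_simps)
		qed
	qed
	then obtain i where i: "k = int_encode i" "coprime i (int d)" "i * (2 * int S) = int d * (2 * int S) + int d * (int p1 - int p2) * int U" by blast
	have "(of_int (i * (2 * int S)) :: rat) = of_int (int d * (2 * int S) + int d * (int p1 - int p2) * int U)" using i(3) by simp
	then have "2 * of_nat S * (of_int i / of_nat d :: rat) = 2 * of_nat S + (of_nat p1 - of_nat p2) * of_nat U"
		using d by (simp add: field_simps)
	then show ?thesis using rat_code_fraction[OF d i(2)] i(1) by blast
qed

lemma ratcheck_complete:
	assumes S: "0 < S"
	shows "\<exists>k d. ratcheck k d S p1 p2 U"
proof -
	define M :: rat where "M = 1 + (of_nat p1 - of_nat p2) * of_nat U / (2 * of_nat S)"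
	obtain i j where ij: "quotient_of M = (i, j)" by fastforce
	have j: "j > 0" "M = of_int i / of_int j" "coprime i j" using quotient_of_denom_pos[OF ij] quotient_of_div[OF ij] quotient_of_coprime[OF ij] by auto
	define d where "d = nat j"
	have d: "0 < d" "j = int d" using j(1) unfolding d_def by auto
	have "of_int i * (2 * of_nat S) = (of_nat d * (2 * of_nat S) + of_nat d * (of_nat p1 - of_nat p2) * of_nat U :: rat)"
		using j(2) d S unfolding M_def by (simp add: field_simps)
	then have "(of_int (i * (2 * int S)) :: rat) = of_int (int d * (2 * int S) + int d * (int p1 - int p2) * int U)" by simp
	then have e: "i * (2 * int S) = int d * (2 * int S) + int d * (int p1 - int p2) * int U" by (simp only: of_int_eq_iff)
	show ?thesis
	proof (cases "i \<ge> 0")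
		case True
		then obtain n where n: "i = int n" using nonneg_int_cases by blast
		have "int (n * (2 * S) + d * p2 * U) = int (d * (2 * S) + d * p1 * U)" using e n by (simp add: algebra_simps)
		then have "n * (2 * S) + d * p2 * U = d * (2 * S) + d * p1 * U" by (simp only: of_nat_eq_iff)
		moreover have "coprime_code n d" using j(3) n d coprime_code_iff by (metis coprime_int_iff)
		ultimately have "ratcheck (2 * n) d S p1 p2 U" unfolding ratcheck_def using d(1) by (intro conjI exI[of _ n]) auto
		then show ?thesis by blast
	next
		case False
		define n where "n = nat (- i - 1)"
		have n: "i = - int (Suc n)" using False unfolding n_def by simp
		have "int (d * p2 * U) = int (Suc n * (2 * S) + d * (2 * S) + d * p1 * U)" using e unfolding n by (simp add: algebra_simps)
		then have "d * p2 * U = Suc n * (2 * S) + d * (2 * S) + d * p1 * U" by (simp only: of_nat_eq_iff)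
		moreover have "coprime (int (Suc n)) (int d)" using j(3) unfolding n d(2) by (simp only: coprime_minus_left_iff)
		then have "coprime_code (Suc n) d" using coprime_code_iff[OF d(1)] by (simp only: coprime_int_iff)
		ultimately have "ratcheck (2 * n + 1) d S p1 p2 U" unfolding ratcheck_def using d(1) by (intro conjI exI[of _ n] disjI2) auto
		then show ?thesis by blast
	qed
qed

section \<open>Certificates\<close>

text \<open>Layout of a certificate: 0 is a common multiple U of the circle lengths, 1 a common
  denominator S, 2 and 3 the positive and negative part of the bound, 4 the table of U divided by
  the circle lengths, 5 and 6 the positive and negative parts of the prices, 7 the number of labels,
  8 their blocks, 9 the mates, 10 and 11 the value. With entry 4 for \<open>u\<close> this sum is U
  times the block area.\<close>

definition "cAl c u b = (\<Sum>d<cN c. of_bool (d : Domain (bQ c b)) * cnth u d)"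
definition "cYs c y b = (\<Sum>e<cE c. of_bool (cEb c b e) * cnth y (prod_encode (b, e)))"
text \<open>\<open>clhs - crhs\<close> is 2 * S * chi - (p1 - p2) * U * area
  (\<open>block_balance\<close>); the terms of either sign stand on separate sides because all
  arithmetic is in natural numbers.\<close>

definition "clhs c w b = 2 * cnth w 1 * cV c b + cnth w 3 * cAl c (cnth w 4) b"
definition "crhs c w b = cnth w 1 * cQ c b + cnth w 2 * cAl c (cnth w 4) b"

text \<open>For the lower bound the two sides change places, which is the dual inequality for
  -chi.\<close>

definition "cdual s c w \<longleftrightarrow>
	 (\<forall>b<cK c. cblock c b --> (if s then clhs c w b + cYs c (cnth w 6) b \<le> crhs c w b + cYs c (cnth w 5) b
			else crhs c w b + cYs c (cnth w 6) b \<le> clhs c w b + cYs c (cnth w 5) b)) &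
	 (\<forall>b<cK c. \<forall>b'<cK c. \<forall>e<cE c. cblock c b --> cblock c b' --> ccompat c b e b' -->
			cnth (cnth w 5) (prod_encode (b, e)) + cnth (cnth w 5) (prod_encode (b', copp c e)) \<le>
			cnth (cnth w 6) (prod_encode (b, e)) + cnth (cnth w 6) (prod_encode (b', copp c e)))"

definition "cprimal c w \<longleftrightarrow> 0 < cnth w 7 &
	 (\<forall>v<cnth w 7. cnth (cnth w 8) v < cK c & cblock c (cnth (cnth w 8) v) &
			(\<forall>e<cE c. cEb c (cnth (cnth w 8) v) e --> cnth (cnth w 9) (prod_encode (v, e)) < cnth w 7 &
				 ccompat c (cnth (cnth w 8) v) e (cnth (cnth w 8) (cnth (cnth w 9) (prod_encode (v, e)))) &
				 cnth (cnth w 9) (prod_encode (cnth (cnth w 9) (prod_encode (v, e)), copp c e)) = v)) &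
	 (\<Sum>v<cnth w 7. clhs c w (cnth (cnth w 8) v)) = (\<Sum>v<cnth w 7. crhs c w (cnth (cnth w 8) v))"

text \<open>A certificate \<open>w\<close> consists of a feasible dual solution and of a system of blocks attaining the bound it proves,
	with all denominators cleared; \<open>s\<close> selects the upper or the lower bound.\<close>

definition "certificate s c w \<longleftrightarrow> 0 < cnth w 0 & 0 < cnth w 1 & (\<forall>d<cN c. cnth (cnth w 4) d * cL c d = cnth w 0) &
	 cdual s c w & cprimal c w & ratcheck (cnth w 10) (cnth w 11) (cnth w 1) (cnth w 2) (cnth w 3) (cnth w 0)"

section \<open>Decidability of certificates\<close>

lemma computable_cL:
	assumes "computable c" "computable d"
	shows "computable (%x. cL (c x) (d x))"
proof -
	have R: "decidable (%x. (f x, g x) : {(i, j). i < cN (h x) & j < cN (h x) & (j = cbopp (h x) i \<or> j = cF (h x) i)}\<^sup>*)"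
		if "computable f" "computable g" "computable h" for f g h
	proof (rule decidable_rtrancl[where n = "%x. cN (h x)"])
		show "{(i, j). i < cN (h x) & j < cN (h x) & (j = cbopp (h x) i \<or> j = cF (h x) i)} \<subseteq> {..<cN (h x)} \<times> {..<cN (h x)}" for x by auto
	qed (unfold mem_Collect_eq case_prod_conv, (intro comp4 computable_comp[OF that(3)] that)+)
	show ?thesis
		unfolding cL_def by (intro R computable_sum computable_of_bool comp4 computable_comp[OF assms(1)] computable_comp[OF assms(2)])
qed

lemma computable_cV:
	assumes "computable c" "computable b"
	shows "computable (%x. cV (c x) (b x))" "computable (%x. cQ (c x) (b x))"
	unfolding cV_def cQ_def by (intro comp5 computable_comp[OF assms(1)] computable_comp[OF assms(2)])+

lemma decidable_cEb:
	assumes "computable c" "computable b" "computable e"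
	shows "decidable (%x. cEb (c x) (b x) (e x))"
	unfolding cEb_def by (intro comp5 computable_comp[OF assms(1)] computable_comp[OF assms(2)] computable_comp[OF assms(3)])

lemma decidable_ccompat:
	assumes "computable c" "computable b" "computable e" "computable b'"
	shows "decidable (%x. ccompat (c x) (b x) (e x) (b' x))"
	unfolding ccompat_def by (intro decidable_cEb comp5 computable_comp[OF assms(1)] computable_comp[OF assms(2)] computable_comp[OF assms(3)]
		 computable_comp[OF assms(4)] assms)

lemma computable_cAl:
	assumes "computable c" "computable u" "computable b"
	shows "computable (%x. cAl (c x) (u x) (b x))" "computable (%x. cYs (c x) (u x) (b x))"
	unfolding cAl_def cYs_def by (intro decidable_cEb comp5 computable_comp[OF assms(1)] computable_comp[OF assms(2)] computable_comp[OF assms(3)])+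

lemma computable_clhs:
	assumes "computable c" "computable w" "computable b"
	shows "computable (%x. clhs (c x) (w x) (b x))" "computable (%x. crhs (c x) (w x) (b x))"
	unfolding clhs_def crhs_def by (intro computable_cAl computable_cV comp5 assms)+

lemma computable_cK: "computable c ==> computable (%x. cK (c x))"
	unfolding cK_def cM_def by (intro comp5)

lemma decidable_ratcheck: "computable k ==> computable d ==> computable s ==> computable p1 ==> computable p2 ==> computable U ==>
		decidable (%x. ratcheck (k x) (d x) (s x) (p1 x) (p2 x) (U x))"
proof -
	assume a: "computable k" "computable d" "computable s" "computable p1" "computable p2" "computable U"
	have C: "decidable (%x. coprime_code (f x) (g x))" if "computable f" "computable g" for f g
		unfolding coprime_code_def by (intro comp1 computable_comp[OF that(1)] computable_comp[OF that(2)])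
	show ?thesis
		unfolding ratcheck_def by (intro C comp1 computable_comp[OF a(1)] computable_comp[OF a(2)] computable_comp[OF a(3)] computable_comp[OF a(4)]
			 computable_comp[OF a(5)] computable_comp[OF a(6)] a)
qed

lemma decidable_certificate: "decidable (%p. certificate s (cfst p) (csnd p))"
proof -
	have "decidable (%p. cdual s (cfst p) (csnd p))"
		by (cases s; simp only: cdual_def if_True if_False;
			intro decidable_cblock decidable_ccompat computable_clhs computable_cAl computable_cK comp5)
	moreover have "decidable (%p. cprimal (cfst p) (csnd p))"
		unfolding cprimal_def by (intro decidable_cblock decidable_ccompat decidable_cEb computable_clhs computable_cK comp5)
	ultimately show ?thesis
		unfolding certificate_def by (intro decidable_ratcheck computable_cL decidable_conj comp5)
qed

section \<open>Soundness of certificates\<close>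

lemma block_area_pos:
	assumes X: "two_complex (cX c)" and b: "cblock c b"
	shows "0 < block_area (cX c) (cdec c b)"
proof -
	have A: "Domain (bQ c b) \<subseteq> {..<cN c}" using Dom_less by blast
	have "finite (Domain (bQ c b))" by (rule finite_subset[OF A]) simp
	moreover have "Domain (bQ c b) ~= {}" using b unfolding cblock_def by blast
	ultimately show ?thesis
		unfolding block_area_def cdec_def fst_conv
	proof (intro sum_pos)
		fix d assume "d : Domain (bQ c b)"
		then have d: "d < cN c" by (rule Dom_less)
		show "0 < 1 / real (circ_len (bdry (cX c)) d)" using circ_len_code[OF X d] by simp
	qed
qed

lemma block_balance:
	assumes X: "two_complex (cX c)" and b: "cblock c b" and u: "!!d. d < cN c ==> cnth (cnth w 4) d * cL c d = U"
	shows "real (clhs c w b) - real (crhs c w b) =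
		2 * real (cnth w 1) * block_chi (cX c) (cdec c b) - (real (cnth w 2) - real (cnth w 3)) * real U * block_area (cX c) (cdec c b)"
proof -
	have A: "Domain (bQ c b) \<subseteq> {..<cN c}" using Dom_less by blast
	have "real (cAl c (cnth w 4) b) = (\<Sum>d<cN c. if d : Domain (bQ c b) then real (cnth (cnth w 4) d) else 0)"
		unfolding cAl_def of_nat_sum by (rule sum.cong) auto
	also have "\<dots> = (\<Sum>d\<in>Domain (bQ c b). real (cnth (cnth w 4) d))"
		using A by (intro sum.mono_neutral_cong_right) auto
	also have "\<dots> = (\<Sum>d\<in>Domain (bQ c b). real U * (1 / real (circ_len (bdry (cX c)) d)))"
	proof (rule sum.cong[OF refl])
		fix d assume "d : Domain (bQ c b)"
		then have d: "d < cN c" by (rule Dom_less)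
		have "real (cnth (cnth w 4) d) * real (cL c d) = real U" using u[OF d] by (metis of_nat_mult)
		then show "real (cnth (cnth w 4) d) = real U * (1 / real (circ_len (bdry (cX c)) d))"
			using circ_len_code[OF X d] by (simp add: field_simps)
	qed
	finally have "real (cAl c (cnth w 4) b) = real U * block_area (cX c) (cdec c b)"
		unfolding block_area_def cdec_def fst_conv by (simp add: sum_distrib_left)
	then show ?thesis unfolding clhs_def crhs_def block_chi_code[OF X b] by (simp add: algebra_simps)
qed

lemma cYs_sum:
	assumes X: "two_complex (cX c)" and b: "cblock c b"
	shows "real (cYs c y b) = (\<Sum>e\<in>bedges (cX c) (cdec c b). real (cnth y (prod_encode (b, e))))"
proof -
	have "real (cYs c y b) = (\<Sum>e<cE c. if e : bedges (cX c) (cdec c b) then real (cnth y (prod_encode (b, e))) else 0)"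
		unfolding cYs_def of_nat_sum cEb_iff by (rule sum.cong) auto
	also have "\<dots> = (\<Sum>e\<in>bedges (cX c) (cdec c b). real (cnth y (prod_encode (b, e))))"
		using bedgesD(1)[OF X, of "cdec c b"] b cblock_iff[OF X] by (intro sum.mono_neutral_cong_right) auto
	finally show ?thesis .
qed

lemma avg_curvature_balance:
	assumes e: "real_of_int (euler_char (skel Y)) = chi" and a: "total_area Y = A" and A: "A > 0" and S: "S > 0"
		and M: "2 * S * M = 2 * S + P * U"
	shows "avg_curvature Y - M = (2 * S * chi - P * U * A) / (2 * S * A)"
proof -
	have 1: "avg_curvature Y = (A + chi) / A" unfolding avg_curvature_def total_curvature_def e a by simp
	have 2: "M = (2 * S + P * U) / (2 * S)" using M S by (simp add: field_simps)
	show ?thesis unfolding 1 2 using A S by (simp add: field_simps)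
qed

lemma dsystem_codes:
	assumes X: "two_complex (cX c)" and sys: "dsystem (cX c) V \<beta> mate"
	obtains bc where "!!v. v : V ==> bc v < cK c" "!!v. v : V ==> cdec c (bc v) = \<beta> v" "!!v. v : V ==> cblock c (bc v)"
proof -
	have "\<forall>v\<in>V. \<exists>b. b < cK c & cdec c b = \<beta> v"
	proof
		fix v assume "v : V"
		then have "xblock (cX c) (\<beta> v)" using sys unfolding dsystem_def by simp
		from xblock_code[OF this] show "\<exists>b. b < cK c & cdec c b = \<beta> v" by simp
	qed
	from bchoice[OF this] obtain bc where bc: "\<forall>v\<in>V. bc v < cK c & cdec c (bc v) = \<beta> v" by (elim exE)
	have cb: "cblock c (bc v)" if "v : V" for v using that sys cblock_iff[OF X] bc unfolding dsystem_def by simp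
	show thesis by (rule that[of bc]) (use bc cb in simp_all)
qed

text \<open>The system of blocks in the certificate is realised by \<open>dart_system.Y\<close>. For
  any other element the dual inequalities are summed over its own blocks, and
  \<open>weak_duality\<close> disposes of the prices.\<close>

lemma certificate_sound:
	assumes X: "two_complex (cX c)" "finite_complex (cX c)" and cert: "certificate s c w"
	shows "\<exists>M. rat_code M = prod_encode (cnth w 10, 2 * cnth w 11) &
		(\<exists>(Y, p, q)\<in>Irred (standard (cX c)). avg_curvature Y = of_rat M) &
		(\<forall>(Y, p, q)\<in>Irred (standard (cX c)). if s then avg_curvature Y \<le> of_rat M else of_rat M \<le> avg_curvature Y)"
proof -
	have U: "0 < cnth w 0" and S: "0 < cnth w 1" and u: "!!d. d < cN c ==> cnth (cnth w 4) d * cL c d = cnth w 0"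
		and dual: "cdual s c w" and pr: "cprimal c w" and rc: "ratcheck (cnth w 10) (cnth w 11) (cnth w 1) (cnth w 2) (cnth w 3) (cnth w 0)"
		using cert unfolding certificate_def by simp_all
	obtain M where M: "rat_code M = prod_encode (cnth w 10, 2 * cnth w 11)"
		"2 * of_nat (cnth w 1) * M = 2 * of_nat (cnth w 1) + (of_nat (cnth w 2) - of_nat (cnth w 3)) * of_nat (cnth w 0)"
		using ratcheck_sound[OF S rc] by blast
	have Mr: "2 * real (cnth w 1) * of_rat M = 2 * real (cnth w 1) + (real (cnth w 2) - real (cnth w 3)) * real (cnth w 0)"
		using arg_cong[OF M(2), of "of_rat :: rat => real"] by (simp add: of_rat_mult of_rat_add of_rat_diff)
	note bal = block_balance[OF X(1) _ u]
	\<comment> \<open>The deviation of the curvature from \<open>M\<close> is the normalised sum of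
	  block defects: it is zero for the certified system and has a definite sign in general.\<close>
	have D: "avg_curvature Y - of_rat M = (\<Sum>v\<in>V. real (clhs c w (bc v)) - real (crhs c w (bc v))) / (2 * real (cnth w 1) * total_area Y)"
		and Apos: "0 < total_area Y"
		if V: "finite V" "V ~= {}" and bc: "!!v. v : V ==> cblock c (bc v)"
			and e: "real_of_int (euler_char (skel Y)) = (\<Sum>v\<in>V. block_chi (cX c) (cdec c (bc v)))"
			and a: "total_area Y = (\<Sum>v\<in>V. block_area (cX c) (cdec c (bc v)))" for V :: "nat set" and bc and Y :: "(nat, nat, nat, nat) branched_complex"
	proof -
		show A: "0 < total_area Y" unfolding a using V bc by (intro sum_pos block_area_pos[OF X(1)])
		have "(\<Sum>v\<in>V. real (clhs c w (bc v)) - real (crhs c w (bc v))) =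
			2 * real (cnth w 1) * (\<Sum>v\<in>V. block_chi (cX c) (cdec c (bc v))) - (real (cnth w 2) - real (cnth w 3)) * real (cnth w 0) * total_area Y"
			unfolding a sum_distrib_left sum_subtractf[symmetric] by (rule sum.cong[OF refl]) (rule bal[OF bc])
		then show "avg_curvature Y - of_rat M = (\<Sum>v\<in>V. real (clhs c w (bc v)) - real (crhs c w (bc v))) / (2 * real (cnth w 1) * total_area Y)"
			using avg_curvature_balance[OF e refl A _ Mr] S by simp
	qed
	have 1: "\<exists>(Y, p, q)\<in>Irred (standard (cX c)). avg_curvature Y = of_rat M"
	proof -
		let ?V = "{..<cnth w 7}" and ?b = "%v. cnth (cnth w 8) v" and ?m = "%v e. cnth (cnth w 9) (prod_encode (v, e))"
		have b: "cblock c (?b v)" if "v : ?V" for v using pr that unfolding cprimal_def by simp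
		have m: "?m v e < cnth w 7 & ccompat c (?b v) e (?b (?m v e)) & ?m (?m v e) (copp c e) = v"
			if "v : ?V" "cEb c (?b v) e" for v e
		proof -
			have "e < cE c" using bedgesD(1)[OF X(1), of "cdec c (?b v)" e] that b[OF that(1)] cEb_iff cblock_iff[OF X(1)] by simp
			then show ?thesis using pr that unfolding cprimal_def by blast
		qed
		have "dsystem (cX c) ?V (%v. cdec c (?b v)) ?m"
			unfolding dsystem_def cEb_iff[symmetric] ccompat_iff[symmetric] cX_simps
		proof (intro conjI ballI)
			show "?V ~= {}" using pr unfolding cprimal_def by auto
			show "xblock (cX c) (cdec c (?b v))" if "v : ?V" for v using b[OF that] cblock_iff[OF X(1)] by simp
			fix v e assume v: "v : ?V" and "e : bedges (cX c) (cdec c (?b v))"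
			then have e: "cEb c (?b v) e" using cEb_iff by simp
			show "?m v e : ?V" "ccompat c (?b v) e (?b (?m v e))" "?m (?m v e) (copp c e) = v" using m[OF v e] by simp_all
		qed simp
		then interpret S: dart_system "cX c" ?V "%v. cdec c (?b v)" ?m by unfold_locales (rule X)+
		have V: "finite ?V" "?V ~= {}" using pr unfolding cprimal_def by auto
		have "avg_curvature S.Y - of_rat M = 0"
			using D(1)[OF V b S.Y_Irred(2,3)] pr unfolding cprimal_def sum_subtractf of_nat_sum[symmetric] by simp
		then have "avg_curvature S.Y = of_rat M" by simp
		then show ?thesis using S.Y_Irred(1) by blast
	qed
	have 2: "if s then avg_curvature Y \<le> of_rat M else of_rat M \<le> avg_curvature Y" if Y: "(Y, p, q) : Irred (standard (cX c))" for Y p q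
	proof -
		obtain V :: "nat set" and \<beta> mate where sys: "dsystem (cX c) V \<beta> mate"
			and e: "real_of_int (euler_char (skel Y)) = (\<Sum>v\<in>V. block_chi (cX c) (\<beta> v))" and a: "total_area Y = (\<Sum>v\<in>V. block_area (cX c) (\<beta> v))"
			using Irred_dsystem[OF Y] by blast
		obtain bc where bc: "!!v. v : V ==> bc v < cK c" "!!v. v : V ==> cdec c (bc v) = \<beta> v" "!!v. v : V ==> cblock c (bc v)"
			using dsystem_codes[OF X(1) sys] by blast
		have V: "finite V" "V ~= {}" using sys unfolding dsystem_def by auto
		have e': "real_of_int (euler_char (skel Y)) = (\<Sum>v\<in>V. block_chi (cX c) (cdec c (bc v)))" unfolding e using bc(2) by (intro sum.cong) auto
		have a': "total_area Y = (\<Sum>v\<in>V. block_area (cX c) (cdec c (bc v)))" unfolding a using bc(2) by (intro sum.cong) auto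
		let ?y = "%v e. real (cnth (cnth w 5) (prod_encode (bc v, e))) - real (cnth (cnth w 6) (prod_encode (bc v, e)))"
		have wd: "(\<Sum>v\<in>V. \<Sum>e\<in>bedges (cX c) (\<beta> v). ?y v e) \<le> 0"
		proof (rule weak_duality[OF X(1) sys])
			fix v e assume v: "v : V" and e: "e : bedges (cX c) (\<beta> v)"
			have m: "mate v e : V" "compat (cX c) (\<beta> v) e (\<beta> (mate v e))" using sys v e unfolding dsystem_def by auto
			have ee: "e < cE c" using bedgesD(1)[OF X(1) _ e] sys v unfolding dsystem_def by simp
			have "ccompat c (bc v) e (bc (mate v e))" using m(2) unfolding ccompat_iff bc(2)[OF v] bc(2)[OF m(1)] .
			then have "cnth (cnth w 5) (prod_encode (bc v, e)) + cnth (cnth w 5) (prod_encode (bc (mate v e), copp c e)) \<le>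
				cnth (cnth w 6) (prod_encode (bc v, e)) + cnth (cnth w 6) (prod_encode (bc (mate v e), copp c e))"
				using dual ee bc(1)[OF v] bc(1)[OF m(1)] bc(3)[OF v] bc(3)[OF m(1)] unfolding cdual_def by blast
			then have "real (cnth (cnth w 5) (prod_encode (bc v, e)) + cnth (cnth w 5) (prod_encode (bc (mate v e), copp c e))) \<le>
				real (cnth (cnth w 6) (prod_encode (bc v, e)) + cnth (cnth w 6) (prod_encode (bc (mate v e), copp c e)))" by (simp only: of_nat_le_iff)
			then show "?y v e + ?y (mate v e) (opp (skel (cX c)) e) \<le> 0" by simp
		qed
		have ys: "(\<Sum>e\<in>bedges (cX c) (\<beta> v). ?y v e) = real (cYs c (cnth w 5) (bc v)) - real (cYs c (cnth w 6) (bc v))" if "v : V" for v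
			unfolding cYs_sum[OF X(1) bc(3)[OF that]] bc(2)[OF that] by (simp add: sum_subtractf)
		have db: "if s then clhs c w (bc v) + cYs c (cnth w 6) (bc v) \<le> crhs c w (bc v) + cYs c (cnth w 5) (bc v)
			else crhs c w (bc v) + cYs c (cnth w 6) (bc v) \<le> clhs c w (bc v) + cYs c (cnth w 5) (bc v)" if "v : V" for v
			using dual bc(1)[OF that] bc(3)[OF that] unfolding cdual_def by blast
		let ?D = "\<Sum>v\<in>V. real (clhs c w (bc v)) - real (crhs c w (bc v))"
		have den: "0 < 2 * real (cnth w 1) * total_area Y" using S Apos[OF V bc(3) e' a'] by simp
		show ?thesis
		proof (cases s)
			case True
			have "?D \<le> (\<Sum>v\<in>V. \<Sum>e\<in>bedges (cX c) (\<beta> v). ?y v e)"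
			proof (rule sum_mono)
				fix v assume v: "v : V"
				show "real (clhs c w (bc v)) - real (crhs c w (bc v)) \<le> (\<Sum>e\<in>bedges (cX c) (\<beta> v). ?y v e)"
					unfolding ys[OF v] using db[OF v] True by simp
			qed
			then have "?D \<le> 0" using wd by linarith
			then have "?D / (2 * real (cnth w 1) * total_area Y) \<le> 0" by (rule divide_nonpos_pos[OF _ den])
			then have "avg_curvature Y - of_rat M \<le> 0" using D[OF V bc(3) e' a'] by linarith
			then show ?thesis using True by simp
		next
			case False
			have "- ?D \<le> (\<Sum>v\<in>V. \<Sum>e\<in>bedges (cX c) (\<beta> v). ?y v e)"
				unfolding sum_negf[symmetric]
			proof (rule sum_mono)
				fix v assume v: "v : V"
				show "- (real (clhs c w (bc v)) - real (crhs c w (bc v))) \<le> (\<Sum>e\<in>bedges (cX c) (\<beta> v). ?y v e)"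
					unfolding ys[OF v] using db[OF v] False by simp
			qed
			then have "0 \<le> ?D" using wd by linarith
			then have "0 \<le> ?D / (2 * real (cnth w 1) * total_area Y)" by (rule divide_nonneg_pos[OF _ den])
			then have "0 \<le> avg_curvature Y - of_rat M" using D[OF V bc(3) e' a'] by linarith
			then show ?thesis using False by simp
		qed
	qed
	show ?thesis using M(1) 1 2 by (intro exI[of _ M]) blast
qed

section \<open>Existence of certificates\<close>

lemma ex_list_code: "\<exists>l. \<forall>i<m. cnth l i = f i"
	by (rule exI[of _ "list_encode (map f [0..<m])"]) (simp add: cnth_list_encode)

lemma ex_table_code: "\<exists>l. \<forall>a<m. \<forall>b<n. cnth l (prod_encode (a, b)) = f a b"
proof -
	obtain l where l: "\<forall>i<Suc (prod_encode (m, n)). cnth l i = f (cfst i) (csnd i)"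
		using ex_list_code[of "Suc (prod_encode (m, n))" "%i. f (cfst i) (csnd i)"] by (elim exE)
	have "prod_encode (a, b) < Suc (prod_encode (m, n))" if "a < m" "b < n" for a b using prod_encode_mono[of a m b n] that by simp
	then show ?thesis using l by (intro exI[of _ l]) simp
qed

lemma int_split:
	fixes t :: rat
	assumes "\<exists>n :: nat. \<bar>t\<bar> = of_nat n"
	shows "real (nat \<lfloor>t\<rfloor>) - real (nat \<lfloor>- t\<rfloor>) = of_rat t"
proof -
	obtain n :: nat where n: "\<bar>t\<bar> = of_nat n" using assms by blast
	consider "t = of_nat n" | "t = - of_nat n" using n by linarith
	then show ?thesis
	proof cases
		case 1
		have "\<lfloor>t\<rfloor> = int n" "\<lfloor>- t\<rfloor> = - int n" unfolding 1 by (simp_all add: floor_minus)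
		then show ?thesis unfolding 1 by simp
	next
		case 2
		have "\<lfloor>t\<rfloor> = - int n" "\<lfloor>- t\<rfloor> = int n" unfolding 2 by (simp_all add: floor_minus)
		then show ?thesis unfolding 2 by (simp add: of_rat_minus)
	qed
qed

text \<open>\<open>lp_duality\<close> gives a dual solution and an integral primal solution with the
  same ratio; a single element of \<open>Irred\<close> supplies the infeasible value
  \<open>a1\<close> that it asks for. The rest clears denominators and splits signs.\<close>

lemma certificate_exists:
	assumes X: "two_complex (cX c)" "finite_complex (cX c)" and ne: "Irred (standard (cX c)) ~= {}"
	shows "\<exists>w. certificate s c w"
proof -
	let ?X = "cX c" and ?E = "%b. bedges (cX c) (cdec c b)" and ?cp = "%b e b'. compat (cX c) (cdec c b) e (cdec c b')" and ?o = "opp (skel (cX c))"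
	\<comment> \<open>The minimum is treated as the maximum for -chi.\<close>
	define eps :: rat where "eps = (if s then 1 else - 1)"
	define B where "B = {b. b < cK c & cblock c b}"
	define chi :: "nat => rat" where "chi b = eps * (of_nat (cV c b) - of_nat (cQ c b) / 2)" for b
	define ar :: "nat => rat" where "ar b = (\<Sum>d\<in>Domain (bQ c b). 1 / of_nat (cL c d))" for b
	have B: "finite B" "!!b. b : B ==> cblock c b" "!!b. b : B ==> xblock ?X (cdec c b)" "!!b. b : B ==> b < cK c"
		unfolding B_def using cblock_iff[OF X(1)] by simp_all
	have chir: "of_rat (chi b) = of_rat eps * block_chi ?X (cdec c b)" if "b : B" for b
		unfolding chi_def block_chi_code[OF X(1) B(2)[OF that]] by (simp add: of_rat_mult of_rat_diff of_rat_divide)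
	have arr: "of_rat (ar b) = block_area ?X (cdec c b)" for b
		unfolding ar_def block_area_def cdec_def fst_conv of_rat_sum
	proof (rule sum.cong[OF refl])
		fix d assume "d : Domain (bQ c b)"
		then show "of_rat (1 / of_nat (cL c d)) = 1 / real (circ_len (bdry ?X) d)"
			using circ_len_code(1)[OF X(1) Dom_less] by (simp add: of_rat_divide)
	qed
	have arpos: "ar b > 0" if "b : B" for b
		using block_area_pos[OF X(1) B(2)[OF that]] unfolding arr[symmetric] by simp
	obtain Y p q where Y: "(Y, p, q) : Irred (standard ?X)" using ne by auto
	obtain V :: "nat set" and \<beta> mate where sys: "dsystem ?X V \<beta> mate" using Irred_dsystem[OF Y] by blast
	obtain bc where bc: "!!v. v : V ==> bc v < cK c" "!!v. v : V ==> cdec c (bc v) = \<beta> v" "!!v. v : V ==> cblock c (bc v)"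
		using dsystem_codes[OF X(1) sys] by blast
	have bcB: "bc v : B" if "v : V" for v using bc that unfolding B_def by simp
	have V: "finite V" "V ~= {}" using sys unfolding dsystem_def by auto
	define A where "A = (\<Sum>v\<in>V. of_rat (ar (bc v)) :: real)"
	define C where "C = (\<Sum>v\<in>V. of_rat (chi (bc v)) :: real)"
	have A: "A > 0" unfolding A_def using V arpos bcB by (intro sum_pos) auto
	\<comment> \<open>A rational number strictly below the ratio C / A of an existing system; a dual
	  solution at \<open>a1\<close> would contradict weak duality for that system.\<close>
	define a1 :: rat where "a1 = of_int (\<lfloor>C / A\<rfloor> - 1)"
	have a1: "of_rat a1 * A < C"
	proof -
		have "of_rat a1 = of_int \<lfloor>C / A\<rfloor> - (1 :: real)" unfolding a1_def by (simp add: of_rat_diff)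
		then have "of_rat a1 < C / A" by linarith
		then show ?thesis using A by (simp add: pos_less_divide_eq)
	qed
	have nd: "\<not> (\<exists>y. lp_dual B ?E ?cp ?o chi ar a1 y)"
	proof
		assume "\<exists>y. lp_dual B ?E ?cp ?o chi ar a1 y"
		then obtain y where y1: "!!b. b : B ==> chi b - a1 * ar b \<le> (\<Sum>e\<in>?E b. y b e)"
			and y2: "!!b b' e. b : B ==> b' : B ==> ?cp b e b' ==> y b e + y b' (?o e) \<le> 0" unfolding lp_dual_def by blast
		have "(\<Sum>v\<in>V. \<Sum>e\<in>bedges ?X (\<beta> v). of_rat (y (bc v) e) :: real) \<le> 0"
		proof (rule weak_duality[OF X(1) sys])
			fix v e assume v: "v : V" and e: "e : bedges ?X (\<beta> v)"
			have m: "mate v e : V" "compat ?X (\<beta> v) e (\<beta> (mate v e))" using sys v e unfolding dsystem_def by auto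
			have "y (bc v) e + y (bc (mate v e)) (?o e) \<le> 0" by (rule y2[OF bcB[OF v] bcB[OF m(1)]]) (use m(2) bc(2)[OF v] bc(2)[OF m(1)] in simp)
			then have "of_rat (y (bc v) e + y (bc (mate v e)) (?o e)) \<le> (0 :: real)" by (simp only: of_rat_le_0_iff)
			then show "of_rat (y (bc v) e) + of_rat (y (bc (mate v e)) (?o e)) \<le> (0 :: real)" by (simp only: of_rat_add)
		qed
		moreover have "C - of_rat a1 * A \<le> (\<Sum>v\<in>V. \<Sum>e\<in>bedges ?X (\<beta> v). of_rat (y (bc v) e))"
			unfolding C_def A_def sum_distrib_left sum_subtractf[symmetric]
		proof (rule sum_mono)
			fix v assume v: "v : V"
			have "(of_rat (chi (bc v) - a1 * ar (bc v)) :: real) \<le> of_rat (\<Sum>e\<in>?E (bc v). y (bc v) e)" using y1[OF bcB[OF v]] by (simp only: of_rat_less_eq)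
			then show "of_rat (chi (bc v)) - of_rat a1 * of_rat (ar (bc v)) \<le> (\<Sum>e\<in>bedges ?X (\<beta> v). of_rat (y (bc v) e) :: real)"
				unfolding bc(2)[OF v] of_rat_sum of_rat_diff of_rat_mult .
		qed
		ultimately show False using a1 by linarith
	qed
	have "\<exists>a y x z. lp_dual B ?E ?cp ?o chi ar a y & lp_primal B ?E ?cp ?o chi ar a x z"
	proof (rule lp_duality[OF B(1) _ _ _ _ arpos nd])
		show "finite (?E b)" if "b : B" for b using finite_bedges[OF B(3)[OF that]] .
		show "e : ?E b" if "?cp b e b'" for b e b' using that unfolding compat_def by (simp split: prod.splits)
		show "?cp b' (?o e) b" if "b : B" "?cp b e b'" for b e b' using compat_sym(2)[OF X(1) B(3)[OF that(1)] that(2)] .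
		show "?o (?o e) = e" if "b : B" "e : ?E b" for b e by (rule bedgesD(2)[OF X(1) B(3)[OF that(1)] that(2)])
	qed
	then obtain a y x z where dual: "lp_dual B ?E ?cp ?o chi ar a y" and pr: "lp_primal B ?E ?cp ?o chi ar a x z" by blast
	obtain k :: nat and bt mt where ksys: "dsystem ?X {..<k} (%v. cdec c (bt v)) mt" and btB: "!!v. v < k ==> bt v : B"
		and ksum: "!!f :: nat => real. (\<Sum>v<k. f (bt v)) = (\<Sum>b\<in>B. of_nat (x b) * f b)"
		using dsystem_of_primal[OF X(1) B(1,3) pr] by blast
	\<comment> \<open>No circle has more than \<open>cN c\<close> darts, so the factorial is divisible
	  by all lengths.\<close>
	define U :: nat where "U = fact (cN c)"
	have U: "U > 0" unfolding U_def by simp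
	\<comment> \<open>The absolute values that the common denominator has to make integral: the scaled
	  bound and all prices.\<close>
	define F where "F = insert \<bar>2 * a / of_nat U\<bar> ((%(b, e). \<bar>2 * y b e\<bar>) ` (B \<times> {..<cE c}))"
	have "finite F" unfolding F_def using B(1) by simp
	have "\<exists>M :: nat. M > 0 & (\<forall>t\<in>F. \<exists>n :: nat. of_nat M * t = of_nat n)"
		by (rule common_denominator[OF \<open>finite F\<close>]) (auto simp: F_def)
	then obtain S :: nat where S: "S > 0" "!!t. t : F ==> \<exists>n :: nat. of_nat S * t = of_nat n" by blast
	\<comment> \<open>Chosen so that P * U / (2 * S) is \<open>eps * a\<close>, the extremal ratio with
	  its sign restored.\<close>
	define P where "P = of_nat S * (eps * (2 * a / of_nat U))"
	have epsa: "\<bar>eps\<bar> = 1" unfolding eps_def by simp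
	have Pint: "\<exists>n :: nat. \<bar>P\<bar> = of_nat n"
		using S(2)[of "\<bar>2 * a / of_nat U\<bar>"] unfolding P_def abs_mult epsa F_def by (simp add: abs_mult)
	define p1 where "p1 = nat \<lfloor>P\<rfloor>"
	define p2 where "p2 = nat \<lfloor>- P\<rfloor>"
	have p12: "real p1 - real p2 = of_rat P" unfolding p1_def p2_def by (rule int_split[OF Pint])
	define h where "h b e = of_nat S * (2 * y b e)" for b e
	have hint: "real (nat \<lfloor>h b e\<rfloor>) - real (nat \<lfloor>- h b e\<rfloor>) = of_rat (h b e)" if "b : B" "e < cE c" for b e
	proof (rule int_split)
		have "\<bar>2 * y b e\<bar> : F" unfolding F_def using that by auto
		from S(2)[OF this] show "\<exists>n :: nat. \<bar>h b e\<bar> = of_nat n" unfolding h_def abs_mult[of "of_nat S"] by simp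
	qed
	have EL: "e < cE c" if "b : B" "e : ?E b" for b e using bedgesD(1)[OF X(1) B(3)[OF that(1)] that(2)] by simp
	have copp: "copp c e < cE c" if "e < cE c" for e using X(1) that unfolding two_complex_def sgraph_def by simp
	obtain u where u: "\<forall>d<cN c. cnth u d = U div cL c d" using ex_list_code[of "cN c" "%d. U div cL c d"] by (elim exE)
	obtain y1 where y1: "\<forall>b<cK c. \<forall>e<cE c. cnth y1 (prod_encode (b, e)) = nat \<lfloor>h b e\<rfloor>"
		using ex_table_code[of "cK c" "cE c" "%b e. nat \<lfloor>h b e\<rfloor>"] by (elim exE)
	obtain y2 where y2: "\<forall>b<cK c. \<forall>e<cE c. cnth y2 (prod_encode (b, e)) = nat \<lfloor>- h b e\<rfloor>"
		using ex_table_code[of "cK c" "cE c" "%b e. nat \<lfloor>- h b e\<rfloor>"] by (elim exE)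
	obtain btl where btl: "\<forall>v<k. cnth btl v = bt v" using ex_list_code[of k bt] by (elim exE)
	obtain mtl where mtl: "\<forall>v<k. \<forall>e<cE c. cnth mtl (prod_encode (v, e)) = mt v e" using ex_table_code[of k "cE c" mt] by (elim exE)
	obtain kk dd where rc: "ratcheck kk dd S p1 p2 U" using ratcheck_complete[OF S(1)] by blast
	define w where "w = list_encode [U, S, p1, p2, u, y1, y2, k, btl, mtl, kk, dd]"
	have w: "cnth w 0 = U" "cnth w 1 = S" "cnth w 2 = p1" "cnth w 3 = p2" "cnth w 4 = u" "cnth w 5 = y1" "cnth w 6 = y2"
		"cnth w 7 = k" "cnth w 8 = btl" "cnth w 9 = mtl" "cnth w 10 = kk" "cnth w 11 = dd"
		unfolding w_def by (simp_all add: cnth_list_encode del: list_encode.simps)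
	have uL: "cnth (cnth w 4) d * cL c d = U" if d: "d < cN c" for d
	proof -
		have "cL c d \<le> (\<Sum>d'<cN c. 1)" unfolding cL_def by (rule sum_mono) simp
		then have "cL c d dvd U" unfolding U_def using circ_len_code(2)[OF X(1) d] by (intro dvd_fact) simp_all
		then show ?thesis unfolding w using u d by simp
	qed
	have bal: "real (clhs c w b) - real (crhs c w b) = of_nat S * 2 * of_rat eps * (of_rat (chi b) - of_rat a * of_rat (ar b))" if "b : B" for b
	proof -
		have ee: "of_rat eps * of_rat eps = (1 :: real)" unfolding eps_def by (simp add: of_rat_minus)
		have PU: "of_rat P * real U = of_nat S * 2 * of_rat eps * of_rat a"
			unfolding P_def using U by (simp add: of_rat_mult of_rat_divide)
		have c: "block_chi ?X (cdec c b) = of_rat eps * of_rat (chi b)"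
			unfolding chir[OF that] using ee by (simp add: mult.assoc[symmetric])
		have "real (clhs c w b) - real (crhs c w b) = 2 * real S * block_chi ?X (cdec c b) - of_rat P * real U * block_area ?X (cdec c b)"
			using block_balance[OF X(1) B(2)[OF that], of w U] uL unfolding w(2-4) p12 by blast
		also have "\<dots> = of_nat S * 2 * of_rat eps * (of_rat (chi b) - of_rat a * of_rat (ar b))"
			unfolding PU c arr[symmetric] by (simp add: algebra_simps)
		finally show ?thesis .
	qed
	have ysum: "real (cYs c (cnth w 5) b) - real (cYs c (cnth w 6) b) = of_nat S * 2 * of_rat (\<Sum>e\<in>?E b. y b e)" if b: "b : B" for b
	proof -
		have "real (cYs c (cnth w 5) b) - real (cYs c (cnth w 6) b) = (\<Sum>e\<in>?E b. of_rat (h b e))"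
			unfolding cYs_sum[OF X(1) B(2)[OF b]] sum_subtractf[symmetric] w
			by (rule sum.cong[OF refl]) (use y1 y2 B(4)[OF b] EL[OF b] hint[OF b] in simp)
		also have "\<dots> = of_nat S * 2 * of_rat (\<Sum>e\<in>?E b. y b e)" unfolding h_def of_rat_sum sum_distrib_left by (simp add: of_rat_mult mult.assoc)
		finally show ?thesis .
	qed
	have "cdual s c w"
		unfolding cdual_def
	proof (intro conjI allI impI)
		fix b assume "b < cK c" "cblock c b"
		then have b: "b : B" unfolding B_def by simp
		have "chi b - a * ar b \<le> (\<Sum>e\<in>?E b. y b e)" using dual b unfolding lp_dual_def by blast
		then have "(of_rat (chi b - a * ar b) :: real) \<le> of_rat (\<Sum>e\<in>?E b. y b e)" by (simp only: of_rat_less_eq)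
		then have "of_rat (chi b) - of_rat a * of_rat (ar b) \<le> (of_rat (\<Sum>e\<in>?E b. y b e) :: real)" by (simp only: of_rat_diff of_rat_mult)
		then have "of_nat S * 2 * (of_rat (chi b) - of_rat a * of_rat (ar b)) \<le> of_nat S * 2 * (of_rat (\<Sum>e\<in>?E b. y b e) :: real)"
			by (intro mult_left_mono) simp_all
		then have le: "of_nat S * 2 * (of_rat (chi b) - of_rat a * of_rat (ar b)) \<le> real (cYs c (cnth w 5) b) - real (cYs c (cnth w 6) b)"
			unfolding ysum[OF b] .
		show "if s then clhs c w b + cYs c (cnth w 6) b \<le> crhs c w b + cYs c (cnth w 5) b
			else crhs c w b + cYs c (cnth w 6) b \<le> clhs c w b + cYs c (cnth w 5) b"
		proof (cases s)
			case True
			then have "real (clhs c w b) - real (crhs c w b) \<le> real (cYs c (cnth w 5) b) - real (cYs c (cnth w 6) b)"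
				using bal[OF b] le unfolding eps_def by simp
			then have "real (clhs c w b + cYs c (cnth w 6) b) \<le> real (crhs c w b + cYs c (cnth w 5) b)" by simp
			then show ?thesis using True by (simp only: of_nat_le_iff if_True)
		next
			case False
			then have "real (crhs c w b) - real (clhs c w b) \<le> real (cYs c (cnth w 5) b) - real (cYs c (cnth w 6) b)"
				using bal[OF b] le unfolding eps_def by (simp add: of_rat_minus)
			then have "real (crhs c w b + cYs c (cnth w 6) b) \<le> real (clhs c w b + cYs c (cnth w 5) b)" by simp
			then show ?thesis using False by (simp only: of_nat_le_iff if_False)
		qed
	next
		fix b b' e assume h0: "b < cK c" "b' < cK c" "e < cE c" "cblock c b" "cblock c b'" "ccompat c b e b'"
		have b: "b : B" "b' : B" "?cp b e b'" using h0 unfolding B_def ccompat_iff by simp_all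
		have "y b e + y b' (?o e) \<le> 0" by (rule conjunct2[OF dual[unfolded lp_dual_def], rule_format, OF b])
		then have "of_nat S * (2 * (y b e + y b' (copp c e))) \<le> 0" by (intro mult_nonneg_nonpos) simp_all
		then have "h b e + h b' (copp c e) \<le> 0" unfolding h_def distrib_left .
		then have "of_rat (h b e + h b' (copp c e)) \<le> (0 :: real)" by (simp only: of_rat_le_0_iff)
		then have "real (nat \<lfloor>h b e\<rfloor> + nat \<lfloor>h b' (copp c e)\<rfloor>) \<le> real (nat \<lfloor>- h b e\<rfloor> + nat \<lfloor>- h b' (copp c e)\<rfloor>)"
			using hint[OF b(1) h0(3)] hint[OF b(2) copp[OF h0(3)]] unfolding of_rat_add of_nat_add by linarith
		then show "cnth (cnth w 5) (prod_encode (b, e)) + cnth (cnth w 5) (prod_encode (b', copp c e)) \<le>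
			cnth (cnth w 6) (prod_encode (b, e)) + cnth (cnth w 6) (prod_encode (b', copp c e))"
			unfolding w y1[rule_format, OF h0(1,3)] y1[rule_format, OF h0(2) copp[OF h0(3)]] y2[rule_format, OF h0(1,3)]
				y2[rule_format, OF h0(2) copp[OF h0(3)]] by (simp only: of_nat_le_iff)
	qed
	moreover have "cprimal c w"
		unfolding cprimal_def w
	proof (intro conjI allI impI)
		show "0 < k" using ksys unfolding dsystem_def by auto
		fix v assume v: "v < k"
		show "cnth btl v < cK c" "cblock c (cnth btl v)" using btl v B(2,4)[OF btB[OF v]] by simp_all
		fix e assume e: "e < cE c" "cEb c (cnth btl v) e"
		have eE: "e : ?E (bt v)" using e(2) btl v unfolding cEb_iff by simp
		have m: "mt v e : {..<k}" "?cp (bt v) e (bt (mt v e))" "mt (mt v e) (?o e) = v" using ksys v eE unfolding dsystem_def by auto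
		have me: "cnth mtl (prod_encode (v, e)) = mt v e" using mtl v e(1) by blast
		show "cnth mtl (prod_encode (v, e)) < k" unfolding me using m(1) by simp
		have "cnth btl (mt v e) = bt (mt v e)" using btl m(1) by simp
		then show "ccompat c (cnth btl v) e (cnth btl (cnth mtl (prod_encode (v, e))))"
			unfolding me ccompat_iff using m(2) btl v by simp
		show "cnth mtl (prod_encode (cnth mtl (prod_encode (v, e)), copp c e)) = v"
			unfolding me using mtl m(1,3) copp[OF e(1)] by simp
	next
		have "(\<Sum>v<k. real (clhs c w (cnth btl v)) - real (crhs c w (cnth btl v))) = (\<Sum>v<k. of_nat S * 2 * of_rat eps * (of_rat (chi (bt v)) - of_rat a * of_rat (ar (bt v))))"
			by (rule sum.cong[OF refl]) (use btl bal btB in simp)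
		also have "\<dots> = of_nat S * 2 * of_rat eps * ((\<Sum>v<k. of_rat (chi (bt v))) - of_rat a * (\<Sum>v<k. of_rat (ar (bt v))))"
			by (simp add: sum_distrib_left sum_subtractf right_diff_distrib)
		also have "(\<Sum>v<k. of_rat (chi (bt v))) - of_rat a * (\<Sum>v<k. of_rat (ar (bt v))) = (0 :: real)"
		proof -
			have "(\<Sum>b\<in>B. of_nat (x b) * chi b) = a * (\<Sum>b\<in>B. of_nat (x b) * ar b)" using pr unfolding lp_primal_def by - (elim conjE, assumption)
			then have "(of_rat (\<Sum>b\<in>B. of_nat (x b) * chi b) :: real) = of_rat (a * (\<Sum>b\<in>B. of_nat (x b) * ar b))" by simp
			then show ?thesis unfolding ksum[of "%b. of_rat (chi b)"] ksum[of "%b. of_rat (ar b)"] by (simp add: of_rat_sum of_rat_mult)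
		qed
		finally have "real (\<Sum>v<k. clhs c w (cnth btl v)) = real (\<Sum>v<k. crhs c w (cnth btl v))" by (simp add: sum_subtractf)
		then show "(\<Sum>v<k. clhs c w (cnth btl v)) = (\<Sum>v<k. crhs c w (cnth btl v))" by (simp only: of_nat_eq_iff)
	qed
	ultimately have "certificate s c w" unfolding certificate_def using U S(1) uL rc by (simp only: w) simp
	then show ?thesis by blast
qed

section \<open>Rationality and computability of the extremal curvatures\<close>

lemma position_nth: "x : set xs ==> position xs x < length xs" "x : set xs ==> xs ! position xs x = x"
	by (induction xs) (auto simp: position_def)

lemma graph_isomorphism_code:
	assumes G: "sgraph G" and vs: "enumerates vs (verts G)" and es: "enumerates es (edges G)"
		and H: "verts H = {..<length vs}" "edges H = {..<length es}"
		and ini: "!!e. e < length es ==> ini H e = position vs (ini G (es ! e))" and opp: "!!e. e < length es ==> opp H e = position es (opp G (es ! e))"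
	shows "graph_isomorphism H G \<lparr>vmap = (!) vs, emap = (!) es\<rparr>"
proof (rule graph_isomorphismI[OF G])
	have v: "distinct vs" "set vs = verts G" and e: "distinct es" "set es = edges G" using vs es unfolding enumerates_def by auto
	show "bij_betw (vmap \<lparr>vmap = (!) vs, emap = (!) es\<rparr>) (verts H) (verts G)" "bij_betw (emap \<lparr>vmap = (!) vs, emap = (!) es\<rparr>) (edges H) (edges G)"
		using bij_betw_nth[OF v(1) H(1) v(2)[symmetric]] bij_betw_nth[OF e(1) H(2) e(2)[symmetric]] by simp_all
	fix d assume "d : edges H"
	then have d: "d < length es" using H by simp
	then have "es ! d : edges G" using nth_mem e(2) by blast
	then have i: "ini G (es ! d) : set vs" "opp G (es ! d) : set es" using G unfolding sgraph_def v(2) e(2) by auto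
	show "ini H d : verts H" "opp H d : edges H" unfolding ini[OF d] opp[OF d] H using position_nth(1) i by auto
	show "ini G (emap \<lparr>vmap = (!) vs, emap = (!) es\<rparr> d) = vmap \<lparr>vmap = (!) vs, emap = (!) es\<rparr> (ini H d)"
		"opp G (emap \<lparr>vmap = (!) vs, emap = (!) es\<rparr> d) = emap \<lparr>vmap = (!) vs, emap = (!) es\<rparr> (opp H d)"
		unfolding ini[OF d] opp[OF d] using position_nth(2)[OF i(1)] position_nth(2)[OF i(2)] by simp_all
qed

lemma graph_code_simps:
	"cfst (graph_code G vs es) = length vs" "clen (csnd (graph_code G vs es)) = length es"
	"e < length es ==> cfst (cnth (csnd (graph_code G vs es)) e) = position vs (ini G (es ! e))"
	"e < length es ==> csnd (cnth (csnd (graph_code G vs es)) e) = position es (opp G (es ! e))"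
	unfolding graph_code_def by (simp_all add: clen_list_encode cnth_list_encode)

lemma complex_code_iso:
	assumes X: "two_complex X" "finite_complex X" and c: "complex_code X c"
	shows "two_complex (cX c)" "finite_complex (cX c)" "\<exists>f g. complex_iso (cX c) X f g"
proof -
	obtain vs es us ds where en: "enumerates vs (verts (skel X))" "enumerates es (edges (skel X))" "enumerates us (verts (bdry X))" "enumerates ds (edges (bdry X))"
		and cc: "c = list_encode [graph_code (skel X) vs es, graph_code (bdry X) us ds,
				list_encode (map (%u. position vs (vmap (att X) u)) us), list_encode (map (%d. position es (emap (att X) d)) ds)]"
		using c unfolding complex_code_def by - (elim exE conjE, rule that)
	have w: "cnth c 0 = graph_code (skel X) vs es" "cnth c 1 = graph_code (bdry X) us ds"
		"cnth c 2 = list_encode (map (%u. position vs (vmap (att X) u)) us)" "cnth c 3 = list_encode (map (%d. position es (emap (att X) d)) ds)"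
		unfolding cc by (simp_all add: cnth_list_encode del: list_encode.simps)
	have sg: "sgraph (skel X)" "sgraph (bdry X)" using X(1) unfolding two_complex_def circles_def by auto
	let ?f = "\<lparr>vmap = (!) vs, emap = (!) es\<rparr>" and ?g = "\<lparr>vmap = (!) us, emap = (!) ds\<rparr>"
	have f: "graph_isomorphism (skel (cX c)) (skel X) ?f"
		by (rule graph_isomorphism_code[OF sg(1) en(1,2)])
			(simp_all add: cE_def cini_def copp_def w graph_code_simps)
	have g: "graph_isomorphism (bdry (cX c)) (bdry X) ?g"
		by (rule graph_isomorphism_code[OF sg(2) en(3,4)])
			(simp_all add: cN_def cbini_def cbopp_def w(2) graph_code_simps flip: One_nat_def)
	have s: "set vs = verts (skel X)" "set es = edges (skel X)" "set us = verts (bdry X)" "set ds = edges (bdry X)" using en unfolding enumerates_def by auto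
	have L: "cN c = length ds" "cE c = length es" "cfst (cnth c 0) = length vs" "cfst (cnth c 1) = length us"
		unfolding cN_def cE_def w by (simp_all add: graph_code_simps)
	have a: "vmap (att X) (us ! u) : set vs" if "u < length us" for u
		using X(1) nth_mem[OF that] unfolding s two_complex_def immersion_def graph_morphism_def by simp
	have b: "emap (att X) (ds ! d) : set es" if "d < length ds" for d
		using X(1) nth_mem[OF that] unfolding s two_complex_def immersion_def graph_morphism_def by simp
	have A: "cA c u = position vs (vmap (att X) (us ! u))" if "u < length us" for u
		using that unfolding cA_def w by (simp add: cnth_list_encode)
	have W: "cW c d = position es (emap (att X) (ds ! d))" if "d < length ds" for d
		using that unfolding cW_def w by (simp add: cnth_list_encode)
	have "gmap_eq_on (bdry (cX c)) (gcomp ?f (att (cX c))) (gcomp (att X) ?g)"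
		unfolding gmap_eq_on_def gcomp_def cX_simps L using A W position_nth(2)[OF a] position_nth(2)[OF b] by simp
	then have iso: "complex_iso (cX c) X ?f ?g" unfolding complex_iso_def using f g by simp
	then show "\<exists>f g. complex_iso (cX c) X f g" by blast
	have "vmap (att (cX c)) u : verts (skel (cX c))" if "u : verts (bdry (cX c))" for u
		using that position_nth(1)[OF a] A unfolding cX_simps L by simp
	moreover have "emap (att (cX c)) d : edges (skel (cX c))" if "d : edges (bdry (cX c))" for d
		using that position_nth(1)[OF b] W unfolding cX_simps L by simp
	ultimately show "two_complex (cX c)" "finite_complex (cX c)" using two_complex_iso[OF iso X] by blast+
qed

lemma complex_code_exists: "finite_complex X ==> \<exists>c. complex_code X c"
	unfolding finite_complex_def finite_sgraph_def complex_code_def enumerates_def using finite_distinct_list by metis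

lemma certificate_rho:
	fixes X :: "('v, 'e, 'u, 'd) two_complex"
	assumes X: "two_complex X" "finite_complex X" and c: "complex_code X c" and w: "certificate s c w"
	shows "\<exists>M. rat_code M = prod_encode (cnth w 10, 2 * cnth w 11) & (\<exists>(Y, p, q)\<in>Irred (standard X). avg_curvature Y = of_rat M) &
		(if s then rho_plus (standard X) else rho_minus (standard X)) = ereal (of_rat M)"
proof -
	note C = complex_code_iso[OF X c]
	obtain f g where iso: "complex_iso (cX c) X f g" using C(3) by blast
	note inv = complex_iso_inverse[OF iso C(1)]
	obtain M where M: "rat_code M = prod_encode (cnth w 10, 2 * cnth w 11)"
		"\<exists>(Y, p, q)\<in>Irred (standard (cX c)). avg_curvature Y = of_rat M"
		"\<forall>(Y, p, q)\<in>Irred (standard (cX c)). if s then avg_curvature Y \<le> of_rat M else of_rat M \<le> avg_curvature Y"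
		using certificate_sound[OF C(1,2) w] by blast
	obtain Y0 p0 q0 where "(Y0, p0, q0) : Irred (standard (cX c))" "avg_curvature Y0 = of_rat M" using M(2) by blast
	then have Y0: "(Y0, gcomp f p0, gcomp g q0) : Irred (standard X)" "avg_curvature Y0 = of_rat M"
		using Irred_iso[OF iso X C(1)] by auto
	have bd: "if s then avg_curvature Y \<le> of_rat M else of_rat M \<le> avg_curvature Y" if "(Y, p, q) : Irred (standard X)" for Y p q
		using Irred_iso[OF inv C(1,2) X(1) that] M(3) by blast
	have "(if s then rho_plus (standard X) else rho_minus (standard X)) = ereal (of_rat M)"
	proof (cases s)
		case True
		have "rho_plus (standard X) = ereal (of_rat M)"
			unfolding rho_plus_def
		proof (rule antisym)
			show "(SUP (Y, p, q)\<in>Irred (standard X). ereal (avg_curvature Y)) \<le> ereal (of_rat M)"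
				by (rule SUP_least) (use bd True in auto)
			show "ereal (of_rat M) \<le> (SUP (Y, p, q)\<in>Irred (standard X). ereal (avg_curvature Y))"
				by (rule SUP_upper2[OF Y0(1)]) (simp add: Y0(2))
		qed
		then show ?thesis using True by simp
	next
		case False
		have "rho_minus (standard X) = ereal (of_rat M)"
			unfolding rho_minus_def
		proof (rule antisym)
			show "ereal (of_rat M) \<le> (INF (Y, p, q)\<in>Irred (standard X). ereal (avg_curvature Y))"
				by (rule INF_greatest) (use bd False in auto)
			show "(INF (Y, p, q)\<in>Irred (standard X). ereal (avg_curvature Y)) \<le> ereal (of_rat M)"
				by (rule INF_lower2[OF Y0(1)]) (simp add: Y0(2))
		qed
		then show ?thesis using False by simp
	qed
	then show ?thesis using M(1) Y0 by (intro exI[of _ M]) auto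
qed

lemma certificate_of_Irred:
	assumes X: "two_complex X" "finite_complex X" and c: "complex_code X c" and ne: "Irred (standard X) ~= {}"
	shows "\<exists>w. certificate s c w"
proof -
	note C = complex_code_iso[OF X c]
	obtain f g where iso: "complex_iso (cX c) X f g" using C(3) by blast
	obtain Y p q where "(Y, p, q) : Irred (standard X)" using ne by auto
	then have "Irred (standard (cX c)) ~= {}" using Irred_iso[OF complex_iso_inverse[OF iso C(1)] C(1,2) X(1)] by blast
	then show ?thesis using certificate_exists[OF C(1,2)] by blast
qed

text \<open>The solutions are the convex weights on two points, and the objective averages
  \<open>M\<close> and \<open>m\<close> with these weights; the extremes are attained at the ends of
  the segment.\<close>

definition segment_lp :: "rat => rat => linear_program" where
	"segment_lp M m = \<lparr>lp_dim = 2, lp_eqs = [([1, 1], 1)], lp_ineqs = [([- 1, 0], 0), ([0, - 1], 0)], lp_obj = [M, m]\<rparr>"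

lemma segment_lp:
	assumes "m \<le> M"
	shows "linear_program (segment_lp M m)" "lp_maximum (segment_lp M m) (of_rat M)" "lp_minimum (segment_lp M m) (of_rat m)"
proof -
	show "linear_program (segment_lp M m)" by (simp add: linear_program_def segment_lp_def)
	have dot2: "dot [a, b] [x, y] = of_rat a * x + of_rat b * y" for a b x y
		by (simp add: dot_def lessThan_Suc numeral_2_eq_2)
	have sol: "z : lp_solutions (segment_lp M m) \<longleftrightarrow> (\<exists>x y. z = [x, y] & x + y = 1 & 0 \<le> x & 0 \<le> y)" for z
	proof -
		have "length z = 2 \<longleftrightarrow> (\<exists>x y. z = [x, y])" by (auto simp: numeral_2_eq_2 length_Suc_conv)
		then show ?thesis unfolding lp_solutions_def segment_lp_def by (auto simp: dot2)
	qed
	have le: "of_rat m * x + of_rat m * y \<le> of_rat M * x + of_rat m * y" "of_rat M * x + of_rat m * y \<le> of_rat M * x + of_rat M * y"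
		if "0 \<le> x" "0 \<le> y" for x y :: real
		using that assms by (simp_all add: mult_right_mono of_rat_less_eq)
	have bd: "of_rat m \<le> of_rat M * x + of_rat m * y" "of_rat M * x + of_rat m * y \<le> of_rat M"
		if "x + y = 1" "0 \<le> x" "0 \<le> y" for x y :: real
		using le[OF that(2,3)] unfolding distrib_left[symmetric] that(1) by simp_all
	have obj: "lp_obj (segment_lp M m) = [M, m]" by (simp add: segment_lp_def)
	have "[1, 0] : lp_solutions (segment_lp M m)" "[0, 1] : lp_solutions (segment_lp M m)" unfolding sol by auto
	moreover have "dot [M, m] [1, 0] = of_rat M" "dot [M, m] [0, 1] = of_rat m" by (simp_all add: dot2)
	moreover have "dot [M, m] z \<le> of_rat M" "of_rat m \<le> dot [M, m] z" if "z : lp_solutions (segment_lp M m)" for z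
		using that bd unfolding sol by (auto simp: dot2)
	ultimately show "lp_maximum (segment_lp M m) (of_rat M)" "lp_minimum (segment_lp M m) (of_rat m)"
		unfolding lp_maximum_def lp_minimum_def obj by blast+
qed

lemma computes_certificate:
	assumes "computable g"
	shows "\<exists>r. \<forall>c. (\<exists>w. certificate s c w) --> (\<exists>w. certificate s c w & computes r [c] (g w))"
	by (rule computes_search[OF decidable_certificate assms])

text \<open>One search for a pair of certificates, since a single program has to contain both
  extreme values.\<close>

lemma decidable_both: "decidable (%p. certificate True (cfst p) (cfst (csnd p)) & certificate False (cfst p) (csnd (csnd p)))"
proof -
	have 1: "decidable (%p. certificate s (cfst p) (f p))" if "computable f" for s f
		using decidable_comp[OF decidable_certificate computable_pair[OF computable_cfst[OF computable_id] that]] by simp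
	show ?thesis by (intro decidable_conj 1 comp1)
qed

theorem theoremA:
  shows
    "(\<exists>r. \<forall>(X :: ('v, 'e, 'u, 'd) two_complex) c.
        two_complex X \<and> finite_complex X \<and> Irred (standard X) \<noteq> {} \<and> complex_code X c \<longrightarrow>
          (\<exists>P M m. computes r [c] (lp_code P) \<and> linear_program P \<and>
             lp_maximum P M \<and> rho_plus (standard X) = ereal M \<and>
             lp_minimum P m \<and> rho_minus (standard X) = ereal m))
   \<and> (\<forall>X :: ('v, 'e, 'u, 'd) two_complex.
        two_complex X \<and> finite_complex X \<and> Irred (standard X) \<noteq> {} \<longrightarrow>
          (\<exists>(Y, p, s)\<in>Irred (standard X). ereal (avg_curvature Y) = rho_plus (standard X)) \<and>
          (\<exists>(Y, p, s)\<in>Irred (standard X). ereal (avg_curvature Y) = rho_minus (standard X)) \<and>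
          rho_plus (standard X) \<in> ereal ` \<rat> \<and> rho_minus (standard X) \<in> ereal ` \<rat>)
   \<and> (\<exists>r r'. \<forall>(X :: ('v, 'e, 'u, 'd) two_complex) c.
        two_complex X \<and> finite_complex X \<and> Irred (standard X) \<noteq> {} \<and> complex_code X c \<longrightarrow>
          (\<exists>a b. computes r [c] (rat_code a) \<and> rho_plus (standard X) = ereal (of_rat a) \<and>
             computes r' [c] (rat_code b) \<and> rho_minus (standard X) = ereal (of_rat b)))"
proof (intro conjI)
	define val where "val w = prod_encode (cnth w 10, 2 * cnth w 11)" for w
	have val: "computable (%x. val (f x))" if "computable f" for f unfolding val_def by (intro comp1 that)
	define C1 where "C1 = constraints_code [([1, 1], 1)]"
	define C2 where "C2 = constraints_code [([- 1, 0], 0), ([0, - 1], 0)]"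
	\<comment> \<open>Only the objective varies with the complex; the code of the program is assembled
	  from constants and the two certified values.\<close>
	define out where "out w = list_encode [2, C1, C2, list_encode [val (cfst w), val (csnd w)]]" for w
	have "computable out" unfolding out_def list_encode.simps by (intro val comp1)
	then obtain r where r: "!!c. \<exists>w. certificate True c (cfst w) & certificate False c (csnd w) ==>
			\<exists>w. (certificate True c (cfst w) & certificate False c (csnd w)) & computes r [c] (out w)"
		using computes_search[OF decidable_both] by blast
	show "\<exists>r. \<forall>(X :: ('v, 'e, 'u, 'd) two_complex) c.
				two_complex X & finite_complex X & Irred (standard X) ~= {} & complex_code X c -->
					(\<exists>P M m. computes r [c] (lp_code P) & linear_program P &
						 lp_maximum P M & rho_plus (standard X) = ereal M &
						 lp_minimum P m & rho_minus (standard X) = ereal m)"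
	proof (intro exI[of _ r] allI impI)
		fix X :: "('v, 'e, 'u, 'd) two_complex" and c
		assume h: "two_complex X & finite_complex X & Irred (standard X) ~= {} & complex_code X c"
		then have X: "two_complex X" "finite_complex X" "complex_code X c" "Irred (standard X) ~= {}" by simp_all
		obtain w1 w2 where "certificate True c w1" "certificate False c w2" using certificate_of_Irred[OF X] by blast
		then have "certificate True c (cfst (prod_encode (w1, w2))) & certificate False c (csnd (prod_encode (w1, w2)))" by simp
		then obtain w where w: "certificate True c (cfst w)" "certificate False c (csnd w)" "computes r [c] (out w)" using r by blast
		obtain M where M: "rat_code M = val (cfst w)" "rho_plus (standard X) = ereal (of_rat M)" "\<exists>(Y, p, q)\<in>Irred (standard X). avg_curvature Y = of_rat M"
			using certificate_rho[OF X(1-3) w(1)] unfolding val_def by auto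
		obtain m where m: "rat_code m = val (csnd w)" "rho_minus (standard X) = ereal (of_rat m)"
			using certificate_rho[OF X(1-3) w(2)] unfolding val_def by auto
		\<comment> \<open>The value \<open>M\<close> is attained, so the infimum is at most
		  \<open>M\<close>; this is the ordering that \<open>segment_lp\<close> requires.\<close>
		have "rho_minus (standard X) \<le> ereal (of_rat M)" unfolding rho_minus_def using M(3) by (auto intro: INF_lower2)
		then have "m \<le> M" unfolding m(2) by (simp add: of_rat_less_eq)
		note P = segment_lp[OF this]
		have "lp_code (segment_lp M m) = out w"
			unfolding lp_code_def out_def segment_lp_def C1_def C2_def vec_code_def by (simp add: M(1) m(1) del: list_encode.simps)
		then show "\<exists>P M m. computes r [c] (lp_code P) & linear_program P & lp_maximum P M & rho_plus (standard X) = ereal M &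
						 lp_minimum P m & rho_minus (standard X) = ereal m"
			using w(3) P M(2) m(2) by metis
	qed
	have rho: "\<exists>M. (\<exists>(Y, p, q)\<in>Irred (standard X). avg_curvature Y = of_rat M) & (if s then rho_plus (standard X) else rho_minus (standard X)) = ereal (of_rat M)"
		if X: "two_complex X" "finite_complex X" "Irred (standard X) ~= {}" for X :: "('v, 'e, 'u, 'd) two_complex" and s
	proof -
		obtain c where c: "complex_code X c" using complex_code_exists[OF X(2)] by blast
		obtain w where "certificate s c w" using certificate_of_Irred[OF X(1,2) c X(3)] by blast
		from certificate_rho[OF X(1,2) c this] show ?thesis by blast
	qed
	show "\<forall>X :: ('v, 'e, 'u, 'd) two_complex.
				two_complex X & finite_complex X & Irred (standard X) ~= {} -->
					(\<exists>(Y, p, s)\<in>Irred (standard X). ereal (avg_curvature Y) = rho_plus (standard X)) &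
					(\<exists>(Y, p, s)\<in>Irred (standard X). ereal (avg_curvature Y) = rho_minus (standard X)) &
					rho_plus (standard X) : ereal ` \<rat> & rho_minus (standard X) : ereal ` \<rat>"
	proof (intro allI impI)
		fix X :: "('v, 'e, 'u, 'd) two_complex"
		assume "two_complex X & finite_complex X & Irred (standard X) ~= {}"
		then have X: "two_complex X" "finite_complex X" "Irred (standard X) ~= {}" by simp_all
		obtain M where M: "\<exists>(Y, p, q)\<in>Irred (standard X). avg_curvature Y = of_rat M" "rho_plus (standard X) = ereal (of_rat M)"
			using rho[OF X, of True] by auto
		obtain m where m: "\<exists>(Y, p, q)\<in>Irred (standard X). avg_curvature Y = of_rat m" "rho_minus (standard X) = ereal (of_rat m)"
			using rho[OF X, of False] by auto
		show "(\<exists>(Y, p, s)\<in>Irred (standard X). ereal (avg_curvature Y) = rho_plus (standard X)) &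
					(\<exists>(Y, p, s)\<in>Irred (standard X). ereal (avg_curvature Y) = rho_minus (standard X)) &
					rho_plus (standard X) : ereal ` \<rat> & rho_minus (standard X) : ereal ` \<rat>"
			unfolding M(2) m(2) using M(1) m(1) by auto
	qed
	obtain r1 where r1: "!!c. \<exists>w. certificate True c w ==> \<exists>w. certificate True c w & computes r1 [c] (val w)"
		using computes_certificate[OF val[OF computable_id], of True] by blast
	obtain r2 where r2: "!!c. \<exists>w. certificate False c w ==> \<exists>w. certificate False c w & computes r2 [c] (val w)"
		using computes_certificate[OF val[OF computable_id], of False] by blast
	show "\<exists>r r'. \<forall>(X :: ('v, 'e, 'u, 'd) two_complex) c.
				two_complex X & finite_complex X & Irred (standard X) ~= {} & complex_code X c -->
					(\<exists>a b. computes r [c] (rat_code a) & rho_plus (standard X) = ereal (of_rat a) &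
						 computes r' [c] (rat_code b) & rho_minus (standard X) = ereal (of_rat b))"
	proof (rule exI[of _ r1], rule exI[of _ r2], intro allI impI)
		fix X :: "('v, 'e, 'u, 'd) two_complex" and c
		assume "two_complex X & finite_complex X & Irred (standard X) ~= {} & complex_code X c"
		then have X: "two_complex X" "finite_complex X" "complex_code X c" "Irred (standard X) ~= {}" by simp_all
		obtain w1 w2 where w: "certificate True c w1" "computes r1 [c] (val w1)" "certificate False c w2" "computes r2 [c] (val w2)"
			using r1[OF certificate_of_Irred[OF X]] r2[OF certificate_of_Irred[OF X]] by blast
		obtain a where a: "rat_code a = val w1" "rho_plus (standard X) = ereal (of_rat a)"
			using certificate_rho[OF X(1-3) w(1)] unfolding val_def by auto
		obtain b where b: "rat_code b = val w2" "rho_minus (standard X) = ereal (of_rat b)"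
			using certificate_rho[OF X(1-3) w(3)] unfolding val_def by auto
		show "\<exists>a b. computes r1 [c] (rat_code a) & rho_plus (standard X) = ereal (of_rat a) &
						 computes r2 [c] (rat_code b) & rho_minus (standard X) = ereal (of_rat b)"
			using w(2,4) a b by metis
	qed
qed

end
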